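(* For every admissible $(\alpha,\beta)$, that is, for every $\alpha\in[0,1]$ and $\beta\ge 0$, one has $$\mathbf{M}_{\alpha,\beta}\ \text{is MSU}\;\Longleftrightarrow\;\mathbf{M}_{\alpha,\beta}\ \text{is MSU*}\;\Longleftrightarrow\;\beta\ge\alpha\ \text{ or }\ \{\beta=0,\ \alpha\le 1/2\}.$$
   Context: The Wright function is $\phi(\rho,\beta,z)=\sum_{n\ge 0}\frac{z^n}{n!\,\Gamma(\beta+\rho n)}$ for $\beta,z\in\mathbb{C}$, $\rho>-1$ (with $1/\Gamma=0$ at the poles of $\Gamma$). The admissible set is $\{\alpha\in[0,1],\ \beta\ge 0\}$. For $(\alpha,\beta)$ in this set, $\mathbf{M}_{\alpha,\beta}$ is the positive random variable with Mellin transform $\mathbb{E}[\mathbf{M}_{\alpha,\beta}^s]=\frac{(1)_s}{(\alpha+\beta)_{\alpha s}}$ for $s>-1$, where $(a)_s=\Gamma(a+s)/\Gamma(a)$. Explicitly: for $\alpha\in(0,1)$ it has density $\Gamma(\alpha+\beta)\,\phi(-\alpha,\beta,-x)$ on $(0,\infty)$; for $\alpha=0$ and any $\beta\ge 0$ it is standard exponential, with density $e^{-x}$ on $(0,\infty)$; for $\alpha=1$ and $\beta>0$ it has density $\beta(1-x)^{\beta-1}\mathbf{1}_{(0,1)}(x)$; and in the degenerate case $\alpha=1$, $\beta=0$ one has $\mathbf{M}_{1,0}=1$. A real random variable is unimodal if there is $m\in\mathbb{R}$ such that its distribution function is convex on $(-\infty,m)$ and concave on $(m,\infty)$. A positive random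 variable $X$ is multiplicatively strongly unimodal (MSU) if for every unimodal random variable $Y$ independent of $X$, the product $XY$ is unimodal. A positive random variable $X$ with density $f$ is MSU* if $t\mapsto f(e^t)$ is log-concave on $\mathbb{R}$ (where $\log 0=-\infty$ is allowed).
   Formalization: At (α,β)=(1,0) the equivalence with MSU is false (M_{1,0}=1 is MSU but has no density, so is not MSU*, and the condition fails); there "MSU ⇔ MSU*" is not asserted. The equivalence of MSU* with the condition on (α,β) is kept for all admissible pairs. *)

theory Defs
  imports "HOL-Probability.Probability"
begin

text \<open>Random variables enter only through their laws: Borel probability measures on the reals.\<close>

definition unimodal :: "real measure \<Rightarrow> bool" where
  "unimodal \<mu> \<longleftrightarrow> (\<exists>m. convex_on {..<m} (cdf \<mu>) \<and> concave_on {m<..} (cdf \<mu>))"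

locale positive_distribution = real_distribution \<mu> for \<mu> :: "real measure" +
  assumes AE_pos: "AE x in \<mu>. 0 < x"

text \<open>The law of \<open>X * Y\<close>, for independent \<open>X\<close> and \<open>Y\<close> with laws \<open>\<mu>\<close> and \<open>\<nu>\<close>, is the image of the
  product measure under multiplication; see the lemma \<open>MSU_indep_var\<close> below.\<close>

definition MSU :: "real measure \<Rightarrow> bool" where
  "MSU \<mu> \<longleftrightarrow> positive_distribution \<mu> \<and>
     (\<forall>\<nu>. real_distribution \<nu> \<and> unimodal \<nu> \<longrightarrow>
        unimodal (distr (\<mu> \<Otimes>\<^sub>M \<nu>) borel (\<lambda>(x, y). x * y)))"

text \<open>Concavity of \<open>ln \<circ> g\<close> with the value \<open>-\<infinity>\<close> where \<open>g\<close> vanishes; \<^const>\<open>concave_on\<close> includes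
  convexity of its domain.\<close>

definition log_concave :: "(real \<Rightarrow> real) \<Rightarrow> bool" where
  "log_concave g \<longleftrightarrow> (\<forall>t. 0 \<le> g t) \<and> concave_on {t. 0 < g t} (\<lambda>t. ln (g t))"

text \<open>A density is determined only almost everywhere, so some version of it has to be
  log-concave in the logarithmic variable.\<close>

definition MSU_star :: "real measure \<Rightarrow> bool" where
  "MSU_star \<mu> \<longleftrightarrow> positive_distribution \<mu> \<and>
     (\<exists>f. f \<in> borel_measurable borel \<and> (\<forall>x. 0 \<le> f x) \<and>
          \<mu> = density lborel (\<lambda>x. ennreal (f x)) \<and>
          log_concave (\<lambda>t. f (exp t)))"

text \<open>\<open>(a)\<^sub>s = \<Gamma>(a + s) / \<Gamma>(a)\<close>. The case \<open>s = 0\<close> is separate because \<open>(0)\<^sub>0 = 1\<close> occurs for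
  \<open>\<alpha> = \<beta> = 0\<close>, whereas \<open>Gamma 0 = 0\<close> in the library.\<close>

definition gen_pochhammer :: "real \<Rightarrow> real \<Rightarrow> real" where
  "gen_pochhammer a s = (if s = 0 then 1 else Gamma (a + s) / Gamma a)"

text \<open>\<open>\<mu>\<close> is the law of \<open>M\<^sub>\<alpha>\<^sub>,\<^sub>\<beta>\<close>; the Mellin transform determines it uniquely.\<close>

definition M_distribution :: "real \<Rightarrow> real \<Rightarrow> real measure \<Rightarrow> bool" where
  "M_distribution \<alpha> \<beta> \<mu> \<longleftrightarrow> positive_distribution \<mu> \<and>
     (\<forall>s>-1. has_bochner_integral \<mu> (\<lambda>x. x powr s)
               (gen_pochhammer 1 s / gen_pochhammer (\<alpha> + \<beta>) (\<alpha> * s)))"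

lemma MSU_indep_var:
  assumes M: "prob_space M"
    and indep: "prob_space.indep_var M borel X borel Y"
    and X: "MSU (distr M borel X)" and Y: "unimodal (distr M borel Y)"
  shows "unimodal (distr M borel (\<lambda>\<omega>. X \<omega> * Y \<omega> :: real))"
proof -
  interpret prob_space M by (rule M)
  have [measurable]: "X \<in> borel_measurable M" "Y \<in> borel_measurable M"
    and eq: "distr M borel X \<Otimes>\<^sub>M distr M borel Y
               = distr M (borel \<Otimes>\<^sub>M borel) (\<lambda>\<omega>. (X \<omega>, Y \<omega>))"
    using indep unfolding indep_var_distribution_eq by auto
  have "real_distribution (distr M borel Y)"
    by (intro real_distribution_distr) simp
  with X Y have "unimodal (distr (distr M borel X \<Otimes>\<^sub>M distr M borel Y) borel (\<lambda>(x, y). x * y))"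
    unfolding MSU_def by blast
  also have "distr (distr M borel X \<Otimes>\<^sub>M distr M borel Y) borel (\<lambda>(x, y). x * y)
               = distr M borel (\<lambda>\<omega>. X \<omega> * Y \<omega>)"
    unfolding eq by (subst distr_distr) (auto simp: comp_def)
  finally show ?thesis .
qed

text \<open>For \<open>\<alpha> = 0\<close> the law is standard exponential, also at \<open>\<beta> = 0\<close>.\<close>

lemma M_distribution_0: "M_distribution 0 \<beta> (density lborel (exponential_density 1))"
proof -
  interpret prob_space "density lborel (exponential_density 1)"
    by (rule prob_space_exponential_density) simp
  have "AE x in lborel. x \<noteq> (0::real)"
    by (rule AE_lborel_singleton)
  then have "AE x in density lborel (exponential_density 1). 0 < x"
    by (subst AE_density) (auto simp: exponential_density_def split: if_splits elim!: eventually_mono)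
  then have pos: "positive_distribution (density lborel (exponential_density 1))"
    by unfold_locales simp_all
  have "has_bochner_integral (density lborel (exponential_density 1)) (\<lambda>x. x powr s) (Gamma (1 + s))"
    if s: "s > -1" for s
  proof (rule has_bochner_integral_nn_integral)
    have "(\<integral>\<^sup>+x. ennreal (x powr s) \<partial>density lborel (exponential_density 1))
            = (\<integral>\<^sup>+x. ennreal (indicator {0..} x * x powr ((1 + s) - 1) / exp x) \<partial>lborel)"
      by (subst nn_integral_density)
        (auto intro!: nn_integral_cong simp: exponential_density_def exp_minus field_simps
          ennreal_mult[symmetric])
    also have "\<dots> = ennreal (Gamma (1 + s))"
      using s by (subst Gamma_conv_nn_integral_real) auto
    finally show "(\<integral>\<^sup>+x. ennreal (x powr s) \<partial>density lborel (exponential_density 1))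
                    = ennreal (Gamma (1 + s))" .
    show "0 \<le> Gamma (1 + s)"
      using s by (intro less_imp_le Gamma_real_pos) simp
  qed auto
  moreover have "gen_pochhammer 1 s / gen_pochhammer (0 + \<beta>) (0 * s) = Gamma (1 + s)" for s
    by (simp add: gen_pochhammer_def)
  ultimately show ?thesis
    using pos by (simp add: M_distribution_def)
qed

text \<open>The case \<open>\<alpha> = 1\<close>, \<open>\<beta> = 0\<close> is the constant \<open>1\<close>, which is MSU because \<open>1 * Y = Y\<close>.\<close>

lemma positive_distribution_return_1: "positive_distribution (return borel 1)"
proof -
  interpret prob_space "return borel (1::real)"
    by (rule prob_space_return) simp
  show ?thesis
    by standard (simp_all add: AE_return)
qed

lemma M_distribution_1_0: "M_distribution 1 0 (return borel 1)"
proof -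
  have "has_bochner_integral (return borel 1) (\<lambda>x::real. x powr s) 1" for s :: real
  proof -
    interpret positive_distribution "return borel 1"
      by (rule positive_distribution_return_1)
    have "has_bochner_integral (return borel 1) (\<lambda>x::real. 1 :: real) 1"
      using prob_space by (auto simp: has_bochner_integral_iff)
    then show ?thesis
      by (subst has_bochner_integral_cong_AE[where g = "\<lambda>_. 1"]) (auto simp: AE_return)
  qed
  moreover have "gen_pochhammer 1 s \<noteq> 0" if "s > -1" for s
  proof -
    have "0 < Gamma (1 + s)"
      using that by (intro Gamma_real_pos) simp
    then show ?thesis
      by (simp add: gen_pochhammer_def)
  qed
  ultimately show ?thesis
    by (auto simp: M_distribution_def positive_distribution_return_1)
qed

lemma MSU_return_1: "MSU (return borel 1)"
proof -
  have "distr (return borel 1 \<Otimes>\<^sub>M \<nu>) borel (\<lambda>(x, y). x * y) = \<nu>"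
    if \<nu>: "real_distribution \<nu>" for \<nu> :: "real measure"
  proof -
    interpret \<nu>: real_distribution \<nu> by (rule \<nu>)
    have "return borel (1::real) \<Otimes>\<^sub>M \<nu> = distr \<nu> (borel \<Otimes>\<^sub>M \<nu>) (Pair 1)"
    proof (rule measure_eqI)
      interpret r: prob_space "return borel (1::real)" by (rule prob_space_return) simp
      fix A assume A: "A \<in> sets (return borel (1::real) \<Otimes>\<^sub>M \<nu>)"
      then have A': "A \<in> sets (borel \<Otimes>\<^sub>M \<nu>)"
        by (simp cong: sets_pair_measure_cong)
      have m: "(\<lambda>x. emeasure \<nu> (Pair x -` A)) \<in> borel_measurable borel"
        using \<nu>.measurable_emeasure_Pair[OF A'] by simp
      show "emeasure (return borel 1 \<Otimes>\<^sub>M \<nu>) A = emeasure (distr \<nu> (borel \<Otimes>\<^sub>M \<nu>) (Pair 1)) A"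
        using A A' m
        by (subst \<nu>.emeasure_pair_measure_alt) (auto simp: nn_integral_return emeasure_distr)
    qed (simp cong: sets_pair_measure_cong)
    then have "distr (return borel 1 \<Otimes>\<^sub>M \<nu>) borel (\<lambda>(x, y). x * y)
                 = distr \<nu> borel (\<lambda>y. y)"
      by (simp add: distr_distr comp_def)
    also have "\<dots> = \<nu>"
      by (intro distr_id2) simp
    finally show ?thesis .
  qed
  then show ?thesis
    by (auto simp: MSU_def positive_distribution_return_1)
qed

end

theory Submission
  imports Defs "HOL-Real_Asymp.Real_Asymp"
begin

text \<open>For \<open>0 < \<alpha> < 1\<close> put \<open>\<gamma> = 1 - \<beta>\<close>. Deforming the contour of the Wright function to the curve on which
  the exponent is real expresses the density of \<open>M\<^sub>\<alpha>\<^sub>,\<^sub>\<beta>\<close>, for \<open>\<bar>\<gamma>\<bar> < 1\<close>, as a power of \<open>x\<close> times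
  \<open>\<integral> exp (- y * A) * W dA\<close> over that curve, where \<open>y = x powr (1 / (1 - \<alpha>))\<close> and \<open>A\<close>, \<open>W\<close> are explicit functions of
  the angle \<open>\<theta> \<in> (0, pi)\<close>. No contour integral is needed: the integral has the right moments because
  \<open>A powr (- q - 1) * W * dA\<close> is exact, and the moments determine the law.

  If \<open>- \<alpha> \<le> \<gamma> \<le> 1 - \<alpha>\<close>, then \<open>ln W\<close> is a concave function of \<open>ln A\<close>, so the density is log-concave in \<open>ln x\<close>, as a
  convolution of two kernels that are totally positive of order two. Larger \<open>\<beta>\<close> are reached because the density for
  \<open>\<beta> + \<alpha>\<close> is the tail integral of that for \<open>\<beta>\<close>, and \<open>\<beta> = 0\<close> because the density is then \<open>x\<close> times that for \<open>1 - \<alpha>\<close>.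
  If \<open>\<gamma> > 1 - \<alpha>\<close>, then \<open>W / A powr \<gamma>\<close> approaches its limit at \<open>A = \<infinity>\<close> from above at the rate \<open>A powr (\<alpha> - 1)\<close>;
  hence the density has a positive limit at \<open>0\<close> and exceeds it nearby, and a suitable \<open>Y\<close> with a step
  density makes the density of \<open>X * Y\<close> first decrease and then increase on \<open>(0, \<infinity>)\<close>.\<close>

text \<open>Where the curve comes from: \<phi>(-\<alpha>, \<beta>, -x) is a Hankel integral of exp
  (s - x s^\<alpha>) s^(-\<beta>). With y = x^(1 / (1 - \<alpha>)) and s = y \<zeta> the exponent
  becomes y (\<zeta> - \<zeta>^\<alpha>). For \<zeta> of modulus \<rho> and angle \<theta> its
  imaginary part vanishes when \<rho>^(1 - \<alpha>) = sin (\<alpha> \<theta>) / sin \<theta>, and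
  its value there is -y A. \<open>Wfun\<close> is Im (\<zeta>^\<gamma>) / \<gamma>, and an
  integration by parts turns the differential of W into y W dA. The gain is positivity: the power
  series of \<phi> has terms of both signs, while W > 0 on the whole curve as long as |\<gamma>| <
  1. This is why 0 < \<beta> < 2 is treated directly and other \<beta> are reduced to it. That MSU
  implies MSU* is not proved for general laws. MSU* implies MSU for every law, MSU* is established
  inside the stated parameter range, and outside of it MSU itself is refuted.\<close>

section \<open>Monotonicity of the logarithmic slope along the curve\<close>

text \<open>The letters stand for a = cot (\<alpha> \<theta>), b = cot ((1 - \<alpha>) \<theta>), y
  = cot (\<gamma> \<theta>) and T = 1 / \<theta>; then D is \<open>Dfun\<close>, and D', E' are the
  derivatives of D and E in \<theta>. The second conclusion is, up to the factor -\<gamma> / D^2,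
  the derivative of \<open>Nfun\<close> / \<open>Dfun\<close>. All trigonometry is compressed into
  the signs of E and E' and the bounds involving y and T, so that a polynomial inequality is
  left.\<close>

lemma curve_core:
  fixes \<alpha> c a b \<gamma> y T :: real
  defines "E \<equiv> \<alpha> * a - c * b"
  defines "D \<equiv> (1 + E\<^sup>2) / (a + b)"
  defines "E' \<equiv> c\<^sup>2 * (1 + b\<^sup>2) - \<alpha>\<^sup>2 * (1 + a\<^sup>2)"
  defines "D' \<equiv> (1 + a\<^sup>2) * (1 + b\<^sup>2) / (a + b)\<^sup>2 - \<alpha>^3 * (1 + a\<^sup>2) - c^3 * (1 + b\<^sup>2)"
  assumes ac: "0 < \<alpha>" "\<alpha> \<le> c" "\<alpha> + c = 1" and ab: "0 < a + b" and E: "0 \<le> E" and E': "0 \<le> E'"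
    and T: "T \<le> D + \<alpha> * c * (a + b)"
    and y: "b \<le> y" "(c - \<gamma>) * (1 + y\<^sup>2) \<le> (y - b) * T"
  shows "T * D \<le> D'" "0 \<le> D * (\<gamma> * (1 + y\<^sup>2) - E') + D' * (y + E)"
proof -
  \<comment> \<open>With m = (1 + E^2) / \<kappa> the quantities D, D' and E' become polynomials in
    E, m, \<kappa> and the weights \<alpha>, c; a and b themselves disappear.\<close>
  define V \<kappa> m d \<tau> where "V = 1 + E\<^sup>2" and "\<kappa> = \<alpha> * c * (a + b)" and "m = V / \<kappa>"
    and "d = c - \<alpha>" and "\<tau> = y - b"
  have \<alpha>: "\<alpha> = 1 - c" and c: "0 < c" and d: "0 \<le> d" "d \<le> 1" and \<tau>: "0 \<le> \<tau>" using ac y unfolding d_def \<tau>_def by auto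
  have V: "0 < V" "E\<^sup>2 \<le> V" unfolding V_def by (auto simp: add_pos_nonneg)
  have \<kappa>: "0 < \<kappa>" unfolding \<kappa>_def using ac c ab by simp
  have m: "0 < m" "m * \<kappa> = V" unfolding m_def using V \<kappa> by auto
  have D: "D = \<alpha> * c * m" unfolding D_def m_def \<kappa>_def V_def using ac c ab by simp
  have b: "b = \<kappa> / c - E" unfolding \<kappa>_def E_def \<alpha> using c by (simp add: field_simps)
  have eE': "E' = d * V - 2 * \<kappa> * E"
    unfolding E'_def d_def V_def \<kappa>_def E_def \<alpha> by algebra
  have eD': "D' = \<alpha> * c * (\<alpha> * c * m\<^sup>2 + 2 * d * E * m + 1 - 3 * E\<^sup>2)"
  proof -
    define K where "K = a + b"
    have K: "K \<noteq> 0" "b = K - a" using ab unfolding K_def by auto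
    have mK: "\<alpha> * c * m = V / K" unfolding m_def \<kappa>_def K_def using ac c ab by simp
    have "\<alpha> * c * (\<alpha> * c * m\<^sup>2 + 2 * d * E * m + 1 - 3 * E\<^sup>2) = (V / K)\<^sup>2 + 2 * d * E * (V / K) + \<alpha> * c * (1 - 3 * E\<^sup>2)"
      unfolding mK[symmetric] by algebra
    also have "\<dots> * K\<^sup>2 = V\<^sup>2 + 2 * d * E * V * K + \<alpha> * c * (1 - 3 * E\<^sup>2) * K\<^sup>2"
      using K by (simp add: field_simps power2_eq_square)
    also have "\<dots> = D' * K\<^sup>2"
    proof -
      have "D' * K\<^sup>2 = (1 + a\<^sup>2) * (1 + b\<^sup>2) - (\<alpha>^3 * (1 + a\<^sup>2) + c^3 * (1 + b\<^sup>2)) * K\<^sup>2"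
        unfolding D'_def K_def using ab by (simp add: field_simps)
      also have "\<dots> = V\<^sup>2 + 2 * d * E * V * K + \<alpha> * c * (1 - 3 * E\<^sup>2) * K\<^sup>2"
        unfolding V_def d_def E_def K_def \<alpha> by algebra
      finally show ?thesis by simp
    qed
    finally show ?thesis using K by simp
  qed
  have T': "T \<le> \<alpha> * c * m + \<kappa>" using T unfolding D \<kappa>_def .
  have V2: "\<alpha> * c * m\<^sup>2 + 2 * d * E * m + 1 - 3 * E\<^sup>2 - (\<alpha> * c * m + \<kappa>) * m = 2 * E * m * d - 4 * E\<^sup>2"
    using m unfolding V_def by (simp add: algebra_simps power2_eq_square)
  \<comment> \<open>This is E' \<ge> 0 divided by \<kappa>; multiplied by E it makes the right-hand
    side of \<open>V2\<close> nonnegative.\<close>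
  have dm: "2 * E \<le> d * m"
  proof -
    have "2 * E * \<kappa> \<le> d * (m * \<kappa>)" using E' unfolding eE' m by (simp add: mult_ac)
    hence "(2 * E) * \<kappa> \<le> (d * m) * \<kappa>" by (simp add: mult_ac)
    thus ?thesis using \<kappa> by simp
  qed
  have dm2: "2 * E\<^sup>2 \<le> d * m * E" using mult_right_mono[OF dm E] by (simp add: power2_eq_square)
  have "(\<alpha> * c * m + \<kappa>) * m \<le> \<alpha> * c * m\<^sup>2 + 2 * d * E * m + 1 - 3 * E\<^sup>2" using V2 dm2 by (simp add: algebra_simps)
  moreover have "T * m \<le> (\<alpha> * c * m + \<kappa>) * m" using T' m by simp
  ultimately have "T * m \<le> \<alpha> * c * m\<^sup>2 + 2 * d * E * m + 1 - 3 * E\<^sup>2" by simp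
  from mult_left_mono[OF this, of "\<alpha> * c"] show "T * D \<le> D'"
    unfolding D eD' using ac c by (simp add: algebra_simps)

  define B where "B = \<alpha> * c * m\<^sup>2 + 2 * d * E * m + 1 - 3 * E\<^sup>2"
  \<comment> \<open>Up to the factor \<alpha> c this is the second claim. Eliminating \<gamma> by
    the hypothesis on y leaves a quadratic polynomial in \<tau> = y - b.\<close>
  define G where "G = m * (\<gamma> * (1 + y\<^sup>2) - E') + B * (y + E)"
  have yb: "y = \<kappa> / c - E + \<tau>" unfolding \<tau>_def using b by simp
  have "\<gamma> * (1 + y\<^sup>2) \<ge> c * (1 + y\<^sup>2) - \<tau> * (\<alpha> * c * m + \<kappa>)"
    using y(2) mult_left_mono[OF T' \<tau>] unfolding \<tau>_def by (simp add: algebra_simps)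
  hence "G \<ge> m * (c * (1 + y\<^sup>2) - \<tau> * (\<alpha> * c * m + \<kappa>) - E') + B * (y + E)"
    unfolding G_def using m by simp
  also have "m * (c * (1 + y\<^sup>2) - \<tau> * (\<alpha> * c * m + \<kappa>) - E') + B * (y + E)
     = m * c * \<tau>\<^sup>2 - 2 * \<tau> * (\<alpha> * E * m + E\<^sup>2 - 1) + (2 * \<alpha> * m * V + 2 * d * E * V / c + (2 - 2 * E\<^sup>2) * \<kappa> / c)"
  proof -
    define k where "k = \<kappa> / c"
    have k: "\<kappa> = k * c" unfolding k_def using c by simp
    have mk: "m * k * c = 1 + E\<^sup>2" using m(2) unfolding V_def k by simp
    have "c * (m * (c * (1 + y\<^sup>2) - \<tau> * (\<alpha> * c * m + \<kappa>) - E') + B * (y + E))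
     = c * (m * c * \<tau>\<^sup>2 - 2 * \<tau> * (\<alpha> * E * m + E\<^sup>2 - 1) + 2 * \<alpha> * m * V + (2 - 2 * E\<^sup>2) * k) + 2 * d * E * V"
      unfolding eE' B_def yb V_def d_def k_def[symmetric] unfolding k \<alpha> using mk by algebra
    also have "\<dots> = c * (m * c * \<tau>\<^sup>2 - 2 * \<tau> * (\<alpha> * E * m + E\<^sup>2 - 1) + (2 * \<alpha> * m * V + 2 * d * E * V / c + (2 - 2 * E\<^sup>2) * \<kappa> / c))"
      unfolding k_def using c by (simp add: field_simps)
    finally show ?thesis using c by simp
  qed
  finally have G1: "G \<ge> m * c * \<tau>\<^sup>2 - 2 * \<tau> * (\<alpha> * E * m + E\<^sup>2 - 1) + (2 * \<alpha> * m * V + 2 * d * E * V / c + (2 - 2 * E\<^sup>2) * \<kappa> / c)" .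
  have "2 * \<kappa> * E\<^sup>2 \<le> d * E * V"
  proof -
    have "2 * \<kappa> * E \<le> d * V" using E' unfolding eE' by simp
    from mult_right_mono[OF this E] show ?thesis by (simp add: power2_eq_square algebra_simps)
  qed
  hence "(2 + 2 * E\<^sup>2) * \<kappa> / c \<le> 2 * d * E * V / c + (2 - 2 * E\<^sup>2) * \<kappa> / c"
    using c by (simp add: field_simps)
  hence G2: "G \<ge> m * c * \<tau>\<^sup>2 - 2 * \<tau> * (\<alpha> * E * m + E\<^sup>2 - 1) + 2 * V * (\<alpha> * m + \<kappa> / c)"
  proof -
    have "2 * V * (\<alpha> * m + \<kappa> / c) = 2 * \<alpha> * m * V + (2 + 2 * E\<^sup>2) * \<kappa> / c"
      unfolding V_def using c by (simp add: field_simps)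
    with G1 \<open>(2 + 2 * E\<^sup>2) * \<kappa> / c \<le> _\<close> show ?thesis by linarith
  qed
  \<comment> \<open>Minus half the linear coefficient. If it is nonpositive, every term is
    nonnegative because \<tau> \<ge> 0; otherwise the discriminant is estimated, using E^2 \<le> V
    and \<alpha> \<le> c.\<close>
  define b2 where "b2 = \<alpha> * E * m + E\<^sup>2 - 1"
  have c0: "0 \<le> 2 * V * (\<alpha> * m + \<kappa> / c)" using V m ac c \<kappa> by simp
  have "0 \<le> m * c * \<tau>\<^sup>2 - 2 * \<tau> * b2 + 2 * V * (\<alpha> * m + \<kappa> / c)"
  proof (cases "b2 \<le> 0")
    case True
    hence "\<tau> * b2 \<le> 0" using \<tau> by (simp add: mult_nonneg_nonpos)
    moreover have "0 \<le> m * c * \<tau>\<^sup>2" using m c by simp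
    ultimately show ?thesis using c0 by simp
  next
    case False
    have "b2\<^sup>2 \<le> (E * (\<alpha> * m + E))\<^sup>2" using False unfolding b2_def
      by (intro power_mono) (auto simp: algebra_simps power2_eq_square)
    also have "\<dots> = E\<^sup>2 * (\<alpha> * m + E)\<^sup>2" by (simp add: power_mult_distrib)
    also have "\<dots> \<le> V * (2 * (\<alpha>\<^sup>2 * m\<^sup>2 + E\<^sup>2))"
    proof (intro mult_mono)
      show "(\<alpha> * m + E)\<^sup>2 \<le> 2 * (\<alpha>\<^sup>2 * m\<^sup>2 + E\<^sup>2)"
        using zero_le_power2[of "\<alpha> * m - E"] by (simp add: power2_eq_square algebra_simps)
    qed (use V in auto)
    also have "\<dots> \<le> V * (2 * (\<alpha> * c * m\<^sup>2 + V))"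
    proof -
      have "\<alpha>\<^sup>2 * m\<^sup>2 \<le> \<alpha> * c * m\<^sup>2" using ac by (intro mult_right_mono) (auto simp: power2_eq_square)
      thus ?thesis using V by (intro mult_left_mono) auto
    qed
    also have "\<dots> = (m * c) * (2 * V * (\<alpha> * m + \<kappa> / c))"
      unfolding m(2)[symmetric] using c by (simp add: field_simps power2_eq_square)
    finally have "b2\<^sup>2 \<le> (m * c) * (2 * V * (\<alpha> * m + \<kappa> / c))" .
    hence "0 \<le> (m * c * \<tau> - b2)\<^sup>2 + ((m * c) * (2 * V * (\<alpha> * m + \<kappa> / c)) - b2\<^sup>2)" by simp
    also have "\<dots> = (m * c) * (m * c * \<tau>\<^sup>2 - 2 * \<tau> * b2 + 2 * V * (\<alpha> * m + \<kappa> / c))"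
      by algebra
    finally have "0 \<le> (m * c) * (m * c * \<tau>\<^sup>2 - 2 * \<tau> * b2 + 2 * V * (\<alpha> * m + \<kappa> / c))" .
    moreover have "0 < m * c" using m c by simp
    ultimately show ?thesis by (simp only: zero_le_mult_iff) linarith
  qed
  hence "0 \<le> G" using G2 unfolding b2_def by simp
  hence "0 \<le> (\<alpha> * c) * G" using ac c by simp
  thus "0 \<le> D * (\<gamma> * (1 + y\<^sup>2) - E') + D' * (y + E)"
    unfolding D eD' G_def B_def by (simp add: algebra_simps)
qed


section \<open>Monotonicity of cotangent expressions\<close>

lemma one_plus_cot_sq: "sin x \<noteq> 0 \<Longrightarrow> 1 + (cot x)\<^sup>2 = 1 / (sin x)\<^sup>2" for x :: real
  using sin_cos_squared_add[of x] by (simp add: cot_def field_simps)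

lemma DERIV_cot_fun:
  fixes f :: "real \<Rightarrow> real"
  assumes "(f has_real_derivative d) (at x)" "sin (f x) \<noteq> 0"
  shows "((\<lambda>x. cot (f x)) has_real_derivative - d * (1 + (cot (f x))\<^sup>2)) (at x)"
  using DERIV_chain2[OF DERIV_cot[OF assms(2)] assms(1)] assms(2)
  by (simp add: one_plus_cot_sq field_simps)

lemma mult_cot_antimono:
  fixes u v :: real
  assumes "0 < u" "u \<le> v" "v < pi"
  shows "v * cot v \<le> u * cot u"
proof (rule DERIV_nonpos_imp_nonincreasing[OF assms(2), of "\<lambda>u. u * cot u"])
  fix x assume x: "u \<le> x" "x \<le> v"
  have s: "0 < sin x" using x assms by (intro sin_gt_zero) auto
  have "((\<lambda>u. u * cot u) has_real_derivative cot x - x / (sin x)\<^sup>2) (at x)"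
    using s by (auto intro!: derivative_eq_intros DERIV_cot_fun simp: one_plus_cot_sq field_simps)
  moreover have "cot x - x / (sin x)\<^sup>2 \<le> 0"
  proof -
    have "sin x * cos x \<le> sin x * 1" using s by (intro mult_left_mono) auto
    also have "\<dots> \<le> x" using sin_x_le_x x assms by simp
    finally show ?thesis using s by (simp add: cot_def field_simps power2_eq_square)
  qed
  ultimately show "\<exists>y. ((\<lambda>u. u * cot u) has_real_derivative y) (at x) \<and> y \<le> 0" by blast
qed

lemma mult_csc_mono:
  fixes u v :: real
  assumes "0 < u" "u \<le> v" "v < pi"
  shows "u / sin u \<le> v / sin v"
proof (rule DERIV_nonneg_imp_nondecreasing[OF assms(2), of "\<lambda>u. u / sin u"])
  fix x assume x: "u \<le> x" "x \<le> v"
  have s: "0 < sin x" using x assms by (intro sin_gt_zero) auto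
  have "((\<lambda>u. u / sin u) has_real_derivative (sin x - x * cos x) / (sin x)\<^sup>2) (at x)"
    using s by (auto intro!: derivative_eq_intros simp: field_simps power2_eq_square)
  moreover have "x * cos x \<le> sin x"
  proof (rule DERIV_nonneg_imp_nondecreasing[of 0 x "\<lambda>x. sin x - x * cos x", simplified])
    show "0 \<le> x" using x assms by simp
    fix z assume z: "0 \<le> z" "z \<le> x"
    have "((\<lambda>x. sin x - x * cos x) has_real_derivative z * sin z) (at z)"
      by (auto intro!: derivative_eq_intros)
    moreover have "0 \<le> z * sin z" using z x assms by (intro mult_nonneg_nonneg sin_ge_zero) auto
    ultimately show "\<exists>y. ((\<lambda>x. sin x - x * cos x) has_real_derivative y) (at z) \<and> 0 \<le> y" by blast
  qed
  ultimately show "\<exists>y. ((\<lambda>u. u / sin u) has_real_derivative y) (at x) \<and> 0 \<le> y"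
    by (intro exI[of _ "(sin x - x * cos x) / (sin x)\<^sup>2"]) auto
qed

lemma inverse_minus_cot_mono:
  fixes u v :: real
  assumes "0 < u" "u \<le> v" "v < pi"
  shows "1 / u - cot u \<le> 1 / v - cot v"
proof (rule DERIV_nonneg_imp_nondecreasing[OF assms(2), of "\<lambda>u. 1 / u - cot u"])
  fix x assume x: "u \<le> x" "x \<le> v"
  have s: "0 < sin x" "0 < x" using x assms by (auto intro!: sin_gt_zero)
  have "((\<lambda>u. 1 / u - cot u) has_real_derivative 1 / (sin x)\<^sup>2 - 1 / x\<^sup>2) (at x)"
    unfolding one_plus_cot_sq[OF less_imp_neq[OF s(1), symmetric], symmetric]
    using s by (auto intro!: derivative_eq_intros DERIV_cot_fun simp: power2_eq_square)
  moreover have "1 / x\<^sup>2 \<le> 1 / (sin x)\<^sup>2"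
    using s sin_x_le_x[of x] by (intro divide_left_mono power_mono) auto
  ultimately show "\<exists>y. ((\<lambda>u. 1 / u - cot u) has_real_derivative y) (at x) \<and> 0 \<le> y"
    by (intro exI[of _ "1 / (sin x)\<^sup>2 - 1 / x\<^sup>2"]) auto
qed

lemma cot_antimono:
  fixes u v :: real
  assumes "0 < u" "u \<le> v" "v < pi"
  shows "cot v \<le> cot u"
proof (rule DERIV_nonpos_imp_nonincreasing[OF assms(2), of cot])
  fix x assume x: "u \<le> x" "x \<le> v"
  have s: "0 < sin x" using x assms by (intro sin_gt_zero) auto
  show "\<exists>y. (cot has_real_derivative y) (at x) \<and> y \<le> 0"
    using DERIV_cot[of x] s by (intro exI[of _ "- inverse ((sin x)\<^sup>2)"]) auto
qed

text \<open>The cotangent is concave on [pi/2, pi), so it lies below its tangent at u. On (0, pi/2)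
  it is convex and the inequality is reversed, which forces the detour in
  \<open>core_ineq\<close>.\<close>

lemma cot_tangent:
  fixes u v :: real
  assumes "pi / 2 \<le> u" "u \<le> v" "v < pi"
  shows "(v - u) * (1 + (cot u)\<^sup>2) \<le> cot u - cot v"
proof -
  have "0 < u" using assms pi_gt_zero by linarith
  have "(\<lambda>v. cot u - cot v - (v - u) * (1 + (cot u)\<^sup>2)) u \<le> (\<lambda>v. cot u - cot v - (v - u) * (1 + (cot u)\<^sup>2)) v"
  proof (rule DERIV_nonneg_imp_nondecreasing[OF assms(2)])
    fix x assume x: "u \<le> x" "x \<le> v"
    have s: "0 < sin x" "0 < sin u" using x assms \<open>0 < u\<close> by (auto intro!: sin_gt_zero)
    have "sin x \<le> sin u" using sin_monotone_2pi_le[of "pi - x" "pi - u"] x assms by simp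
    hence "1 / (sin u)\<^sup>2 \<le> 1 / (sin x)\<^sup>2" using s by (intro divide_left_mono power_mono) auto
    moreover have "((\<lambda>v. cot u - cot v - (v - u) * (1 + (cot u)\<^sup>2)) has_real_derivative 1 / (sin x)\<^sup>2 - 1 / (sin u)\<^sup>2) (at x)"
      using s by (auto intro!: derivative_eq_intros DERIV_cot_fun simp: one_plus_cot_sq field_simps)
    ultimately show "\<exists>y. ((\<lambda>v. cot u - cot v - (v - u) * (1 + (cot u)\<^sup>2)) has_real_derivative y) (at x) \<and> 0 \<le> y"
      by (intro exI[of _ "1 / (sin x)\<^sup>2 - 1 / (sin u)\<^sup>2"]) auto
  qed
  thus ?thesis by simp
qed

text \<open>The logarithmic derivative in \<theta> of sin (x \<theta>); 1 / \<theta> is its limit as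
  x tends to 0, the value for \<gamma> = 0.\<close>

definition rcot :: "real \<Rightarrow> real \<Rightarrow> real" where
  "rcot x \<theta> = (if x = 0 then 1 / \<theta> else x * cot (x * \<theta>))"

text \<open>Along the curve, \<open>Dfun / (1 - \<alpha>)\<close> is the derivative of \<open>ln A\<close>, and the slope of \<open>ln W\<close> with respect to
  \<open>ln A\<close> is \<open>\<gamma> + (1 - \<alpha>) * Nfun / Dfun\<close>.\<close>

definition Nfun :: "real \<Rightarrow> real \<Rightarrow> real \<Rightarrow> real" where
  "Nfun \<alpha> \<gamma> \<theta> = \<gamma> * (\<alpha> * cot (\<alpha> * \<theta>) - (1 - \<alpha>) * cot ((1 - \<alpha>) * \<theta>)) + rcot \<gamma> \<theta>"

definition Dfun :: "real \<Rightarrow> real \<Rightarrow> real" where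
  "Dfun \<alpha> \<theta> = \<alpha>\<^sup>2 * cot (\<alpha> * \<theta>) + (1 - \<alpha>)\<^sup>2 * cot ((1 - \<alpha>) * \<theta>) - cot \<theta>"

definition Dder :: "real \<Rightarrow> real \<Rightarrow> real" where
  "Dder \<alpha> \<theta> = (1 + (cot \<theta>)\<^sup>2) - \<alpha>^3 * (1 + (cot (\<alpha> * \<theta>))\<^sup>2) - (1 - \<alpha>)^3 * (1 + (cot ((1 - \<alpha>) * \<theta>))\<^sup>2)"

text \<open>The symmetry that exchanges \<open>\<alpha>\<close> and \<open>1 - \<alpha>\<close> reduces negative \<open>\<gamma>\<close> to positive ones.\<close>

lemma Dfun_swap: "Dfun (1 - \<alpha>) \<theta> = Dfun \<alpha> \<theta>" "Dder (1 - \<alpha>) \<theta> = Dder \<alpha> \<theta>"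
  by (auto simp: Dfun_def Dder_def)

lemma Nfun_swap: "Nfun (1 - \<alpha>) (- \<gamma>) \<theta> = Nfun \<alpha> \<gamma> \<theta>"
  by (simp add: Nfun_def rcot_def algebra_simps)

lemma sin_scaled_pos: "0 < x \<Longrightarrow> x \<le> 1 \<Longrightarrow> 0 < \<theta> \<Longrightarrow> \<theta> < pi \<Longrightarrow> 0 < sin (x * \<theta>)" for x \<theta> :: real
proof (intro sin_gt_zero)
  assume "0 < x" "x \<le> 1" "0 < \<theta>" "\<theta> < pi"
  then have "x * \<theta> \<le> 1 * \<theta>" by (intro mult_right_mono) auto
  then show "x * \<theta> < pi" using \<open>\<theta> < pi\<close> by simp
qed auto

context
  fixes \<alpha> \<theta> a b :: real
  assumes \<alpha>: "0 < \<alpha>" "\<alpha> < 1" and \<theta>: "0 < \<theta>" "\<theta> < pi"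
  defines "a \<equiv> cot (\<alpha> * \<theta>)" and "b \<equiv> cot ((1 - \<alpha>) * \<theta>)"
begin

lemma sin_pos3: "0 < sin \<theta>" "0 < sin (\<alpha> * \<theta>)" "0 < sin ((1 - \<alpha>) * \<theta>)"
  using sin_scaled_pos[of 1 \<theta>] sin_scaled_pos[of \<alpha> \<theta>] sin_scaled_pos[of "1 - \<alpha>" \<theta>] \<alpha> \<theta> by auto

lemma sin_split: "sin \<theta> = sin (\<alpha> * \<theta>) * sin ((1 - \<alpha>) * \<theta>) * (a + b)"
proof -
  have "sin \<theta> = sin (\<alpha> * \<theta> + (1 - \<alpha>) * \<theta>)" by (simp add: algebra_simps)
  also have "\<dots> = sin (\<alpha> * \<theta>) * sin ((1 - \<alpha>) * \<theta>) * (a + b)"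
    unfolding sin_add a_def b_def cot_def using sin_pos3 by (simp add: field_simps)
  finally show ?thesis .
qed

lemma cot_sum_pos: "0 < a + b"
  using sin_split sin_pos3 by (metis mult_pos_pos zero_less_mult_pos)

lemma cot_split: "cot \<theta> = (a * b - 1) / (a + b)"
proof -
  have "cos \<theta> = cos (\<alpha> * \<theta> + (1 - \<alpha>) * \<theta>)" by (simp add: algebra_simps)
  also have "\<dots> = sin (\<alpha> * \<theta>) * sin ((1 - \<alpha>) * \<theta>) * (a * b - 1)"
    unfolding cos_add a_def b_def cot_def using sin_pos3 by (simp add: field_simps)
  finally show ?thesis unfolding cot_def sin_split using sin_pos3 by simp
qed

lemma Dfun_closed: "Dfun \<alpha> \<theta> = (1 + (\<alpha> * a - (1 - \<alpha>) * b)\<^sup>2) / (a + b)"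
  unfolding Dfun_def cot_split a_def[symmetric] b_def[symmetric]
  using cot_sum_pos by (simp add: field_simps power2_eq_square)

lemma Dfun_pos: "0 < Dfun \<alpha> \<theta>"
  unfolding Dfun_closed using cot_sum_pos by (auto intro!: divide_pos_pos add_pos_nonneg)

lemma Dder_closed:
  "Dder \<alpha> \<theta> = (1 + a\<^sup>2) * (1 + b\<^sup>2) / (a + b)\<^sup>2 - \<alpha>^3 * (1 + a\<^sup>2) - (1 - \<alpha>)^3 * (1 + b\<^sup>2)"
proof -
  have "1 + (cot \<theta>)\<^sup>2 = (1 + a\<^sup>2) * (1 + b\<^sup>2) / (a + b)\<^sup>2"
    unfolding cot_split using cot_sum_pos by (simp add: field_simps) algebra
  thus ?thesis unfolding Dder_def a_def b_def by simp
qed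

text \<open>The bound on T = 1 / \<theta> required by \<open>curve_core\<close>. It amounts to 1 /
  \<theta> + cot \<theta> \<le> \<alpha> a + (1 - \<alpha>) b. Since 1 / u - cot u increases, its
  values at \<alpha> \<theta> and (1 - \<alpha>) \<theta> are at most the one at \<theta>; the mean
  of these two inequalities with weights \<alpha> and 1 - \<alpha> is the claim.\<close>

lemma cot_sum_ge: "1 / \<theta> \<le> Dfun \<alpha> \<theta> + \<alpha> * (1 - \<alpha>) * (a + b)"
proof -
  have 1: "1 / (\<alpha> * \<theta>) - a \<le> 1 / \<theta> - cot \<theta>"
    unfolding a_def using \<alpha> \<theta> by (intro inverse_minus_cot_mono) auto
  have 2: "1 / ((1 - \<alpha>) * \<theta>) - b \<le> 1 / \<theta> - cot \<theta>"
    unfolding b_def using \<alpha> \<theta> by (intro inverse_minus_cot_mono) auto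
  have "1 / \<theta> - \<alpha> * a = \<alpha> * (1 / (\<alpha> * \<theta>) - a)" using \<alpha> by (simp add: field_simps)
  also have "\<dots> \<le> \<alpha> * (1 / \<theta> - cot \<theta>)" using 1 \<alpha> by (intro mult_left_mono) auto
  finally have 3: "1 / \<theta> - \<alpha> * a \<le> \<alpha> * (1 / \<theta> - cot \<theta>)" .
  have "1 / \<theta> - (1 - \<alpha>) * b = (1 - \<alpha>) * (1 / ((1 - \<alpha>) * \<theta>) - b)" using \<alpha> by (simp add: right_diff_distrib)
  also have "\<dots> \<le> (1 - \<alpha>) * (1 / \<theta> - cot \<theta>)" using 2 \<alpha> by (intro mult_left_mono) auto
  finally have "1 / \<theta> - (1 - \<alpha>) * b \<le> (1 - \<alpha>) * (1 / \<theta> - cot \<theta>)" .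
  moreover have "\<alpha> * (1 / \<theta> - cot \<theta>) + (1 - \<alpha>) * (1 / \<theta> - cot \<theta>) = 1 / \<theta> - cot \<theta>" by algebra
  ultimately have "1 / \<theta> + cot \<theta> \<le> \<alpha> * a + (1 - \<alpha>) * b" using 3 by linarith
  also have "\<dots> = Dfun \<alpha> \<theta> + cot \<theta> + \<alpha> * (1 - \<alpha>) * (a + b)"
    unfolding Dfun_def a_def[symmetric] b_def[symmetric] by (simp add: algebra_simps power2_eq_square)
  finally show ?thesis by simp
qed

text \<open>u cot u decreases, and \<alpha> \<theta> is the smaller of the two angles.\<close>

lemma E_nonneg:
  assumes "\<alpha> \<le> 1 - \<alpha>"
  shows "0 \<le> \<alpha> * a - (1 - \<alpha>) * b"
proof -
  have "((1 - \<alpha>) * \<theta>) * b \<le> (\<alpha> * \<theta>) * a"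
    unfolding a_def b_def using assms \<alpha> \<theta> sin_pos3
    by (intro mult_cot_antimono mult_right_mono) (auto intro: le_less_trans[OF mult_left_le_one_le])
  hence "((1 - \<alpha>) * b) * \<theta> \<le> (\<alpha> * a) * \<theta>" by (simp add: mult_ac)
  thus ?thesis using \<theta> by simp
qed

text \<open>In terms of sines this compares the squares of u / sin u, an increasing function, at the
  two angles.\<close>

lemma E_deriv_nonneg:
  assumes "\<alpha> \<le> 1 - \<alpha>"
  shows "\<alpha>\<^sup>2 * (1 + a\<^sup>2) \<le> (1 - \<alpha>)\<^sup>2 * (1 + b\<^sup>2)"
proof -
  have "(\<alpha> * \<theta>) / sin (\<alpha> * \<theta>) \<le> ((1 - \<alpha>) * \<theta>) / sin ((1 - \<alpha>) * \<theta>)"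
    using assms \<alpha> \<theta> by (intro mult_csc_mono mult_right_mono) (auto intro: le_less_trans[OF mult_left_le_one_le])
  hence "\<theta> * (\<alpha> / sin (\<alpha> * \<theta>)) \<le> \<theta> * ((1 - \<alpha>) / sin ((1 - \<alpha>) * \<theta>))" by (simp add: mult_ac)
  hence "\<alpha> / sin (\<alpha> * \<theta>) \<le> (1 - \<alpha>) / sin ((1 - \<alpha>) * \<theta>)" using \<theta> by (simp only: mult_le_cancel_left_pos)
  hence "(\<alpha> / sin (\<alpha> * \<theta>))\<^sup>2 \<le> ((1 - \<alpha>) / sin ((1 - \<alpha>) * \<theta>))\<^sup>2"
    using \<alpha> sin_pos3 by (intro power_mono) auto
  thus ?thesis unfolding a_def b_def using sin_pos3 by (simp add: one_plus_cot_sq power_divide)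
qed

lemma core_bounds:
  assumes "\<alpha> \<le> 1 - \<alpha>"
  shows "1 / \<theta> * Dfun \<alpha> \<theta> \<le> Dder \<alpha> \<theta>"
    and "b \<le> y \<Longrightarrow> (1 - \<alpha> - g) * (1 + y\<^sup>2) \<le> (y - b) * (1 / \<theta>) \<Longrightarrow>
      0 \<le> Dfun \<alpha> \<theta> * (g * (1 + y\<^sup>2) - ((1 - \<alpha>)\<^sup>2 * (1 + b\<^sup>2) - \<alpha>\<^sup>2 * (1 + a\<^sup>2)))
        + Dder \<alpha> \<theta> * (y + (\<alpha> * a - (1 - \<alpha>) * b))"
proof -
  note * = curve_core[of \<alpha> "1 - \<alpha>" a b "1 / \<theta>", folded Dfun_closed Dder_closed]
  have **: "0 \<le> (1 - \<alpha>)\<^sup>2 * (1 + b\<^sup>2) - \<alpha>\<^sup>2 * (1 + a\<^sup>2)" using E_deriv_nonneg[OF assms] by simp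
  show "1 / \<theta> * Dfun \<alpha> \<theta> \<le> Dder \<alpha> \<theta>"
    using *(1)[of b "1 - \<alpha>"] \<alpha> assms cot_sum_pos cot_sum_ge E_nonneg[OF assms] ** by simp
  show "0 \<le> Dfun \<alpha> \<theta> * (g * (1 + y\<^sup>2) - ((1 - \<alpha>)\<^sup>2 * (1 + b\<^sup>2) - \<alpha>\<^sup>2 * (1 + a\<^sup>2)))
        + Dder \<alpha> \<theta> * (y + (\<alpha> * a - (1 - \<alpha>) * b))"
    if "b \<le> y" "(1 - \<alpha> - g) * (1 + y\<^sup>2) \<le> (y - b) * (1 / \<theta>)"
    using *(2)[of y g] that \<alpha> assms cot_sum_pos cot_sum_ge E_nonneg[OF assms] ** by simp
qed

text \<open>\<open>core_bounds\<close> asks for the tangent inequality of the cotangent between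
  \<gamma> \<theta> and (1 - \<alpha>) \<theta>, which is available for \<gamma> \<theta> \<ge> pi /
  2. For smaller \<gamma> the expression turns out to be nonincreasing in \<gamma> up to a value g0
  at which the inequality can be used.\<close>

lemma core_ineq:
  assumes \<alpha>': "\<alpha> \<le> 1 - \<alpha>" and \<gamma>: "0 < \<gamma>" "\<gamma> \<le> 1 - \<alpha>"
  shows "0 \<le> Dfun \<alpha> \<theta> * (\<gamma> * (1 + (cot (\<gamma> * \<theta>))\<^sup>2) - ((1 - \<alpha>)\<^sup>2 * (1 + b\<^sup>2) - \<alpha>\<^sup>2 * (1 + a\<^sup>2)))
        + Dder \<alpha> \<theta> * (cot (\<gamma> * \<theta>) + (\<alpha> * a - (1 - \<alpha>) * b))" (is "0 \<le> ?F \<gamma>")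
proof -
  \<comment> \<open>The least g \<ge> \<gamma> at which the tangent condition is known: either g
    \<theta> \<ge> pi / 2, or g = 1 - \<alpha>, where both sides vanish.\<close>
  define g0 where "g0 = max \<gamma> (min (1 - \<alpha>) (pi / (2 * \<theta>)))"
  have g0: "\<gamma> \<le> g0" "0 < g0" "g0 \<le> 1 - \<alpha>" using \<gamma> \<alpha> unfolding g0_def by auto
  have c\<theta>: "(1 - \<alpha>) * \<theta> < pi" using \<alpha> \<theta> by (auto intro: le_less_trans[OF mult_left_le_one_le])
  have yb: "b \<le> cot (g0 * \<theta>)"
    unfolding b_def using g0 \<theta> c\<theta> by (intro cot_antimono mult_right_mono) auto
  have "0 \<le> ?F g0"
  proof (rule core_bounds(2)[OF \<alpha>' yb])
    show "(1 - \<alpha> - g0) * (1 + (cot (g0 * \<theta>))\<^sup>2) \<le> (cot (g0 * \<theta>) - b) * (1 / \<theta>)"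
    proof (cases "g0 = 1 - \<alpha>")
      case True thus ?thesis unfolding b_def by simp
    next
      case False
      hence "pi / (2 * \<theta>) \<le> g0" using g0 unfolding g0_def by auto
      hence "pi / 2 \<le> g0 * \<theta>" using \<theta> by (simp add: field_simps)
      hence "((1 - \<alpha>) * \<theta> - g0 * \<theta>) * (1 + (cot (g0 * \<theta>))\<^sup>2) \<le> cot (g0 * \<theta>) - b"
        unfolding b_def using g0 \<theta> c\<theta> by (intro cot_tangent mult_right_mono) auto
      thus ?thesis using \<theta> by (simp add: field_simps)
    qed
  qed
  also have "?F g0 \<le> ?F \<gamma>"
  proof (cases "g0 = \<gamma>")
    case False
    hence g0': "g0 \<le> pi / (2 * \<theta>)" unfolding g0_def by auto
    have "(\<lambda>g. Dfun \<alpha> \<theta> * (g * (1 + (cot (g * \<theta>))\<^sup>2)) + Dder \<alpha> \<theta> * cot (g * \<theta>)) g0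
        \<le> (\<lambda>g. Dfun \<alpha> \<theta> * (g * (1 + (cot (g * \<theta>))\<^sup>2)) + Dder \<alpha> \<theta> * cot (g * \<theta>)) \<gamma>"
    proof (rule DERIV_nonpos_imp_nonincreasing[OF g0(1)])
      \<comment> \<open>Up to pi / 2 the cotangent is nonnegative, and D \<le> \<theta> D' by the
        first part of \<open>core_bounds\<close>; both push the derivative in g below 0.\<close>
      fix g assume g: "\<gamma> \<le> g" "g \<le> g0"
      have g': "0 < g" "g * \<theta> \<le> pi / 2"
        using g \<gamma> \<theta> mult_right_mono[OF order_trans[OF g(2) g0'], of \<theta>] by auto
      have "0 < sin (g * \<theta>)" using g g' \<gamma> \<theta> pi_gt_zero by (intro sin_gt_zero) (auto intro: le_less_trans)
      hence "((\<lambda>g. Dfun \<alpha> \<theta> * (g * (1 + (cot (g * \<theta>))\<^sup>2)) + Dder \<alpha> \<theta> * cot (g * \<theta>)) has_real_derivative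
        (1 + (cot (g * \<theta>))\<^sup>2) * (Dfun \<alpha> \<theta> - \<theta> * Dder \<alpha> \<theta> - 2 * (Dfun \<alpha> \<theta> * (g * \<theta> * cot (g * \<theta>))))) (at g)"
        by (auto intro!: derivative_eq_intros DERIV_cot_fun simp: algebra_simps power2_eq_square)
      moreover have "0 \<le> Dfun \<alpha> \<theta> * (g * \<theta> * cot (g * \<theta>))"
      proof -
        have "0 \<le> cos (g * \<theta>)" using g' \<theta> by (intro cos_ge_zero) (auto intro: order_trans[of _ 0])
        thus ?thesis using Dfun_pos g' \<theta> \<open>0 < sin (g * \<theta>)\<close> by (simp add: cot_def)
      qed
      moreover have "Dfun \<alpha> \<theta> \<le> \<theta> * Dder \<alpha> \<theta>" using core_bounds(1)[OF \<alpha>'] \<theta> by (simp add: field_simps)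
      ultimately show "\<exists>y. ((\<lambda>g. Dfun \<alpha> \<theta> * (g * (1 + (cot (g * \<theta>))\<^sup>2)) + Dder \<alpha> \<theta> * cot (g * \<theta>)) has_real_derivative y) (at g) \<and> y \<le> 0"
        by (intro exI conjI) (auto intro!: mult_nonneg_nonpos)
    qed
    thus ?thesis by (simp add: algebra_simps)
  qed simp
  finally show ?thesis .
qed

end

lemma Dder_pos:
  assumes "0 < \<alpha>" "\<alpha> < 1" "0 < \<theta>" "\<theta> < pi"
  shows "0 < Dder \<alpha> \<theta>"
proof -
  have *: "0 < Dder \<alpha> \<theta>" if "0 < \<alpha>" "\<alpha> < 1" "\<alpha> \<le> 1 - \<alpha>" for \<alpha>
    using core_bounds(1)[of \<alpha> \<theta>] Dfun_pos[of \<alpha> \<theta>] assms(3,4) that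
    by (smt (verit) mult_pos_pos zero_less_divide_iff)
  show ?thesis using *[of \<alpha>] *[of "1 - \<alpha>"] assms by (cases "\<alpha> \<le> 1 - \<alpha>") (auto simp: Dfun_swap)
qed

lemma Nfun_deriv:
  assumes "0 < \<alpha>" "\<alpha> < 1" "0 < \<theta>" "\<theta> < pi" "\<gamma> \<noteq> 0" "\<bar>\<gamma>\<bar> \<le> 1"
  shows "(Nfun \<alpha> \<gamma> has_real_derivative
    \<gamma> * ((1 - \<alpha>)\<^sup>2 * (1 + (cot ((1 - \<alpha>) * \<theta>))\<^sup>2) - \<alpha>\<^sup>2 * (1 + (cot (\<alpha> * \<theta>))\<^sup>2)) - \<gamma>\<^sup>2 * (1 + (cot (\<gamma> * \<theta>))\<^sup>2)) (at \<theta>)"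
proof -
  have "sin (\<gamma> * \<theta>) \<noteq> 0"
    using sin_scaled_pos[of "\<bar>\<gamma>\<bar>" \<theta>] assms by (cases "\<gamma> > 0") (auto simp: abs_if)
  thus ?thesis unfolding Nfun_def rcot_def using assms sin_pos3[of \<alpha> \<theta>]
    by (auto intro!: derivative_eq_intros DERIV_cot_fun simp: algebra_simps power2_eq_square)
qed

lemma Dfun_deriv:
  assumes "0 < \<alpha>" "\<alpha> < 1" "0 < \<theta>" "\<theta> < pi"
  shows "(Dfun \<alpha> has_real_derivative Dder \<alpha> \<theta>) (at \<theta>)"
  unfolding Dfun_def Dder_def using assms sin_pos3[of \<alpha> \<theta>]
  by (auto intro!: derivative_eq_intros DERIV_cot_fun simp: algebra_simps power2_eq_square power3_eq_cube)

lemma Nfun_Dfun_antimono_pos: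
  assumes "0 < \<alpha>" "\<alpha> < 1" "0 < \<gamma>" "\<gamma> \<le> 1 - \<alpha>" "0 < s" "s \<le> t" "t < pi"
  shows "Nfun \<alpha> \<gamma> t / Dfun \<alpha> t \<le> Nfun \<alpha> \<gamma> s / Dfun \<alpha> s"
proof (rule DERIV_nonpos_imp_nonincreasing[OF assms(6), of "\<lambda>\<theta>. Nfun \<alpha> \<gamma> \<theta> / Dfun \<alpha> \<theta>"])
  fix \<theta> assume "s \<le> \<theta>" "\<theta> \<le> t"
  hence \<theta>: "0 < \<theta>" "\<theta> < pi" using assms by auto
  define a b y where "a = cot (\<alpha> * \<theta>)" and "b = cot ((1 - \<alpha>) * \<theta>)" and "y = cot (\<gamma> * \<theta>)"
  define E' where "E' = (1 - \<alpha>)\<^sup>2 * (1 + b\<^sup>2) - \<alpha>\<^sup>2 * (1 + a\<^sup>2)"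
  have D: "0 < Dfun \<alpha> \<theta>" and D': "0 < Dder \<alpha> \<theta>" using Dfun_pos Dder_pos assms \<theta> by auto
  have ab: "0 < a + b" unfolding a_def b_def using cot_sum_pos[of \<alpha> \<theta>] assms \<theta> by simp
  have c\<theta>: "(1 - \<alpha>) * \<theta> < pi" using assms \<theta> by (auto intro: le_less_trans[OF mult_left_le_one_le])
  have yb: "b \<le> y"
    unfolding b_def y_def using assms \<theta> c\<theta> by (intro cot_antimono mult_right_mono) auto
  have F: "0 \<le> Dfun \<alpha> \<theta> * (\<gamma> * (1 + y\<^sup>2) - E') + Dder \<alpha> \<theta> * (y + (\<alpha> * a - (1 - \<alpha>) * b))"
  proof (cases "\<alpha> \<le> 1 - \<alpha>")
    case True
    show ?thesis unfolding y_def E'_def a_def b_def using core_ineq[of \<alpha> \<theta> \<gamma>] True assms \<theta> by simp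
  next
    \<comment> \<open>For \<alpha> > 1 - \<alpha> the swapped \<open>E_deriv_nonneg\<close> gives E'
      \<le> 0, and y \<ge> b gives y + E \<ge> \<alpha> (a + b) > 0, so both summands are
      nonnegative.\<close>
    case False
    have "E' \<le> 0" unfolding E'_def a_def b_def
      using E_deriv_nonneg[of "1 - \<alpha>" \<theta>] False assms \<theta> by simp
    moreover have "0 \<le> y + (\<alpha> * a - (1 - \<alpha>) * b)"
    proof -
      have "0 \<le> \<alpha> * (a + b)" using ab assms by simp
      also have "\<dots> = b + (\<alpha> * a - (1 - \<alpha>) * b)" by algebra
      finally show ?thesis using yb by simp
    qed
    moreover have "0 \<le> \<gamma> * (1 + y\<^sup>2)" using assms by simp
    ultimately show ?thesis using D D'
      by (intro add_nonneg_nonneg[OF mult_nonneg_nonneg mult_nonneg_nonneg]) linarith+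
  qed
  have N: "Nfun \<alpha> \<gamma> \<theta> = \<gamma> * (y + (\<alpha> * a - (1 - \<alpha>) * b))"
    unfolding Nfun_def rcot_def a_def b_def y_def using assms by (simp add: algebra_simps)
  have "((\<lambda>\<theta>. Nfun \<alpha> \<gamma> \<theta> / Dfun \<alpha> \<theta>) has_real_derivative
     ((\<gamma> * E' - \<gamma>\<^sup>2 * (1 + y\<^sup>2)) * Dfun \<alpha> \<theta> - Nfun \<alpha> \<gamma> \<theta> * Dder \<alpha> \<theta>) / (Dfun \<alpha> \<theta> * Dfun \<alpha> \<theta>)) (at \<theta>)"
    unfolding E'_def a_def b_def y_def using assms \<theta> D
    by (intro DERIV_divide Nfun_deriv Dfun_deriv) auto
  moreover have "(\<gamma> * E' - \<gamma>\<^sup>2 * (1 + y\<^sup>2)) * Dfun \<alpha> \<theta> - Nfun \<alpha> \<gamma> \<theta> * Dder \<alpha> \<theta> \<le> 0"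
  proof -
    have "(\<gamma> * E' - \<gamma>\<^sup>2 * (1 + y\<^sup>2)) * Dfun \<alpha> \<theta> - Nfun \<alpha> \<gamma> \<theta> * Dder \<alpha> \<theta>
      = - \<gamma> * (Dfun \<alpha> \<theta> * (\<gamma> * (1 + y\<^sup>2) - E') + Dder \<alpha> \<theta> * (y + (\<alpha> * a - (1 - \<alpha>) * b)))"
      unfolding N by algebra
    thus ?thesis using F assms by (simp add: mult_nonneg_nonneg)
  qed
  ultimately show "\<exists>y. ((\<lambda>\<theta>. Nfun \<alpha> \<gamma> \<theta> / Dfun \<alpha> \<theta>) has_real_derivative y) (at \<theta>) \<and> y \<le> 0"
    by (intro exI conjI) (auto intro!: divide_nonpos_nonneg)
qed

text \<open>By the slope formula this is the concavity of ln W in ln A. Exchanging \<alpha> and 1 -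
  \<alpha> turns the lower bound -\<alpha> for negative \<gamma> into the upper bound for positive
  ones. At \<gamma> = 0 the numerator 1 / \<theta> decreases while \<open>Dfun\<close>
  increases.\<close>

lemma Nfun_Dfun_antimono:
  assumes "0 < \<alpha>" "\<alpha> < 1" "- \<alpha> \<le> \<gamma>" "\<gamma> \<le> 1 - \<alpha>" "0 < s" "s \<le> t" "t < pi"
  shows "Nfun \<alpha> \<gamma> t / Dfun \<alpha> t \<le> Nfun \<alpha> \<gamma> s / Dfun \<alpha> s"
proof -
  consider "0 < \<gamma>" | "\<gamma> < 0" | "\<gamma> = 0" by linarith
  then show ?thesis
  proof cases
    case 1 thus ?thesis using Nfun_Dfun_antimono_pos assms by simp
  next
    case 2 thus ?thesis using Nfun_Dfun_antimono_pos[of "1 - \<alpha>" "- \<gamma>" s t] assms by (simp add: Nfun_swap Dfun_swap)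
  next
    case 3
    have "Dfun \<alpha> s \<le> Dfun \<alpha> t"
    proof (rule DERIV_nonneg_imp_nondecreasing[OF assms(6), of "Dfun \<alpha>"])
      fix x assume "s \<le> x" "x \<le> t"
      thus "\<exists>y. (Dfun \<alpha> has_real_derivative y) (at x) \<and> 0 \<le> y"
        using Dfun_deriv[of \<alpha> x] Dder_pos[of \<alpha> x] assms by (intro exI[of _ "Dder \<alpha> x"]) auto
    qed
    moreover have "Nfun \<alpha> \<gamma> t \<le> Nfun \<alpha> \<gamma> s" using 3 assms by (simp add: Nfun_def rcot_def frac_le)
    moreover have "0 \<le> Nfun \<alpha> \<gamma> t" "0 < Dfun \<alpha> s" using 3 assms Dfun_pos by (auto simp: Nfun_def rcot_def)
    ultimately show ?thesis by (intro frac_le) auto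
  qed
qed

section \<open>Moments on the curve\<close>

text \<open>\<open>A = \<rho> * R\<close>, with \<open>R\<close> the modulus of the point with angle \<open>\<theta>\<close> on the curve and
  \<open>\<rho> = (sin (\<alpha> * \<theta>) / sin \<theta>) powr (1 / (1 - \<alpha>))\<close>. Here \<open>sinq x\<close> continues \<open>sin (x * \<theta>) / x\<close> to \<open>x = 0\<close>.\<close>

definition lnrho :: "real \<Rightarrow> real \<Rightarrow> real" where
  "lnrho \<alpha> \<theta> = (ln (sin (\<alpha> * \<theta>)) - ln (sin \<theta>)) / (1 - \<alpha>)"

definition lnR :: "real \<Rightarrow> real \<Rightarrow> real" where
  "lnR \<alpha> \<theta> = ln (sin ((1 - \<alpha>) * \<theta>)) - ln (sin (\<alpha> * \<theta>))"

definition lnA :: "real \<Rightarrow> real \<Rightarrow> real" where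
  "lnA \<alpha> \<theta> = lnrho \<alpha> \<theta> + lnR \<alpha> \<theta>"

definition sinq :: "real \<Rightarrow> real \<Rightarrow> real" where
  "sinq x \<theta> = (if x = 0 then \<theta> else sin (x * \<theta>) / x)"

definition Wfun :: "real \<Rightarrow> real \<Rightarrow> real \<Rightarrow> real" where
  "Wfun \<alpha> \<gamma> \<theta> = exp (\<gamma> * lnrho \<alpha> \<theta>) * sinq \<gamma> \<theta>"

lemma mult_sinq: "x * sinq x \<theta> = sin (x * \<theta>)"
  by (simp add: sinq_def)

lemma sinq_deriv: "(sinq x has_real_derivative cos (x * \<theta>)) (at \<theta>)"
  unfolding sinq_def by (cases "x = 0") (auto intro!: derivative_eq_intros)

lemma sinq_pos: "\<bar>x\<bar> < 1 \<Longrightarrow> 0 < \<theta> \<Longrightarrow> \<theta> < pi \<Longrightarrow> 0 < sinq x \<theta>"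
  using sin_scaled_pos[of "\<bar>x\<bar>" \<theta>] by (cases x "0::real" rule: linorder_cases) (auto simp: sinq_def divide_neg_neg)

lemma lnrho_deriv:
  assumes "0 < \<alpha>" "\<alpha> < 1" "0 < \<theta>" "\<theta> < pi"
  shows "(lnrho \<alpha> has_real_derivative (\<alpha> * cot (\<alpha> * \<theta>) - cot \<theta>) / (1 - \<alpha>)) (at \<theta>)"
proof -
  have "((\<lambda>\<theta>. ln (sin (\<alpha> * \<theta>)) - ln (sin \<theta>)) has_real_derivative (\<alpha> * cot (\<alpha> * \<theta>) - cot \<theta>)) (at \<theta>)"
    unfolding cot_def using assms sin_pos3[of \<alpha> \<theta>] by (auto intro!: derivative_eq_intros simp: field_simps)
  from DERIV_cdivide[OF this, of "1 - \<alpha>"] show ?thesis unfolding lnrho_def .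
qed

lemma lnR_deriv:
  assumes "0 < \<alpha>" "\<alpha> < 1" "0 < \<theta>" "\<theta> < pi"
  shows "(lnR \<alpha> has_real_derivative (1 - \<alpha>) * cot ((1 - \<alpha>) * \<theta>) - \<alpha> * cot (\<alpha> * \<theta>)) (at \<theta>)"
  unfolding lnR_def cot_def using assms sin_pos3[of \<alpha> \<theta>]
  by (auto intro!: derivative_eq_intros simp: field_simps)

lemma lnA_deriv:
  assumes "0 < \<alpha>" "\<alpha> < 1" "0 < \<theta>" "\<theta> < pi"
  shows "(lnA \<alpha> has_real_derivative Dfun \<alpha> \<theta> / (1 - \<alpha>)) (at \<theta>)"
proof -
  have "(\<alpha> * cot (\<alpha> * \<theta>) - cot \<theta>) / (1 - \<alpha>) + ((1 - \<alpha>) * cot ((1 - \<alpha>) * \<theta>) - \<alpha> * cot (\<alpha> * \<theta>))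
      = Dfun \<alpha> \<theta> / (1 - \<alpha>)"
    unfolding Dfun_def using assms by (simp add: field_simps power2_eq_square)
  thus ?thesis using DERIV_add[OF lnrho_deriv[OF assms] lnR_deriv[OF assms]] by (simp add: lnA_def[abs_def])
qed

lemma Wfun_deriv:
  assumes "0 < \<alpha>" "\<alpha> < 1" "0 < \<theta>" "\<theta> < pi"
  shows "(Wfun \<alpha> \<gamma> has_real_derivative exp (\<gamma> * lnrho \<alpha> \<theta>) *
    ((\<alpha> * cot (\<alpha> * \<theta>) - cot \<theta>) / (1 - \<alpha>) * sin (\<gamma> * \<theta>) + cos (\<gamma> * \<theta>))) (at \<theta>)"
  unfolding Wfun_def using assms
  by (auto intro!: derivative_eq_intros lnrho_deriv sinq_deriv simp: mult_sinq[symmetric] algebra_simps)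

text \<open>Imaginary and real part of cis (x \<theta>) (1 + R cis \<theta>)^n, expanded on the left
  and in polar form on the right.\<close>

lemma binom_cis_sum:
  fixes R x \<theta> :: real and r \<phi> :: real
  assumes "1 + of_real R * cis \<theta> = of_real r * cis \<phi>"
  shows "(\<Sum>j\<le>n. of_nat (n choose j) * R ^ j * sin ((x + j) * \<theta>)) = r ^ n * sin (x * \<theta> + n * \<phi>)"
    and "(\<Sum>j\<le>n. of_nat (n choose j) * R ^ j * cos ((x + j) * \<theta>)) = r ^ n * cos (x * \<theta> + n * \<phi>)"
proof -
  have "(\<Sum>j\<le>n. of_real (of_nat (n choose j) * R ^ j) * cis ((x + j) * \<theta>)) = cis (x * \<theta>) * (of_real R * cis \<theta> + 1) ^ n"
    unfolding binomial_ring sum_distrib_left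
  proof (intro sum.cong refl)
    fix j
    have "cis ((x + j) * \<theta>) = cis (x * \<theta>) * cis \<theta> ^ j" using Complex.DeMoivre[of \<theta> j] by (simp add: cis_mult distrib_right)
    thus "of_real (of_nat (n choose j) * R ^ j) * cis ((x + j) * \<theta>)
      = cis (x * \<theta>) * (of_nat (n choose j) * (of_real R * cis \<theta>) ^ j * 1 ^ (n - j))"
      by (simp add: power_mult_distrib)
  qed
  also have "\<dots> = of_real (r ^ n) * cis (x * \<theta> + n * \<phi>)"
    using Complex.DeMoivre[of \<phi> n] assms
    by (simp add: add.commute power_mult_distrib cis_mult[symmetric])
  finally have *: "(\<Sum>j\<le>n. of_real (of_nat (n choose j) * R ^ j) * cis ((x + j) * \<theta>)) = of_real (r ^ n) * cis (x * \<theta> + n * \<phi>)" .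
  have 1: "Im (of_real u * cis v) = u * sin v" "Re (of_real u * cis v) = u * cos v" for u v by auto
  show "(\<Sum>j\<le>n. of_nat (n choose j) * R ^ j * sin ((x + j) * \<theta>)) = r ^ n * sin (x * \<theta> + n * \<phi>)"
    using arg_cong[OF *, of Im] unfolding Im_sum 1 .
  show "(\<Sum>j\<le>n. of_nat (n choose j) * R ^ j * cos ((x + j) * \<theta>)) = r ^ n * cos (x * \<theta> + n * \<phi>)"
    using arg_cong[OF *, of Re] unfolding Re_sum 1 .
qed

text \<open>In the triangle with vertices \<open>0\<close>, \<open>-1\<close> and \<open>z = R cis \<theta>\<close>, the law of sines expresses \<open>1 + z\<close>
  through the angles \<open>\<alpha> \<theta>\<close> and \<open>(1 - \<alpha>) \<theta>\<close>.\<close>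

lemma triangle:
  assumes "0 < \<alpha>" "\<alpha> < 1" "0 < \<theta>" "\<theta> < pi"
  shows "1 + of_real (sin ((1 - \<alpha>) * \<theta>) / sin (\<alpha> * \<theta>)) * cis \<theta>
    = of_real (sin \<theta> / sin (\<alpha> * \<theta>)) * cis ((1 - \<alpha>) * \<theta>)"
proof -
  note s = sin_pos3[OF assms]
  have "sin (\<alpha> * \<theta>) = sin (\<theta> - (1 - \<alpha>) * \<theta>)" by (simp add: algebra_simps)
  hence "sin (\<alpha> * \<theta>) + sin ((1 - \<alpha>) * \<theta>) * cos \<theta> = sin \<theta> * cos ((1 - \<alpha>) * \<theta>)" by (simp add: sin_diff)
  thus ?thesis using s by (simp add: complex_eq_iff field_simps)
qed

lemma exp_lnR: "0 < \<alpha> \<Longrightarrow> \<alpha> < 1 \<Longrightarrow> 0 < \<theta> \<Longrightarrow> \<theta> < pi \<Longrightarrow> exp (lnR \<alpha> \<theta>) = sin ((1 - \<alpha>) * \<theta>) / sin (\<alpha> * \<theta>)"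
  using sin_pos3[of \<alpha> \<theta>] by (simp add: lnR_def exp_diff)

lemma exp_lnrho: "0 < \<alpha> \<Longrightarrow> \<alpha> < 1 \<Longrightarrow> 0 < \<theta> \<Longrightarrow> \<theta> < pi \<Longrightarrow> exp (- ((1 - \<alpha>) * lnrho \<alpha> \<theta>)) = sin \<theta> / sin (\<alpha> * \<theta>)"
  using sin_pos3[of \<alpha> \<theta>] by (simp add: lnrho_def exp_diff)

text \<open>A primitive of the integrand of the moment of order \<open>n\<close>. The binomial sum is the imaginary
  part of a primitive of \<open>(1 + z) ^ n * z powr (- q)\<close> at \<open>z = R cis \<theta>\<close>.\<close>

definition moment_prim :: "real \<Rightarrow> real \<Rightarrow> nat \<Rightarrow> real \<Rightarrow> real" where
  "moment_prim \<alpha> \<gamma> n \<theta> = (let q = (1 - \<alpha>) * (real n + 1) + \<gamma> in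
     (\<Sum>j\<le>n. of_nat (n choose j) * (exp ((1 - q + j) * lnR \<alpha> \<theta>) * sinq (1 - q + j) \<theta>))
     - (1 - \<alpha>) * (exp (- q * lnA \<alpha> \<theta>) * Wfun \<alpha> \<gamma> \<theta>))"

text \<open>Integration by parts: the integrand is -(1 - \<alpha>) (A^(-q))' W, and what remains to
  be integrated, (1 - \<alpha>) A^(-q) W', is exactly the derivative of the binomial sum.\<close>

lemma moment_prim_deriv:
  fixes \<alpha> \<gamma> \<theta> :: real and n :: nat
  assumes "0 < \<alpha>" "\<alpha> < 1" "0 < \<theta>" "\<theta> < pi"
  defines "q \<equiv> (1 - \<alpha>) * (real n + 1) + \<gamma>"
  shows "(moment_prim \<alpha> \<gamma> n has_real_derivative
    q * (Dfun \<alpha> \<theta> * exp (- q * lnA \<alpha> \<theta>) * Wfun \<alpha> \<gamma> \<theta>)) (at \<theta>)"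
proof -
  define x where "x = 1 - q"
  define R' \<rho>' where "R' = (1 - \<alpha>) * cot ((1 - \<alpha>) * \<theta>) - \<alpha> * cot (\<alpha> * \<theta>)"
    and "\<rho>' = (\<alpha> * cot (\<alpha> * \<theta>) - cot \<theta>) / (1 - \<alpha>)"
  define R r where "R = sin ((1 - \<alpha>) * \<theta>) / sin (\<alpha> * \<theta>)" and "r = sin \<theta> / sin (\<alpha> * \<theta>)"
  note s = sin_pos3[OF assms(1-4)]
  have "(moment_prim \<alpha> \<gamma> n has_real_derivative
     (\<Sum>j\<le>n. of_nat (n choose j) * (exp ((x + j) * lnR \<alpha> \<theta>) * (R' * sin ((x + j) * \<theta>) + cos ((x + j) * \<theta>))))
     - (1 - \<alpha>) * (exp (- q * lnA \<alpha> \<theta>) * exp (\<gamma> * lnrho \<alpha> \<theta>) * (\<rho>' * sin (\<gamma> * \<theta>) + cos (\<gamma> * \<theta>))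
        - q * (Dfun \<alpha> \<theta> / (1 - \<alpha>)) * exp (- q * lnA \<alpha> \<theta>) * Wfun \<alpha> \<gamma> \<theta>)) (at \<theta>)"
  proof -
    \<comment> \<open>With \<open>sinq\<close> this stays valid when x + j = 0, where the primitive
      of 1 / z is a logarithm with imaginary part \<theta>.\<close>
    have "((\<lambda>\<theta>. exp ((x + j) * lnR \<alpha> \<theta>) * sinq (x + j) \<theta>) has_real_derivative
       exp ((x + j) * lnR \<alpha> \<theta>) * (R' * sin ((x + j) * \<theta>) + cos ((x + j) * \<theta>))) (at \<theta>)" for j
      unfolding mult_sinq[symmetric]
      by (rule derivative_eq_intros lnR_deriv[OF assms(1-4), folded R'_def] sinq_deriv refl)+ (simp add: algebra_simps)
    moreover have "((\<lambda>\<theta>. exp (- q * lnA \<alpha> \<theta>) * Wfun \<alpha> \<gamma> \<theta>) has_real_derivative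
       exp (- q * lnA \<alpha> \<theta>) * exp (\<gamma> * lnrho \<alpha> \<theta>) * (\<rho>' * sin (\<gamma> * \<theta>) + cos (\<gamma> * \<theta>))
        - q * (Dfun \<alpha> \<theta> / (1 - \<alpha>)) * exp (- q * lnA \<alpha> \<theta>) * Wfun \<alpha> \<gamma> \<theta>) (at \<theta>)"
      by (rule derivative_eq_intros lnA_deriv[OF assms(1-4)] Wfun_deriv[OF assms(1-4), folded \<rho>'_def] refl)+ (simp add: algebra_simps)
    ultimately show ?thesis
      unfolding moment_prim_def Let_def q_def[symmetric] x_def[symmetric]
      by (intro DERIV_diff DERIV_sum DERIV_cmult)
  qed
  moreover have "(\<Sum>j\<le>n. of_nat (n choose j) * (exp ((x + j) * lnR \<alpha> \<theta>) * (R' * sin ((x + j) * \<theta>) + cos ((x + j) * \<theta>))))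
     = (1 - \<alpha>) * (exp (- q * lnA \<alpha> \<theta>) * exp (\<gamma> * lnrho \<alpha> \<theta>) * (\<rho>' * sin (\<gamma> * \<theta>) + cos (\<gamma> * \<theta>)))"
  proof -
    \<comment> \<open>The angle x \<theta> + n (1 - \<alpha>) \<theta> that comes out of the
      binomial sum does not depend on n.\<close>
    define v where "v = (\<alpha> - \<gamma>) * \<theta>"
    have v: "x * \<theta> + n * ((1 - \<alpha>) * \<theta>) = v" unfolding v_def x_def q_def by (simp add: algebra_simps)
    have "(\<Sum>j\<le>n. of_nat (n choose j) * (exp ((x + j) * lnR \<alpha> \<theta>) * (R' * sin ((x + j) * \<theta>) + cos ((x + j) * \<theta>))))
      = exp (x * lnR \<alpha> \<theta>) * (R' * (\<Sum>j\<le>n. of_nat (n choose j) * R ^ j * sin ((x + j) * \<theta>))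
          + (\<Sum>j\<le>n. of_nat (n choose j) * R ^ j * cos ((x + j) * \<theta>)))"
      unfolding sum_distrib_left distrib_left sum.distrib[symmetric] R_def exp_lnR[OF assms(1-4), symmetric]
      by (intro sum.cong refl) (simp add: exp_add exp_of_nat_mult algebra_simps)
    also have "\<dots> = exp (x * lnR \<alpha> \<theta>) * r ^ n * (R' * sin v + cos v)"
      unfolding binom_cis_sum[OF triangle[OF assms(1-4)], folded R_def r_def] v by (simp add: algebra_simps)
    also have "r ^ n = exp (- (n * ((1 - \<alpha>) * lnrho \<alpha> \<theta>)))"
      unfolding r_def exp_lnrho[OF assms(1-4), symmetric] by (simp add: exp_of_nat_mult[symmetric])
    also have "exp (x * lnR \<alpha> \<theta>) * \<dots> = exp (- q * lnA \<alpha> \<theta> + \<gamma> * lnrho \<alpha> \<theta>) * (exp (lnR \<alpha> \<theta>) / exp (- ((1 - \<alpha>) * lnrho \<alpha> \<theta>)))"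
      unfolding exp_add[symmetric] exp_diff[symmetric] x_def q_def lnA_def by (simp add: algebra_simps)
    also have "exp (lnR \<alpha> \<theta>) / exp (- ((1 - \<alpha>) * lnrho \<alpha> \<theta>)) = sin ((1 - \<alpha>) * \<theta>) / sin \<theta>"
      unfolding exp_lnR[OF assms(1-4)] exp_lnrho[OF assms(1-4)] using s by simp
    also have "exp (- q * lnA \<alpha> \<theta> + \<gamma> * lnrho \<alpha> \<theta>) * (sin ((1 - \<alpha>) * \<theta>) / sin \<theta>) * (R' * sin v + cos v)
      = exp (- q * lnA \<alpha> \<theta> + \<gamma> * lnrho \<alpha> \<theta>) * ((1 - \<alpha>) * (\<rho>' * sin (\<gamma> * \<theta>) + cos (\<gamma> * \<theta>)))"
    proof -
      define S C Sc Cc where "S = sin (\<alpha> * \<theta>)" and "C = cos (\<alpha> * \<theta>)" and "Sc = sin ((1 - \<alpha>) * \<theta>)" and "Cc = cos ((1 - \<alpha>) * \<theta>)"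
      have e: "\<theta> = \<alpha> * \<theta> + (1 - \<alpha>) * \<theta>" by (simp add: algebra_simps)
      have st: "sin \<theta> = S * Cc + C * Sc" unfolding S_def C_def Sc_def Cc_def by (subst e, subst sin_add) simp
      have ct: "cos \<theta> = C * Cc - S * Sc" unfolding S_def C_def Sc_def Cc_def by (subst e, subst cos_add) simp
      have sv: "sin v = S * cos (\<gamma> * \<theta>) - C * sin (\<gamma> * \<theta>)" "cos v = C * cos (\<gamma> * \<theta>) + S * sin (\<gamma> * \<theta>)"
        unfolding v_def S_def C_def by (simp_all add: left_diff_distrib sin_diff cos_diff)
      have R: "R' = ((1 - \<alpha>) * Cc * S - \<alpha> * C * Sc) / (Sc * S)"
        unfolding R'_def cot_def using s by (simp add: S_def C_def Sc_def Cc_def field_simps)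
      have \<rho>: "(1 - \<alpha>) * \<rho>' = (\<alpha> * C * sin \<theta> - cos \<theta> * S) / (S * sin \<theta>)"
        unfolding \<rho>'_def cot_def using s assms(2) by (simp add: S_def C_def field_simps)
      have nz: "S \<noteq> 0" "Sc \<noteq> 0" "sin \<theta> \<noteq> 0" using s by (auto simp: S_def Sc_def)
      have "S * (Sc * (R' * sin v + cos v)) = ((1 - \<alpha>) * Cc * S - \<alpha> * C * Sc) * sin v + S * Sc * cos v"
        unfolding R using nz by (simp add: field_simps)
      also have "\<dots> = (\<alpha> * C * sin \<theta> - cos \<theta> * S) * sin (\<gamma> * \<theta>) + (1 - \<alpha>) * (S * sin \<theta>) * cos (\<gamma> * \<theta>)"
        unfolding sv st ct by (simp add: algebra_simps)
      also have "\<dots> = S * (sin \<theta> * ((1 - \<alpha>) * \<rho>' * sin (\<gamma> * \<theta>) + (1 - \<alpha>) * cos (\<gamma> * \<theta>)))"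
        unfolding \<rho> using nz by (simp add: field_simps)
      finally have "Sc * (R' * sin v + cos v) = sin \<theta> * ((1 - \<alpha>) * \<rho>' * sin (\<gamma> * \<theta>) + (1 - \<alpha>) * cos (\<gamma> * \<theta>))"
        using mult_left_cancel[OF nz(1)] by blast
      hence "Sc * (R' * sin v + cos v) = sin \<theta> * ((1 - \<alpha>) * (\<rho>' * sin (\<gamma> * \<theta>) + cos (\<gamma> * \<theta>)))"
        by (simp only: distrib_left mult.assoc)
      hence "Sc / sin \<theta> * (R' * sin v + cos v) = (1 - \<alpha>) * (\<rho>' * sin (\<gamma> * \<theta>) + cos (\<gamma> * \<theta>))"
        using nz by simp
      thus ?thesis unfolding Sc_def[symmetric] mult.assoc by simp
    qed
    finally show ?thesis unfolding exp_add by (simp only: mult_ac)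
  qed
  ultimately show ?thesis
    by (elim DERIV_cong) (use assms(2) in \<open>simp add: right_diff_distrib\<close>)
qed


text \<open>Euler's reflection formula; written with \<open>rGamma\<close> it also covers the
  integers.\<close>

lemma sinq_pi: "sinq x pi = pi * (rGamma (1 - x) * rGamma (1 + x))"
proof (cases "x = 0")
  case False
  have "rGamma (complex_of_real x) * rGamma (1 - complex_of_real x) = sin (of_real pi * of_real x) / of_real pi"
    by (rule rGamma_reflection_complex)
  moreover have "complex_of_real (rGamma x * rGamma (1 - x)) = rGamma (of_real x) * rGamma (1 - of_real x)"
    using rGamma_complex_of_real[of x] rGamma_complex_of_real[of "1 - x"] by simp
  moreover have "sin (complex_of_real pi * of_real x) / of_real pi = of_real (sin (pi * x) / pi)"
    using sin_of_real[of "pi * x", where 'a = complex] by simp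
  ultimately have "complex_of_real (rGamma x * rGamma (1 - x)) = of_real (sin (pi * x) / pi)" by simp
  hence "rGamma x * rGamma (1 - x) = sin (pi * x) / pi" unfolding of_real_eq_iff .
  moreover have "rGamma x = x * rGamma (1 + x)" using rGamma_plus1[of x] by (simp add: add.commute)
  ultimately show ?thesis using False by (simp add: sinq_def field_simps)
qed (simp add: sinq_def)

text \<open>The value of the binomial sum at \<theta> = pi, where R = 1. By Pascal's rule the sum
  for n + 1 is the sum of those for n at x and at x + 1, and the recurrence of \<open>rGamma\<close>
  combines the two.\<close>

lemma sum_binomial_sinq:
  "(\<Sum>j\<le>n. of_nat (n choose j) * sinq (x + j) pi) = pi * (fact n * rGamma (1 - x) * rGamma (n + 1 + x))"
proof (induction n arbitrary: x)
  case 0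
  show ?case using sinq_pi[of x] by simp
next
  case (Suc n)
  have "(\<Sum>j\<le>Suc n. of_nat (Suc n choose j) * sinq (x + j) pi)
     = (\<Sum>j\<le>n. of_nat (n choose j) * sinq (x + j) pi) + (\<Sum>j\<le>n. of_nat (n choose j) * sinq (x + 1 + j) pi)"
  proof -
    have "(\<Sum>j\<le>Suc n. of_nat (Suc n choose j) * sinq (x + j) pi)
       = sinq x pi + (\<Sum>j\<le>n. (of_nat (n choose j) + of_nat (n choose Suc j)) * sinq (x + Suc j) pi)"
      by (subst sum.atMost_Suc_shift) simp
    also have "\<dots> = (\<Sum>j\<le>n. of_nat (n choose j) * sinq (x + Suc j) pi) + (\<Sum>j\<le>Suc n. of_nat (n choose j) * sinq (x + j) pi)"
      unfolding sum.atMost_Suc_shift by (simp add: distrib_right sum.distrib)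
    finally show ?thesis by (simp add: algebra_simps)
  qed
  also have "\<dots> = pi * fact n * (rGamma (1 - x) * rGamma (n + 1 + x) + rGamma (- x) * rGamma (n + 2 + x))"
    unfolding Suc.IH by (simp add: algebra_simps)
  also have "rGamma (- x) = - x * rGamma (1 - x)" using rGamma_plus1[of "- x"] by simp
  also have "rGamma (n + 1 + x) = (n + 1 + x) * rGamma (n + 2 + x)"
    using rGamma_plus1[of "n + 1 + x"] by (simp add: algebra_simps)
  finally show ?case by (simp add: algebra_simps)
qed

text \<open>A is infinite at pi. Since -q + \<gamma> = -(1 - \<alpha>) (n + 1), the \<rho> part of
  A^(-q) W is the power n + 1 of sin \<theta> / sin (\<alpha> \<theta>), a form in which the limits
  at both ends can be read off.\<close>

lemma moment_prim_eq:
  fixes n :: nat and \<alpha> \<gamma> \<theta> :: real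
  assumes "0 < \<alpha>" "\<alpha> < 1" "0 < \<theta>" "\<theta> < pi"
  defines "q \<equiv> (1 - \<alpha>) * (real n + 1) + \<gamma>"
  shows "moment_prim \<alpha> \<gamma> n \<theta> =
    (\<Sum>j\<le>n. of_nat (n choose j) * (exp ((1 - q + j) * lnR \<alpha> \<theta>) * sinq (1 - q + j) \<theta>))
     - (1 - \<alpha>) * (exp (- q * lnR \<alpha> \<theta>) * (sin \<theta> / sin (\<alpha> * \<theta>)) ^ (n + 1) * sinq \<gamma> \<theta>)"
proof -
  have "exp (- q * lnA \<alpha> \<theta>) * exp (\<gamma> * lnrho \<alpha> \<theta>) = exp (- q * lnR \<alpha> \<theta>) * exp (- ((1 - \<alpha>) * lnrho \<alpha> \<theta>)) ^ (n + 1)"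
    unfolding exp_of_nat_mult[symmetric] exp_add[symmetric] lnA_def q_def by (simp add: algebra_simps)
  from arg_cong[OF this, of "\<lambda>z. z * sinq \<gamma> \<theta>"]
  have "exp (- q * lnA \<alpha> \<theta>) * Wfun \<alpha> \<gamma> \<theta> = exp (- q * lnR \<alpha> \<theta>) * (sin \<theta> / sin (\<alpha> * \<theta>)) ^ (n + 1) * sinq \<gamma> \<theta>"
    unfolding exp_lnrho[OF assms(1-4)] Wfun_def by (simp only: mult.assoc)
  thus ?thesis unfolding moment_prim_def Let_def q_def[symmetric] by simp
qed

lemma sinq_0: "sinq a 0 = 0"
  by (simp add: sinq_def)

lemma sinq_tendsto: "(f \<longlongrightarrow> l) F \<Longrightarrow> ((\<lambda>x. sinq a (f x)) \<longlongrightarrow> sinq a l) F"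
  using isCont_tendsto_compose[OF DERIV_isCont[OF sinq_deriv]] .

lemma sin_ratio_at_0:
  assumes "0 < a" "0 < (b::real)"
  shows "((\<lambda>\<theta>. sin (a * \<theta>) / sin (b * \<theta>)) \<longlongrightarrow> a / b) (at_right 0)"
proof -
  have "((\<lambda>\<theta>. sin (a * \<theta>) / sin (b * \<theta>)) \<longlongrightarrow> a * inverse b) (at_right 0)"
    using assms by real_asymp
  thus ?thesis by (simp add: divide_inverse)
qed

lemma moment_prim_at_0:
  assumes "0 < \<alpha>" "\<alpha> < 1"
  shows "(moment_prim \<alpha> \<gamma> n \<longlongrightarrow> 0) (at_right 0)"
proof -
  define q where "q = (1 - \<alpha>) * (real n + 1) + \<gamma>"
  have R: "(lnR \<alpha> \<longlongrightarrow> ln ((1 - \<alpha>) / \<alpha>)) (at_right 0)"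
  proof (rule Lim_transform_eventually)
    show "((\<lambda>\<theta>. ln (sin ((1 - \<alpha>) * \<theta>) / sin (\<alpha> * \<theta>))) \<longlongrightarrow> ln ((1 - \<alpha>) / \<alpha>)) (at_right 0)"
      using assms by (intro tendsto_ln sin_ratio_at_0) auto
    show "\<forall>\<^sub>F \<theta> in at_right 0. ln (sin ((1 - \<alpha>) * \<theta>) / sin (\<alpha> * \<theta>)) = lnR \<alpha> \<theta>"
      using eventually_at_right_real[OF pi_gt_zero]
    proof eventually_elim
      case (elim \<theta>)
      thus ?case using sin_pos3[of \<alpha> \<theta>] assms by (simp add: lnR_def ln_div)
    qed
  qed
  have z: "((\<lambda>\<theta>. sinq a \<theta>) \<longlongrightarrow> sinq a 0) (at_right 0)" for a by (rule sinq_tendsto) (rule tendsto_ident_at)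
  have r: "((\<lambda>\<theta>. sin \<theta> / sin (\<alpha> * \<theta>)) \<longlongrightarrow> 1 / \<alpha>) (at_right 0)" using sin_ratio_at_0[of 1 \<alpha>] assms by simp
  have "((\<lambda>\<theta>. (\<Sum>j\<le>n. of_nat (n choose j) * (exp ((1 - q + j) * lnR \<alpha> \<theta>) * sinq (1 - q + j) \<theta>))
     - (1 - \<alpha>) * (exp (- q * lnR \<alpha> \<theta>) * (sin \<theta> / sin (\<alpha> * \<theta>)) ^ (n + 1) * sinq \<gamma> \<theta>)) \<longlongrightarrow>
     (\<Sum>j\<le>n. of_nat (n choose j) * (exp ((1 - q + j) * ln ((1 - \<alpha>) / \<alpha>)) * sinq (1 - q + j) 0))
     - (1 - \<alpha>) * (exp (- q * ln ((1 - \<alpha>) / \<alpha>)) * (1 / \<alpha>) ^ (n + 1) * sinq \<gamma> 0)) (at_right 0)"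
    by (intro tendsto_intros R z r)
  also have "(\<Sum>j\<le>n. of_nat (n choose j) * (exp ((1 - q + j) * ln ((1 - \<alpha>) / \<alpha>)) * sinq (1 - q + j) 0))
     - (1 - \<alpha>) * (exp (- q * ln ((1 - \<alpha>) / \<alpha>)) * (1 / \<alpha>) ^ (n + 1) * sinq \<gamma> 0) = 0"
    by (simp add: sinq_0)
  finally show ?thesis
    by (rule Lim_transform_eventually)
      (use eventually_at_right_real[OF pi_gt_zero] assms in \<open>auto elim!: eventually_mono simp: moment_prim_eq q_def\<close>)
qed

text \<open>R tends to 1 because sin ((1 - \<alpha>) pi) = sin (\<alpha> pi), and the boundary term
  vanishes with sin \<theta>; only the binomial sum survives.\<close>

lemma moment_prim_at_pi:
  assumes "0 < \<alpha>" "\<alpha> < 1"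
  shows "(moment_prim \<alpha> \<gamma> n \<longlongrightarrow> pi * (fact n * rGamma ((1 - \<alpha>) * (real n + 1) + \<gamma>) * rGamma (1 - \<gamma> + \<alpha> * (real n + 1)))) (at_left pi)"
proof -
  define q where "q = (1 - \<alpha>) * (real n + 1) + \<gamma>"
  have s\<alpha>: "sin (\<alpha> * pi) > 0" using sin_gt_zero[of "\<alpha> * pi"] assms by simp
  have sc: "sin ((1 - \<alpha>) * pi) = sin (\<alpha> * pi)" by (simp add: left_diff_distrib)
  have i: "((\<lambda>\<theta>. \<theta>) \<longlongrightarrow> pi) (at_left pi)" by (rule tendsto_ident_at)
  have R: "(lnR \<alpha> \<longlongrightarrow> ln (sin ((1 - \<alpha>) * pi)) - ln (sin (\<alpha> * pi))) (at_left pi)"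
    unfolding lnR_def using s\<alpha> sc by (intro tendsto_intros i) auto
  have r: "((\<lambda>\<theta>. sin \<theta> / sin (\<alpha> * \<theta>)) \<longlongrightarrow> sin pi / sin (\<alpha> * pi)) (at_left pi)"
    using s\<alpha> by (intro tendsto_intros i) auto
  have "((\<lambda>\<theta>. (\<Sum>j\<le>n. of_nat (n choose j) * (exp ((1 - q + j) * lnR \<alpha> \<theta>) * sinq (1 - q + j) \<theta>))
     - (1 - \<alpha>) * (exp (- q * lnR \<alpha> \<theta>) * (sin \<theta> / sin (\<alpha> * \<theta>)) ^ (n + 1) * sinq \<gamma> \<theta>)) \<longlongrightarrow>
     (\<Sum>j\<le>n. of_nat (n choose j) * (exp ((1 - q + j) * (ln (sin ((1 - \<alpha>) * pi)) - ln (sin (\<alpha> * pi)))) * sinq (1 - q + j) pi))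
     - (1 - \<alpha>) * (exp (- q * (ln (sin ((1 - \<alpha>) * pi)) - ln (sin (\<alpha> * pi)))) * (sin pi / sin (\<alpha> * pi)) ^ (n + 1) * sinq \<gamma> pi)) (at_left pi)"
    by (intro tendsto_intros R r sinq_tendsto i)
  also have "(\<Sum>j\<le>n. of_nat (n choose j) * (exp ((1 - q + j) * (ln (sin ((1 - \<alpha>) * pi)) - ln (sin (\<alpha> * pi)))) * sinq (1 - q + j) pi))
     - (1 - \<alpha>) * (exp (- q * (ln (sin ((1 - \<alpha>) * pi)) - ln (sin (\<alpha> * pi)))) * (sin pi / sin (\<alpha> * pi)) ^ (n + 1) * sinq \<gamma> pi)
    = (\<Sum>j\<le>n. of_nat (n choose j) * sinq (1 - q + j) pi)"
    unfolding sc by simp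
  also have "\<dots> = pi * (fact n * rGamma q * rGamma (1 - \<gamma> + \<alpha> * (real n + 1)))"
    unfolding sum_binomial_sinq q_def by (simp add: algebra_simps)
  finally show ?thesis unfolding q_def[symmetric]
    by (rule Lim_transform_eventually)
      (use eventually_at_left_real[OF pi_gt_zero] assms in \<open>auto elim!: eventually_mono simp: moment_prim_eq q_def\<close>)
qed

lemma Wfun_pos: "\<bar>\<gamma>\<bar> < 1 \<Longrightarrow> 0 < \<theta> \<Longrightarrow> \<theta> < pi \<Longrightarrow> 0 < Wfun \<alpha> \<gamma> \<theta>"
  unfolding Wfun_def using sinq_pos by simp

text \<open>The condition q > 0 makes the derivative of \<open>moment_prim\<close> nonnegative, so
  the fundamental theorem on the open interval yields integrability as well. Dividing by q turns
  \<open>rGamma q\<close> into \<open>rGamma (q + 1)\<close>.\<close>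

lemma nn_integral_curve:
  fixes n :: nat and \<alpha> \<gamma> :: real
  assumes "0 < \<alpha>" "\<alpha> < 1" "\<bar>\<gamma>\<bar> < 1" "0 < (1 - \<alpha>) * (real n + 1) + \<gamma>"
  defines "q \<equiv> (1 - \<alpha>) * (real n + 1) + \<gamma>"
  shows "(\<integral>\<^sup>+\<theta>. ennreal (indicator {0<..<pi} \<theta> * (Dfun \<alpha> \<theta> * exp (- q * lnA \<alpha> \<theta>) * Wfun \<alpha> \<gamma> \<theta>)) \<partial>lborel)
    = ennreal (pi * fact n * rGamma (q + 1) * rGamma (1 - \<gamma> + \<alpha> * (real n + 1)))"
proof -
  define f where "f \<theta> = q * (Dfun \<alpha> \<theta> * exp (- q * lnA \<alpha> \<theta>) * Wfun \<alpha> \<gamma> \<theta>)" for \<theta>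
  have q: "0 < q" using assms by (simp add: q_def)
  have D: "DERIV (moment_prim \<alpha> \<gamma> n) x :> f x" if "0 < x" "x < pi" for x
    using moment_prim_deriv[OF assms(1,2) that, of \<gamma> n] unfolding f_def q_def .
  have cont: "isCont f x" if "0 < x" "x < pi" for x
    unfolding f_def
    by (intro continuous_intros DERIV_isCont[OF Dfun_deriv] DERIV_isCont[OF lnA_deriv] DERIV_isCont[OF Wfun_deriv] assms that)
  have nonneg: "0 \<le> f x" if "0 < x" "x < pi" for x
    unfolding f_def using Dfun_pos[of \<alpha> x] Wfun_pos[of \<gamma> x \<alpha>] that assms q by simp
  have l: "((moment_prim \<alpha> \<gamma> n \<circ> real_of_ereal) \<longlongrightarrow> 0) (at_right (ereal 0))"
    "((moment_prim \<alpha> \<gamma> n \<circ> real_of_ereal) \<longlongrightarrow> pi * (fact n * rGamma (q) * rGamma (1 - \<gamma> + \<alpha> * (real n + 1)))) (at_left (ereal pi))"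
    using moment_prim_at_0[of \<alpha> \<gamma> n] moment_prim_at_pi[of \<alpha> \<gamma> n] assms(1,2) unfolding q_def
    by (simp_all add: ereal_tendsto_simps1)
  have 0: "set_integrable lborel (einterval (ereal 0) (ereal pi)) f"
    "(LBINT x=ereal 0..ereal pi. f x) = pi * (fact n * rGamma q * rGamma (1 - \<gamma> + \<alpha> * (real n + 1))) - 0"
    by (rule interval_integral_FTC_nonneg[OF _ D cont _ l]; simp add: nonneg)+
  have 1: "set_integrable lborel {0<..<pi} f" using 0(1) by simp
  from 1 have meas: "(\<lambda>x. indicator {0<..<pi} x * f x) \<in> borel_measurable lborel"
    unfolding set_integrable_def by (auto dest: borel_measurable_integrable)
  have "(LBINT x=ereal 0..ereal pi. f x) = (\<integral>x. indicator {0<..<pi} x * f x \<partial>lborel)"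
    by (simp add: interval_lebesgue_integral_def set_lebesgue_integral_def)
  with 0(2) have "(\<integral>x. indicator {0<..<pi} x * f x \<partial>lborel) = pi * (fact n * rGamma q * rGamma (1 - \<gamma> + \<alpha> * (real n + 1)))" by simp
  hence 2: "(\<integral>\<^sup>+x. ennreal (indicator {0<..<pi} x * f x) \<partial>lborel) = ennreal (pi * (fact n * rGamma (q) * rGamma (1 - \<gamma> + \<alpha> * (real n + 1))))"
    using 1 nonneg by (subst nn_integral_eq_integral) (auto simp: set_integrable_def indicator_def)
  have "(\<integral>\<^sup>+\<theta>. ennreal (indicator {0<..<pi} \<theta> * (Dfun \<alpha> \<theta> * exp (- q * lnA \<alpha> \<theta>) * Wfun \<alpha> \<gamma> \<theta>)) \<partial>lborel)
    = (\<integral>\<^sup>+x. ennreal (1 / q) * ennreal (indicator {0<..<pi} x * f x) \<partial>lborel)"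
    using q by (intro nn_integral_cong) (auto simp: ennreal_mult'[symmetric] f_def mult_ac)
  also have "\<dots> = ennreal (1 / q) * (\<integral>\<^sup>+x. ennreal (indicator {0<..<pi} x * f x) \<partial>lborel)"
    using meas by (intro nn_integral_cmult) simp
  also have "\<dots> = ennreal (1 / q * (pi * (fact n * rGamma (q) * rGamma (1 - \<gamma> + \<alpha> * (real n + 1)))))"
    unfolding 2 using q by (subst ennreal_mult'[symmetric]) auto
  also have "rGamma (q) = q * rGamma (q + 1)" using rGamma_plus1[of "q"] by simp
  finally show ?thesis using q by (simp add: algebra_simps)
qed

section \<open>Total positivity of order two\<close>

text \<open>Moving two arguments towards each other does not decrease the product. For nonnegative g
  this is total positivity of order two of the kernel g (s - t). In contrast to
  \<open>log_concave\<close> it mentions neither logarithms nor the set where g is positive, so it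
  passes through integrals.\<close>

definition tp2 :: "(real \<Rightarrow> real) \<Rightarrow> bool" where
  "tp2 g \<longleftrightarrow> (\<forall>x y h. 0 \<le> h \<longrightarrow> x + h \<le> y \<longrightarrow> g x * g y \<le> g (x + h) * g (y - h))"

lemma log_concave_tp2:
  assumes "log_concave g"
  shows "tp2 g"
  unfolding tp2_def
proof (intro allI impI)
  fix x y h :: real assume h: "0 \<le> h" "x + h \<le> y"
  have nn: "0 \<le> g t" for t using assms by (simp add: log_concave_def)
  have conc: "concave_on {t. 0 < g t} (\<lambda>t. ln (g t))" using assms by (simp add: log_concave_def)
  show "g x * g y \<le> g (x + h) * g (y - h)"
  proof (cases "0 < g x \<and> 0 < g y \<and> x < y")
    case True
    define u where "u = h / (y - x)"
    have u: "u \<in> {0..1}" and hu: "h = u * (y - x)" using h True by (auto simp: u_def)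
    have p: "(1 - u) *\<^sub>R x + u *\<^sub>R y = x + h" "(1 - (1 - u)) *\<^sub>R x + (1 - u) *\<^sub>R y = y - h"
      unfolding hu by (auto simp: algebra_simps)
    have u': "1 - u \<in> {0..1}" using u by auto
    have "convex {t. 0 < g t}" using conc by (simp add: concave_on_def convex_on_def)
    hence pos: "0 < g (x + h)" "0 < g (y - h)"
      using convexD_alt[of "{t. 0 < g t}" x y u] convexD_alt[of "{t. 0 < g t}" x y "1 - u"] True u
      unfolding p by auto
    have "(1 - u) * ln (g x) + u * ln (g y) \<le> ln (g (x + h))"
      using concave_onD[OF conc, of u x y] True u unfolding p by simp
    moreover have "u * ln (g x) + (1 - u) * ln (g y) \<le> ln (g (y - h))"
      using concave_onD[OF conc, of "1 - u" x y] True u' unfolding p by simp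
    ultimately have "ln (g x) + ln (g y) \<le> ln (g (x + h)) + ln (g (y - h))" by (simp add: algebra_simps)
    hence "ln (g x * g y) \<le> ln (g (x + h) * g (y - h))" using True pos by (simp add: ln_mult)
    thus ?thesis using True pos by (simp add: ln_le_cancel_iff)
  next
    case False
    then consider "g x = 0 \<or> g y = 0" | "x = y" "h = 0" using nn[of x] nn[of y] h by force
    thus ?thesis using nn by cases (auto simp: mult_nonneg_nonneg)
  qed
qed

text \<open>The composition formula of order two: after symmetrisation in (a, b), the two sides
  differ by the integral of a product of two 2 x 2 minors, one of F and one of l, which have the
  same sign. As the integrals may be infinite, sums are compared and nothing is subtracted.\<close>

lemma tp2_convolution:
  fixes F l :: "real \<Rightarrow> real"
  assumes [measurable]: "F \<in> borel_measurable borel" "l \<in> borel_measurable borel"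
    and nn: "\<And>t. 0 \<le> F t" "\<And>t. 0 \<le> l t" and F: "tp2 F" and l: "tp2 l"
    and h: "0 \<le> h" "x + h \<le> y"
  defines "C \<equiv> \<lambda>t. \<integral>\<^sup>+a. ennreal (F (t + a) * l a) \<partial>lborel"
  shows "C x * C y \<le> C (x + h) * C (y - h)"
proof -
  \<comment> \<open>Shifting the variable moves h from F to l. All four integrals then use F shifted
    by x + h or y and l shifted by 0 or h, so they share one pair of minors.\<close>
  have sh: "(\<integral>\<^sup>+a. ennreal (F (t + a) * l (a + h)) \<partial>lborel) = C (t - h)" for t
    unfolding C_def by (subst nn_integral_real_affine[where c = 1 and t = "h"]) (auto simp: add_ac)
  define f1 f2 g1 g2 where "f1 a = ennreal (F (x + h + a) * l a)" and "f2 b = ennreal (F (y + b) * l (b + h))"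
    and "g1 a = ennreal (F (x + h + a) * l (a + h))" and "g2 b = ennreal (F (y + b) * l b)" for a b
  have m[measurable]: "f1 \<in> borel_measurable lborel" "f2 \<in> borel_measurable lborel"
      "g1 \<in> borel_measurable lborel" "g2 \<in> borel_measurable lborel"
    unfolding f1_def f2_def g1_def g2_def by measurable
  have i: "integral\<^sup>N lborel f1 = C (x + h)" "integral\<^sup>N lborel f2 = C (y - h)"
    "integral\<^sup>N lborel g1 = C x" "integral\<^sup>N lborel g2 = C y"
    using sh[of "x + h"] sh[of y] unfolding f1_def[abs_def] f2_def[abs_def] g1_def[abs_def] g2_def[abs_def]
    by (simp_all add: C_def)
  have pw: "g1 a * g2 b + g2 a * g1 b \<le> f1 a * f2 b + f2 a * f1 b" for a b
  proof -
    define u v p q where "u = F (x + h + a) * F (y + b)" and "v = F (x + h + b) * F (y + a)"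
      and "p = l a * l (b + h)" and "q = l (a + h) * l b"
    have "0 \<le> (u - v) * (p - q)"
    proof (cases "a \<le> b")
      case True
      have "u \<le> v" using F[unfolded tp2_def, rule_format, of "b - a" "x + h + a" "y + b"] True h
        unfolding u_def v_def by (simp add: add_ac)
      moreover have "p \<le> q" using l[unfolded tp2_def, rule_format, of h a "b + h"] True h
        unfolding p_def q_def by simp
      ultimately show ?thesis by (simp add: mult_nonpos_nonpos)
    next
      case False
      have "v \<le> u" using F[unfolded tp2_def, rule_format, of "a - b" "x + h + b" "y + a"] False h
        unfolding u_def v_def by (simp add: mult.commute add_ac)
      moreover have "q \<le> p" using l[unfolded tp2_def, rule_format, of h b "a + h"] False h
        unfolding p_def q_def by (simp add: mult.commute)
      ultimately show ?thesis by simp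
    qed
    hence "u * q + v * p \<le> u * p + v * q" by (simp add: algebra_simps)
    hence "ennreal (u * q + v * p) \<le> ennreal (u * p + v * q)" by (rule ennreal_leI)
    moreover have "g1 a * g2 b + g2 a * g1 b = ennreal (u * q + v * p)"
      unfolding g1_def g2_def u_def v_def p_def q_def using nn
      by (simp add: ennreal_mult[symmetric] mult_ac del: ennreal_plus flip: ennreal_plus)
    moreover have "f1 a * f2 b + f2 a * f1 b = ennreal (u * p + v * q)"
      unfolding f1_def f2_def u_def v_def p_def q_def using nn
      by (simp add: ennreal_mult[symmetric] mult_ac del: ennreal_plus flip: ennreal_plus)
    ultimately show ?thesis by simp
  qed
  have "(\<integral>\<^sup>+a. \<integral>\<^sup>+b. g1 a * g2 b + g2 a * g1 b \<partial>lborel \<partial>lborel) \<le> (\<integral>\<^sup>+a. \<integral>\<^sup>+b. f1 a * f2 b + f2 a * f1 b \<partial>lborel \<partial>lborel)"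
    by (intro nn_integral_mono pw)
  hence "C x * C y + C x * C y \<le> C (x + h) * C (y - h) + C (x + h) * C (y - h)"
    by (simp add: nn_integral_add nn_integral_cmult nn_integral_multc i mult.commute)
  hence "2 * (C x * C y) \<le> 2 * (C (x + h) * C (y - h))" by (simp add: mult_2)
  thus ?thesis by (simp add: ennreal_mult_le_mult_iff)
qed

section \<open>From total positivity to concavity\<close>

lemma concave_seq:
  fixes a :: "nat \<Rightarrow> real"
  assumes "\<And>i. a i + a (Suc (Suc i)) \<le> 2 * a (Suc i)" "k \<le> n"
  shows "k * a n + (n - k) * a 0 \<le> n * a k"
proof (cases k)
  case (Suc k')
  define d where "d i = a (Suc i) - a i" for i
  have "d (Suc i) \<le> d i" for i using assms(1)[of i] unfolding d_def by simp
  hence dec: "decseq d" by (rule decseq_SucI)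
  have up: "a (k + j) \<le> a k + j * d k'" for j
  proof (induction j)
    case (Suc j)
    have "d (k + j) \<le> d k'" using dec \<open>k = Suc k'\<close> by (auto simp: decseq_def)
    with Suc show ?case unfolding d_def by (simp add: algebra_simps)
  qed simp
  have dn: "j \<le> k \<Longrightarrow> a (k - j) \<le> a k - j * d k'" for j
  proof (induction j)
    case (Suc j)
    have "d k' \<le> d (k - Suc j)" using dec \<open>k = Suc k'\<close> Suc(2) by (auto simp: decseq_def)
    moreover have "Suc (k - Suc j) = k - j" using Suc(2) by simp
    ultimately show ?case using Suc unfolding d_def by (simp add: algebra_simps)
  qed simp
  have 1: "a n \<le> a k + real (n - k) * d k'" using up[of "n - k"] assms(2) by simp
  have 2: "a 0 \<le> a k - k * d k'" using dn[of k] by simp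
  have "k * a n + real (n - k) * a 0 \<le> k * (a k + real (n - k) * d k') + real (n - k) * (a k - k * d k')"
    by (intro add_mono mult_left_mono 1 2) auto
  also have "\<dots> = n * a k" using assms(2) by (simp add: algebra_simps of_nat_diff)
  finally show ?thesis using assms(2) by (simp add: of_nat_diff)
qed simp

text \<open>For p = ln g the hypothesis is Wright concavity, p x + p y \<le> p (x + h) + p (y - h),
  which yields concavity along equidistant grids. The passage from rational to real weights needs
  some regularity, here supplied by monotonicity.\<close>

lemma tp2_antimono_concave:
  fixes g :: "real \<Rightarrow> real"
  assumes pos: "\<And>t. 0 < g t" and "antimono g" and tp: "tp2 g"
  shows "concave_on UNIV (\<lambda>t. ln (g t))"
proof -
  define p where "p t = ln (g t)" for t
  have mono: "p t \<le> p s" if "s \<le> t" for s t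
    unfolding p_def using pos antimonoD[OF assms(2) that] by simp
  have W: "p x + p y \<le> p (x + h) + p (y - h)" if "0 \<le> h" "x + h \<le> y" for x y h
  proof -
    have "ln (g x * g y) \<le> ln (g (x + h) * g (y - h))"
      using tp that pos by (simp add: tp2_def)
    thus ?thesis unfolding p_def using pos by (simp add: ln_mult less_imp_neq[symmetric] del: ln_le_cancel_iff)
  qed
  have rat: "(1 - k / n) * p x + k / n * p y \<le> p (x + k / n * (y - x))" if "x < y" "0 < n" "k \<le> n" for x y and k n :: nat
  proof -
    define a where "a i = p (x + real i / n * (y - x))" for i :: nat
    have "a i + a (Suc (Suc i)) \<le> 2 * a (Suc i)" for i
    proof -
      have "a i + a (Suc (Suc i)) \<le> p (x + i / n * (y - x) + (y - x) / n) + p (x + Suc (Suc i) / n * (y - x) - (y - x) / n)"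
        unfolding a_def using that by (intro W) (auto simp: field_simps)
      also have "\<dots> = 2 * a (Suc i)"
      proof -
        have e: "x + i / n * (y - x) + (y - x) / n = x + real (Suc i) / n * (y - x)"
          "x + real (Suc (Suc i)) / n * (y - x) - (y - x) / n = x + real (Suc i) / n * (y - x)"
          using that by (auto simp: field_simps)
        show ?thesis unfolding a_def e by simp
      qed
      finally show ?thesis .
    qed
    from concave_seq[of a, OF this that(3)] have "k * p y + (n - k) * p x \<le> n * a k"
      unfolding a_def using that by simp
    thus ?thesis using that unfolding a_def by (simp add: field_simps of_nat_diff)
  qed
  have main: "(1 - t) * p x + t * p y \<le> p ((1 - t) * x + t * y)" if "x < y" "0 < t" "t < 1" for x y t
  proof -
    \<comment> \<open>Rounding up places the grid point to the right of (1 - t) x + t y, where p is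
      at most as large.\<close>
    define k where "k n = nat \<lceil>t * real n\<rceil>" for n
    have kb: "t * n \<le> k n" "k n \<le> t * n + 1" for n
      unfolding k_def using that by (auto simp: le_nat_iff)
    have kn: "k n \<le> n" for n
    proof -
      have "t * real n \<le> 1 * real n" using that by (intro mult_right_mono) auto
      hence "\<lceil>t * real n\<rceil> \<le> int n" by (simp add: ceiling_le_iff)
      thus ?thesis unfolding k_def by (simp only: nat_le_iff)
    qed
    have lim: "(\<lambda>n. k n / n) \<longlonglongrightarrow> t"
    proof (rule tendsto_sandwich)
      show "\<forall>\<^sub>F n in sequentially. t \<le> k n / n" "\<forall>\<^sub>F n in sequentially. k n / n \<le> t + 1 / n"
        using kb by (auto intro!: eventually_sequentiallyI[of 1] simp: field_simps)
      show "(\<lambda>n. t + 1 / real n) \<longlonglongrightarrow> t" using tendsto_add[OF tendsto_const lim_1_over_n, of t] by simp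
    qed simp
    have ev: "\<forall>\<^sub>F n in sequentially. (1 - k n / n) * p x + k n / n * p y \<le> p ((1 - t) * x + t * y)"
    proof (rule eventually_sequentiallyI[of 1])
      fix n :: nat assume n: "1 \<le> n"
      have "(1 - k n / n) * p x + k n / n * p y \<le> p (x + k n / n * (y - x))" using rat[OF that(1), of n "k n"] kn n by simp
      also have "\<dots> \<le> p ((1 - t) * x + t * y)"
      proof (rule mono)
        have "t \<le> k n / n" using kb(1)[of n] n by (simp add: field_simps)
        hence "t * (y - x) \<le> k n / n * (y - x)" using that by (intro mult_right_mono) auto
        thus "(1 - t) * x + t * y \<le> x + k n / n * (y - x)" by (simp add: algebra_simps)
      qed
      finally show "(1 - k n / n) * p x + k n / n * p y \<le> p ((1 - t) * x + t * y)" .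
    qed
    have "(\<lambda>n. (1 - k n / n) * p x + k n / n * p y) \<longlonglongrightarrow> (1 - t) * p x + t * p y"
      by (intro tendsto_intros lim)
    thus ?thesis using ev by (rule tendsto_upperbound) simp
  qed
  show ?thesis unfolding p_def[symmetric] concave_on_def
  proof (rule convex_on_linorderI)
    fix t x y :: real assume "0 < t" "t < 1" "x < y"
    from main[OF this(3,1,2)] show "- p ((1 - t) *\<^sub>R x + t *\<^sub>R y) \<le> (1 - t) * - p x + t * - p y" by simp
  qed simp
qed

lemma concave_on_eq:
  fixes f g :: "real \<Rightarrow> real"
  assumes "concave_on S f" "\<And>x. x \<in> S \<Longrightarrow> f x = g x"
  shows "concave_on S g"
  using assms unfolding concave_on_def convex_on_def by (auto simp: convex_def)

text \<open>The change of variables theorem for absolutely integrable functions shows that both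
  sides are integrable at the same time; if they are not, both nonnegative integrals are infinite.
  So finiteness need not be known in advance.\<close>

lemma nn_integral_subst:
  fixes f g g' :: "real \<Rightarrow> real"
  assumes f[measurable]: "f \<in> borel_measurable borel" and nn: "\<And>x. 0 \<le> f x"
    and S[measurable]: "S \<in> sets borel" and gS[measurable]: "g ` S \<in> sets borel"
    and der: "\<And>x. x \<in> S \<Longrightarrow> (g has_field_derivative g' x) (at x)"
    and pos: "\<And>x. x \<in> S \<Longrightarrow> 0 \<le> g' x" and inj: "inj_on g S"
    and m[measurable]: "(\<lambda>x. indicator S x * (g' x * f (g x))) \<in> borel_measurable borel"
  shows "(\<integral>\<^sup>+x. ennreal (indicator S x * (g' x * f (g x))) \<partial>lborel) = (\<integral>\<^sup>+x. ennreal (indicator (g ` S) x * f x) \<partial>lborel)"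
proof -
  have der': "x \<in> S \<Longrightarrow> (g has_field_derivative g' x) (at x within S)" for x
    using der has_field_derivative_at_within by blast
  have Sl: "S \<in> sets lebesgue" using S by simp
  note cv = has_absolute_integral_change_of_variables_1'[OF Sl der' inj, of f]
  have conv: "h absolutely_integrable_on T \<longleftrightarrow> integrable lborel (\<lambda>x. indicator T x * h x)"
    "integrable lborel (\<lambda>x. indicator T x * h x) \<Longrightarrow> integral T h = integral\<^sup>L lborel (\<lambda>x. indicator T x * h x)"
    if [measurable]: "(\<lambda>x. indicator T x * h x) \<in> borel_measurable borel" for h :: "real \<Rightarrow> real" and T
  proof -
    show 1: "h absolutely_integrable_on T \<longleftrightarrow> integrable lborel (\<lambda>x. indicator T x * h x)"
      unfolding set_integrable_def by (simp add: integrable_completion)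
    assume i: "integrable lborel (\<lambda>x. indicator T x * h x)"
    hence "h absolutely_integrable_on T" using 1 by simp
    hence "integral T h = (LINT x:T|lebesgue. h x)" by (simp add: set_lebesgue_integral_eq_integral)
    also have "\<dots> = integral\<^sup>L lborel (\<lambda>x. indicator T x * h x)"
      unfolding set_lebesgue_integral_def by (simp add: integral_completion)
    finally show "integral T h = integral\<^sup>L lborel (\<lambda>x. indicator T x * h x)" .
  qed
  have eq: "(\<lambda>x. indicator S x * (\<bar>g' x\<bar> * f (g x))) = (\<lambda>x. indicator S x * (g' x * f (g x)))"
    using pos by (auto simp: indicator_def)
  have m1: "(\<lambda>x. indicator S x * (\<bar>g' x\<bar> * f (g x))) \<in> borel_measurable borel" unfolding eq by (rule m)
  have m2: "(\<lambda>x. indicator (g ` S) x * f x) \<in> borel_measurable borel" by measurable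
  show ?thesis
  proof (cases "integrable lborel (\<lambda>x. indicator (g ` S) x * f x)")
    case True
    have 1: "integrable lborel (\<lambda>x. indicator S x * (g' x * f (g x)))"
      "integral\<^sup>L lborel (\<lambda>x. indicator S x * (g' x * f (g x))) = integral\<^sup>L lborel (\<lambda>x. indicator (g ` S) x * f x)"
      using cv[of "integral\<^sup>L lborel (\<lambda>x. indicator (g ` S) x * f x)"] conv[OF m1] conv[OF m2] True unfolding eq by auto
    show ?thesis using 1 True nn pos
      by (subst (1 2) nn_integral_eq_integral) (auto simp: indicator_def)
  next
    case False
    hence False2: "\<not> integrable lborel (\<lambda>x. indicator S x * (g' x * f (g x)))"
      using cv conv(1)[OF m1] conv(1)[OF m2] unfolding eq by auto
    have "(\<integral>\<^sup>+x. ennreal (indicator S x * (g' x * f (g x))) \<partial>lborel) = \<infinity>"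
      using False2 m nn pos by (auto simp: less_top indicator_def intro!: integrableI_nonneg)
    moreover have "(\<integral>\<^sup>+x. ennreal (indicator (g ` S) x * f x) \<partial>lborel) = \<infinity>"
      using False m2 nn by (auto simp: less_top indicator_def intro!: integrableI_nonneg)
    ultimately show ?thesis by simp
  qed
qed

section \<open>The Wright density\<close>

lemma measurable_trig [measurable]:
  "(sin :: real \<Rightarrow> real) \<in> borel_measurable borel" "(cos :: real \<Rightarrow> real) \<in> borel_measurable borel"
  "(cot :: real \<Rightarrow> real) \<in> borel_measurable borel"
proof -
  show 1[measurable]: "(sin :: real \<Rightarrow> real) \<in> borel_measurable borel" "(cos :: real \<Rightarrow> real) \<in> borel_measurable borel"
    by (intro borel_measurable_continuous_onI continuous_intros)+
  show "(cot :: real \<Rightarrow> real) \<in> borel_measurable borel" unfolding cot_def[abs_def] by measurable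
qed

lemma measurable_curve [measurable]:
  "Dfun \<alpha> \<in> borel_measurable borel" "lnA \<alpha> \<in> borel_measurable borel" "Wfun \<alpha> \<gamma> \<in> borel_measurable borel"
  unfolding Dfun_def[abs_def] lnA_def[abs_def] lnrho_def[abs_def] lnR_def[abs_def] Wfun_def[abs_def] sinq_def[abs_def]
  by measurable

text \<open>Since \<open>Dfun\<close> d\<theta> = (1 - \<alpha>) d (ln A), this is (1 - \<alpha>)
  times the Laplace transform of W dA at y.\<close>

definition curve_laplace :: "real \<Rightarrow> real \<Rightarrow> real \<Rightarrow> ennreal" where
  "curve_laplace \<alpha> \<gamma> y = (\<integral>\<^sup>+\<theta>. ennreal (indicator {0<..<pi} \<theta> *
     (Dfun \<alpha> \<theta> * exp (lnA \<alpha> \<theta> - y * exp (lnA \<alpha> \<theta>)) * Wfun \<alpha> \<gamma> \<theta>)) \<partial>lborel)"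

lemma measurable_curve_laplace [measurable]: "curve_laplace \<alpha> \<gamma> \<in> borel_measurable borel"
  unfolding curve_laplace_def[abs_def] by measurable

text \<open>An integral form of \<phi>(-\<alpha>, 1 - \<gamma>, -x): in terms of y = x^(1 / (1 -
  \<alpha>)) the prefactor is y^(1 + \<gamma>) / pi, and the 1 - \<alpha> cancels the one in
  \<open>curve_laplace\<close>. The link to the law is made through the moments.\<close>

definition wright_density :: "real \<Rightarrow> real \<Rightarrow> real \<Rightarrow> real" where
  "wright_density \<alpha> \<gamma> x = (if 0 < x then x powr ((1 + \<gamma>) / (1 - \<alpha>)) / (pi * (1 - \<alpha>))
     * enn2real (curve_laplace \<alpha> \<gamma> (x powr (1 / (1 - \<alpha>)))) else 0)"

lemma measurable_wright_density [measurable]: "wright_density \<alpha> \<gamma> \<in> borel_measurable borel"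
  unfolding wright_density_def[abs_def] by measurable

lemma wright_density_0: "x \<le> 0 \<Longrightarrow> wright_density \<alpha> \<gamma> x = 0"
  by (simp add: wright_density_def)

text \<open>For negative \<gamma> the exponent q of a low moment may fail to be positive, and then
  \<open>nn_integral_curve\<close> is silent. The moments of large order are enough later.\<close>

lemma exponent_pos:
  assumes "0 < \<alpha>" "\<alpha> < 1" "\<bar>\<gamma>\<bar> < 1"
  shows "\<exists>N. \<forall>n\<ge>N. 0 < (1 - \<alpha>) * (real n + 1) + \<gamma>"
proof -
  obtain N :: nat where N: "1 / (1 - \<alpha>) < N" using reals_Archimedean2 by blast
  have "0 < (1 - \<alpha>) * (real n + 1) + \<gamma>" if "n \<ge> N" for n
  proof -
    have "1 < (1 - \<alpha>) * N" using N assms by (simp add: field_simps)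
    also have "\<dots> \<le> (1 - \<alpha>) * (real n + 1)" using that assms by (intro mult_left_mono) auto
    finally show ?thesis using assms by simp
  qed
  thus ?thesis by blast
qed

context
  fixes \<alpha> \<gamma> :: real
  assumes \<alpha>: "0 < \<alpha>" "\<alpha> < 1" and \<gamma>: "\<bar>\<gamma>\<bar> < 1"
begin

lemma curve_laplace_finite:
  assumes y: "0 < y"
  shows "curve_laplace \<alpha> \<gamma> y < \<infinity>"
proof -
  obtain n where n: "0 < (1 - \<alpha>) * (real n + 1) + \<gamma>" using exponent_pos[OF \<alpha> \<gamma>] by blast
  \<comment> \<open>K is the maximum over a of exp (p a - y exp a), attained at exp a = p / y. It
    bounds the Laplace kernel by the integrand of a moment.\<close>
  define q p K where "q = (1 - \<alpha>) * (real n + 1) + \<gamma>" and "p = q + 1" and "K = exp (p * ln (p / y) - p)"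
  have p: "0 < p" using n by (simp add: p_def q_def)
  have b: "exp (a - y * exp a) \<le> K * exp (- q * a)" for a
  proof -
    have "p * (1 + (a - ln (p / y))) \<le> p * exp (a - ln (p / y))" using p by (intro mult_left_mono exp_ge_add_one_self) auto
    also have "\<dots> = y * exp a" using p y by (simp add: exp_diff)
    finally show ?thesis unfolding K_def exp_add[symmetric] p_def by (simp add: algebra_simps)
  qed
  have "curve_laplace \<alpha> \<gamma> y \<le> (\<integral>\<^sup>+\<theta>. ennreal K * ennreal (indicator {0<..<pi} \<theta> * (Dfun \<alpha> \<theta> * exp (- q * lnA \<alpha> \<theta>) * Wfun \<alpha> \<gamma> \<theta>)) \<partial>lborel)"
    unfolding curve_laplace_def
  proof (intro nn_integral_mono)
    fix \<theta> :: real
    have "indicator {0<..<pi} \<theta> * (Dfun \<alpha> \<theta> * exp (lnA \<alpha> \<theta> - y * exp (lnA \<alpha> \<theta>)) * Wfun \<alpha> \<gamma> \<theta>)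
       \<le> K * (indicator {0<..<pi} \<theta> * (Dfun \<alpha> \<theta> * exp (- q * lnA \<alpha> \<theta>) * Wfun \<alpha> \<gamma> \<theta>))"
    proof (cases "\<theta> \<in> {0<..<pi}")
      case True
      have "Dfun \<alpha> \<theta> * exp (lnA \<alpha> \<theta> - y * exp (lnA \<alpha> \<theta>)) * Wfun \<alpha> \<gamma> \<theta> \<le> Dfun \<alpha> \<theta> * (K * exp (- q * lnA \<alpha> \<theta>)) * Wfun \<alpha> \<gamma> \<theta>"
        using True Dfun_pos[OF \<alpha>, of \<theta>] Wfun_pos[OF \<gamma>, of \<theta> \<alpha>] by (intro mult_right_mono mult_left_mono b) auto
      thus ?thesis using True by (simp add: mult_ac)
    qed simp
    thus "ennreal (indicator {0<..<pi} \<theta> * (Dfun \<alpha> \<theta> * exp (lnA \<alpha> \<theta> - y * exp (lnA \<alpha> \<theta>)) * Wfun \<alpha> \<gamma> \<theta>))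
      \<le> ennreal K * ennreal (indicator {0<..<pi} \<theta> * (Dfun \<alpha> \<theta> * exp (- q * lnA \<alpha> \<theta>) * Wfun \<alpha> \<gamma> \<theta>))"
      by (subst ennreal_mult'[symmetric]) (auto simp: K_def intro: ennreal_leI)
  qed
  also have "\<dots> = ennreal K * ennreal (pi * fact n * rGamma (q + 1) * rGamma (1 - \<gamma> + \<alpha> * (real n + 1)))"
    using nn_integral_curve[OF \<alpha> \<gamma> n] unfolding q_def by (subst nn_integral_cmult) auto
  also have "\<dots> < \<infinity>" by (simp add: ennreal_mult_less_top)
  finally show ?thesis .
qed

lemma curve_laplace_pos: "0 < curve_laplace \<alpha> \<gamma> y"
proof (rule ccontr)
  assume "\<not> 0 < curve_laplace \<alpha> \<gamma> y"
  hence "curve_laplace \<alpha> \<gamma> y = 0" by (simp add: zero_less_iff_neq_zero)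
  hence "AE \<theta> in lborel. ennreal (indicator {0<..<pi} \<theta> *
     (Dfun \<alpha> \<theta> * exp (lnA \<alpha> \<theta> - y * exp (lnA \<alpha> \<theta>)) * Wfun \<alpha> \<gamma> \<theta>)) = 0"
    unfolding curve_laplace_def by (subst (asm) nn_integral_0_iff_AE) auto
  hence "AE \<theta> in lborel. \<theta> \<notin> {0<..<pi}"
  proof eventually_elim
    case (elim \<theta>)
    show ?case
    proof
      assume "\<theta> \<in> {0<..<pi}"
      hence "0 < Dfun \<alpha> \<theta> * exp (lnA \<alpha> \<theta> - y * exp (lnA \<alpha> \<theta>)) * Wfun \<alpha> \<gamma> \<theta>"
        using Dfun_pos[OF \<alpha>, of \<theta>] Wfun_pos[OF \<gamma>, of \<theta> \<alpha>] by simp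
      thus False using elim \<open>\<theta> \<in> {0<..<pi}\<close> by (simp add: ennreal_eq_0_iff not_le)
    qed
  qed
  hence "emeasure lborel {0<..<pi} = 0"
    by (subst (asm) AE_iff_measurable[of "{0<..<pi}"]) (auto simp del: greaterThanLessThan_iff)
  thus False by simp
qed

lemma ennreal_curve_laplace: "0 < y \<Longrightarrow> ennreal (enn2real (curve_laplace \<alpha> \<gamma> y)) = curve_laplace \<alpha> \<gamma> y"
  using curve_laplace_finite[of y] by simp

lemma enn2real_curve_laplace_pos: "0 < y \<Longrightarrow> 0 < enn2real (curve_laplace \<alpha> \<gamma> y)"
  using curve_laplace_finite[of y] curve_laplace_pos[of y] by (simp add: enn2real_positive_iff)

lemma wright_density_nonneg: "0 \<le> wright_density \<alpha> \<gamma> x"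
  using \<alpha> by (simp add: wright_density_def)

lemma wright_density_pos: "0 < x \<Longrightarrow> 0 < wright_density \<alpha> \<gamma> x"
  using \<alpha> enn2real_curve_laplace_pos[of "x powr (1 / (1 - \<alpha>))"] by (simp add: wright_density_def)

end

lemma nn_integral_stretched_exponential:
  fixes A c p :: real
  assumes "0 < A" "0 < c" "0 < p"
  shows "(\<integral>\<^sup>+x. ennreal (indicator {0<..} x * (x powr (p / c - 1) * exp (- (x powr (1 / c) * A)))) \<partial>lborel)
    = ennreal (c * Gamma p * A powr - p)"
proof -
  define f g g' where "f t = t powr (p - 1) * exp (- t)" and "g x = A * x powr (1 / c)"
    and "g' x = A * (1 / c * x powr (1 / c - 1))" for t x :: real
  have m[measurable]: "f \<in> borel_measurable borel" "g \<in> borel_measurable borel" "g' \<in> borel_measurable borel"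
    unfolding f_def[abs_def] g_def[abs_def] g'_def[abs_def] by measurable
  have gS: "g ` {0<..} = {0<..}"
  proof (intro equalityI subsetI)
    fix t :: real assume "t \<in> {0<..}"
    hence "g ((t / A) powr c) = t" "(t / A) powr c \<in> {0<..}" using assms by (auto simp: g_def powr_powr)
    thus "t \<in> g ` {0<..}" by (metis imageI)
  qed (use assms in \<open>auto simp: g_def\<close>)
  have inj: "inj_on g {0<..}"
  proof (rule inj_onI)
    fix x y assume "x \<in> {0<..}" "y \<in> {0<..}" "g x = g y"
    hence "(x powr (1 / c)) powr c = (y powr (1 / c)) powr c" using assms by (simp add: g_def)
    thus "x = y" using \<open>x \<in> {0<..}\<close> \<open>y \<in> {0<..}\<close> assms by (simp add: powr_powr)
  qed
  have "(\<integral>\<^sup>+x. ennreal (indicator {0<..} x * (x powr (p / c - 1) * exp (- (x powr (1 / c) * A)))) \<partial>lborel)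
    = (\<integral>\<^sup>+x. ennreal (c * A powr - p) * ennreal (indicator {0<..} x * (g' x * f (g x))) \<partial>lborel)"
  proof (intro nn_integral_cong)
    fix x :: real
    have "x powr (p / c - 1) * exp (- (x powr (1 / c) * A)) = c * A powr - p * (g' x * f (g x))" if "0 < x"
    proof -
      have 1: "c * A powr - p * (g' x * f (g x)) = (A powr - p * A * A powr (p - 1)) * (x powr (1 / c - 1) * x powr ((p - 1) / c)) * exp (- (x powr (1 / c) * A))"
        unfolding g'_def f_def g_def using assms that by (simp add: powr_mult powr_powr mult_ac)
      have 2: "A powr - p * A * A powr (p - 1) = 1"
        using assms by (simp add: powr_minus powr_diff field_simps)
      have 3: "x powr (1 / c - 1) * x powr ((p - 1) / c) = x powr (p / c - 1)"
        unfolding powr_add[symmetric] by (simp add: diff_divide_distrib)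
      show ?thesis unfolding 1 2 3 by simp
    qed
    thus "ennreal (indicator {0<..} x * (x powr (p / c - 1) * exp (- (x powr (1 / c) * A))))
      = ennreal (c * A powr - p) * ennreal (indicator {0<..} x * (g' x * f (g x)))"
      using assms by (subst ennreal_mult'[symmetric]) (auto simp: indicator_def)
  qed
  also have "\<dots> = ennreal (c * A powr - p) * (\<integral>\<^sup>+x. ennreal (indicator {0<..} x * (g' x * f (g x))) \<partial>lborel)"
    by (intro nn_integral_cmult) measurable
  also have "(\<integral>\<^sup>+x. ennreal (indicator {0<..} x * (g' x * f (g x))) \<partial>lborel) = (\<integral>\<^sup>+x. ennreal (indicator {0<..} x * f x) \<partial>lborel)"
  proof (subst nn_integral_subst[where g = g and g' = g'])
    show "(g has_field_derivative g' x) (at x)" if "x \<in> {0<..}" for x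
      unfolding g_def g'_def using that by (auto intro!: derivative_eq_intros)
  qed (use assms inj in \<open>auto simp: gS f_def g'_def\<close>)
  also have "\<dots> = (\<integral>\<^sup>+x. ennreal (indicator {0..} x * x powr (p - 1) / exp x) \<partial>lborel)"
    by (intro nn_integral_cong) (auto simp: indicator_def f_def exp_minus field_simps)
  also have "\<dots> = ennreal (Gamma p)" using Gamma_conv_nn_integral_real[OF assms(3)] by simp
  also have "ennreal (c * A powr - p) * ennreal (Gamma p) = ennreal (c * Gamma p * A powr - p)"
    using assms by (subst ennreal_mult'[symmetric]) (auto simp: mult_ac)
  finally show ?thesis .
qed

text \<open>Integrating over x first produces Gamma (q + 1) A^(-q - 1), and the factor Gamma (q + 1)
  cancels against \<open>rGamma (q + 1)\<close> in \<open>nn_integral_curve\<close>.\<close>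

lemma wright_density_moment:
  assumes \<alpha>: "0 < \<alpha>" "\<alpha> < 1" and \<gamma>: "\<bar>\<gamma>\<bar> < 1" and n: "0 < (1 - \<alpha>) * (real n + 1) + \<gamma>"
  shows "(\<integral>\<^sup>+x. ennreal (x ^ n * wright_density \<alpha> \<gamma> x) \<partial>lborel) = ennreal (fact n * rGamma (1 - \<gamma> + \<alpha> * (real n + 1)))"
proof -
  define q p c where "q = (1 - \<alpha>) * (real n + 1) + \<gamma>" and "p = q + 1" and "c = 1 - \<alpha>"
  have c: "0 < c" and p: "0 < p" using \<alpha> n by (auto simp: c_def p_def q_def)
  define k where "k \<theta> = indicator {0<..<pi} \<theta> * (Dfun \<alpha> \<theta> * exp (lnA \<alpha> \<theta>) * Wfun \<alpha> \<gamma> \<theta>) / (pi * c)" for \<theta>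
  have k0: "0 \<le> k \<theta>" for \<theta>
    unfolding k_def using Dfun_pos[OF \<alpha>, of \<theta>] Wfun_pos[OF \<gamma>, of \<theta> \<alpha>] c by (auto simp: indicator_def)
  have [measurable]: "k \<in> borel_measurable borel" unfolding k_def[abs_def] by measurable
  define h where "h x \<theta> = indicator {0<..} x * (x powr (p / c - 1) * exp (- (x powr (1 / c) * exp (lnA \<alpha> \<theta>))))" for x \<theta>
  have h0: "0 \<le> h x \<theta>" for x \<theta> unfolding h_def by simp
  have [measurable]: "case_prod h \<in> borel_measurable (borel \<Otimes>\<^sub>M borel)" unfolding h_def by measurable
  have "(\<integral>\<^sup>+x. ennreal (x ^ n * wright_density \<alpha> \<gamma> x) \<partial>lborel) = (\<integral>\<^sup>+x. \<integral>\<^sup>+\<theta>. ennreal (k \<theta> * h x \<theta>) \<partial>lborel \<partial>lborel)"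
  proof (intro nn_integral_cong)
    fix x :: real
    show "ennreal (x ^ n * wright_density \<alpha> \<gamma> x) = (\<integral>\<^sup>+\<theta>. ennreal (k \<theta> * h x \<theta>) \<partial>lborel)"
    proof (cases "0 < x")
      case True
      have e: "p / c - 1 = n + (1 + \<gamma>) / c" using c unfolding p_def q_def c_def by (simp add: field_simps)
      have "ennreal (x ^ n * wright_density \<alpha> \<gamma> x) = ennreal (x powr (p / c - 1) / (pi * c)) * curve_laplace \<alpha> \<gamma> (x powr (1 / c))"
      proof -
        have "x ^ n * wright_density \<alpha> \<gamma> x = x powr (p / c - 1) / (pi * c) * enn2real (curve_laplace \<alpha> \<gamma> (x powr (1 / c)))"
          using True unfolding wright_density_def c_def[symmetric] e by (simp add: powr_add powr_realpow)
        moreover have e0: "0 \<le> x powr (p / c - 1) / (pi * c)" using c by simp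
        ultimately show ?thesis
          using ennreal_curve_laplace[OF \<alpha> \<gamma>, of "x powr (1 / c)"] True by (simp only: ennreal_mult'[OF e0] powr_gt_zero)
      qed
      also have "\<dots> = (\<integral>\<^sup>+\<theta>. ennreal (k \<theta> * h x \<theta>) \<partial>lborel)"
        unfolding curve_laplace_def using True c
        by (subst nn_integral_cmult[symmetric])
          (auto intro!: nn_integral_cong simp: ennreal_mult'[symmetric] k_def h_def exp_diff exp_minus field_simps)
      finally show ?thesis .
    qed (simp add: wright_density_def h_def)
  qed
  also have "\<dots> = (\<integral>\<^sup>+\<theta>. \<integral>\<^sup>+x. ennreal (k \<theta> * h x \<theta>) \<partial>lborel \<partial>lborel)"
    by (rule lborel_pair.Fubini') measurable
  also have "\<dots> = (\<integral>\<^sup>+\<theta>. ennreal (Gamma p / pi) * ennreal (indicator {0<..<pi} \<theta> * (Dfun \<alpha> \<theta> * exp (- q * lnA \<alpha> \<theta>) * Wfun \<alpha> \<gamma> \<theta>)) \<partial>lborel)"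
  proof (intro nn_integral_cong)
    fix \<theta> :: real
    have "(\<integral>\<^sup>+x. ennreal (k \<theta> * h x \<theta>) \<partial>lborel) = ennreal (k \<theta>) * ennreal (c * Gamma p * exp (lnA \<alpha> \<theta>) powr - p)"
      using nn_integral_stretched_exponential[of "exp (lnA \<alpha> \<theta>)" c p] c p k0 h0 unfolding h_def
      by (simp add: ennreal_mult' nn_integral_cmult)
    also have "\<dots> = ennreal (Gamma p / pi) * ennreal (indicator {0<..<pi} \<theta> * (Dfun \<alpha> \<theta> * exp (- q * lnA \<alpha> \<theta>) * Wfun \<alpha> \<gamma> \<theta>))"
    proof -
      have e: "exp (lnA \<alpha> \<theta>) * exp (lnA \<alpha> \<theta>) powr - p = exp (- q * lnA \<alpha> \<theta>)"
        by (simp add: powr_def p_def exp_add[symmetric] algebra_simps)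
      have "k \<theta> * (c * Gamma p * exp (lnA \<alpha> \<theta>) powr - p)
         = Gamma p / pi * (indicator {0<..<pi} \<theta> * (Dfun \<alpha> \<theta> * (exp (lnA \<alpha> \<theta>) * exp (lnA \<alpha> \<theta>) powr - p) * Wfun \<alpha> \<gamma> \<theta>))"
        using c by (simp add: k_def)
      thus ?thesis unfolding e using k0 Gamma_real_pos[OF p] by (simp add: ennreal_mult'[symmetric])
    qed
    finally show "(\<integral>\<^sup>+x. ennreal (k \<theta> * h x \<theta>) \<partial>lborel) = ennreal (Gamma p / pi) * ennreal (indicator {0<..<pi} \<theta> * (Dfun \<alpha> \<theta> * exp (- q * lnA \<alpha> \<theta>) * Wfun \<alpha> \<gamma> \<theta>))" .
  qed
  also have "\<dots> = ennreal (Gamma p / pi) * ennreal (pi * fact n * rGamma p * rGamma (1 - \<gamma> + \<alpha> * (real n + 1)))"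
    using nn_integral_curve[OF \<alpha> \<gamma> n] unfolding q_def p_def by (subst nn_integral_cmult) auto
  also have "\<dots> = ennreal (fact n * rGamma (1 - \<gamma> + \<alpha> * (real n + 1)))"
    using Gamma_real_pos[OF p] by (subst ennreal_mult'[symmetric]) (auto simp: rGamma_inverse_Gamma field_simps)
  finally show ?thesis .
qed


text \<open>m is the slope of ln W against ln A at s. By \<open>Nfun_Dfun_antimono\<close> the
  function ln W - m ln A increases up to s and decreases afterwards. Supergradients express
  concavity in ln A without any derivative of the inverse of \<open>lnA\<close>.\<close>

lemma Wfun_supergradient:
  assumes \<alpha>: "0 < \<alpha>" "\<alpha> < 1" and \<gamma>: "\<bar>\<gamma>\<bar> < 1" "- \<alpha> \<le> \<gamma>" "\<gamma> \<le> 1 - \<alpha>" and s: "0 < s" "s < pi"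
  shows "\<exists>m. \<forall>t. 0 < t \<longrightarrow> t < pi \<longrightarrow> ln (Wfun \<alpha> \<gamma> t) \<le> ln (Wfun \<alpha> \<gamma> s) + m * (lnA \<alpha> t - lnA \<alpha> s)"
proof -
  define Q where "Q = Nfun \<alpha> \<gamma> s / Dfun \<alpha> s"
  define m where "m = \<gamma> + (1 - \<alpha>) * Q"
  define \<psi> where "\<psi> t = ln (Wfun \<alpha> \<gamma> t) - m * lnA \<alpha> t" for t
  have D: "0 < Dfun \<alpha> t" if "0 < t" "t < pi" for t using Dfun_pos[OF \<alpha> that] .
  have der: "(\<psi> has_real_derivative Dfun \<alpha> t * (Nfun \<alpha> \<gamma> t / Dfun \<alpha> t - Q)) (at t)" if t: "0 < t" "t < pi" for t
  proof -
    have W: "0 < Wfun \<alpha> \<gamma> t" and S: "0 < sinq \<gamma> t" using Wfun_pos[OF \<gamma>(1) t] sinq_pos[OF \<gamma>(1) t] by auto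
    have "exp (\<gamma> * lnrho \<alpha> t) * ((\<alpha> * cot (\<alpha> * t) - cot t) / (1 - \<alpha>) * sin (\<gamma> * t) + cos (\<gamma> * t)) / Wfun \<alpha> \<gamma> t
      = \<gamma> * ((\<alpha> * cot (\<alpha> * t) - cot t) / (1 - \<alpha>)) + cos (\<gamma> * t) / sinq \<gamma> t"
      unfolding Wfun_def mult_sinq[symmetric] using S by (simp add: field_simps)
    also have "cos (\<gamma> * t) / sinq \<gamma> t = rcot \<gamma> t"
      by (simp add: sinq_def rcot_def cot_def)
    finally have e: "exp (\<gamma> * lnrho \<alpha> t) * ((\<alpha> * cot (\<alpha> * t) - cot t) / (1 - \<alpha>) * sin (\<gamma> * t) + cos (\<gamma> * t)) / Wfun \<alpha> \<gamma> t
      = \<gamma> * ((\<alpha> * cot (\<alpha> * t) - cot t) / (1 - \<alpha>)) + rcot \<gamma> t" .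
    have "(\<psi> has_real_derivative \<gamma> * ((\<alpha> * cot (\<alpha> * t) - cot t) / (1 - \<alpha>)) + rcot \<gamma> t - m * (Dfun \<alpha> t / (1 - \<alpha>))) (at t)"
      unfolding \<psi>_def e[symmetric] using W
      by (auto intro!: derivative_eq_intros Wfun_deriv[OF \<alpha> t] lnA_deriv[OF \<alpha> t])
    moreover have "\<gamma> * ((\<alpha> * cot (\<alpha> * t) - cot t) / (1 - \<alpha>)) + rcot \<gamma> t - m * (Dfun \<alpha> t / (1 - \<alpha>))
      = Dfun \<alpha> t * (Nfun \<alpha> \<gamma> t / Dfun \<alpha> t - Q)"
    proof -
      have "Dfun \<alpha> t * (Nfun \<alpha> \<gamma> t / Dfun \<alpha> t - Q) = Nfun \<alpha> \<gamma> t - Q * Dfun \<alpha> t" using D[OF t] by (simp add: field_simps)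
      moreover have "\<gamma> * ((\<alpha> * cot (\<alpha> * t) - cot t) / (1 - \<alpha>)) - \<gamma> * (Dfun \<alpha> t / (1 - \<alpha>)) = Nfun \<alpha> \<gamma> t - rcot \<gamma> t"
      proof -
        have "(\<alpha> * cot (\<alpha> * t) - cot t) - Dfun \<alpha> t = (1 - \<alpha>) * (\<alpha> * cot (\<alpha> * t) - (1 - \<alpha>) * cot ((1 - \<alpha>) * t))"
          unfolding Dfun_def by (simp add: algebra_simps power2_eq_square)
        hence "((\<alpha> * cot (\<alpha> * t) - cot t) - Dfun \<alpha> t) / (1 - \<alpha>) = \<alpha> * cot (\<alpha> * t) - (1 - \<alpha>) * cot ((1 - \<alpha>) * t)"
          using \<alpha> by simp
        hence "\<gamma> * (((\<alpha> * cot (\<alpha> * t) - cot t) - Dfun \<alpha> t) / (1 - \<alpha>)) = Nfun \<alpha> \<gamma> t - rcot \<gamma> t"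
          unfolding Nfun_def by simp
        thus ?thesis by (simp only: right_diff_distrib diff_divide_distrib)
      qed
      moreover have "m * (Dfun \<alpha> t / (1 - \<alpha>)) = \<gamma> * (Dfun \<alpha> t / (1 - \<alpha>)) + Q * Dfun \<alpha> t"
      proof -
        define c where "c = 1 - \<alpha>"
        have "c \<noteq> 0" using \<alpha> by (simp add: c_def)
        thus ?thesis unfolding m_def c_def[symmetric] by (simp add: field_simps)
      qed
      ultimately show ?thesis by linarith
    qed
    ultimately show ?thesis by simp
  qed
  have "\<psi> t \<le> \<psi> s" if t: "0 < t" "t < pi" for t
  proof (cases "t \<le> s")
    case True
    show ?thesis
    proof (rule DERIV_nonneg_imp_nondecreasing[OF True])
      fix x assume x: "t \<le> x" "x \<le> s"
      have "Q \<le> Nfun \<alpha> \<gamma> x / Dfun \<alpha> x" unfolding Q_def using Nfun_Dfun_antimono[OF \<alpha> \<gamma>(2,3)] x t s by simp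
      thus "\<exists>y. (\<psi> has_real_derivative y) (at x) \<and> 0 \<le> y"
        using der[of x] D[of x] x t s
          by (intro exI[of _ "Dfun \<alpha> x * (Nfun \<alpha> \<gamma> x / Dfun \<alpha> x - Q)"] conjI mult_nonneg_nonneg) auto
    qed
  next
    case False
    hence "s \<le> t" by simp
    thus ?thesis
    proof (rule DERIV_nonpos_imp_nonincreasing)
      fix x assume x: "s \<le> x" "x \<le> t"
      have "Nfun \<alpha> \<gamma> x / Dfun \<alpha> x \<le> Q" unfolding Q_def using Nfun_Dfun_antimono[OF \<alpha> \<gamma>(2,3)] x t s by simp
      thus "\<exists>y. (\<psi> has_real_derivative y) (at x) \<and> y \<le> 0"
        using der[of x] D[of x] x t s by (intro exI[of _ "Dfun \<alpha> x * (Nfun \<alpha> \<gamma> x / Dfun \<alpha> x - Q)"] conjI mult_nonneg_nonpos) auto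
    qed
  qed
  thus ?thesis unfolding \<psi>_def by (intro exI[of _ m]) (auto simp: algebra_simps)
qed

lemma lnA_strict_mono:
  assumes "0 < \<alpha>" "\<alpha> < 1" "0 < s" "s < t" "t < pi"
  shows "lnA \<alpha> s < lnA \<alpha> t"
proof (rule DERIV_pos_imp_increasing[OF assms(4)])
  fix x assume x: "s \<le> x" "x \<le> t"
  show "\<exists>y. (lnA \<alpha> has_real_derivative y) (at x) \<and> 0 < y"
    using lnA_deriv[of \<alpha> x] Dfun_pos[of \<alpha> x] assms x by (intro exI[of _ "Dfun \<alpha> x / (1 - \<alpha>)"]) auto
qed

lemma lnA_inj: "0 < \<alpha> \<Longrightarrow> \<alpha> < 1 \<Longrightarrow> inj_on (lnA \<alpha>) {0<..<pi}"
  by (rule linorder_inj_onI) (use lnA_strict_mono in force)+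

lemma lnA_image:
  assumes "0 < \<alpha>" "\<alpha> < 1"
  shows "open (lnA \<alpha> ` {0<..<pi})" "convex (lnA \<alpha> ` {0<..<pi})"
proof -
  have cont: "continuous_on {0<..<pi} (lnA \<alpha>)"
    using DERIV_isCont[OF lnA_deriv[OF assms]] by (intro continuous_at_imp_continuous_on) auto
  show "open (lnA \<alpha> ` {0<..<pi})"
    by (rule invariance_of_domain[OF cont open_greaterThanLessThan lnA_inj[OF assms]])
  have "connected (lnA \<alpha> ` {0<..<pi})" by (intro connected_continuous_image cont) simp
  thus "convex (lnA \<alpha> ` {0<..<pi})" by (simp add: connected_convex_1)
qed

lemma concave_on_supergradient:
  fixes f :: "real \<Rightarrow> real"
  assumes "convex S" and sg: "\<And>x. x \<in> S \<Longrightarrow> \<exists>m. \<forall>y\<in>S. f y \<le> f x + m * (y - x)"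
  shows "concave_on S f"
  unfolding concave_on_def
proof (rule convex_onI)
  fix t x y :: real assume t: "0 < t" "t < 1" and xy: "x \<in> S" "y \<in> S"
  define z where "z = (1 - t) *\<^sub>R x + t *\<^sub>R y"
  have "z \<in> S" unfolding z_def using assms(1) t xy by (intro convexD) auto
  then obtain m where m: "f x \<le> f z + m * (x - z)" "f y \<le> f z + m * (y - z)" using sg xy by blast
  have "(1 - t) * f x + t * f y \<le> (1 - t) * (f z + m * (x - z)) + t * (f z + m * (y - z))"
    using t by (intro add_mono mult_left_mono m) auto
  also have "\<dots> = f z + m * ((1 - t) * x + t * y - z)" by algebra
  also have "\<dots> = f z" unfolding z_def by simp
  finally show "- f ((1 - t) *\<^sub>R x + t *\<^sub>R y) \<le> (1 - t) * - f x + t * - f y" unfolding z_def by simp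
qed fact

lemma curve_laplace_log_concave:
  assumes \<alpha>: "0 < \<alpha>" "\<alpha> < 1" and \<gamma>: "\<bar>\<gamma>\<bar> < 1" "- \<alpha> \<le> \<gamma>" "\<gamma> \<le> 1 - \<alpha>"
  shows "concave_on UNIV (\<lambda>t. ln (enn2real (curve_laplace \<alpha> \<gamma> (exp t))))"
proof -
  define S T where "S = {0<..<pi}" and "T = lnA \<alpha> ` S"
  define inv where "inv = the_inv_into S (lnA \<alpha>)"
  have inv: "inv (lnA \<alpha> \<theta>) = \<theta>" if "\<theta> \<in> S" for \<theta>
    unfolding inv_def using that lnA_inj[OF \<alpha>] by (simp add: the_inv_into_f_f S_def)
  have T: "open T" "convex T" unfolding T_def S_def using lnA_image[OF \<alpha>] by auto
  \<comment> \<open>The logarithm of the density of (1 - \<alpha>) W dA with respect to a = ln A;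
    the summand a comes from dA = A da.\<close>
  define lW where "lW a = ln (1 - \<alpha>) + a + ln (Wfun \<alpha> \<gamma> (inv a))" for a
  have conc: "concave_on T lW"
  proof (rule concave_on_supergradient[OF T(2)])
    fix a assume "a \<in> T"
    then obtain s where s: "s \<in> S" "a = lnA \<alpha> s" unfolding T_def by blast
    obtain m where m: "\<forall>t. 0 < t \<longrightarrow> t < pi \<longrightarrow> ln (Wfun \<alpha> \<gamma> t) \<le> ln (Wfun \<alpha> \<gamma> s) + m * (lnA \<alpha> t - lnA \<alpha> s)"
      using Wfun_supergradient[OF \<alpha> \<gamma>] s unfolding S_def by auto
    have "\<forall>b\<in>T. lW b \<le> lW a + (1 + m) * (b - a)"
      using m s unfolding T_def lW_def by (auto simp: inv S_def algebra_simps)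
    thus "\<exists>m. \<forall>b\<in>T. lW b \<le> lW a + m * (b - a)" by blast
  qed
  \<comment> \<open>Extension by 0 keeps log-concavity because the range T of \<open>lnA\<close> is
    an interval.\<close>
  define l where "l a = (if a \<in> T then exp (lW a) else 0)" for a
  have "continuous_on T (\<lambda>a. - lW a)" using conc T(1) unfolding concave_on_def by (intro convex_on_continuous) auto
  from continuous_on_minus[OF this] have "continuous_on T lW" by simp
  hence [measurable]: "l \<in> borel_measurable borel"
    unfolding l_def using T(1) by (intro borel_measurable_continuous_on_if continuous_intros) auto
  have l: "tp2 l" "\<And>a. 0 \<le> l a"
  proof -
    have "{t. 0 < l t} = T" by (auto simp: l_def)
    moreover have "concave_on T (\<lambda>t. ln (l t))"
      by (rule concave_on_eq[OF conc]) (simp add: l_def)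
    ultimately have "log_concave l" unfolding log_concave_def by (auto simp: l_def)
    thus "tp2 l" by (rule log_concave_tp2)
  qed (simp add: l_def)
  define F where "F u = exp (- exp u)" for u :: real
  have [measurable]: "F \<in> borel_measurable borel" unfolding F_def by measurable
  have F: "tp2 F"
  proof (rule log_concave_tp2)
    have "convex_on UNIV (exp :: real \<Rightarrow> real)" by (rule exp_convex)
    thus "log_concave F" unfolding log_concave_def F_def by (simp add: concave_on_def)
  qed
  have rep: "curve_laplace \<alpha> \<gamma> (exp t) = (\<integral>\<^sup>+a. ennreal (F (t + a) * l a) \<partial>lborel)" for t
  proof -
    have TB[measurable]: "T \<in> sets borel" using T(1) by simp
    have SB[measurable]: "S \<in> sets borel" unfolding S_def by simp
    have e: "indicator S \<theta> * (Dfun \<alpha> \<theta> * exp (lnA \<alpha> \<theta> - exp t * exp (lnA \<alpha> \<theta>)) * Wfun \<alpha> \<gamma> \<theta>)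
      = indicator S \<theta> * (Dfun \<alpha> \<theta> / (1 - \<alpha>) * (F (t + lnA \<alpha> \<theta>) * l (lnA \<alpha> \<theta>)))" for \<theta>
    proof (cases "\<theta> \<in> S")
      case True
      have "l (lnA \<alpha> \<theta>) = (1 - \<alpha>) * exp (lnA \<alpha> \<theta>) * Wfun \<alpha> \<gamma> \<theta>"
        using True \<alpha> Wfun_pos[OF \<gamma>(1), of \<theta> \<alpha>] unfolding l_def lW_def T_def by (auto simp: inv exp_add S_def)
      moreover define c where "c = 1 - \<alpha>"
      moreover have "c \<noteq> 0" using \<alpha> by (simp add: c_def)
      ultimately have "Dfun \<alpha> \<theta> / c * l (lnA \<alpha> \<theta>) = Dfun \<alpha> \<theta> * exp (lnA \<alpha> \<theta>) * Wfun \<alpha> \<gamma> \<theta>" by simp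
      thus ?thesis unfolding c_def by (auto simp: F_def exp_diff exp_add exp_minus divide_inverse mult_ac)
    qed simp
    have m: "(\<lambda>\<theta>. indicator S \<theta> * (Dfun \<alpha> \<theta> / (1 - \<alpha>) * (F (t + lnA \<alpha> \<theta>) * l (lnA \<alpha> \<theta>)))) \<in> borel_measurable borel"
      by measurable
    have "curve_laplace \<alpha> \<gamma> (exp t) = (\<integral>\<^sup>+\<theta>. ennreal (indicator S \<theta> * (Dfun \<alpha> \<theta> / (1 - \<alpha>) * (F (t + lnA \<alpha> \<theta>) * l (lnA \<alpha> \<theta>)))) \<partial>lborel)"
      unfolding curve_laplace_def S_def[symmetric] e ..
    also have "\<dots> = (\<integral>\<^sup>+a. ennreal (indicator (lnA \<alpha> ` S) a * (F (t + a) * l a)) \<partial>lborel)"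
    proof (rule nn_integral_subst[where f = "\<lambda>a. F (t + a) * l a" and g' = "\<lambda>\<theta>. Dfun \<alpha> \<theta> / (1 - \<alpha>)"])
      show "inj_on (lnA \<alpha>) S" unfolding S_def by (rule lnA_inj[OF \<alpha>])
      show "(lnA \<alpha> has_real_derivative Dfun \<alpha> x / (1 - \<alpha>)) (at x)" if "x \<in> S" for x
        using lnA_deriv[OF \<alpha>, of x] that by (simp add: S_def)
      show "0 \<le> Dfun \<alpha> x / (1 - \<alpha>)" if "x \<in> S" for x
        using Dfun_pos[OF \<alpha>, of x] \<alpha> that by (simp add: S_def)
      show "lnA \<alpha> ` S \<in> sets borel" using TB by (simp add: T_def)
    qed (use l(2) SB m in \<open>auto simp: F_def\<close>)
    also have "\<dots> = (\<integral>\<^sup>+a. ennreal (F (t + a) * l a) \<partial>lborel)"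
      by (intro nn_integral_cong) (auto simp: l_def T_def indicator_def)
    finally show ?thesis .
  qed
  have fin: "ennreal (enn2real (curve_laplace \<alpha> \<gamma> (exp t))) = curve_laplace \<alpha> \<gamma> (exp t)" for t
    by (rule ennreal_curve_laplace[OF \<alpha> \<gamma>(1)]) simp
  show ?thesis
  proof (rule tp2_antimono_concave)
    show "0 < enn2real (curve_laplace \<alpha> \<gamma> (exp t))" for t
      by (rule enn2real_curve_laplace_pos[OF \<alpha> \<gamma>(1)]) simp
    show "antimono (\<lambda>t. enn2real (curve_laplace \<alpha> \<gamma> (exp t)))"
    proof (rule antimonoI)
      fix s t :: real assume "s \<le> t"
      have "curve_laplace \<alpha> \<gamma> (exp t) \<le> curve_laplace \<alpha> \<gamma> (exp s)"
        unfolding rep using l(2) \<open>s \<le> t\<close> by (intro nn_integral_mono ennreal_leI mult_right_mono) (auto simp: F_def)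
      thus "enn2real (curve_laplace \<alpha> \<gamma> (exp t)) \<le> enn2real (curve_laplace \<alpha> \<gamma> (exp s))"
        using curve_laplace_finite[OF \<alpha> \<gamma>(1), of "exp s"] by (intro enn2real_mono) auto
    qed
    show "tp2 (\<lambda>t. enn2real (curve_laplace \<alpha> \<gamma> (exp t)))"
      unfolding tp2_def
    proof (intro allI impI)
      fix x y h :: real assume "0 \<le> h" "x + h \<le> y"
      from tp2_convolution[OF _ _ _ l(2) F l(1) this, folded rep]
      have "curve_laplace \<alpha> \<gamma> (exp x) * curve_laplace \<alpha> \<gamma> (exp y)
         \<le> curve_laplace \<alpha> \<gamma> (exp (x + h)) * curve_laplace \<alpha> \<gamma> (exp (y - h))"
        by (simp add: F_def)
      thus "enn2real (curve_laplace \<alpha> \<gamma> (exp x)) * enn2real (curve_laplace \<alpha> \<gamma> (exp y))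
         \<le> enn2real (curve_laplace \<alpha> \<gamma> (exp (x + h))) * enn2real (curve_laplace \<alpha> \<gamma> (exp (y - h)))"
        unfolding enn2real_mult[symmetric] using curve_laplace_finite[OF \<alpha> \<gamma>(1)]
        by (intro enn2real_mono) (auto simp: ennreal_mult_less_top)
    qed
  qed
qed

lemma wright_density_log_concave:
  assumes \<alpha>: "0 < \<alpha>" "\<alpha> < 1" and \<gamma>: "\<bar>\<gamma>\<bar> < 1" "- \<alpha> \<le> \<gamma>" "\<gamma> \<le> 1 - \<alpha>"
  shows "log_concave (\<lambda>t. wright_density \<alpha> \<gamma> (exp t))"
proof -
  define L where "L t = enn2real (curve_laplace \<alpha> \<gamma> (exp t))" for t
  define K where "K = (1 + \<gamma>) / (1 - \<alpha>)"
  have conc: "concave_on UNIV (\<lambda>t. ln (L t))" unfolding L_def by (rule curve_laplace_log_concave[OF assms])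
  have L: "0 < L t" for t unfolding L_def by (rule enn2real_curve_laplace_pos[OF \<alpha> \<gamma>(1)]) simp
  have pos: "0 < wright_density \<alpha> \<gamma> (exp t)" for t by (rule wright_density_pos[OF \<alpha> \<gamma>(1)]) simp
  have e: "ln (wright_density \<alpha> \<gamma> (exp t)) = K * t - ln (pi * (1 - \<alpha>)) + ln (L (t / (1 - \<alpha>)))" for t
  proof -
    have "wright_density \<alpha> \<gamma> (exp t) = exp (K * t) / (pi * (1 - \<alpha>)) * L (t / (1 - \<alpha>))"
      unfolding wright_density_def L_def K_def by (simp add: powr_def)
    thus ?thesis using L[of "t / (1 - \<alpha>)"] \<alpha> by (simp add: ln_mult ln_div)
  qed
  have "concave_on UNIV (\<lambda>t. ln (wright_density \<alpha> \<gamma> (exp t)))"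
    unfolding e concave_on_def
  proof (rule convex_onI)
    fix u x y :: real assume u: "0 < u" "u < 1"
    have "(1 - u) * ln (L (x / (1 - \<alpha>))) + u * ln (L (y / (1 - \<alpha>))) \<le> ln (L ((1 - u) *\<^sub>R (x / (1 - \<alpha>)) + u *\<^sub>R (y / (1 - \<alpha>))))"
      using u by (intro concave_onD[OF conc]) auto
    also have "(1 - u) *\<^sub>R (x / (1 - \<alpha>)) + u *\<^sub>R (y / (1 - \<alpha>)) = ((1 - u) *\<^sub>R x + u *\<^sub>R y) / (1 - \<alpha>)"
      by (simp add: add_divide_distrib)
    finally show "- (K * ((1 - u) *\<^sub>R x + u *\<^sub>R y) - ln (pi * (1 - \<alpha>)) + ln (L (((1 - u) *\<^sub>R x + u *\<^sub>R y) / (1 - \<alpha>))))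
      \<le> (1 - u) * - (K * x - ln (pi * (1 - \<alpha>)) + ln (L (x / (1 - \<alpha>))))
        + u * - (K * y - ln (pi * (1 - \<alpha>)) + ln (L (y / (1 - \<alpha>))))"
      unfolding scaleR_conv_of_real of_real_eq_id id_apply by (simp add: algebra_simps)
  qed simp
  thus ?thesis using pos unfolding log_concave_def by (simp add: less_imp_le)
qed

section \<open>The Wright density near the origin\<close>

text \<open>On the curve, \<open>W = A powr \<gamma> * S\<close>, and \<open>S\<close> extends differentiably to \<open>\<theta> = pi\<close>, where \<open>A\<close> is infinite.\<close>

definition Sfun :: "real \<Rightarrow> real \<Rightarrow> real \<Rightarrow> real" where
  "Sfun \<alpha> \<gamma> \<theta> = exp (- \<gamma> * lnR \<alpha> \<theta>) * sinq \<gamma> \<theta>"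

lemma Wfun_eq_Sfun: "Wfun \<alpha> \<gamma> \<theta> = exp (\<gamma> * lnA \<alpha> \<theta>) * Sfun \<alpha> \<gamma> \<theta>"
  unfolding Wfun_def Sfun_def lnA_def by (simp add: exp_add[symmetric] algebra_simps)

lemma measurable_Sfun [measurable]: "Sfun \<alpha> \<gamma> \<in> borel_measurable borel"
  unfolding Sfun_def[abs_def] lnR_def[abs_def] sinq_def[abs_def] by measurable

context
  fixes \<alpha> \<gamma> :: real
  assumes \<alpha>: "0 < \<alpha>" "\<alpha> < 1" and \<gamma>: "1 - \<alpha> < \<gamma>" "\<gamma> < 1"
begin

definition "S_at_pi = sinq \<gamma> pi"
text \<open>The coefficient of \<open>eta\<close> = A^(\<alpha> - 1) in the first-order expansion of
  S at \<theta> = pi; see \<open>Sfun_near_pi\<close>.\<close>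

definition "S_slope = - sin ((\<gamma> + \<alpha>) * pi)"
definition "eta \<theta> = exp (- ((1 - \<alpha>) * lnA \<alpha> \<theta>))"

lemma gamma_bounds: "0 < \<gamma>" "\<bar>\<gamma>\<bar> < 1" using \<alpha> \<gamma> by auto

lemma S_at_pi_pos: "0 < S_at_pi"
  unfolding S_at_pi_def sinq_def using gamma_bounds by (auto intro!: divide_pos_pos sin_gt_zero)

text \<open>\<gamma> + \<alpha> lies strictly between 1 and 2, where the sine of its multiple by pi
  is negative. This is the place where \<gamma> > 1 - \<alpha> decides from which side S approaches
  its limit.\<close>

lemma S_slope_pos: "0 < S_slope"
proof -
  have "0 < sin ((\<gamma> + \<alpha> - 1) * pi)"
  proof (rule sin_gt_zero)
    have "(\<gamma> + \<alpha> - 1) * pi < 1 * pi" using \<alpha> \<gamma> by (intro mult_strict_right_mono) auto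
    thus "(\<gamma> + \<alpha> - 1) * pi < pi" by simp
  qed (use \<gamma> in simp)
  also have "(\<gamma> + \<alpha> - 1) * pi = (\<gamma> + \<alpha>) * pi - pi" by (simp add: algebra_simps)
  finally show ?thesis unfolding S_slope_def by simp
qed

lemma sin_at_pi: "0 < sin (\<alpha> * pi)" "sin ((1 - \<alpha>) * pi) = sin (\<alpha> * pi)" "cos ((1 - \<alpha>) * pi) = - cos (\<alpha> * pi)"
  using \<alpha> by (auto intro!: sin_gt_zero simp: left_diff_distrib)

lemma Sfun_nonneg: "0 < \<theta> \<Longrightarrow> \<theta> < pi \<Longrightarrow> 0 \<le> Sfun \<alpha> \<gamma> \<theta>"
  unfolding Sfun_def using sinq_pos[OF gamma_bounds(2), of \<theta>] by simp

lemma Sfun_bounded: "\<exists>B. 0 < B \<and> (\<forall>\<theta>. 0 < \<theta> \<longrightarrow> \<theta> < pi \<longrightarrow> Sfun \<alpha> \<gamma> \<theta> \<le> B)"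
proof -
  \<comment> \<open>A lower bound for R: sin ((1 - \<alpha>) \<theta>) \<ge> \<theta> sin (\<alpha>
    pi) / pi because u / sin u increases, and sin (\<alpha> \<theta>) \<le> \<alpha>
    \<theta>.\<close>
  define r where "r = sin (\<alpha> * pi) / (\<alpha> * pi)"
  have r: "0 < r" unfolding r_def using sin_at_pi \<alpha> by simp
  have "Sfun \<alpha> \<gamma> \<theta> \<le> exp (- \<gamma> * ln r) * pi" if \<theta>: "0 < \<theta>" "\<theta> < pi" for \<theta>
  proof -
    note s = sin_pos3[OF \<alpha> \<theta>]
    have "(1 - \<alpha>) * \<theta> / sin ((1 - \<alpha>) * \<theta>) \<le> (1 - \<alpha>) * pi / sin ((1 - \<alpha>) * pi)"
      using \<alpha> \<theta> by (intro mult_csc_mono mult_left_mono) auto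
    hence "(1 - \<alpha>) * (\<theta> / sin ((1 - \<alpha>) * \<theta>)) \<le> (1 - \<alpha>) * (pi / sin (\<alpha> * pi))" unfolding sin_at_pi by simp
    hence 1: "\<theta> / sin ((1 - \<alpha>) * \<theta>) \<le> pi / sin (\<alpha> * pi)" using \<alpha> by (simp only: mult_le_cancel_left_pos)
    hence 2: "\<theta> * sin (\<alpha> * pi) \<le> pi * sin ((1 - \<alpha>) * \<theta>)" using s sin_at_pi by (simp add: field_simps)
    have "r \<le> sin ((1 - \<alpha>) * \<theta>) / sin (\<alpha> * \<theta>)"
    proof -
      have "r = \<theta> * sin (\<alpha> * pi) / (pi * (\<alpha> * \<theta>))" unfolding r_def using \<theta> \<alpha> by simp
      also have "\<dots> \<le> pi * sin ((1 - \<alpha>) * \<theta>) / (pi * (\<alpha> * \<theta>))" using 2 \<theta> \<alpha> by (intro divide_right_mono) auto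
      also have "\<dots> = sin ((1 - \<alpha>) * \<theta>) / (\<alpha> * \<theta>)" by simp
      also have "\<dots> \<le> sin ((1 - \<alpha>) * \<theta>) / sin (\<alpha> * \<theta>)"
        using s sin_x_le_x[of "\<alpha> * \<theta>"] \<theta> \<alpha> by (intro divide_left_mono) auto
      finally show ?thesis .
    qed
    hence "ln r \<le> ln (sin ((1 - \<alpha>) * \<theta>) / sin (\<alpha> * \<theta>))" using r s by (simp only: ln_le_cancel_iff divide_pos_pos)
    hence "ln r \<le> lnR \<alpha> \<theta>" unfolding lnR_def using s by (simp add: ln_div)
    hence "exp (- \<gamma> * lnR \<alpha> \<theta>) \<le> exp (- \<gamma> * ln r)" using gamma_bounds by simp
    moreover have "sinq \<gamma> \<theta> \<le> pi"
    proof -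
      have "sin (\<gamma> * \<theta>) \<le> \<gamma> * \<theta>" using gamma_bounds \<theta> by (intro sin_x_le_x) auto
      hence "sinq \<gamma> \<theta> \<le> \<theta>" unfolding sinq_def using gamma_bounds by (simp add: field_simps)
      thus ?thesis using \<theta> by simp
    qed
    ultimately show ?thesis unfolding Sfun_def using sinq_pos[OF gamma_bounds(2) \<theta>] by (intro mult_mono) auto
  qed
  thus ?thesis by (intro exI[of _ "exp (- \<gamma> * ln r) * pi"]) auto
qed

lemma eta_eq:
  assumes "0 < \<theta>" "\<theta> < pi"
  shows "eta \<theta> = sin \<theta> * exp (- (\<alpha> * ln (sin (\<alpha> * \<theta>)) + (1 - \<alpha>) * ln (sin ((1 - \<alpha>) * \<theta>))))"
proof -
  have "(1 - \<alpha>) * lnA \<alpha> \<theta> = \<alpha> * ln (sin (\<alpha> * \<theta>)) + (1 - \<alpha>) * ln (sin ((1 - \<alpha>) * \<theta>)) - ln (sin \<theta>)"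
    unfolding lnA_def lnrho_def lnR_def using \<alpha> by (simp add: distrib_left) (simp add: algebra_simps)
  hence "eta \<theta> = exp (ln (sin \<theta>) + - (\<alpha> * ln (sin (\<alpha> * \<theta>)) + (1 - \<alpha>) * ln (sin ((1 - \<alpha>) * \<theta>))))"
    unfolding eta_def by simp
  thus ?thesis unfolding exp_add using sin_pos3[OF \<alpha> assms] by simp
qed

text \<open>S - S(pi) and \<open>eta\<close> both vanish to first order at pi, \<open>eta\<close>
  through its factor sin \<theta>, so the limit is the quotient of their derivatives.\<close>

lemma Sfun_near_pi:
  "((\<lambda>\<theta>. (Sfun \<alpha> \<gamma> \<theta> - S_at_pi) / eta \<theta>) \<longlongrightarrow> S_slope) (at_left pi)"
proof -
  define q where "q \<theta> = exp (- (\<alpha> * ln (sin (\<alpha> * \<theta>)) + (1 - \<alpha>) * ln (sin ((1 - \<alpha>) * \<theta>))))" for \<theta>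
  have dR: "(lnR \<alpha> has_real_derivative - (cos (\<alpha> * pi) / sin (\<alpha> * pi))) (at pi)"
    unfolding lnR_def using sin_at_pi \<alpha>
    by (auto intro!: derivative_eq_intros simp: field_simps)
  have R0: "lnR \<alpha> pi = 0" unfolding lnR_def using sin_at_pi by simp
  have dS: "(Sfun \<alpha> \<gamma> has_real_derivative - S_slope / sin (\<alpha> * pi)) (at pi)"
  proof -
    have "(Sfun \<alpha> \<gamma> has_real_derivative \<gamma> * (cos (\<alpha> * pi) / sin (\<alpha> * pi)) * sinq \<gamma> pi + cos (\<gamma> * pi)) (at pi)"
      unfolding Sfun_def by (rule derivative_eq_intros dR sinq_deriv refl)+ (simp add: R0)
    moreover have "\<gamma> * (cos (\<alpha> * pi) / sin (\<alpha> * pi)) * sinq \<gamma> pi + cos (\<gamma> * pi) = - S_slope / sin (\<alpha> * pi)"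
    proof -
      have "\<gamma> * (cos (\<alpha> * pi) / sin (\<alpha> * pi)) * sinq \<gamma> pi = (cos (\<alpha> * pi) / sin (\<alpha> * pi)) * sin (\<gamma> * pi)"
        unfolding mult_sinq[symmetric] by simp
      thus ?thesis unfolding S_slope_def using sin_at_pi(1) by (simp add: distrib_right sin_add field_simps)
    qed
    ultimately show ?thesis by simp
  qed
  have S0: "Sfun \<alpha> \<gamma> pi = S_at_pi" unfolding Sfun_def S_at_pi_def R0 by simp
  have q: "q pi = 1 / sin (\<alpha> * pi)"
    unfolding q_def sin_at_pi using sin_at_pi(1) by (simp add: exp_minus distrib_right[symmetric] inverse_eq_divide)
  have cq: "isCont q pi" unfolding q_def using sin_at_pi by (intro continuous_intros) auto
  have 1: "((\<lambda>\<theta>. (Sfun \<alpha> \<gamma> \<theta> - S_at_pi) / (\<theta> - pi)) \<longlongrightarrow> - S_slope / sin (\<alpha> * pi)) (at_left pi)"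
    using dS unfolding has_field_derivative_iff S0 by (auto intro: filterlim_mono[OF _ order_refl at_le])
  have "(sin has_real_derivative cos pi) (at pi)" by (rule DERIV_sin)
  hence 2: "((\<lambda>\<theta>. sin \<theta> / (\<theta> - pi)) \<longlongrightarrow> - 1) (at_left pi)"
    unfolding has_field_derivative_iff by (auto intro: filterlim_mono[OF _ order_refl at_le])
  have 3: "(q \<longlongrightarrow> q pi) (at_left pi)" using cq unfolding isCont_def by (auto intro: filterlim_mono[OF _ order_refl at_le])
  have "((\<lambda>\<theta>. ((Sfun \<alpha> \<gamma> \<theta> - S_at_pi) / (\<theta> - pi)) / ((sin \<theta> / (\<theta> - pi)) * q \<theta>)) \<longlongrightarrow> (- S_slope / sin (\<alpha> * pi)) / (- 1 * q pi)) (at_left pi)"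
    using sin_at_pi by (intro tendsto_intros 1 2 3) (auto simp: q)
  also have "(- S_slope / sin (\<alpha> * pi)) / (- 1 * q pi) = S_slope" unfolding q using sin_at_pi(1) by simp
  finally show ?thesis
  proof (rule Lim_transform_eventually)
    show "\<forall>\<^sub>F \<theta> in at_left pi. ((Sfun \<alpha> \<gamma> \<theta> - S_at_pi) / (\<theta> - pi)) / ((sin \<theta> / (\<theta> - pi)) * q \<theta>) = (Sfun \<alpha> \<gamma> \<theta> - S_at_pi) / eta \<theta>"
      using eventually_at_left_real[OF pi_gt_zero]
    proof eventually_elim
      case (elim \<theta>)
      thus ?case unfolding eta_eq[of \<theta>, folded q_def] by (subst eta_eq) (auto simp: q_def)
    qed
  qed
qed

section \<open>Gamma integrals truncated to the range of A\<close>

lemma lnA_unbounded: "\<exists>t. s < t \<and> t < pi \<and> v < lnA \<alpha> t" if "s < pi" for s v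
proof -
  define q where "q \<theta> = exp (- (\<alpha> * ln (sin (\<alpha> * \<theta>)) + (1 - \<alpha>) * ln (sin ((1 - \<alpha>) * \<theta>))))" for \<theta>
  have "((\<lambda>\<theta>. sin \<theta> * q \<theta>) \<longlongrightarrow> sin pi * q pi) (at_left pi)"
    unfolding q_def using sin_at_pi by (intro tendsto_intros tendsto_ident_at) auto
  hence "\<forall>\<^sub>F \<theta> in at_left pi. sin \<theta> * q \<theta> < exp (- ((1 - \<alpha>) * v))" by (rule order_tendstoD) simp
  moreover have "\<forall>\<^sub>F \<theta> in at_left pi. \<theta> \<in> {max s 0<..<pi}" using that by (intro eventually_at_left_real) simp
  ultimately have "\<forall>\<^sub>F \<theta> in at_left pi. s < \<theta> \<and> \<theta> < pi \<and> v < lnA \<alpha> \<theta>"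
  proof eventually_elim
    case (elim \<theta>)
    hence "eta \<theta> < exp (- ((1 - \<alpha>) * v))" using eta_eq[of \<theta>] by (simp add: q_def)
    thus ?case using elim \<alpha> by (simp add: eta_def)
  qed
  thus ?thesis by (intro eventually_happens'[of "at_left pi"]) auto
qed

lemma lnA_image_contains: "0 < s \<Longrightarrow> s < pi \<Longrightarrow> lnA \<alpha> s < v \<Longrightarrow> v \<in> lnA \<alpha> ` {0<..<pi}"
proof -
  assume s: "0 < s" "s < pi" and v: "lnA \<alpha> s < v"
  obtain t where t: "s < t" "t < pi" "v < lnA \<alpha> t" using lnA_unbounded[OF s(2)] by blast
  have "\<exists>x\<ge>s. x \<le> t \<and> lnA \<alpha> x = v"
    using s t v by (intro IVT) (auto intro: DERIV_isCont[OF lnA_deriv[OF \<alpha>]])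
  thus ?thesis using s t by auto
qed

text \<open>What a term A^(-p) in S contributes to pi times the density. Substituting u = y A gives
  y^p times the integral of Gamma (1 + \<gamma> - p), truncated to the range of y A.\<close>

definition curve_Gamma :: "real \<Rightarrow> real \<Rightarrow> ennreal" where
  "curve_Gamma p y = (\<integral>\<^sup>+\<theta>. ennreal (indicator {0<..<pi} \<theta> * (Dfun \<alpha> \<theta> / (1 - \<alpha>) * (y powr (1 + \<gamma>) * exp ((1 + \<gamma> - p) * lnA \<alpha> \<theta> - y * exp (lnA \<alpha> \<theta>))))) \<partial>lborel)"

lemma curve_Gamma_eq:
  assumes y: "0 < y"
  defines "T \<equiv> (\<lambda>\<theta>. y * exp (lnA \<alpha> \<theta>)) ` {0<..<pi}"
  shows "T \<in> sets borel" "curve_Gamma p y = ennreal (y powr p) * (\<integral>\<^sup>+u. ennreal (indicator T u * (u powr (\<gamma> - p) * exp (- u))) \<partial>lborel)"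
proof -
  define G where "G \<theta> = y * exp (lnA \<alpha> \<theta>)" for \<theta>
  have cont: "continuous_on {0<..<pi} G"
    unfolding G_def using DERIV_isCont[OF lnA_deriv[OF \<alpha>]] by (intro continuous_intros continuous_at_imp_continuous_on) auto
  have inj: "inj_on G {0<..<pi}"
    using lnA_inj[OF \<alpha>] y by (auto simp: inj_on_def G_def)
  have "open T" unfolding T_def G_def[symmetric] by (rule invariance_of_domain[OF cont open_greaterThanLessThan inj])
  thus Tb: "T \<in> sets borel" by simp
  have Tb': "G ` {0<..<pi} \<in> sets borel" using Tb unfolding T_def G_def .
  define f where "f u = indicator {0<..} u * (u powr (\<gamma> - p) * exp (- u))" for u :: real
  have [measurable]: "f \<in> borel_measurable borel" unfolding f_def[abs_def] by measurable
  have "curve_Gamma p y = (\<integral>\<^sup>+\<theta>. ennreal (y powr p) * ennreal (indicator {0<..<pi} \<theta> * (y * (exp (lnA \<alpha> \<theta>) * (Dfun \<alpha> \<theta> / (1 - \<alpha>))) * f (G \<theta>))) \<partial>lborel)"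
    unfolding curve_Gamma_def
  proof (intro nn_integral_cong)
    fix \<theta> :: real
    have "y powr (1 + \<gamma>) * exp ((1 + \<gamma> - p) * lnA \<alpha> \<theta> - y * exp (lnA \<alpha> \<theta>)) = y powr p * (y * (exp (lnA \<alpha> \<theta>) * f (G \<theta>)))"
    proof -
      have e: "exp ((1 + \<gamma> - p) * lnA \<alpha> \<theta>) = exp (lnA \<alpha> \<theta>) * exp (lnA \<alpha> \<theta>) powr (\<gamma> - p)"
        by (simp add: powr_def exp_add[symmetric] algebra_simps)
      have Z: "y powr p * y * y powr (\<gamma> - p) = y powr (1 + \<gamma>)"
      proof -
        have "y powr p * y powr 1 * y powr (\<gamma> - p) = y powr (p + 1 + (\<gamma> - p))" by (simp only: powr_add)
        thus ?thesis using y by simp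
      qed
      have fG: "f (G \<theta>) = y powr (\<gamma> - p) * exp (lnA \<alpha> \<theta>) powr (\<gamma> - p) * exp (- (y * exp (lnA \<alpha> \<theta>)))"
        using y by (simp add: f_def G_def powr_mult)
      have e2: "exp ((1 + \<gamma> - p) * lnA \<alpha> \<theta> - y * exp (lnA \<alpha> \<theta>)) = exp ((1 + \<gamma> - p) * lnA \<alpha> \<theta>) * exp (- (y * exp (lnA \<alpha> \<theta>)))"
        by (simp add: exp_add[symmetric])
      show ?thesis unfolding fG e2 e Z[symmetric] by (simp only: mult_ac)
    qed
    thus "ennreal (indicator {0<..<pi} \<theta> * (Dfun \<alpha> \<theta> / (1 - \<alpha>) * (y powr (1 + \<gamma>) * exp ((1 + \<gamma> - p) * lnA \<alpha> \<theta> - y * exp (lnA \<alpha> \<theta>)))))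
      = ennreal (y powr p) * ennreal (indicator {0<..<pi} \<theta> * (y * (exp (lnA \<alpha> \<theta>) * (Dfun \<alpha> \<theta> / (1 - \<alpha>))) * f (G \<theta>)))"
      by (subst ennreal_mult'[symmetric]) (auto simp: mult_ac)
  qed
  also have "\<dots> = ennreal (y powr p) * (\<integral>\<^sup>+\<theta>. ennreal (indicator {0<..<pi} \<theta> * (y * (exp (lnA \<alpha> \<theta>) * (Dfun \<alpha> \<theta> / (1 - \<alpha>))) * f (G \<theta>))) \<partial>lborel)"
    unfolding G_def by (intro nn_integral_cmult) measurable
  also have "(\<integral>\<^sup>+\<theta>. ennreal (indicator {0<..<pi} \<theta> * (y * (exp (lnA \<alpha> \<theta>) * (Dfun \<alpha> \<theta> / (1 - \<alpha>))) * f (G \<theta>))) \<partial>lborel)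
    = (\<integral>\<^sup>+u. ennreal (indicator (G ` {0<..<pi}) u * f u) \<partial>lborel)"
  proof (rule nn_integral_subst)
    show "(G has_real_derivative y * (exp (lnA \<alpha> x) * (Dfun \<alpha> x / (1 - \<alpha>)))) (at x)" if "x \<in> {0<..<pi}" for x
      unfolding G_def using that by (auto intro!: derivative_eq_intros lnA_deriv[OF \<alpha>])
    show "0 \<le> y * (exp (lnA \<alpha> x) * (Dfun \<alpha> x / (1 - \<alpha>)))" if "x \<in> {0<..<pi}" for x
      using that y Dfun_pos[OF \<alpha>, of x] \<alpha> by simp
    show "(\<lambda>x. indicator {0<..<pi} x * (y * (exp (lnA \<alpha> x) * (Dfun \<alpha> x / (1 - \<alpha>))) * f (G x))) \<in> borel_measurable borel"
      unfolding G_def by measurable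
  qed (use inj Tb' in \<open>auto simp: f_def\<close>)
  also have "\<dots> = (\<integral>\<^sup>+u. ennreal (indicator T u * (u powr (\<gamma> - p) * exp (- u))) \<partial>lborel)"
    unfolding T_def using y by (intro nn_integral_cong) (auto simp: f_def G_def indicator_def)
  finally show "curve_Gamma p y = ennreal (y powr p) * (\<integral>\<^sup>+u. ennreal (indicator T u * (u powr (\<gamma> - p) * exp (- u))) \<partial>lborel)" .
qed

lemma Gamma_nn_integral: "0 < z \<Longrightarrow> (\<integral>\<^sup>+u. ennreal (indicator {0<..} u * (u powr (z - 1) * exp (- u))) \<partial>lborel) = ennreal (Gamma z)"
proof -
  assume "0 < z"
  have "(\<integral>\<^sup>+u. ennreal (indicator {0<..} u * (u powr (z - 1) * exp (- u))) \<partial>lborel) = (\<integral>\<^sup>+u. ennreal (indicator {0..} u * u powr (z - 1) / exp u) \<partial>lborel)"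
    by (intro nn_integral_cong) (auto simp: indicator_def exp_minus field_simps)
  thus ?thesis using Gamma_conv_nn_integral_real[OF \<open>0 < z\<close>] by simp
qed

lemma curve_Gamma_upper:
  assumes "0 < y" "p < 1 + \<gamma>"
  shows "curve_Gamma p y \<le> ennreal (y powr p * Gamma (1 + \<gamma> - p))"
proof -
  define T where "T = (\<lambda>\<theta>. y * exp (lnA \<alpha> \<theta>)) ` {0<..<pi}"
  have "(\<integral>\<^sup>+u. ennreal (indicator T u * (u powr (\<gamma> - p) * exp (- u))) \<partial>lborel)
    \<le> (\<integral>\<^sup>+u. ennreal (indicator {0<..} u * (u powr ((1 + \<gamma> - p) - 1) * exp (- u))) \<partial>lborel)"
    using assms by (intro nn_integral_mono ennreal_leI) (auto simp: T_def indicator_def)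
  also have "\<dots> = ennreal (Gamma (1 + \<gamma> - p))" using assms by (intro Gamma_nn_integral) simp
  finally show ?thesis unfolding curve_Gamma_eq(2)[OF assms(1), folded T_def] using assms
    by (subst ennreal_mult') (auto intro!: mult_left_mono)
qed

text \<open>The range of y A contains everything above a = y A(s), and the missing part of the Gamma
  integral is at most a times a^\<gamma>.\<close>

lemma curve_Gamma_lower_0:
  assumes "0 < y" "0 < s" "s < pi"
  shows "ennreal (Gamma (1 + \<gamma>)) \<le> curve_Gamma 0 y + ennreal ((y * exp (lnA \<alpha> s)) powr (1 + \<gamma>))"
proof -
  define T a where "T = (\<lambda>\<theta>. y * exp (lnA \<alpha> \<theta>)) ` {0<..<pi}" and "a = y * exp (lnA \<alpha> s)"
  have a: "0 < a" unfolding a_def using assms by simp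
  have TB[measurable]: "T \<in> sets borel" using curve_Gamma_eq(1)[OF assms(1)] unfolding T_def .
  have T: "u \<in> T" if "a < u" for u
  proof -
    have "y * exp (lnA \<alpha> s) < u" using that a_def by simp
    hence "exp (lnA \<alpha> s) < u / y" using assms by (simp add: field_simps)
    hence "ln (exp (lnA \<alpha> s)) < ln (u / y)" using that a assms by (subst ln_less_cancel_iff) auto
    hence "lnA \<alpha> s < ln (u / y)" by simp
    then obtain \<theta> where "\<theta> \<in> {0<..<pi}" "lnA \<alpha> \<theta> = ln (u / y)" using lnA_image_contains[OF assms(2,3)] by (metis imageE)
    hence "u = y * exp (lnA \<alpha> \<theta>)" using assms that a by simp
    thus ?thesis unfolding T_def using \<open>\<theta> \<in> _\<close> by blast
  qed
  have "ennreal (Gamma (1 + \<gamma>)) = (\<integral>\<^sup>+u. ennreal (indicator {0<..} u * (u powr \<gamma> * exp (- u))) \<partial>lborel)"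
    using Gamma_nn_integral[of "1 + \<gamma>"] gamma_bounds by simp
  also have "\<dots> \<le> (\<integral>\<^sup>+u. ennreal (indicator T u * (u powr \<gamma> * exp (- u))) + ennreal (a powr \<gamma>) * indicator {0..a} u \<partial>lborel)"
  proof (intro nn_integral_mono)
    fix u :: real
    show "ennreal (indicator {0<..} u * (u powr \<gamma> * exp (- u))) \<le> ennreal (indicator T u * (u powr \<gamma> * exp (- u))) + ennreal (a powr \<gamma>) * indicator {0..a} u"
    proof (cases "0 < u \<and> u \<le> a")
      case True
      have "u powr \<gamma> * exp (- u) \<le> a powr \<gamma> * 1" using True gamma_bounds by (intro mult_mono powr_mono2) auto
      hence "ennreal (u powr \<gamma> * exp (- u)) \<le> ennreal (a powr \<gamma>)" by (intro ennreal_leI) simp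
      thus ?thesis using True by (simp add: add_increasing)
    next
      case False thus ?thesis using T[of u] by (auto simp: indicator_def)
    qed
  qed
  also have "\<dots> = (\<integral>\<^sup>+u. ennreal (indicator T u * (u powr \<gamma> * exp (- u))) \<partial>lborel) + ennreal (a powr \<gamma>) * ennreal a"
    using a by (subst nn_integral_add) (auto simp: nn_integral_cmult_indicator)
  also have "ennreal (a powr \<gamma>) * ennreal a = ennreal (a powr (1 + \<gamma>))"
    using a by (simp add: ennreal_mult[symmetric] powr_add mult.commute)
  finally show ?thesis using curve_Gamma_eq(2)[OF assms(1), of 0, folded T_def] assms(1) by (simp add: a_def)
qed

text \<open>On (1, 2] the integrand is at least exp (-2), because \<gamma> - (1 - \<alpha>) > 0
  makes the power of u at least 1. Any positive constant would do.\<close>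

lemma curve_Gamma_lower_c:
  assumes "0 < y" "0 < s" "s < pi" "y * exp (lnA \<alpha> s) \<le> 1"
  shows "ennreal (y powr (1 - \<alpha>) * exp (- 2)) \<le> curve_Gamma (1 - \<alpha>) y"
proof -
  define T where "T = (\<lambda>\<theta>. y * exp (lnA \<alpha> \<theta>)) ` {0<..<pi}"
  have T: "u \<in> T" if "1 < u" for u
  proof -
    have "y * exp (lnA \<alpha> s) < u" using that assms by simp
    hence "exp (lnA \<alpha> s) < u / y" using assms by (simp add: field_simps)
    hence "ln (exp (lnA \<alpha> s)) < ln (u / y)" using that assms by (subst ln_less_cancel_iff) auto
    hence "lnA \<alpha> s < ln (u / y)" by simp
    then obtain \<theta> where "\<theta> \<in> {0<..<pi}" "lnA \<alpha> \<theta> = ln (u / y)" using lnA_image_contains[OF assms(2,3)] by (metis imageE)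
    hence "u = y * exp (lnA \<alpha> \<theta>)" using assms that by simp
    thus ?thesis unfolding T_def using \<open>\<theta> \<in> _\<close> by blast
  qed
  have "ennreal (exp (- 2)) = (\<integral>\<^sup>+u. ennreal (exp (- 2)) * indicator {1<..2::real} u \<partial>lborel)"
    by (simp add: nn_integral_cmult_indicator)
  also have "\<dots> \<le> (\<integral>\<^sup>+u. ennreal (indicator T u * (u powr (\<gamma> - (1 - \<alpha>)) * exp (- u))) \<partial>lborel)"
  proof (intro nn_integral_mono)
    fix u :: real
    show "ennreal (exp (- 2)) * indicator {1<..2::real} u \<le> ennreal (indicator T u * (u powr (\<gamma> - (1 - \<alpha>)) * exp (- u)))"
    proof (cases "u \<in> {1<..2}")
      case True
      have "1 * exp (- 2) \<le> u powr (\<gamma> - (1 - \<alpha>)) * exp (- u)"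
        using True \<gamma> by (intro mult_mono ge_one_powr_ge_zero) auto
      thus ?thesis using True T[of u] by (auto intro: ennreal_leI)
    qed simp
  qed
  finally show ?thesis unfolding curve_Gamma_eq(2)[OF assms(1), folded T_def]
    by (subst ennreal_mult') (auto intro!: mult_left_mono)
qed

text \<open>Near pi both bounds come from the limit \<open>S_slope\<close>. On the rest of the curve
  A is bounded above, so a large multiple of A^(\<alpha> - 1) or of A^(-1) dominates everything. The
  error in the lower bound has order A^(-1) because this integrates to order y, which is small
  against x = y^(1 - \<alpha>).\<close>

lemma Sfun_bounds:
  "\<exists>s \<kappa> M. 0 < s \<and> s < pi \<and> 0 < \<kappa> \<and> 0 < M \<and>
    (\<forall>\<theta>. 0 < \<theta> \<longrightarrow> \<theta> < pi \<longrightarrow> Sfun \<alpha> \<gamma> \<theta> \<le> S_at_pi + M * exp (- ((1 - \<alpha>) * lnA \<alpha> \<theta>)) \<and>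
      S_at_pi + \<kappa> * exp (- ((1 - \<alpha>) * lnA \<alpha> \<theta>)) \<le> Sfun \<alpha> \<gamma> \<theta> + M * exp (- lnA \<alpha> \<theta>))"
proof -
  have "\<forall>\<^sub>F \<theta> in at_left pi. S_slope / 2 < (Sfun \<alpha> \<gamma> \<theta> - S_at_pi) / eta \<theta>"
    using S_slope_pos by (intro order_tendstoD(1)[OF Sfun_near_pi]) simp
  moreover have "\<forall>\<^sub>F \<theta> in at_left pi. (Sfun \<alpha> \<gamma> \<theta> - S_at_pi) / eta \<theta> < 2 * S_slope"
    using S_slope_pos by (intro order_tendstoD(2)[OF Sfun_near_pi]) simp
  moreover have "\<forall>\<^sub>F \<theta> in at_left pi. \<theta> \<in> {0<..<pi}" by (rule eventually_at_left_real) simp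
  ultimately have "\<forall>\<^sub>F \<theta> in at_left pi. \<theta> \<in> {0<..<pi} \<and> S_slope / 2 < (Sfun \<alpha> \<gamma> \<theta> - S_at_pi) / eta \<theta> \<and> (Sfun \<alpha> \<gamma> \<theta> - S_at_pi) / eta \<theta> < 2 * S_slope"
    by eventually_elim auto
  then obtain s0 where s0: "s0 < pi" "\<And>\<theta>. s0 < \<theta> \<Longrightarrow> \<theta> < pi \<Longrightarrow>
     \<theta> \<in> {0<..<pi} \<and> S_slope / 2 < (Sfun \<alpha> \<gamma> \<theta> - S_at_pi) / eta \<theta> \<and> (Sfun \<alpha> \<gamma> \<theta> - S_at_pi) / eta \<theta> < 2 * S_slope"
    unfolding eventually_at_left_field by blast
  define s where "s = max ((s0 + pi) / 2) (pi / 2)"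
  have s: "0 < s" "s < pi" "s0 < s" unfolding s_def using s0(1) by (auto simp: max_def)
  obtain B where B: "0 < B" "\<And>\<theta>. 0 < \<theta> \<Longrightarrow> \<theta> < pi \<Longrightarrow> Sfun \<alpha> \<gamma> \<theta> \<le> B" using Sfun_bounded by blast
  define a where "a = lnA \<alpha> s"
  define \<kappa> where "\<kappa> = S_slope / 2"
  define M where "M = (2 * S_slope + B * exp ((1 - \<alpha>) * a)) + (S_at_pi * exp a + \<kappa> * exp (\<alpha> * a))"
  have \<kappa>: "0 < \<kappa>" unfolding \<kappa>_def using S_slope_pos by simp
  have M1: "2 * S_slope \<le> M" "B * exp ((1 - \<alpha>) * a) \<le> M" "S_at_pi * exp a + \<kappa> * exp (\<alpha> * a) \<le> M" "0 < M"
    unfolding M_def using S_slope_pos B S_at_pi_pos \<kappa> by (auto intro!: add_pos_pos add_increasing add_increasing2)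
  show ?thesis
  proof (rule exI[of _ s], rule exI[of _ \<kappa>], rule exI[of _ M], intro conjI allI impI)
    fix \<theta> assume \<theta>: "0 < \<theta>" "\<theta> < pi"
    have et: "exp (- ((1 - \<alpha>) * lnA \<alpha> \<theta>)) = eta \<theta>" "0 < eta \<theta>" by (auto simp: eta_def)
    have "Sfun \<alpha> \<gamma> \<theta> \<le> S_at_pi + M * eta \<theta> \<and> S_at_pi + \<kappa> * eta \<theta> \<le> Sfun \<alpha> \<gamma> \<theta> + M * exp (- lnA \<alpha> \<theta>)"
    proof (cases "s < \<theta>")
      case True
      hence b: "S_slope / 2 < (Sfun \<alpha> \<gamma> \<theta> - S_at_pi) / eta \<theta>" "(Sfun \<alpha> \<gamma> \<theta> - S_at_pi) / eta \<theta> < 2 * S_slope"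
        using s0(2)[of \<theta>] s \<theta> by auto
      have "2 * S_slope * eta \<theta> \<le> M * eta \<theta>" using M1 et by (intro mult_right_mono) auto
      moreover have "0 \<le> M * exp (- lnA \<alpha> \<theta>)" using M1 by simp
      moreover have "S_slope / 2 * eta \<theta> < Sfun \<alpha> \<gamma> \<theta> - S_at_pi" "Sfun \<alpha> \<gamma> \<theta> - S_at_pi < 2 * S_slope * eta \<theta>"
        using b et(2) by (simp_all only: pos_less_divide_eq pos_divide_less_eq)
      ultimately show ?thesis unfolding \<kappa>_def by linarith
    next
      case False
      have la: "lnA \<alpha> \<theta> \<le> a" using lnA_strict_mono[OF \<alpha> \<theta>(1), of s] False s unfolding a_def by (cases "\<theta> = s") auto
      have "Sfun \<alpha> \<gamma> \<theta> \<le> B" using B \<theta> by simp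
      also have "\<dots> = B * exp ((1 - \<alpha>) * a) * exp (- ((1 - \<alpha>) * a))" by (simp add: exp_minus)
      also have "\<dots> \<le> M * eta \<theta>"
        unfolding eta_def using M1 la \<alpha> B by (intro mult_mono) auto
      finally have 1: "Sfun \<alpha> \<gamma> \<theta> \<le> S_at_pi + M * eta \<theta>" using S_at_pi_pos by simp
      have "S_at_pi \<le> S_at_pi * exp a * exp (- lnA \<alpha> \<theta>)"
      proof -
        have "S_at_pi * 1 \<le> S_at_pi * exp (a - lnA \<alpha> \<theta>)" using la S_at_pi_pos by (intro mult_left_mono) auto
        thus ?thesis by (simp add: exp_diff exp_minus field_simps)
      qed
      moreover have "\<kappa> * eta \<theta> \<le> \<kappa> * exp (\<alpha> * a) * exp (- lnA \<alpha> \<theta>)"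
      proof -
        have "- ((1 - \<alpha>) * lnA \<alpha> \<theta>) \<le> \<alpha> * a + - lnA \<alpha> \<theta>"
          using mult_left_mono[OF la, of \<alpha>] \<alpha> by (simp add: algebra_simps)
        hence "eta \<theta> \<le> exp (\<alpha> * a + - lnA \<alpha> \<theta>)" unfolding eta_def by simp
        thus ?thesis using \<kappa> by (simp only: exp_add mult.assoc mult_le_cancel_left_pos)
      qed
      ultimately have "S_at_pi + \<kappa> * eta \<theta> \<le> (S_at_pi * exp a + \<kappa> * exp (\<alpha> * a)) * exp (- lnA \<alpha> \<theta>)" by (simp add: distrib_right)
      also have "\<dots> \<le> M * exp (- lnA \<alpha> \<theta>)" using M1 by (intro mult_right_mono) auto
      also have "\<dots> \<le> Sfun \<alpha> \<gamma> \<theta> + M * exp (- lnA \<alpha> \<theta>)" using Sfun_nonneg \<theta> by simp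
      finally show ?thesis using 1 by simp
    qed
    thus "Sfun \<alpha> \<gamma> \<theta> \<le> S_at_pi + M * exp (- ((1 - \<alpha>) * lnA \<alpha> \<theta>))"
      "S_at_pi + \<kappa> * exp (- ((1 - \<alpha>) * lnA \<alpha> \<theta>)) \<le> Sfun \<alpha> \<gamma> \<theta> + M * exp (- lnA \<alpha> \<theta>)" unfolding et by auto
  qed (use s \<kappa> M1 in auto)
qed

lemma wright_density_curve:
  assumes x: "0 < x"
  defines "y \<equiv> x powr (1 / (1 - \<alpha>))"
  shows "ennreal (pi * wright_density \<alpha> \<gamma> x) = (\<integral>\<^sup>+\<theta>. ennreal (indicator {0<..<pi} \<theta> *
    (Dfun \<alpha> \<theta> / (1 - \<alpha>) * (y powr (1 + \<gamma>) * exp ((1 + \<gamma>) * lnA \<alpha> \<theta> - y * exp (lnA \<alpha> \<theta>)))) * Sfun \<alpha> \<gamma> \<theta>) \<partial>lborel)"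
proof -
  define K where "K = y powr (1 + \<gamma>) / (1 - \<alpha>)"
  have y: "0 < y" unfolding y_def using x by simp
  have K: "0 \<le> K" unfolding K_def using \<alpha> by simp
  have "pi * wright_density \<alpha> \<gamma> x = K * enn2real (curve_laplace \<alpha> \<gamma> y)"
    unfolding wright_density_def K_def y_def using x by (simp add: powr_powr)
  hence "ennreal (pi * wright_density \<alpha> \<gamma> x) = ennreal K * curve_laplace \<alpha> \<gamma> y"
    using ennreal_curve_laplace[OF \<alpha> gamma_bounds(2) y] K by (simp add: ennreal_mult')
  also have "ennreal K * curve_laplace \<alpha> \<gamma> y = (\<integral>\<^sup>+\<theta>. ennreal K * ennreal (indicator {0<..<pi} \<theta> *
     (Dfun \<alpha> \<theta> * exp (lnA \<alpha> \<theta> - y * exp (lnA \<alpha> \<theta>)) * Wfun \<alpha> \<gamma> \<theta>)) \<partial>lborel)"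
    unfolding curve_laplace_def by (rule nn_integral_cmult[symmetric]) measurable
  also have "\<dots> = (\<integral>\<^sup>+\<theta>. ennreal (indicator {0<..<pi} \<theta> *
    (Dfun \<alpha> \<theta> / (1 - \<alpha>) * (y powr (1 + \<gamma>) * exp ((1 + \<gamma>) * lnA \<alpha> \<theta> - y * exp (lnA \<alpha> \<theta>)))) * Sfun \<alpha> \<gamma> \<theta>) \<partial>lborel)"
  proof (intro nn_integral_cong)
    fix \<theta> :: real
    have "exp ((1 + \<gamma>) * lnA \<alpha> \<theta> - y * exp (lnA \<alpha> \<theta>)) = exp (lnA \<alpha> \<theta> - y * exp (lnA \<alpha> \<theta>)) * exp (\<gamma> * lnA \<alpha> \<theta>)"
      unfolding exp_add[symmetric] by (simp add: algebra_simps)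
    thus "ennreal K * ennreal (indicator {0<..<pi} \<theta> * (Dfun \<alpha> \<theta> * exp (lnA \<alpha> \<theta> - y * exp (lnA \<alpha> \<theta>)) * Wfun \<alpha> \<gamma> \<theta>))
      = ennreal (indicator {0<..<pi} \<theta> *
    (Dfun \<alpha> \<theta> / (1 - \<alpha>) * (y powr (1 + \<gamma>) * exp ((1 + \<gamma>) * lnA \<alpha> \<theta> - y * exp (lnA \<alpha> \<theta>)))) * Sfun \<alpha> \<gamma> \<theta>)"
      by (subst ennreal_mult'[OF K, symmetric]) (simp only: Wfun_eq_Sfun K_def divide_inverse mult_ac)
  qed
  finally show ?thesis .
qed

text \<open>The bounds for S integrate term by term to \<open>curve_Gamma\<close> with p = 0, 1 -
  \<alpha> and 1. As y^(1 - \<alpha>) = x, the middle one is a linear term in x.\<close>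

lemma wright_density_sandwich:
  assumes x: "0 < x" and s: "0 < s" "s < pi"
    and S: "\<And>\<theta>. 0 < \<theta> \<Longrightarrow> \<theta> < pi \<Longrightarrow> Sfun \<alpha> \<gamma> \<theta> \<le> S_at_pi + M * exp (- ((1 - \<alpha>) * lnA \<alpha> \<theta>))"
      "\<And>\<theta>. 0 < \<theta> \<Longrightarrow> \<theta> < pi \<Longrightarrow> S_at_pi + \<kappa> * exp (- ((1 - \<alpha>) * lnA \<alpha> \<theta>)) \<le> Sfun \<alpha> \<gamma> \<theta> + M * exp (- lnA \<alpha> \<theta>)"
    and M: "0 < M" "0 < \<kappa>"
  defines "y \<equiv> x powr (1 / (1 - \<alpha>))"
  assumes y1: "y * exp (lnA \<alpha> s) \<le> 1"
  shows "pi * wright_density \<alpha> \<gamma> x \<le> S_at_pi * Gamma (1 + \<gamma>) + M * (x * Gamma (\<gamma> + \<alpha>))"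
    "S_at_pi * Gamma (1 + \<gamma>) + \<kappa> * (x * exp (- 2)) \<le> pi * wright_density \<alpha> \<gamma> x + M * (y * Gamma \<gamma>) + S_at_pi * (y * exp (lnA \<alpha> s)) powr (1 + \<gamma>)"
proof -
  have y: "0 < y" unfolding y_def using x by simp
  have yc: "y powr (1 - \<alpha>) = x" unfolding y_def using x \<alpha> by (simp add: powr_powr)
  define w where "w \<theta> = indicator {0<..<pi} \<theta> *
    (Dfun \<alpha> \<theta> / (1 - \<alpha>) * (y powr (1 + \<gamma>) * exp ((1 + \<gamma>) * lnA \<alpha> \<theta> - y * exp (lnA \<alpha> \<theta>))))" for \<theta>
  have [measurable]: "w \<in> borel_measurable borel" unfolding w_def[abs_def] by measurable
  have w0: "0 \<le> w \<theta>" for \<theta>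
    unfolding w_def using Dfun_pos[OF \<alpha>, of \<theta>] \<alpha> by (cases "\<theta> \<in> {0<..<pi}") auto
  have ww: "w \<theta> = 0" if "\<not> (0 < \<theta> \<and> \<theta> < pi)" for \<theta> using that by (auto simp: w_def)
  have I: "curve_Gamma p y = (\<integral>\<^sup>+\<theta>. ennreal (w \<theta> * exp (- (p * lnA \<alpha> \<theta>))) \<partial>lborel)" for p
    unfolding curve_Gamma_def
  proof (intro nn_integral_cong)
    fix \<theta> :: real
    have "exp ((1 + \<gamma> - p) * lnA \<alpha> \<theta> - y * exp (lnA \<alpha> \<theta>)) = exp ((1 + \<gamma>) * lnA \<alpha> \<theta> - y * exp (lnA \<alpha> \<theta>)) * exp (- (p * lnA \<alpha> \<theta>))"
      unfolding exp_add[symmetric] by (simp add: algebra_simps)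
    thus "ennreal (indicator {0<..<pi} \<theta> * (Dfun \<alpha> \<theta> / (1 - \<alpha>) * (y powr (1 + \<gamma>) * exp ((1 + \<gamma> - p) * lnA \<alpha> \<theta> - y * exp (lnA \<alpha> \<theta>)))))
      = ennreal (w \<theta> * exp (- (p * lnA \<alpha> \<theta>)))" unfolding w_def by (simp only: mult_ac)
  qed
  define i where "i p = enn2real (curve_Gamma p y)" for p
  have i: "curve_Gamma p y = ennreal (i p)" "0 \<le> i p" "i p \<le> y powr p * Gamma (1 + \<gamma> - p)" if "p < 1 + \<gamma>" for p
  proof -
    have "0 < Gamma (1 + \<gamma> - p)" using that by (intro Gamma_real_pos) simp
    hence G: "0 \<le> y powr p * Gamma (1 + \<gamma> - p)" by simp
    have u: "curve_Gamma p y \<le> ennreal (y powr p * Gamma (1 + \<gamma> - p))" by (rule curve_Gamma_upper[OF y that])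
    hence "curve_Gamma p y < top" by (rule le_less_trans) simp
    thus e: "curve_Gamma p y = ennreal (i p)" unfolding i_def by simp
    show "0 \<le> i p" unfolding i_def by simp
    show "i p \<le> y powr p * Gamma (1 + \<gamma> - p)" using u G unfolding e by (simp only: ennreal_le_iff)
  qed
  have c: "0 < 1 + \<gamma>" "1 - \<alpha> < 1 + \<gamma>" "1 < 1 + \<gamma>" using gamma_bounds \<alpha> by auto
  have k0: "0 \<le> pi * wright_density \<alpha> \<gamma> x" using wright_density_nonneg[OF \<alpha> gamma_bounds(2), of x] by simp
  have k: "ennreal (pi * wright_density \<alpha> \<gamma> x) = (\<integral>\<^sup>+\<theta>. ennreal (w \<theta> * Sfun \<alpha> \<gamma> \<theta>) \<partial>lborel)"
    using wright_density_curve[OF x] unfolding w_def y_def .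
  have lin: "(\<integral>\<^sup>+\<theta>. ennreal (a * (w \<theta> * exp (- (p * lnA \<alpha> \<theta>)))) \<partial>lborel) = ennreal (a * i p)" if "0 \<le> a" "p < 1 + \<gamma>" for a p
  proof -
    have "(\<integral>\<^sup>+\<theta>. ennreal (a * (w \<theta> * exp (- (p * lnA \<alpha> \<theta>)))) \<partial>lborel) = (\<integral>\<^sup>+\<theta>. ennreal a * ennreal (w \<theta> * exp (- (p * lnA \<alpha> \<theta>))) \<partial>lborel)"
      using that w0 by (simp add: ennreal_mult')
    also have "\<dots> = ennreal a * curve_Gamma p y" unfolding I by (rule nn_integral_cmult) measurable
    finally show ?thesis using i[OF that(2)] that(1) by (simp add: ennreal_mult')
  qed
  have "ennreal (pi * wright_density \<alpha> \<gamma> x) \<le> (\<integral>\<^sup>+\<theta>. ennreal (S_at_pi * (w \<theta> * exp (- (0 * lnA \<alpha> \<theta>)))) + ennreal (M * (w \<theta> * exp (- ((1 - \<alpha>) * lnA \<alpha> \<theta>)))) \<partial>lborel)"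
    unfolding k
  proof (intro nn_integral_mono)
    fix \<theta> :: real
    have "w \<theta> * Sfun \<alpha> \<gamma> \<theta> \<le> w \<theta> * (S_at_pi + M * exp (- ((1 - \<alpha>) * lnA \<alpha> \<theta>)))"
      using S(1)[of \<theta>] w0[of \<theta>] ww[of \<theta>] by (cases "0 < \<theta> \<and> \<theta> < pi") (auto intro: mult_left_mono)
    also have "\<dots> = S_at_pi * (w \<theta> * exp (- (0 * lnA \<alpha> \<theta>))) + M * (w \<theta> * exp (- ((1 - \<alpha>) * lnA \<alpha> \<theta>)))"
      by (simp add: distrib_left)
    finally have le: "w \<theta> * Sfun \<alpha> \<gamma> \<theta> \<le> S_at_pi * (w \<theta> * exp (- (0 * lnA \<alpha> \<theta>))) + M * (w \<theta> * exp (- ((1 - \<alpha>) * lnA \<alpha> \<theta>)))" .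
    have "0 \<le> S_at_pi * (w \<theta> * exp (- (0 * lnA \<alpha> \<theta>)))" "0 \<le> M * (w \<theta> * exp (- ((1 - \<alpha>) * lnA \<alpha> \<theta>)))"
      using w0[of \<theta>] M S_at_pi_pos by auto
    thus "ennreal (w \<theta> * Sfun \<alpha> \<gamma> \<theta>) \<le> ennreal (S_at_pi * (w \<theta> * exp (- (0 * lnA \<alpha> \<theta>)))) + ennreal (M * (w \<theta> * exp (- ((1 - \<alpha>) * lnA \<alpha> \<theta>))))"
      using le by (simp only: ennreal_plus[symmetric] ennreal_leI)
  qed
  also have "\<dots> = ennreal (S_at_pi * i 0) + ennreal (M * i (1 - \<alpha>))"
    using lin[of S_at_pi 0] lin[of M "1 - \<alpha>"] S_at_pi_pos M c by (subst nn_integral_add) auto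
  also have "\<dots> = ennreal (S_at_pi * i 0 + M * i (1 - \<alpha>))"
    using S_at_pi_pos M i(2)[OF c(1)] i(2)[OF c(2)] by (subst ennreal_plus[symmetric]) auto
  finally have up: "pi * wright_density \<alpha> \<gamma> x \<le> S_at_pi * i 0 + M * i (1 - \<alpha>)"
    using S_at_pi_pos M i(2)[OF c(1)] i(2)[OF c(2)] by (subst (asm) ennreal_le_iff) auto
  have "ennreal (S_at_pi * i 0) + ennreal (\<kappa> * i (1 - \<alpha>))
    = (\<integral>\<^sup>+\<theta>. ennreal (S_at_pi * (w \<theta> * exp (- (0 * lnA \<alpha> \<theta>)))) + ennreal (\<kappa> * (w \<theta> * exp (- ((1 - \<alpha>) * lnA \<alpha> \<theta>)))) \<partial>lborel)"
    using lin[of S_at_pi 0] lin[of \<kappa> "1 - \<alpha>"] S_at_pi_pos M c by (subst nn_integral_add) auto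
  also have "\<dots> \<le> (\<integral>\<^sup>+\<theta>. ennreal (w \<theta> * Sfun \<alpha> \<gamma> \<theta>) + ennreal (M * (w \<theta> * exp (- (1 * lnA \<alpha> \<theta>)))) \<partial>lborel)"
  proof (intro nn_integral_mono)
    fix \<theta> :: real
    have "S_at_pi * (w \<theta> * exp (- (0 * lnA \<alpha> \<theta>))) + \<kappa> * (w \<theta> * exp (- ((1 - \<alpha>) * lnA \<alpha> \<theta>)))
      = w \<theta> * (S_at_pi + \<kappa> * exp (- ((1 - \<alpha>) * lnA \<alpha> \<theta>)))" by (simp add: distrib_left)
    also have "\<dots> \<le> w \<theta> * (Sfun \<alpha> \<gamma> \<theta> + M * exp (- lnA \<alpha> \<theta>))"
      using S(2)[of \<theta>] w0[of \<theta>] ww[of \<theta>] by (cases "0 < \<theta> \<and> \<theta> < pi") (auto intro: mult_left_mono)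
    also have "\<dots> = w \<theta> * Sfun \<alpha> \<gamma> \<theta> + M * (w \<theta> * exp (- (1 * lnA \<alpha> \<theta>)))" by (simp add: distrib_left)
    finally have le: "S_at_pi * (w \<theta> * exp (- (0 * lnA \<alpha> \<theta>))) + \<kappa> * (w \<theta> * exp (- ((1 - \<alpha>) * lnA \<alpha> \<theta>)))
      \<le> w \<theta> * Sfun \<alpha> \<gamma> \<theta> + M * (w \<theta> * exp (- (1 * lnA \<alpha> \<theta>)))" .
    have "0 \<le> w \<theta> * Sfun \<alpha> \<gamma> \<theta>" using w0[of \<theta>] ww[of \<theta>] Sfun_nonneg[of \<theta>] by (cases "0 < \<theta> \<and> \<theta> < pi") auto
    moreover have "0 \<le> M * (w \<theta> * exp (- (1 * lnA \<alpha> \<theta>)))" "0 \<le> S_at_pi * (w \<theta> * exp (- (0 * lnA \<alpha> \<theta>)))"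
      "0 \<le> \<kappa> * (w \<theta> * exp (- ((1 - \<alpha>) * lnA \<alpha> \<theta>)))" using w0[of \<theta>] M S_at_pi_pos by auto
    ultimately show "ennreal (S_at_pi * (w \<theta> * exp (- (0 * lnA \<alpha> \<theta>)))) + ennreal (\<kappa> * (w \<theta> * exp (- ((1 - \<alpha>) * lnA \<alpha> \<theta>))))
      \<le> ennreal (w \<theta> * Sfun \<alpha> \<gamma> \<theta>) + ennreal (M * (w \<theta> * exp (- (1 * lnA \<alpha> \<theta>))))"
      using le by (simp only: ennreal_plus[symmetric] ennreal_leI)
  qed
  also have "\<dots> = ennreal (pi * wright_density \<alpha> \<gamma> x) + ennreal (M * i 1)"
    unfolding k using lin[of M 1] M c by (subst nn_integral_add) auto
  finally have lo: "S_at_pi * i 0 + \<kappa> * i (1 - \<alpha>) \<le> pi * wright_density \<alpha> \<gamma> x + M * i 1"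
    using S_at_pi_pos M i(2)[OF c(1)] i(2)[OF c(2)] i(2)[OF c(3)] k0
    by (subst (asm) (1 2) ennreal_plus[symmetric]) (simp_all del: ennreal_plus)
  have "S_at_pi * i 0 \<le> S_at_pi * Gamma (1 + \<gamma>)" using i(3)[OF c(1)] S_at_pi_pos y by simp
  moreover have "M * i (1 - \<alpha>) \<le> M * (x * Gamma (\<gamma> + \<alpha>))"
    using i(3)[OF c(2)] M unfolding yc by (simp add: add.commute)
  ultimately show "pi * wright_density \<alpha> \<gamma> x \<le> S_at_pi * Gamma (1 + \<gamma>) + M * (x * Gamma (\<gamma> + \<alpha>))" using up by linarith
  define r where "r = (y * exp (lnA \<alpha> s)) powr (1 + \<gamma>)"
  have r: "0 \<le> r" unfolding r_def by simp
  have "M * i 1 \<le> M * (y * Gamma \<gamma>)" using i(3)[OF c(3)] M y by simp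
  moreover have "x * exp (- 2) \<le> i (1 - \<alpha>)"
    using curve_Gamma_lower_c[OF y s y1] i(2)[OF c(2)] unfolding i(1)[OF c(2)] yc by (simp only: ennreal_le_iff)
  hence "\<kappa> * (x * exp (- 2)) \<le> \<kappa> * i (1 - \<alpha>)" using M by simp
  moreover have "Gamma (1 + \<gamma>) \<le> i 0 + r"
    using curve_Gamma_lower_0[OF y s, folded r_def] i(2)[OF c(1)] r unfolding i(1)[OF c(1)] by (simp add: ennreal_plus[symmetric] del: ennreal_plus)
  hence "S_at_pi * Gamma (1 + \<gamma>) \<le> S_at_pi * (i 0 + r)" using S_at_pi_pos by simp
  hence "S_at_pi * Gamma (1 + \<gamma>) \<le> S_at_pi * i 0 + S_at_pi * r" by (simp add: distrib_left)
  ultimately show "S_at_pi * Gamma (1 + \<gamma>) + \<kappa> * (x * exp (- 2)) \<le> pi * wright_density \<alpha> \<gamma> x + M * (y * Gamma \<gamma>) + S_at_pi * (y * exp (lnA \<alpha> s)) powr (1 + \<gamma>)"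
    using lo unfolding r_def[symmetric] by linarith
qed

lemma wright_density_near_0:
  "\<exists>k0 \<epsilon> z. 0 < k0 \<and> 0 < \<epsilon> \<and> 0 < z \<and> (wright_density \<alpha> \<gamma> \<longlongrightarrow> k0) (at_right 0) \<and>
     (\<forall>x. z < x \<longrightarrow> x < 2 * z \<longrightarrow> k0 + \<epsilon> \<le> wright_density \<alpha> \<gamma> x)"
proof -
  obtain s \<kappa> M where s: "0 < s" "s < pi" and \<kappa>: "0 < \<kappa>" and M: "0 < M"
    and S: "\<And>\<theta>. 0 < \<theta> \<Longrightarrow> \<theta> < pi \<Longrightarrow> Sfun \<alpha> \<gamma> \<theta> \<le> S_at_pi + M * exp (- ((1 - \<alpha>) * lnA \<alpha> \<theta>))"
      "\<And>\<theta>. 0 < \<theta> \<Longrightarrow> \<theta> < pi \<Longrightarrow> S_at_pi + \<kappa> * exp (- ((1 - \<alpha>) * lnA \<alpha> \<theta>)) \<le> Sfun \<alpha> \<gamma> \<theta> + M * exp (- lnA \<alpha> \<theta>)"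
    using Sfun_bounds by blast
  define k where "k = wright_density \<alpha> \<gamma>"
  define G where "G = S_at_pi * Gamma (1 + \<gamma>)"
  define a where "a = exp (lnA \<alpha> s)"
  define c where "c = 1 - \<alpha>"
  define K where "K = \<kappa> * exp (- 2)"
  \<comment> \<open>The error of the lower bound divided by x. Both exponents are positive, so h
    tends to 0 and at most half of the linear gain K x is lost near 0.\<close>
  define h where "h x = M * Gamma \<gamma> * x powr (1 / c - 1) + S_at_pi * a powr (1 + \<gamma>) * x powr ((1 + \<gamma>) / c - 1)" for x :: real
  have c: "0 < c" "c < 1" unfolding c_def using \<alpha> by auto
  have G: "0 < G" unfolding G_def using S_at_pi_pos gamma_bounds by (simp add: Gamma_real_pos)
  have K: "0 < K" unfolding K_def using \<kappa> by simp
  have a: "0 < a" unfolding a_def by simp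
  have pw: "((\<lambda>x. x powr p) \<longlongrightarrow> 0 powr p) (at_right 0)" if "0 < p" for p :: real
    using that by (intro tendsto_powr' tendsto_ident_at tendsto_const) (auto simp: eventually_at_right_less eventually_at_filter)
  have e: "0 < 1 / c - 1" "0 < (1 + \<gamma>) / c - 1" using c gamma_bounds by (auto simp: field_simps)
  have "(h \<longlongrightarrow> M * Gamma \<gamma> * 0 powr (1 / c - 1) + S_at_pi * a powr (1 + \<gamma>) * 0 powr ((1 + \<gamma>) / c - 1)) (at_right 0)"
    unfolding h_def by (intro tendsto_intros pw e)
  hence "\<forall>\<^sub>F x in at_right 0. h x < K / 2" using K by (intro order_tendstoD(2)) auto
  moreover have "\<forall>\<^sub>F x in at_right 0. x powr (1 / c) < 1 / a"
    using pw[of "1 / c"] a c by (intro order_tendstoD(2)) auto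
  moreover have "\<forall>\<^sub>F x in at_right (0::real). 0 < x" by (rule eventually_at_right_less)
  ultimately have ev: "\<forall>\<^sub>F x in at_right 0. G + K / 2 * x \<le> pi * k x \<and> pi * k x \<le> G + M * (x * Gamma (\<gamma> + \<alpha>))"
  proof eventually_elim
    case (elim x)
    define y where "y = x powr (1 / c)"
    have y1: "y * a \<le> 1" using elim a unfolding y_def by (simp add: field_simps)
    have y1': "x powr (1 / (1 - \<alpha>)) * exp (lnA \<alpha> s) \<le> 1" using y1 unfolding y_def a_def c_def .
    have sw: "pi * k x \<le> G + M * (x * Gamma (\<gamma> + \<alpha>))"
      "G + \<kappa> * (x * exp (- 2)) \<le> pi * k x + M * (y * Gamma \<gamma>) + S_at_pi * (y * a) powr (1 + \<gamma>)"
      unfolding k_def G_def y_def a_def c_def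
      by (rule wright_density_sandwich[of x s M \<kappa>], (fact elim(3) s S M \<kappa> y1' | erule S | assumption)+)+
    have 1: "M * (y * Gamma \<gamma>) + S_at_pi * (y * a) powr (1 + \<gamma>) = x * h x"
    proof -
      have "x powr 1 * x powr (1 / c - 1) = y" "x powr 1 * x powr ((1 + \<gamma>) / c - 1) = y powr (1 + \<gamma>)"
        unfolding y_def powr_add[symmetric] by (simp_all add: powr_powr)
      hence "x * x powr (1 / c - 1) = y" "x * x powr ((1 + \<gamma>) / c - 1) = y powr (1 + \<gamma>)" using elim by simp_all
      moreover have "x * h x = M * Gamma \<gamma> * (x * x powr (1 / c - 1)) + S_at_pi * a powr (1 + \<gamma>) * (x * x powr ((1 + \<gamma>) / c - 1))"
        unfolding h_def by (simp add: algebra_simps)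
      moreover have "(y * a) powr (1 + \<gamma>) = y powr (1 + \<gamma>) * a powr (1 + \<gamma>)" by (rule powr_mult)
      ultimately show ?thesis by simp
    qed
    have "x * h x \<le> x * (K / 2)" using elim by (intro mult_left_mono) auto
    moreover have "G + K * x \<le> pi * k x + x * h x" using sw(2) 1 unfolding K_def by (simp add: mult_ac)
    moreover have "K * x = K / 2 * x + x * (K / 2)" by simp
    ultimately show ?case using sw(1) by linarith
  qed
  have lim: "(k \<longlongrightarrow> G / pi) (at_right 0)"
  proof (rule tendsto_sandwich)
    have "\<forall>\<^sub>F x in at_right (0::real). 0 < x" by (rule eventually_at_right_less)
    with ev show "\<forall>\<^sub>F x in at_right 0. G / pi \<le> k x"
    proof eventually_elim
      case (elim x)
      have "0 \<le> K / 2 * x" using elim K by simp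
      hence "G \<le> pi * k x" using elim by linarith
      thus ?case by (simp add: field_simps)
    qed
    show "\<forall>\<^sub>F x in at_right 0. k x \<le> (G + M * (x * Gamma (\<gamma> + \<alpha>))) / pi"
      using ev by eventually_elim (simp add: field_simps)
    have "((\<lambda>x. (G + M * (x * Gamma (\<gamma> + \<alpha>))) / pi) \<longlongrightarrow> (G + M * (0 * Gamma (\<gamma> + \<alpha>))) / pi) (at_right 0)"
      by (intro tendsto_intros tendsto_ident_at) simp
    thus "((\<lambda>x. (G + M * (x * Gamma (\<gamma> + \<alpha>))) / pi) \<longlongrightarrow> G / pi) (at_right 0)" by simp
  qed simp
  \<comment> \<open>On (d / 2, d) the gain K x / 2 is at least K d / 4; division by pi gives the
    value of \<epsilon>.\<close>
  obtain d where d: "0 < d" "\<And>x. 0 < x \<Longrightarrow> x < d \<Longrightarrow> G + K / 2 * x \<le> pi * k x"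
    using ev unfolding eventually_at_right_field by blast
  have "G / pi + K * d / (4 * pi) \<le> k x" if "d / 2 < x" "x < 2 * (d / 2)" for x
  proof -
    have "K / 2 * (d / 2) \<le> K / 2 * x" using that K by (intro mult_left_mono) auto
    moreover have "G + K / 2 * x \<le> pi * k x" using d(2)[of x] that d(1) by simp
    ultimately have "G + K * d / 4 \<le> pi * k x" by simp
    hence "(G + K * d / 4) / pi \<le> k x" by (simp add: divide_le_eq mult.commute)
    thus ?thesis by (simp add: add_divide_distrib)
  qed
  thus ?thesis using lim G K d(1) unfolding k_def
    by - (rule exI[of _ "G / pi"], rule exI[of _ "K * d / (4 * pi)"], rule exI[of _ "d / 2"], auto)
qed

end

section \<open>Unimodal laws and multiplicative convolution\<close>

text \<open>The difference H of f and the integral of s satisfies |H y - H x| \<le> (s y - s x) (y -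
  x). Over n equal pieces these bounds telescope to (s b - s a) (b - a) / n, which forces H b = H
  a.\<close>

lemma has_integral_subgradient:
  fixes f s :: "real \<Rightarrow> real"
  assumes ab: "a \<le> b"
    and bd: "\<And>x y. a \<le> x \<Longrightarrow> x \<le> y \<Longrightarrow> y \<le> b \<Longrightarrow> s x * (y - x) \<le> f y - f x \<and> f y - f x \<le> s y * (y - x)"
  shows "(s has_integral (f b - f a)) {a..b}"
proof -
  have mono: "s x \<le> s y" if "a \<le> x" "x \<le> y" "y \<le> b" for x y
  proof (cases "x = y")
    case False
    have "s x * (y - x) \<le> s y * (y - x)" using bd[OF that] by linarith
    thus ?thesis using False that by simp
  qed simp
  have int: "s integrable_on {x..y}" if "a \<le> x" "y \<le> b" for x y
    using mono that by (intro integrable_on_mono_on) (auto simp: mono_on_def)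
  have ib: "s x * (y - x) \<le> integral {x..y} s \<and> integral {x..y} s \<le> s y * (y - x)" if "a \<le> x" "x \<le> y" "y \<le> b" for x y
  proof
    have "integral {x..y} (\<lambda>_. s x) \<le> integral {x..y} s"
      using that by (intro integral_le int mono) auto
    thus "s x * (y - x) \<le> integral {x..y} s" using that by (simp add: mult.commute)
    have "integral {x..y} s \<le> integral {x..y} (\<lambda>_. s y)"
      using that by (intro integral_le int mono) auto
    thus "integral {x..y} s \<le> s y * (y - x)" using that by (simp add: mult.commute)
  qed
  define H where "H x = f x - integral {a..x} s" for x
  have Hd: "\<bar>H y - H x\<bar> \<le> (s y - s x) * (y - x)" if "a \<le> x" "x \<le> y" "y \<le> b" for x y
  proof -
    have "integral {a..x} s + integral {x..y} s = integral {a..y} s"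
      using that by (intro Henstock_Kurzweil_Integration.integral_combine int) auto
    thus ?thesis using bd[OF that] ib[OF that] unfolding H_def left_diff_distrib abs_le_iff by linarith
  qed
  have "\<bar>H b - H a\<bar> \<le> (s b - s a) * (b - a) / n" if "0 < n" for n :: nat
  proof -
    define x where "x i = a + real i * ((b - a) / n)" for i :: nat
    have x: "a \<le> x i" "x i \<le> x (Suc i)" for i
      using ab that mult_right_mono[of "real i" "real (Suc i)" "(b - a) / n"] unfolding x_def by simp_all
    have xb: "x i \<le> b" if "i \<le> n" for i
    proof -
      have "real i * ((b - a) / n) \<le> real n * ((b - a) / n)" using that ab by (intro mult_right_mono) auto
      thus ?thesis using \<open>0 < n\<close> by (simp add: x_def)
    qed
    have xn: "x 0 = a" "x n = b" using that by (auto simp: x_def)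
    have "\<bar>H b - H a\<bar> = \<bar>\<Sum>i<n. H (x (Suc i)) - H (x i)\<bar>" by (simp only: sum_lessThan_telescope[of "\<lambda>i. H (x i)"] xn)
    also have "\<dots> \<le> (\<Sum>i<n. \<bar>H (x (Suc i)) - H (x i)\<bar>)" by (rule sum_abs)
    also have "\<dots> \<le> (\<Sum>i<n. (s (x (Suc i)) - s (x i)) * ((b - a) / n))"
    proof (intro sum_mono)
      fix i assume "i \<in> {..<n}"
      hence "\<bar>H (x (Suc i)) - H (x i)\<bar> \<le> (s (x (Suc i)) - s (x i)) * (x (Suc i) - x i)" using x xb by (intro Hd) auto
      also have "x (Suc i) - x i = (b - a) / n" unfolding x_def of_nat_Suc distrib_right by linarith
      finally show "\<bar>H (x (Suc i)) - H (x i)\<bar> \<le> (s (x (Suc i)) - s (x i)) * ((b - a) / n)" .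
    qed
    also have "\<dots> = (s b - s a) * (b - a) / n"
      unfolding sum_distrib_right[symmetric] sum_lessThan_telescope[of "\<lambda>i. s (x i)"] xn by simp
    finally show ?thesis .
  qed
  hence "\<forall>\<^sub>F n in sequentially. \<bar>H b - H a\<bar> \<le> (s b - s a) * (b - a) / real n"
    by (intro eventually_sequentiallyI[of 1]) auto
  moreover have "(\<lambda>n. (s b - s a) * (b - a) / real n) \<longlonglongrightarrow> 0" by (rule lim_const_over_n)
  ultimately have "\<bar>H b - H a\<bar> \<le> 0" by (intro tendsto_lowerbound) auto
  hence "integral {a..b} s = f b - f a" unfolding H_def by simp
  thus ?thesis using int[of a b] by (simp add: has_integral_integrable_integral)
qed

lemma nn_integral_Ioc_has_integral:
  fixes \<psi> :: "real \<Rightarrow> real"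
  assumes [measurable]: "\<psi> \<in> borel_measurable borel" and nn: "\<And>x. 0 \<le> \<psi> x" and hi: "(\<psi> has_integral I) {a..b}"
  shows "(\<integral>\<^sup>+x. ennreal (indicator {a<..b} x * \<psi> x) \<partial>lborel) = ennreal I"
proof -
  have m: "(\<lambda>x. indicator {a..b} x * \<psi> x) \<in> borel_measurable borel" by measurable
  have "((\<lambda>x. indicator {a..b} x * \<psi> x) has_integral I) UNIV"
  proof -
    have "((\<lambda>x. if x \<in> {a..b} then \<psi> x else 0) has_integral I) UNIV"
      using hi by (simp only: has_integral_restrict_UNIV)
    moreover have "(\<lambda>x. indicator {a..b} x * \<psi> x) = (\<lambda>x. if x \<in> {a..b} then \<psi> x else 0)"
      by (auto simp: indicator_def)
    ultimately show ?thesis by simp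
  qed
  hence "(\<integral>\<^sup>+x. ennreal (indicator {a..b} x * \<psi> x) \<partial>lborel) = ennreal I"
    using nn by (intro nn_integral_has_integral_lborel m) auto
  moreover have "(\<integral>\<^sup>+x. ennreal (indicator {a<..b} x * \<psi> x) \<partial>lborel) = (\<integral>\<^sup>+x. ennreal (indicator {a..b} x * \<psi> x) \<partial>lborel)"
    using AE_lborel_singleton[of a] by (intro nn_integral_cong_AE) (auto elim!: eventually_mono simp: indicator_def)
  ultimately show ?thesis by simp
qed

lemma measure_eq_on_Ioc:
  fixes M N :: "real measure"
  assumes sets: "sets M = sets borel" "sets N = sets borel"
    and eq: "\<And>a b. u \<le> a \<Longrightarrow> a \<le> b \<Longrightarrow> b \<le> v \<Longrightarrow> emeasure M {a<..b} = emeasure N {a<..b}"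
    and fin: "emeasure M {u<..v} < \<infinity>" and B: "B \<in> sets borel" "B \<subseteq> {u<..v}"
  shows "emeasure M B = emeasure N B"
proof (cases "u \<le> v")
  case True
  have fb: "finite_borel_measure (density L (indicator {u<..v}))"
    and dm: "C \<in> sets borel \<Longrightarrow> emeasure (density L (indicator {u<..v})) C = emeasure L ({u<..v} \<inter> C)"
    if L: "sets L = sets borel" "emeasure L {u<..v} < \<infinity>" for L :: "real measure" and C
  proof -
    have [measurable_cong]: "sets L = sets borel" by fact
    show dm: "emeasure (density L (indicator {u<..v})) C = emeasure L ({u<..v} \<inter> C)" if "C \<in> sets borel" for C
      using that L(1) by (intro emeasure_restricted) auto
    have "space L = UNIV" using sets_eq_imp_space_eq[OF L(1)] by simp
    show "finite_borel_measure (density L (indicator {u<..v}))"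
    proof (intro finite_borel_measure.intro finite_measureI finite_borel_measure_axioms.intro)
      show "emeasure (density L (indicator {u<..v})) (space (density L (indicator {u<..v}))) \<noteq> \<infinity>"
        using dm[of UNIV] L(2) \<open>space L = UNIV\<close> by simp
    qed (simp add: L(1))
  qed
  have finN: "emeasure N {u<..v} < \<infinity>" using eq[of u v] fin True by simp
  have "density M (indicator {u<..v}) = density N (indicator {u<..v})"
  proof (rule cdf_unique'[OF fb[OF sets(1) fin] fb[OF sets(2) finN]])
    show "cdf (density M (indicator {u<..v})) = cdf (density N (indicator {u<..v}))"
    proof
      fix x
      have "{u<..v} \<inter> {..x} = {u<..max u (min x v)}" using True by auto
      hence "emeasure M ({u<..v} \<inter> {..x}) = emeasure N ({u<..v} \<inter> {..x})" using eq[of u "max u (min x v)"] True by simp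
      thus "cdf (density M (indicator {u<..v})) x = cdf (density N (indicator {u<..v})) x"
        unfolding cdf_def measure_def using dm[OF sets(1) fin, of "{..x}"] dm[OF sets(2) finN, of "{..x}"] by simp
    qed
  qed
  hence "emeasure M ({u<..v} \<inter> B) = emeasure N ({u<..v} \<inter> B)"
    using dm[OF sets(1) fin B(1)] dm[OF sets(2) finN B(1)] by simp
  thus ?thesis using B by (simp add: Int_absorb1)
next
  case False thus ?thesis using B by auto
qed

text \<open>The two measures are compared only on intervals that keep a distance from the endpoint
  m, where a density may be unbounded; such intervals exhaust B.\<close>

lemma measure_eq_on_halfline:
  fixes M N :: "real measure"
  assumes sets: "sets M = sets borel" "sets N = sets borel"
    and S: "S = {..<m} \<or> S = {m<..}"
    and eq: "\<And>a b. {a..b} \<subseteq> S \<Longrightarrow> a \<le> b \<Longrightarrow> emeasure M {a<..b} = emeasure N {a<..b}"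
    and fin: "\<And>a b. emeasure M {a<..b} < \<infinity>" and B: "B \<in> sets borel" "B \<subseteq> S"
  shows "emeasure M B = emeasure N B"
proof -
  define l r where "l n = (if S = {..<m} then m - real (Suc n) else m + 1 / real (Suc n))"
    and "r n = (if S = {..<m} then m - 1 / real (Suc n) else m + real (Suc n))" for n :: nat
  have ne: "{m<..} \<noteq> {..<m}" by (metis greaterThan_iff lessThan_iff lt_ex order_less_asym)
  have lr: "{l n..r n} \<subseteq> S" for n
  proof -
    obtain e where e: "1 / real (Suc n) = e" "0 < e" by simp
    thus ?thesis using S ne unfolding l_def r_def e(1)
      by (elim disjE; simp only: if_True if_False ne) (auto simp del: of_nat_Suc)
  qed
  have inc: "incseq (\<lambda>n. {l n<..r n} \<inter> B)"
  proof (rule incseq_SucI)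
    fix n
    have "1 / real (Suc (Suc n)) \<le> 1 / real (Suc n)" by (intro divide_left_mono) auto
    thus "{l n<..r n} \<inter> B \<subseteq> {l (Suc n)<..r (Suc n)} \<inter> B" by (auto simp: l_def r_def split: if_splits)
  qed
  have un: "(\<Union>n. {l n<..r n} \<inter> B) = B"
  proof (intro equalityI subsetI)
    fix x assume x: "x \<in> B"
    hence "0 < \<bar>x - m\<bar>" using B S by auto
    then obtain n1 where n1: "1 / \<bar>x - m\<bar> < real n1" using reals_Archimedean2 by blast
    obtain n2 where n2: "\<bar>x - m\<bar> < real n2" using reals_Archimedean2 by blast
    define n where "n = max n1 n2"
    have 1: "\<bar>x - m\<bar> < real (Suc n)" using n2 unfolding n_def by linarith
    have "1 / \<bar>x - m\<bar> < real (Suc n)" using n1 unfolding n_def by linarith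
    hence 2: "1 / real (Suc n) < \<bar>x - m\<bar>" using \<open>0 < \<bar>x - m\<bar>\<close> by (simp add: field_simps)
    have "x \<in> {l n<..r n}" using 1 2 x B S ne by (auto simp: l_def r_def abs_if split: if_splits)
    thus "x \<in> (\<Union>n. {l n<..r n} \<inter> B)" using x by blast
  qed auto
  have "emeasure M ({l n<..r n} \<inter> B) = emeasure N ({l n<..r n} \<inter> B)" for n
  proof (rule measure_eq_on_Ioc[OF sets _ fin])
    fix a b assume "l n \<le> a" "a \<le> b" "b \<le> r n"
    thus "emeasure M {a<..b} = emeasure N {a<..b}" using lr[of n] by (intro eq) auto
  qed (use B in auto)
  moreover have "emeasure L B = (SUP n. emeasure L ({l n<..r n} \<inter> B))" if "sets L = sets borel" for L :: "real measure"
    using inc un that B by (subst SUP_emeasure_incseq) auto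
  ultimately show ?thesis using sets by simp
qed

text \<open>\<open>p\<close> is the mass of a possible atom at the mode \<open>m\<close>.\<close>

definition unimodal_density :: "real measure \<Rightarrow> real \<Rightarrow> real \<Rightarrow> (real \<Rightarrow> real) \<Rightarrow> bool" where
  "unimodal_density \<nu> m p \<psi> \<longleftrightarrow> 0 \<le> p \<and> \<psi> \<in> borel_measurable borel \<and> (\<forall>x. 0 \<le> \<psi> x) \<and>
     mono_on {..<m} \<psi> \<and> monotone_on {m<..} (\<le>) (\<ge>) \<psi> \<and>
     (\<forall>A\<in>sets borel. emeasure \<nu> A = ennreal p * indicator A m + (\<integral>\<^sup>+x. ennreal (indicator A x * \<psi> x) \<partial>lborel))"

text \<open>A convex function on an open half line has a subgradient at every point, and a choice of
  subgradients is a density that is monotone everywhere on that half line, not just almost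
  everywhere. The law has this density away from m, which leaves m as the only possible
  atom.\<close>

lemma unimodal_imp_density:
  assumes "real_distribution \<nu>" and "unimodal \<nu>"
  shows "\<exists>m p \<psi>. unimodal_density \<nu> m p \<psi>"
proof -
  interpret real_distribution \<nu> by fact
  obtain m where left: "convex_on {..<m} (cdf \<nu>)" and right: "convex_on {m<..} (\<lambda>x. - cdf \<nu> x)"
    using assms(2) unfolding unimodal_def concave_on_def by blast
  have "\<exists>s. \<forall>x\<in>S. \<forall>y\<in>S. f x + s x * (y - x) \<le> f y" if "convex_on S f" "open S" for S and f :: "real \<Rightarrow> real"
  proof -
    have "\<forall>x\<in>S. \<exists>c. \<forall>y\<in>S. f x + c * (y - x) \<le> f y"
      using convex_le_Inf_differential[OF that(1)] that(2) by (auto simp: interior_open)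
    thus ?thesis by metis
  qed
  note ex = this
  obtain s1 where s1': "\<forall>x\<in>{..<m}. \<forall>y\<in>{..<m}. cdf \<nu> x + s1 x * (y - x) \<le> cdf \<nu> y"
    using ex[OF left] by auto
  obtain s2 where s2': "\<forall>x\<in>{m<..}. \<forall>y\<in>{m<..}. - cdf \<nu> x + s2 x * (y - x) \<le> - cdf \<nu> y"
    using ex[OF right] by auto
  have s1: "cdf \<nu> x + s1 x * (y - x) \<le> cdf \<nu> y" if "x < m" "y < m" for x y using s1' that by auto
  have s2: "- cdf \<nu> x + s2 x * (y - x) \<le> - cdf \<nu> y" if "m < x" "m < y" for x y using s2' that by auto
  define \<psi> where "\<psi> x = (if x < m then s1 x else if m < x then - s2 x else 0)" for x
  have L: "\<psi> x * (y - x) \<le> cdf \<nu> y - cdf \<nu> x" "cdf \<nu> y - cdf \<nu> x \<le> \<psi> y * (y - x)" if "x < m" "y < m" for x y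
    using s1[OF that] s1[OF that(2,1)] that by (auto simp: \<psi>_def algebra_simps)
  have R: "\<psi> y * (y - x) \<le> cdf \<nu> y - cdf \<nu> x" "cdf \<nu> y - cdf \<nu> x \<le> \<psi> x * (y - x)" if "m < x" "m < y" for x y
    using s2[OF that] s2[OF that(2,1)] that by (auto simp: \<psi>_def algebra_simps)
  have monoL: "\<psi> x \<le> \<psi> y" if "x \<le> y" "y < m" for x y
  proof (cases "x = y")
    case False
    have "\<psi> x * (y - x) \<le> \<psi> y * (y - x)" using L[of x y] that by linarith
    thus ?thesis using False that by simp
  qed simp
  have monoR: "\<psi> y \<le> \<psi> x" if "x \<le> y" "m < x" for x y
  proof (cases "x = y")
    case False
    have "\<psi> y * (y - x) \<le> \<psi> x * (y - x)" using R[of x y] that by linarith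
    thus ?thesis using False that by simp
  qed simp
  have nn: "0 \<le> \<psi> x" for x
  proof -
    consider "x < m" | "m < x" | "x = m" by linarith
    thus ?thesis
    proof cases
      case 1
      have "0 \<le> cdf \<nu> x - cdf \<nu> (x - 1)" using cdf_nondecreasing[of "x - 1" x] by simp
      also have "\<dots> \<le> \<psi> x * (x - (x - 1))" using 1 by (intro L) auto
      finally show ?thesis by simp
    next
      case 2
      have "0 \<le> cdf \<nu> (x + 1) - cdf \<nu> x" using cdf_nondecreasing[of x "x + 1"] by simp
      also have "\<dots> \<le> \<psi> x * ((x + 1) - x)" using 2 by (intro R) auto
      finally show ?thesis by simp
    qed (simp add: \<psi>_def)
  qed
  have m[measurable]: "\<psi> \<in> borel_measurable borel"
  proof -
    have 1: "(\<lambda>x. if x < m then \<psi> x else 0) \<in> borel_measurable borel"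
    proof (subst measurable_If_restrict_space_iff)
      have "mono_on {..<m} \<psi>" using monoL by (auto simp: mono_on_def)
      thus "\<psi> \<in> borel_measurable (restrict_space borel {x. x < m}) \<and> (\<lambda>x. 0) \<in> borel_measurable (restrict_space borel {x. \<not> x < m})"
        using borel_measurable_mono_on_fnc[of "{..<m}" \<psi>] by (simp add: lessThan_def)
    qed auto
    have 2: "(\<lambda>x. if m < x then - \<psi> x else 0) \<in> borel_measurable borel"
    proof (subst measurable_If_restrict_space_iff)
      have "mono_on {m<..} (\<lambda>x. - \<psi> x)" using monoR by (auto simp: mono_on_def)
      thus "(\<lambda>x. - \<psi> x) \<in> borel_measurable (restrict_space borel {x. m < x}) \<and> (\<lambda>x. 0) \<in> borel_measurable (restrict_space borel {x. \<not> m < x})"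
        using borel_measurable_mono_on_fnc[of "{m<..}" "\<lambda>x. - \<psi> x"] by (simp add: greaterThan_def)
    qed auto
    have "\<psi> = (\<lambda>x. (if x < m then \<psi> x else 0) - (if m < x then - \<psi> x else 0))" by (auto simp: \<psi>_def fun_eq_iff)
    thus ?thesis using borel_measurable_diff[OF 1 2] by simp
  qed
  define N where "N = density lborel (\<lambda>x. ennreal (\<psi> x))"
  have N: "emeasure N A = (\<integral>\<^sup>+x. ennreal (indicator A x * \<psi> x) \<partial>lborel)" if "A \<in> sets borel" for A
    using that nn unfolding N_def by (subst emeasure_density) (auto intro!: nn_integral_cong simp: indicator_def)
  have em: "emeasure \<nu> {a<..b} = ennreal (cdf \<nu> b - cdf \<nu> a)" if "a \<le> b" for a b
    using cdf_diff_eq[of a b] that by (cases "a = b") (auto simp: emeasure_eq_measure)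
  have eqL: "emeasure \<nu> B = emeasure N B" if "B \<in> sets borel" "B \<subseteq> {..<m}" for B
  proof (rule measure_eq_on_halfline[of \<nu> N "{..<m}" m])
    fix a b :: real assume ab: "{a..b} \<subseteq> {..<m}" "a \<le> b"
    hence "b < m" by auto
    have "(\<psi> has_integral (cdf \<nu> b - cdf \<nu> a)) {a..b}"
      using \<open>b < m\<close> ab(2) L by (intro has_integral_subgradient) auto
    from nn_integral_Ioc_has_integral[OF m nn this] show "emeasure \<nu> {a<..b} = emeasure N {a<..b}"
      using em[OF ab(2)] by (simp add: N)
  qed (use that in \<open>auto simp: N_def emeasure_eq_measure\<close>)
  have eqR: "emeasure \<nu> B = emeasure N B" if "B \<in> sets borel" "B \<subseteq> {m<..}" for B
  proof (rule measure_eq_on_halfline[of \<nu> N "{m<..}" m])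
    fix a b :: real assume ab: "{a..b} \<subseteq> {m<..}" "a \<le> b"
    hence "m < a" by auto
    have "((\<lambda>x. - \<psi> x) has_integral (- cdf \<nu> b - - cdf \<nu> a)) {a..b}"
      using \<open>m < a\<close> ab(2) R by (intro has_integral_subgradient) (auto simp: algebra_simps)
    from has_integral_neg[OF this] have "(\<psi> has_integral (cdf \<nu> b - cdf \<nu> a)) {a..b}" by simp
    from nn_integral_Ioc_has_integral[OF m nn this] show "emeasure \<nu> {a<..b} = emeasure N {a<..b}"
      using em[OF ab(2)] by (simp add: N)
  qed (use that in \<open>auto simp: N_def emeasure_eq_measure\<close>)
  have "emeasure \<nu> A = ennreal (measure \<nu> {m}) * indicator A m + (\<integral>\<^sup>+x. ennreal (indicator A x * \<psi> x) \<partial>lborel)"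
    if A[measurable]: "A \<in> sets borel" for A
  proof -
    have sp: "emeasure K A = emeasure K (A \<inter> {..<m}) + emeasure K (A \<inter> {m}) + emeasure K (A \<inter> {m<..})"
      if [measurable_cong]: "sets K = sets borel" for K :: "real measure"
    proof -
      have "emeasure K (A \<inter> {..<m}) + emeasure K (A \<inter> {m}) = emeasure K ((A \<inter> {..<m}) \<union> (A \<inter> {m}))"
        by (rule plus_emeasure) auto
      also have "\<dots> + emeasure K (A \<inter> {m<..}) = emeasure K (((A \<inter> {..<m}) \<union> (A \<inter> {m})) \<union> (A \<inter> {m<..}))"
        by (rule plus_emeasure) auto
      also have "((A \<inter> {..<m}) \<union> (A \<inter> {m})) \<union> (A \<inter> {m<..}) = A" by auto
      finally show ?thesis by simp
    qed
    have "emeasure N (A \<inter> {m}) = 0"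
    proof -
      have "A \<inter> {m} \<in> sets borel" by simp
      moreover have "AE x in lborel. ennreal (indicator (A \<inter> {m}) x * \<psi> x) = 0"
        using AE_lborel_singleton[of m] by eventually_elim (auto simp: indicator_def)
      ultimately show ?thesis using N by (simp add: nn_integral_0_iff_AE)
    qed
    moreover have "emeasure \<nu> (A \<inter> {m}) = ennreal (measure \<nu> {m}) * indicator A m"
      by (cases "m \<in> A") (auto simp: emeasure_eq_measure)
    ultimately show ?thesis
      unfolding N[OF A, symmetric] using sp[of \<nu>] sp[of N] eqL[of "A \<inter> {..<m}"] eqR[of "A \<inter> {m<..}"]
      by (simp add: N_def ac_simps)
  qed
  hence "unimodal_density \<nu> m (measure \<nu> {m}) \<psi>"
    unfolding unimodal_density_def using nn m monoL monoR by (auto simp: mono_on_def monotone_on_def)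
  thus ?thesis by blast
qed

text \<open>Only intervals that avoid m are tested, so an atom at m is allowed. The values of g are
  in \<open>ennreal\<close> because the density of a product arises as a nonnegative integral whose
  finiteness is not known pointwise.\<close>

lemma unimodalI_density:
  fixes g :: "real \<Rightarrow> ennreal"
  assumes "real_distribution \<nu>" and [measurable]: "g \<in> borel_measurable borel"
    and left: "\<And>x y. x \<le> y \<Longrightarrow> y < m \<Longrightarrow> g x \<le> g y" and right: "\<And>x y. m < x \<Longrightarrow> x \<le> y \<Longrightarrow> g y \<le> g x"
    and em: "\<And>a b. a < b \<Longrightarrow> b < m \<or> m < a \<Longrightarrow> emeasure \<nu> {a<..b} = (\<integral>\<^sup>+x\<in>{a<..b}. g x \<partial>lborel)"
  shows "unimodal \<nu>"
proof -
  interpret real_distribution \<nu> by fact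
  have em': "emeasure \<nu> {a<..b} = ennreal (cdf \<nu> b - cdf \<nu> a)" if "a < b" for a b
    using cdf_diff_eq[of a b] that by (auto simp: emeasure_eq_measure)
  have cI: "(\<integral>\<^sup>+x\<in>{a<..b}. c \<partial>lborel) = c * ennreal (b - a)" if "a < b" for c :: ennreal and a b :: real
    using that by (simp add: nn_integral_cmult_indicator)
  have upper: "ennreal (cdf \<nu> b - cdf \<nu> a) \<le> c * ennreal (b - a)"
    if "a < b" "b < m \<or> m < a" "\<And>x. a < x \<Longrightarrow> x \<le> b \<Longrightarrow> g x \<le> c" for a b c
    unfolding em'[OF that(1), symmetric] em[OF that(1,2)] cI[OF that(1), symmetric]
    using that(3) by (intro nn_integral_mono) (auto simp: indicator_def)
  have lower: "c * ennreal (b - a) \<le> ennreal (cdf \<nu> b - cdf \<nu> a)"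
    if "a < b" "b < m \<or> m < a" "\<And>x. a < x \<Longrightarrow> x \<le> b \<Longrightarrow> c \<le> g x" for a b c
    unfolding em'[OF that(1), symmetric] em[OF that(1,2)] cI[OF that(1), symmetric]
    using that(3) by (intro nn_integral_mono) (auto simp: indicator_def)
  have slopes: "(cdf \<nu> y - cdf \<nu> x) * (z - y) \<le> (cdf \<nu> z - cdf \<nu> y) * (y - x)" if "x < y" "y < z" "z < m" for x y z
  proof -
    have lo: "g y * ennreal (z - y) \<le> ennreal (cdf \<nu> z - cdf \<nu> y)" using that by (intro lower left) auto
    have up: "ennreal (cdf \<nu> y - cdf \<nu> x) \<le> g y * ennreal (y - x)" using that by (intro upper left) auto
    have d: "0 \<le> cdf \<nu> y - cdf \<nu> x" "0 \<le> cdf \<nu> z - cdf \<nu> y" using cdf_nondecreasing[of x y] cdf_nondecreasing[of y z] that by auto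
    have "ennreal (cdf \<nu> y - cdf \<nu> x) * ennreal (z - y) \<le> g y * ennreal (y - x) * ennreal (z - y)"
      by (intro mult_right_mono up) simp
    also have "\<dots> = g y * ennreal (z - y) * ennreal (y - x)" by (simp add: mult_ac)
    also have "\<dots> \<le> ennreal (cdf \<nu> z - cdf \<nu> y) * ennreal (y - x)" by (intro mult_right_mono lo) simp
    finally show ?thesis using d that by (simp add: ennreal_mult[symmetric])
  qed
  have slopesR: "(cdf \<nu> z - cdf \<nu> y) * (y - x) \<le> (cdf \<nu> y - cdf \<nu> x) * (z - y)" if "m < x" "x < y" "y < z" for x y z
  proof -
    have lo: "g y * ennreal (y - x) \<le> ennreal (cdf \<nu> y - cdf \<nu> x)" using that by (intro lower right) auto
    have up: "ennreal (cdf \<nu> z - cdf \<nu> y) \<le> g y * ennreal (z - y)" using that by (intro upper right) auto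
    have d: "0 \<le> cdf \<nu> y - cdf \<nu> x" "0 \<le> cdf \<nu> z - cdf \<nu> y" using cdf_nondecreasing[of x y] cdf_nondecreasing[of y z] that by auto
    have "ennreal (cdf \<nu> z - cdf \<nu> y) * ennreal (y - x) \<le> g y * ennreal (z - y) * ennreal (y - x)"
      by (intro mult_right_mono up) simp
    also have "\<dots> = g y * ennreal (y - x) * ennreal (z - y)" by (simp add: mult_ac)
    also have "\<dots> \<le> ennreal (cdf \<nu> y - cdf \<nu> x) * ennreal (z - y)" by (intro mult_right_mono lo) simp
    finally show ?thesis using d that by (simp add: ennreal_mult[symmetric])
  qed
  have "convex_on {..<m} (cdf \<nu>)"
  proof (rule convex_on_linorderI)
    fix t x y :: real assume t: "0 < t" "t < 1" "x \<in> {..<m}" "y \<in> {..<m}" "x < y"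
    define w where "w = (1 - t) *\<^sub>R x + t *\<^sub>R y"
    have w: "w - x = t * (y - x)" "y - w = (1 - t) * (y - x)" unfolding w_def by (auto simp: algebra_simps)
    have "0 < w - x" "0 < y - w" unfolding w using t by auto
    hence "(cdf \<nu> w - cdf \<nu> x) * (y - w) \<le> (cdf \<nu> y - cdf \<nu> w) * (w - x)" using t by (intro slopes) auto
    hence "(y - x) * ((cdf \<nu> w - cdf \<nu> x) * (1 - t)) \<le> (y - x) * ((cdf \<nu> y - cdf \<nu> w) * t)"
      unfolding w by (simp add: mult_ac)
    hence "(cdf \<nu> w - cdf \<nu> x) * (1 - t) \<le> (cdf \<nu> y - cdf \<nu> w) * t" using t by (simp only: mult_le_cancel_left_pos diff_gt_0_iff_gt)
    thus "cdf \<nu> ((1 - t) *\<^sub>R x + t *\<^sub>R y) \<le> (1 - t) * cdf \<nu> x + t * cdf \<nu> y" unfolding w_def[symmetric] by (simp add: algebra_simps)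
  qed simp
  moreover have "concave_on {m<..} (cdf \<nu>)" unfolding concave_on_def
  proof (rule convex_on_linorderI)
    fix t x y :: real assume t: "0 < t" "t < 1" "x \<in> {m<..}" "y \<in> {m<..}" "x < y"
    define w where "w = (1 - t) *\<^sub>R x + t *\<^sub>R y"
    have w: "w - x = t * (y - x)" "y - w = (1 - t) * (y - x)" unfolding w_def by (auto simp: algebra_simps)
    have "0 < w - x" "0 < y - w" unfolding w using t by auto
    hence "(cdf \<nu> y - cdf \<nu> w) * (w - x) \<le> (cdf \<nu> w - cdf \<nu> x) * (y - w)" using t by (intro slopesR) auto
    hence "(y - x) * ((cdf \<nu> y - cdf \<nu> w) * t) \<le> (y - x) * ((cdf \<nu> w - cdf \<nu> x) * (1 - t))"
      unfolding w by (simp add: mult_ac)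
    hence "(cdf \<nu> y - cdf \<nu> w) * t \<le> (cdf \<nu> w - cdf \<nu> x) * (1 - t)" using t by (simp only: mult_le_cancel_left_pos diff_gt_0_iff_gt)
    thus "- cdf \<nu> ((1 - t) *\<^sub>R x + t *\<^sub>R y) \<le> (1 - t) * - cdf \<nu> x + t * - cdf \<nu> y" unfolding w_def[symmetric] by (simp add: algebra_simps)
  qed simp
  ultimately show ?thesis unfolding unimodal_def by blast
qed

text \<open>The multiplicative convolution. The factor 1 / x carries no absolute value because it is
  applied to f vanishing on the nonpositive half line.\<close>

definition product_density :: "(real \<Rightarrow> real) \<Rightarrow> (real \<Rightarrow> real) \<Rightarrow> real \<Rightarrow> ennreal" where
  "product_density f \<psi> z = (\<integral>\<^sup>+x. ennreal (f x * \<psi> (z / x) / x) \<partial>lborel)"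

lemma measurable_product_density [measurable]:
  assumes [measurable]: "f \<in> borel_measurable borel" "\<psi> \<in> borel_measurable borel"
  shows "product_density f \<psi> \<in> borel_measurable borel"
  unfolding product_density_def[abs_def] by measurable

lemma real_distribution_product:
  assumes "real_distribution \<mu>" "real_distribution \<nu>"
  shows "real_distribution (distr (\<mu> \<Otimes>\<^sub>M \<nu>) borel (\<lambda>(x, y). x * y))"
proof -
  interpret \<mu>: real_distribution \<mu> by fact
  interpret \<nu>: real_distribution \<nu> by fact
  interpret P: pair_prob_space \<mu> \<nu> ..
  show ?thesis by (rule P.real_distribution_distr) measurable
qed

text \<open>The atom of Y contributes the law of m X with weight p. It is left as an integral over x
  because for m = 0 it is a point mass at 0.\<close>

lemma emeasure_product:
  assumes \<mu>: "real_distribution \<mu>" "\<mu> = density lborel (\<lambda>x. ennreal (f x))"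
    and f[measurable]: "f \<in> borel_measurable borel" and f0: "\<And>x. 0 \<le> f x" "\<And>x. x \<le> 0 \<Longrightarrow> f x = 0"
    and \<nu>: "real_distribution \<nu>" "unimodal_density \<nu> m p \<psi>" and A[measurable]: "A \<in> sets borel"
  shows "emeasure (distr (\<mu> \<Otimes>\<^sub>M \<nu>) borel (\<lambda>(x, y). x * y)) A =
    (\<integral>\<^sup>+x. ennreal (p * f x) * indicator A (x * m) \<partial>lborel) + (\<integral>\<^sup>+z. product_density f \<psi> z * indicator A z \<partial>lborel)"
proof -
  interpret \<mu>: real_distribution \<mu> by fact
  interpret \<nu>: real_distribution \<nu> by fact
  have [measurable]: "\<psi> \<in> borel_measurable borel" and \<psi>0: "\<And>x. 0 \<le> \<psi> x" and p: "0 \<le> p"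
    and em: "\<And>B. B \<in> sets borel \<Longrightarrow> emeasure \<nu> B = ennreal p * indicator B m + (\<integral>\<^sup>+x. ennreal (indicator B x * \<psi> x) \<partial>lborel)"
    using \<nu>(2) unfolding unimodal_density_def by auto
  have sec: "Pair x -` ((\<lambda>(x, y). x * y) -` A \<inter> space (\<mu> \<Otimes>\<^sub>M \<nu>)) = (\<lambda>y. x * y) -` A" for x :: real
    by (auto simp: space_pair_measure)
  have "emeasure (distr (\<mu> \<Otimes>\<^sub>M \<nu>) borel (\<lambda>(x, y). x * y)) A = emeasure (\<mu> \<Otimes>\<^sub>M \<nu>) ((\<lambda>(x, y). x * y) -` A \<inter> space (\<mu> \<Otimes>\<^sub>M \<nu>))"
    by (rule emeasure_distr) measurable
  also have "\<dots> = (\<integral>\<^sup>+x. emeasure \<nu> ((\<lambda>y. x * y) -` A) \<partial>\<mu>)"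
  proof -
    have "(\<lambda>(x, y). x * y) -` A \<inter> space (\<mu> \<Otimes>\<^sub>M \<nu>) \<in> sets (\<mu> \<Otimes>\<^sub>M \<nu>)"
      by (rule measurable_sets[OF _ A]) measurable
    thus ?thesis by (simp only: \<nu>.emeasure_pair_measure_alt sec)
  qed
  also have "\<dots> = (\<integral>\<^sup>+x. ennreal p * indicator A (x * m) + (\<integral>\<^sup>+y. ennreal (indicator A (x * y) * \<psi> y) \<partial>lborel) \<partial>\<mu>)"
  proof (intro nn_integral_cong)
    fix x :: real
    have "(\<lambda>y. x * y) -` A \<in> sets borel" using measurable_sets_borel[of "\<lambda>y. x * y" borel A] by simp
    from em[OF this] show "emeasure \<nu> ((\<lambda>y. x * y) -` A) = ennreal p * indicator A (x * m) + (\<integral>\<^sup>+y. ennreal (indicator A (x * y) * \<psi> y) \<partial>lborel)"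
      by (simp add: indicator_def)
  qed
  also have "\<dots> = (\<integral>\<^sup>+x. ennreal (f x) * (ennreal p * indicator A (x * m) + (\<integral>\<^sup>+y. ennreal (indicator A (x * y) * \<psi> y) \<partial>lborel)) \<partial>lborel)"
    unfolding \<mu>(2) by (subst nn_integral_density) auto
  also have "\<dots> = (\<integral>\<^sup>+x. ennreal (p * f x) * indicator A (x * m) + (\<integral>\<^sup>+z. ennreal (f x * \<psi> (z / x) / x) * indicator A z \<partial>lborel) \<partial>lborel)"
  proof (intro nn_integral_cong)
    fix x :: real
    have "ennreal (f x) * (\<integral>\<^sup>+y. ennreal (indicator A (x * y) * \<psi> y) \<partial>lborel) = (\<integral>\<^sup>+z. ennreal (f x * \<psi> (z / x) / x) * indicator A z \<partial>lborel)"
    proof (cases "0 < x")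
      case True
      have 1: "(\<integral>\<^sup>+y. ennreal (indicator A (x * y) * \<psi> y) \<partial>lborel) = ennreal \<bar>1 / x\<bar> * (\<integral>\<^sup>+z. ennreal (indicator A (x * (0 + 1 / x * z)) * \<psi> (0 + 1 / x * z)) \<partial>lborel)"
        using True by (intro nn_integral_real_affine) auto
      have "ennreal (f x) * (\<integral>\<^sup>+y. ennreal (indicator A (x * y) * \<psi> y) \<partial>lborel) = (\<integral>\<^sup>+z. ennreal (f x) * (ennreal \<bar>1 / x\<bar> * ennreal (indicator A (x * (0 + 1 / x * z)) * \<psi> (0 + 1 / x * z))) \<partial>lborel)"
        unfolding 1 by (simp add: nn_integral_cmult)
      also have "\<dots> = (\<integral>\<^sup>+z. ennreal (f x * \<psi> (z / x) / x) * indicator A z \<partial>lborel)"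
        using True f0 \<psi>0 by (intro nn_integral_cong) (auto simp: indicator_def ennreal_mult[symmetric])
      finally show ?thesis .
    next
      case False
      hence "f x = 0" using f0(2)[of x] by linarith
      thus ?thesis by simp
    qed
    thus "ennreal (f x) * (ennreal p * indicator A (x * m) + (\<integral>\<^sup>+y. ennreal (indicator A (x * y) * \<psi> y) \<partial>lborel))
      = ennreal (p * f x) * indicator A (x * m) + (\<integral>\<^sup>+z. ennreal (f x * \<psi> (z / x) / x) * indicator A z \<partial>lborel)"
      using f0(1)[of x] p by (simp add: distrib_left ennreal_mult mult_ac)
  qed
  also have "\<dots> = (\<integral>\<^sup>+x. ennreal (p * f x) * indicator A (x * m) \<partial>lborel) +
      (\<integral>\<^sup>+x. \<integral>\<^sup>+z. ennreal (f x * \<psi> (z / x) / x) * indicator A z \<partial>lborel \<partial>lborel)"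
    by (intro nn_integral_add) measurable
  also have "(\<integral>\<^sup>+x. \<integral>\<^sup>+z. ennreal (f x * \<psi> (z / x) / x) * indicator A z \<partial>lborel \<partial>lborel) =
      (\<integral>\<^sup>+z. \<integral>\<^sup>+x. ennreal (f x * \<psi> (z / x) / x) * indicator A z \<partial>lborel \<partial>lborel)"
    by (rule lborel_pair.Fubini') measurable
  also have "\<dots> = (\<integral>\<^sup>+z. product_density f \<psi> z * indicator A z \<partial>lborel)"
    unfolding product_density_def by (simp add: nn_integral_multc)
  finally show ?thesis .
qed

section \<open>Products with a law of positive mode\<close>

lemma ennreal_top_unique_ge:
  fixes x :: ennreal
  assumes "\<And>n::nat. of_nat n \<le> x"
  shows "x = \<infinity>"
proof (cases x)
  case (real r)
  obtain n :: nat where "r < n" using reals_Archimedean2 by blast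
  moreover have "ennreal (real n) \<le> ennreal r" using assms[of n] real by (simp add: ennreal_of_nat_eq_real_of_nat)
  ultimately show ?thesis using real by (simp add: ennreal_le_iff)
qed simp

lemma nn_integral_dilate:
  fixes f :: "real \<Rightarrow> ennreal"
  assumes [measurable]: "f \<in> borel_measurable borel" and "0 < c"
  shows "(\<integral>\<^sup>+x. f x \<partial>lborel) = ennreal c * (\<integral>\<^sup>+x. f (c * x) \<partial>lborel)"
  using nn_integral_real_affine[of f c 0] assms by simp

text \<open>The density of X * Y for a mode m > 0: the atom of Y now contributes the density of m X
  with weight p.\<close>

definition pdens :: "(real \<Rightarrow> real) \<Rightarrow> (real \<Rightarrow> real) \<Rightarrow> real \<Rightarrow> real \<Rightarrow> real \<Rightarrow> ennreal" where
  "pdens f \<psi> m p z = ennreal (p * f (z / m) / m) + product_density f \<psi> z"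

text \<open>The differences \<open>\<psi> (h * y) - \<psi> y\<close> of a unimodal function change sign once. Multiplied with a
  kernel that is totally positive of order two, they still change sign at most once.\<close>

context
  fixes f \<psi> :: "real \<Rightarrow> real" and m p :: real
  assumes f[measurable]: "f \<in> borel_measurable borel" and f0: "\<And>x. 0 \<le> f x" "\<And>x. x \<le> 0 \<Longrightarrow> f x = 0"
    and \<psi>[measurable]: "\<psi> \<in> borel_measurable borel" and \<psi>0: "\<And>x. 0 \<le> \<psi> x"
    and inc: "\<And>x y. x \<le> y \<Longrightarrow> y < m \<Longrightarrow> \<psi> x \<le> \<psi> y" and dec: "\<And>x y. m < x \<Longrightarrow> x \<le> y \<Longrightarrow> \<psi> y \<le> \<psi> x"
    and m: "0 < m" and p: "0 \<le> p"
    and tp: "\<And>a b r. 0 < a \<Longrightarrow> 1 \<le> r \<Longrightarrow> a * r \<le> b \<Longrightarrow> f a * f b \<le> f (a * r) * f (b / r)"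
    and cont: "\<And>x. 0 < x \<Longrightarrow> 0 < f x \<Longrightarrow> isCont f x"
begin

abbreviation pd :: "real \<Rightarrow> ennreal" where
  "pd \<equiv> pdens f \<psi> m p"

lemma product_density_scaled:
  assumes "0 < z" "0 < h"
  shows "product_density f \<psi> (h * z) = (\<integral>\<^sup>+v. ennreal (f (z * v) * \<psi> (h / v) / v) \<partial>lborel)"
proof -
  have "product_density f \<psi> (h * z) = ennreal z * (\<integral>\<^sup>+v. ennreal (f (z * v) * \<psi> (h * z / (z * v)) / (z * v)) \<partial>lborel)"
    unfolding product_density_def using assms by (intro nn_integral_dilate) auto
  also have "\<dots> = (\<integral>\<^sup>+v. ennreal z * ennreal (f (z * v) * \<psi> (h * z / (z * v)) / (z * v)) \<partial>lborel)"
    by (subst nn_integral_cmult) auto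
  also have "\<dots> = (\<integral>\<^sup>+v. ennreal (f (z * v) * \<psi> (h / v) / v) \<partial>lborel)"
    using assms by (intro nn_integral_cong) (auto simp: ennreal_mult'[symmetric])
  finally show ?thesis .
qed

text \<open>For y < m / h both y and h y lie in the increasing range of \<psi>, for y > m both in
  the decreasing one. In between, \<psi> (h y) decreases and \<psi> y increases, so the sign changes
  once. The points m / h and m are left out since \<psi> m is arbitrary.\<close>

lemma sign_change:
  assumes h: "1 < h"
  obtains w where "m / h \<le> w" "w \<le> m"
    "\<And>y. y < w \<Longrightarrow> y \<noteq> m / h \<Longrightarrow> 0 < y \<Longrightarrow> \<psi> y \<le> \<psi> (h * y)" "\<And>y. w < y \<Longrightarrow> y \<noteq> m \<Longrightarrow> \<psi> (h * y) \<le> \<psi> y"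
proof -
  \<comment> \<open>The point m is added to make P nonempty; w is then the place where the
    difference starts to be negative.\<close>
  define P where "P = {y \<in> {m / h..m}. y = m \<or> (m / h < y \<and> \<psi> (h * y) < \<psi> y)}"
  have mh: "m / h \<le> m" using h m by (simp add: field_simps)
  have P: "m \<in> P" "bdd_below P" using mh unfolding P_def by auto
  define w where "w = Inf P"
  have w: "m / h \<le> w" "w \<le> m"
    unfolding w_def using P by (auto intro!: cInf_greatest cInf_lower simp: P_def)
  show thesis
  proof (rule that[OF w])
    fix y assume y: "y < w" "y \<noteq> m / h" "0 < y"
    show "\<psi> y \<le> \<psi> (h * y)"
    proof (cases "y < m / h")
      case True
      have "y \<le> h * y" using h y(3) by simp
      moreover have "h * y < m" using True h by (simp add: field_simps)
      ultimately show ?thesis by (rule inc)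
    next
      case False
      have "y \<notin> P" using y(1) P(2) unfolding w_def by (meson cInf_lower not_le)
      thus ?thesis using False y w unfolding P_def by auto
    qed
  next
    fix y assume y: "w < y" "y \<noteq> m"
    have "0 < m / h" using m h by simp
    hence y0: "0 < y" "m / h < y" using w y by auto
    have hm: "m < h * y" using y0(2) h by (simp add: field_simps)
    show "\<psi> (h * y) \<le> \<psi> y"
    proof (cases "m < y")
      case True
      thus ?thesis using h y0 by (intro dec) auto
    next
      case False
      obtain y' where y': "y' \<in> P" "y' < y" using y(1) P cInf_lessD[of P y] unfolding w_def by blast
      hence *: "m / h < y'" "\<psi> (h * y') < \<psi> y'" using False y unfolding P_def by auto
      have "m < h * y'" using *(1) h by (simp add: field_simps)
      hence "\<psi> (h * y) \<le> \<psi> (h * y')" using y' h by (intro dec) auto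
      also have "\<dots> \<le> \<psi> y'" using * by simp
      also have "\<dots> \<le> \<psi> y" using y' False y by (intro inc) auto
      finally show ?thesis .
    qed
  qed
qed

lemma add_le_cancel_strict:
  fixes a b c d :: ennreal
  assumes "a + b \<le> c + d" "c < b"
  shows "a \<le> d"
proof (cases d)
  case (real d')
  obtain c' where c: "c = ennreal c'" "0 \<le> c'" using assms(2) by (cases c) auto
  have "c + d < \<infinity>" using real c by simp
  with assms(1) have "a + b < \<infinity>" by (rule le_less_trans)
  then obtain a' b' where ab: "a = ennreal a'" "b = ennreal b'" "0 \<le> a'" "0 \<le> b'" by (cases a; cases b) auto
  have "a' + b' \<le> c' + d'" "c' < b'" using assms real c ab by (simp_all add: ennreal_less_iff flip: ennreal_plus)
  thus ?thesis using real ab by (simp add: ennreal_leI)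
qed simp

text \<open>In the variable u, the difference pd (h z) - pd z integrates f (z u) against \<psi> (h /
  u) - \<psi> (1 / u), which is negative before v = 1 / w and positive after it. By total positivity
  f (z2 u) / f (z1 u) is nonincreasing in u where it is defined, so passing from z1 to z2 shifts
  weight to the negative part. The factors c and d equalise the weights at v, and sums replace
  differences since the values may be infinite.\<close>

lemma single_crossing:
  assumes z: "0 < z1" "z1 \<le> z2" and h: "1 < h" and less: "pd (h * z1) < pd z1"
  shows "pd (h * z2) \<le> pd z2"
proof -
  obtain w where w: "m / h \<le> w" "w \<le> m"
    and up: "\<And>y. y < w \<Longrightarrow> y \<noteq> m / h \<Longrightarrow> 0 < y \<Longrightarrow> \<psi> y \<le> \<psi> (h * y)"
    and down: "\<And>y. w < y \<Longrightarrow> y \<noteq> m \<Longrightarrow> \<psi> (h * y) \<le> \<psi> y" using sign_change[OF h] by blast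
  have "0 < m / h" using m h by simp
  hence w0: "0 < w" using w by simp
  define v where "v = 1 / w"
  have v: "0 < v" "1 / m \<le> v" "v \<le> h / m" unfolding v_def using w w0 m h by (auto simp: field_simps)
  define c d where "c = f (z1 * v)" and "d = f (z2 * v)"
  have cd0: "0 \<le> c" "0 \<le> d" unfolding c_def d_def using f0 by auto
  have z2: "0 < z2" using z by simp
  have lo: "f (z1 * u) * d \<le> c * f (z2 * u)" if "0 < u" "u \<le> v" for u
    using tp[of "z1 * u" "v / u" "z2 * v"] that z z2 mult_right_mono[OF z(2), of v] v unfolding c_def d_def by (simp add: field_simps)
  have hi: "c * f (z2 * u) \<le> f (z1 * u) * d" if "v \<le> u" for u
    using tp[of "z1 * v" "u / v" "z2 * u"] that z z2 mult_right_mono[OF z(2), of u] v unfolding c_def d_def by (simp add: field_simps)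
  have Kpos: "\<psi> (1 / u) \<le> \<psi> (h / u)" if "v < u" "u \<noteq> h / m" for u
    using up[of "1 / u"] that v w0 m h unfolding v_def by (simp add: field_simps)
  have Kneg: "\<psi> (h / u) \<le> \<psi> (1 / u)" if "0 < u" "u < v" "u \<noteq> 1 / m" for u
    using down[of "1 / u"] that v w0 m h unfolding v_def by (simp add: field_simps)
  have ae: "AE u in lborel. u \<noteq> v \<and> u \<noteq> 1 / m \<and> u \<noteq> h / m"
    using AE_lborel_singleton[of v] AE_lborel_singleton[of "1 / m"] AE_lborel_singleton[of "h / m"] by eventually_elim simp
  define a1 a2 b1 b2 where
    "a1 = (\<lambda>u. ennreal (f (z1 * u) * \<psi> (h / u) / u))" and "a2 = (\<lambda>u. ennreal (f (z2 * u) * \<psi> (h / u) / u))" and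
    "b1 = (\<lambda>u. ennreal (f (z1 * u) * \<psi> (1 / u) / u))" and "b2 = (\<lambda>u. ennreal (f (z2 * u) * \<psi> (1 / u) / u))"
  define pa1 pa2 pb1 pb2 where "pa1 = p * f (z1 * (h / m)) / m" and "pa2 = p * f (z2 * (h / m)) / m"
    and "pb1 = p * f (z1 * (1 / m)) / m" and "pb2 = p * f (z2 * (1 / m)) / m"
  have pn: "0 \<le> pa1" "0 \<le> pa2" "0 \<le> pb1" "0 \<le> pb2"
    unfolding pa1_def pa2_def pb1_def pb2_def using p f0 m by auto
  have [measurable]: "a1 \<in> borel_measurable lborel" "a2 \<in> borel_measurable lborel" "b1 \<in> borel_measurable lborel" "b2 \<in> borel_measurable lborel"
    unfolding a1_def a2_def b1_def b2_def by measurable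
  have G: "pd (h * z1) = ennreal pa1 + integral\<^sup>N lborel a1" "pd (h * z2) = ennreal pa2 + integral\<^sup>N lborel a2"
    "pd z1 = ennreal pb1 + integral\<^sup>N lborel b1" "pd z2 = ennreal pb2 + integral\<^sup>N lborel b2"
    using product_density_scaled[of z1 h] product_density_scaled[of z2 h] product_density_scaled[of z1 1] product_density_scaled[of z2 1] z z2 h
    unfolding pdens_def pa1_def pa2_def pb1_def pb2_def a1_def a2_def b1_def b2_def by (auto simp: mult.commute)
  show ?thesis
  proof (cases "c = 0")
    \<comment> \<open>Here f vanishes at z1 v, and its support, an interval, lies on one side of
      that point. If it lies to the left, only the range u < v of negative difference matters for
      z2; if it lies to the right, \<open>less\<close> is contradicted.\<close>
    case True
    have ex: "\<exists>u. 0 < u \<and> u < v \<and> 0 < f (z1 * u)" if "d = 0"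
    proof (rule ccontr)
      assume "\<nexists>u. 0 < u \<and> u < v \<and> 0 < f (z1 * u)"
      hence z0: "f (z1 * u) = 0" if "u < v" for u
        using that f0(1)[of "z1 * u"] f0(2)[of "z1 * u"] z by (cases "0 < u") (auto simp: mult_nonneg_nonpos2 mult_nonneg_nonpos less_le)
      have "pd z1 \<le> pd (h * z1)" unfolding G
      proof (intro add_mono nn_integral_mono_AE)
        have "f (z1 * (1 / m)) = 0" using z0[of "1 / m"] True v unfolding c_def by (cases "1 / m = v") auto
        thus "ennreal pb1 \<le> ennreal pa1" using pn unfolding pb1_def by simp
        show "AE u in lborel. b1 u \<le> a1 u" using ae
        proof eventually_elim
          case (elim u)
          show ?case
          proof (cases "u < v")
            case True thus ?thesis unfolding a1_def b1_def using z0 by simp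
          next
            case False
            thus ?thesis unfolding a1_def b1_def using Kpos[of u] elim f0 v
              by (intro ennreal_leI divide_right_mono mult_left_mono) auto
          qed
        qed
      qed
      thus False using less by simp
    qed
    show ?thesis
    proof (cases "d = 0")
      case True
      then obtain u where u: "0 < u" "u < v" "0 < f (z1 * u)" using ex by blast
      have z0: "f x = 0" if "z1 * v \<le> x" for x
      proof -
        have "f (z1 * u) * f x \<le> f (z1 * u * (v / u)) * f (x / (v / u))" using u that z by (intro tp) (auto simp: field_simps)
        also have "\<dots> = 0" using \<open>c = 0\<close> u unfolding c_def by simp
        finally show ?thesis using u f0(1)[of x] by (simp add: mult_le_0_iff)
      qed
      have z0': "f (z2 * x) = 0" if "v \<le> x" for x
        using z0[of "z2 * x"] that z v z2 mult_mono[OF z(2) that] by simp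
      show ?thesis unfolding G
      proof (intro add_mono nn_integral_mono_AE)
        show "ennreal pa2 \<le> ennreal pb2" using pn z0'[of "h / m"] v unfolding pa2_def by simp
        show "AE u in lborel. a2 u \<le> b2 u" using ae
        proof eventually_elim
          case (elim u)
          consider "u \<le> 0" | "0 < u" "u < v" | "v \<le> u" by linarith
          then show ?case
          proof cases
            case 1 thus ?thesis unfolding a2_def b2_def using f0(2)[of "z2 * u"] z2 by (simp add: mult_nonneg_nonpos)
          next
            case 2
            thus ?thesis unfolding a2_def b2_def using Kneg[of u] elim f0
              by (intro ennreal_leI divide_right_mono mult_left_mono) auto
          next
            case 3 thus ?thesis unfolding a2_def b2_def using z0' by simp
          qed
        qed
      qed
    next
      case False
      hence d: "0 < d" using cd0 by simp
      have z0: "f (z1 * u) = 0" if "u \<le> v" for u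
      proof (cases "0 < u")
        case True thus ?thesis using lo[of u] that \<open>c = 0\<close> d f0(1)[of "z1 * u"] by (simp add: mult_le_0_iff)
      next
        case False thus ?thesis using f0(2)[of "z1 * u"] z by (simp add: mult_nonneg_nonpos)
      qed
      have "pd z1 \<le> pd (h * z1)" unfolding G
      proof (intro add_mono nn_integral_mono_AE)
        show "ennreal pb1 \<le> ennreal pa1" using pn z0[of "1 / m"] v unfolding pb1_def by simp
        show "AE u in lborel. b1 u \<le> a1 u" using ae
        proof eventually_elim
          case (elim u)
          show ?case
          proof (cases "u < v")
            case True thus ?thesis unfolding a1_def b1_def using z0 by simp
          next
            case False
            thus ?thesis unfolding a1_def b1_def using Kpos[of u] elim f0 v
              by (intro ennreal_leI divide_right_mono mult_left_mono) auto
          qed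
        qed
      qed
      thus ?thesis using less by simp
    qed
  next
    case False
    hence c: "0 < c" using cd0 by simp
    have atoms: "c * pa2 + d * pb1 \<le> d * pa1 + c * pb2"
    proof (intro add_mono)
      have "c * f (z2 * (h / m)) \<le> f (z1 * (h / m)) * d" using hi[of "h / m"] v by simp
      from mult_left_mono[OF this, of "p / m"] show "c * pa2 \<le> d * pa1"
        using p m unfolding pa1_def pa2_def by (simp add: mult_ac)
      have "f (z1 * (1 / m)) * d \<le> c * f (z2 * (1 / m))" using lo[of "1 / m"] v m by simp
      from mult_left_mono[OF this, of "p / m"] show "d * pb1 \<le> c * pb2"
        using p m unfolding pb1_def pb2_def by (simp add: mult_ac)
    qed
    have ints: "ennreal c * integral\<^sup>N lborel a2 + ennreal d * integral\<^sup>N lborel b1 \<le> ennreal d * integral\<^sup>N lborel a1 + ennreal c * integral\<^sup>N lborel b2"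
      unfolding nn_integral_cmult[symmetric, OF \<open>a2 \<in> _\<close>] nn_integral_cmult[symmetric, OF \<open>a1 \<in> _\<close>]
        nn_integral_cmult[symmetric, OF \<open>b2 \<in> _\<close>] nn_integral_cmult[symmetric, OF \<open>b1 \<in> _\<close>]
    proof (subst (1 2) nn_integral_add[symmetric])
      show "(\<integral>\<^sup>+u. ennreal c * a2 u + ennreal d * b1 u \<partial>lborel) \<le> (\<integral>\<^sup>+u. ennreal d * a1 u + ennreal c * b2 u \<partial>lborel)"
      proof (rule nn_integral_mono_AE)
        show "AE u in lborel. ennreal c * a2 u + ennreal d * b1 u \<le> ennreal d * a1 u + ennreal c * b2 u" using ae
        proof eventually_elim
          case (elim u)
          show ?case
          proof (cases "0 < u")
            case True
            define s t where "s = \<psi> (h / u)" and "t = \<psi> (1 / u)"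
            have st: "0 \<le> s" "0 \<le> t" unfolding s_def t_def using \<psi>0 by auto
            have "(c * f (z2 * u) - f (z1 * u) * d) * (s - t) \<le> 0"
            proof (cases "u < v")
              case True2: True
              thus ?thesis using lo[of u] Kneg[of u] elim True unfolding s_def t_def by (intro mult_nonneg_nonpos) auto
            next
              case False
              thus ?thesis using hi[of u] Kpos[of u] elim unfolding s_def t_def by (intro mult_nonpos_nonneg) auto
            qed
            hence "c * (f (z2 * u) * s) + d * (f (z1 * u) * t) \<le> d * (f (z1 * u) * s) + c * (f (z2 * u) * t)"
              by (simp add: algebra_simps)
            hence "(c * (f (z2 * u) * s) + d * (f (z1 * u) * t)) / u \<le> (d * (f (z1 * u) * s) + c * (f (z2 * u) * t)) / u"
              using True by (intro divide_right_mono) auto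
            hence "ennreal ((c * (f (z2 * u) * s) + d * (f (z1 * u) * t)) / u) \<le> ennreal ((d * (f (z1 * u) * s) + c * (f (z2 * u) * t)) / u)"
              by (rule ennreal_leI)
            thus ?thesis unfolding a1_def a2_def b1_def b2_def s_def[symmetric] t_def[symmetric] using True cd0 f0(1) st
              by (simp add: add_divide_distrib ennreal_mult'[symmetric] flip: ennreal_plus)
          next
            case False
            thus ?thesis unfolding a1_def a2_def b1_def b2_def using f0(2)[of "z1 * u"] f0(2)[of "z2 * u"] z z2
              by (simp add: mult_nonneg_nonpos)
          qed
        qed
      qed
    qed measurable
    have main: "ennreal c * pd (h * z2) + ennreal d * pd z1 \<le> ennreal d * pd (h * z1) + ennreal c * pd z2"
    proof -
      have "ennreal c * ennreal pa2 + ennreal d * ennreal pb1 \<le> ennreal d * ennreal pa1 + ennreal c * ennreal pb2"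
        using atoms cd0 pn by (simp add: ennreal_mult[symmetric] ennreal_leI flip: ennreal_plus)
      from add_mono[OF this ints] show ?thesis unfolding G distrib_left by (simp add: ac_simps)
    qed
    have "ennreal c * pd (h * z2) \<le> ennreal c * pd z2"
    proof (cases "d = 0")
      case True thus ?thesis using main by simp
    next
      case False
      hence "ennreal d * pd (h * z1) < ennreal d * pd z1"
        using less cd0 by (intro ennreal_mult_strict_left_mono) auto
      thus ?thesis using main by (rule add_le_cancel_strict[rotated])
    qed
    thus ?thesis using c by (simp add: ennreal_mult_le_mult_iff)
  qed
qed


text \<open>Being nonnegative and continuous where it is positive, f is lower semicontinuous on the
  positive half line, and Fatou's lemma carries this over to the density.\<close>

lemma pdens_lsc:
  assumes z: "0 < z" and u: "u \<longlonglongrightarrow> z" "\<And>n. 0 < u n"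
  shows "pd z \<le> liminf (\<lambda>n. pd (u n))"
proof -
  \<comment> \<open>The atom term is spread over (0, 1), so that one application of Fatou's lemma
    covers both terms of \<open>pdens\<close>.\<close>
  define J where "J x v = ennreal (f (x * v) * \<psi> (1 / v) / v) + ennreal (indicator {0<..<1} v * (p * f (x / m) / m))" for x v
  have Jm[measurable]: "J x \<in> borel_measurable lborel" for x unfolding J_def by measurable
  have J: "pd x = integral\<^sup>N lborel (J x)" if "0 < x" for x
  proof -
    have "(\<integral>\<^sup>+v. ennreal (indicator {0<..<1::real} v * (p * f (x / m) / m)) \<partial>lborel) = (\<integral>\<^sup>+v. ennreal (p * f (x / m) / m) * indicator {0<..<1::real} v \<partial>lborel)"
      by (intro nn_integral_cong) (auto simp: indicator_def)
    also have "\<dots> = ennreal (p * f (x / m) / m)" by (simp add: nn_integral_cmult_indicator)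
    finally have e: "(\<integral>\<^sup>+v. ennreal (indicator {0<..<1::real} v * (p * f (x / m) / m)) \<partial>lborel) = ennreal (p * f (x / m) / m)" .
    have "integral\<^sup>N lborel (J x) = (\<integral>\<^sup>+v. ennreal (f (x * v) * \<psi> (1 / v) / v) \<partial>lborel)
      + (\<integral>\<^sup>+v. ennreal (indicator {0<..<1::real} v * (p * f (x / m) / m)) \<partial>lborel)"
      unfolding J_def[abs_def] by (intro nn_integral_add) measurable
    thus ?thesis unfolding e using product_density_scaled[of x 1] that by (simp add: pdens_def add.commute)
  qed
  have lim: "(\<lambda>n. f (u n * c)) \<longlonglongrightarrow> f (z * c)" if "0 < c" "0 < f (z * c)" for c
    by (rule isCont_tendsto_compose[OF cont]) (use that z in \<open>auto intro!: tendsto_intros u\<close>)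
  have "J z v \<le> liminf (\<lambda>n. J (u n) v)" for v
  proof -
    define a b where "a n = f (u n * v) * \<psi> (1 / v) / v" and "b n = indicator {0<..<1} v * (p * f (u n / m) / m)" for n
    have b0: "0 \<le> b n" for n unfolding b_def using p f0 m by simp
    have cv: "(\<lambda>n. b n) \<longlonglongrightarrow> indicator {0<..<1} v * (p * f (z / m) / m)" if "0 < f (z / m)"
      unfolding b_def using lim[of "1 / m"] that m by (intro tendsto_intros) auto
    have ca: "(\<lambda>n. a n) \<longlonglongrightarrow> f (z * v) * \<psi> (1 / v) / v" if "0 < v" "0 < f (z * v)"
      unfolding a_def using lim[of v] that by (intro tendsto_intros) auto
    define A B where "A = f (z * v) * \<psi> (1 / v) / v" and "B = indicator {0<..<1} v * (p * f (z / m) / m)"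
    have AB: "ennreal A + ennreal B \<le> liminf (\<lambda>n. ennreal (a n) + ennreal (b n))"
    proof -
      consider "A \<le> 0" "B \<le> 0" | "A \<le> 0" "0 < B" | "0 < A" "B \<le> 0" | "0 < A" "0 < B" by linarith
      then show ?thesis
      proof cases
        case 1 thus ?thesis by (simp add: ennreal_neg)
      next
        case 2
        hence "0 < f (z / m)" using f0(1)[of "z / m"] unfolding B_def by (cases "f (z / m) = 0") auto
        hence "(\<lambda>n. ennreal (b n)) \<longlonglongrightarrow> ennreal B" unfolding B_def by (intro tendsto_ennrealI cv)
        hence "ennreal B = liminf (\<lambda>n. ennreal (b n))" by (simp add: lim_imp_Liminf)
        also have "\<dots> \<le> liminf (\<lambda>n. ennreal (a n) + ennreal (b n))" by (intro Liminf_mono always_eventually) auto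
        finally show ?thesis using 2 by (simp add: ennreal_neg)
      next
        case 3
        hence "0 < v" using f0(2)[of "z * v"] z unfolding A_def by (cases "0 < v") (auto simp: mult_nonneg_nonpos)
        moreover have "0 < f (z * v)" using 3 f0(1)[of "z * v"] unfolding A_def by (cases "f (z * v) = 0") auto
        ultimately have "(\<lambda>n. ennreal (a n)) \<longlonglongrightarrow> ennreal A" unfolding A_def by (intro tendsto_ennrealI ca)
        hence "ennreal A = liminf (\<lambda>n. ennreal (a n))" by (simp add: lim_imp_Liminf)
        also have "\<dots> \<le> liminf (\<lambda>n. ennreal (a n) + ennreal (b n))" by (intro Liminf_mono always_eventually) auto
        finally show ?thesis using 3 by (simp add: ennreal_neg)
      next
        case 4
        hence "0 < v" using f0(2)[of "z * v"] z unfolding A_def by (cases "0 < v") (auto simp: mult_nonneg_nonpos)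
        moreover have "0 < f (z * v)" using 4 f0(1)[of "z * v"] unfolding A_def by (cases "f (z * v) = 0") auto
        ultimately have "(\<lambda>n. ennreal (a n)) \<longlonglongrightarrow> ennreal A" unfolding A_def by (intro tendsto_ennrealI ca)
        moreover have "0 < f (z / m)" using 4 f0(1)[of "z / m"] unfolding B_def by (cases "f (z / m) = 0") auto
        hence "(\<lambda>n. ennreal (b n)) \<longlonglongrightarrow> ennreal B" unfolding B_def by (intro tendsto_ennrealI cv)
        ultimately have "(\<lambda>n. ennreal (a n) + ennreal (b n)) \<longlonglongrightarrow> ennreal A + ennreal B" by (rule tendsto_add)
        hence "liminf (\<lambda>n. ennreal (a n) + ennreal (b n)) = ennreal A + ennreal B" by (simp add: lim_imp_Liminf)
        thus ?thesis by simp
      qed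
    qed
    thus ?thesis unfolding J_def A_def B_def a_def b_def .
  qed
  hence "integral\<^sup>N lborel (J z) \<le> (\<integral>\<^sup>+v. liminf (\<lambda>n. J (u n) v) \<partial>lborel)" by (intro nn_integral_mono)
  also have "\<dots> \<le> liminf (\<lambda>n. integral\<^sup>N lborel (J (u n)))" by (intro nn_integral_liminf) measurable
  finally show ?thesis using J z u by simp
qed

text \<open>Divide the way from z1 to z2 into n steps of equal ratio h. At least one of them
  descends strictly, so by \<open>single_crossing\<close> every later step by the factor h does not
  ascend. As n grows, points h^k a converge to b, where lower semicontinuity gives the
  bound.\<close>

lemma pdens_decreasing_after:
  assumes z: "0 < z1" "z1 < z2" and less: "pd z2 < pd z1" and ab: "z2 \<le> a" "a \<le> b"
  shows "pd b \<le> pd a"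
proof -
  define L t where "L = ln (z2 / z1)" and "t = ln (b / a) / L"
  have L: "0 < L" unfolding L_def using z by simp
  have a: "0 < a" using z ab by simp
  have t: "0 \<le> t" unfolding t_def using L a ab by simp
  have step: "pd (exp (L / n) ^ k * a) \<le> pd a" if n: "0 < n" for n k :: nat
  proof -
    define h where "h = exp (L / n)"
    have h: "1 < h" unfolding h_def using L n by simp
    have hn: "z1 * h ^ n = z2" unfolding h_def exp_of_nat_mult[symmetric] L_def using n z by simp
    have "\<exists>i<n. pd (h * (z1 * h ^ i)) < pd (z1 * h ^ i)"
    proof (rule ccontr)
      assume "\<not> ?thesis"
      hence *: "pd (z1 * h ^ i) \<le> pd (h * (z1 * h ^ i))" if "i < n" for i using that by (meson not_less)
      have "i \<le> n \<Longrightarrow> pd z1 \<le> pd (z1 * h ^ i)" for i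
      proof (induction i)
        case (Suc i)
        thus ?case using *[of i] by (simp add: mult_ac)
      qed simp
      thus False using less hn by (metis leD order_refl)
    qed
    then obtain i where i: "i < n" "pd (h * (z1 * h ^ i)) < pd (z1 * h ^ i)" by blast
    have "z1 * h ^ i \<le> z1 * h ^ n" using i h z by (intro mult_left_mono power_increasing) auto
    hence zi: "z1 * h ^ i \<le> a" using hn ab by simp
    have "pd (h ^ k * a) \<le> pd a"
    proof (induction k)
      case (Suc k)
      have "1 * a \<le> h ^ k * a" using h a by (intro mult_right_mono one_le_power) auto
      hence "pd (h * (h ^ k * a)) \<le> pd (h ^ k * a)"
        using z h zi by (intro single_crossing[OF _ _ h i(2)]) auto
      thus ?case using Suc by (simp add: mult_ac)
    qed simp
    thus ?thesis unfolding h_def .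
  qed
  \<comment> \<open>The powers of the step ratio are rounded down so that u tends to b;
    \<open>Suc n\<close> avoids division by 0.\<close>
  define u where "u n = exp (L / real (Suc n)) ^ nat \<lfloor>real (Suc n) * t\<rfloor> * a" for n
  have u_eq: "u n = exp (L * (real (nat \<lfloor>real (Suc n) * t\<rfloor>) / real (Suc n))) * a" for n
    unfolding u_def exp_of_nat_mult[symmetric] by (simp add: field_simps)
  have "(\<lambda>n. real (nat \<lfloor>real (Suc n) * t\<rfloor>) / real (Suc n)) \<longlonglongrightarrow> t"
  proof (rule tendsto_sandwich)
    have fl: "real (Suc n) * t - 1 \<le> real (nat \<lfloor>real (Suc n) * t\<rfloor>)" "real (nat \<lfloor>real (Suc n) * t\<rfloor>) \<le> real (Suc n) * t" for n
    proof -
      have "0 \<le> real (Suc n) * t" using t by (intro mult_nonneg_nonneg) auto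
      hence "real (nat \<lfloor>real (Suc n) * t\<rfloor>) = of_int \<lfloor>real (Suc n) * t\<rfloor>" by (intro of_nat_nat) (simp add: zero_le_floor)
      thus "real (Suc n) * t - 1 \<le> real (nat \<lfloor>real (Suc n) * t\<rfloor>)" "real (nat \<lfloor>real (Suc n) * t\<rfloor>) \<le> real (Suc n) * t"
        by linarith+
    qed
    show "\<forall>\<^sub>F n in sequentially. t - 1 / real (Suc n) \<le> real (nat \<lfloor>real (Suc n) * t\<rfloor>) / real (Suc n)"
    proof (intro always_eventually allI)
      fix n
      have "t - 1 / real (Suc n) = (real (Suc n) * t - 1) / real (Suc n)" by (simp add: diff_divide_distrib del: of_nat_Suc)
      also have "\<dots> \<le> real (nat \<lfloor>real (Suc n) * t\<rfloor>) / real (Suc n)" by (intro divide_right_mono fl) auto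
      finally show "t - 1 / real (Suc n) \<le> real (nat \<lfloor>real (Suc n) * t\<rfloor>) / real (Suc n)" .
    qed
    show "\<forall>\<^sub>F n in sequentially. real (nat \<lfloor>real (Suc n) * t\<rfloor>) / real (Suc n) \<le> t"
    proof (intro always_eventually allI)
      fix n
      have "real (nat \<lfloor>real (Suc n) * t\<rfloor>) / real (Suc n) \<le> (real (Suc n) * t) / real (Suc n)" by (intro divide_right_mono fl) auto
      thus "real (nat \<lfloor>real (Suc n) * t\<rfloor>) / real (Suc n) \<le> t" by (simp del: of_nat_Suc)
    qed
    show "(\<lambda>n. t - 1 / real (Suc n)) \<longlonglongrightarrow> t"
      using tendsto_diff[OF tendsto_const LIMSEQ_Suc[OF lim_1_over_n], of t] by simp
  qed simp
  hence "u \<longlonglongrightarrow> exp (L * t) * a" unfolding u_eq[abs_def] by (intro tendsto_intros)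
  moreover have "exp (L * t) * a = b" unfolding t_def using L a ab by simp
  ultimately have ub: "u \<longlonglongrightarrow> b" by simp
  have "0 < u n" for n unfolding u_eq using a by simp
  hence "pd b \<le> liminf (\<lambda>n. pd (u n))"
    using a ab by (intro pdens_lsc ub) auto
  also have "\<dots> \<le> liminf (\<lambda>n. pd a)"
    unfolding u_def using step by (intro Liminf_mono always_eventually) (auto simp del: of_nat_Suc)
  finally show ?thesis by (simp add: Liminf_const)
qed

text \<open>The mode is the infimum of the set S of points that lie lower than some earlier positive
  point. If S is empty the density is nondecreasing, and a finite integral forces it to be 0. On the
  nonpositive half line it is nondecreasing because all arguments z / x stay below m > 0; Fatou's
  lemma bridges the point 0.\<close>

lemma pdens_unimodal:
  assumes fin: "(\<integral>\<^sup>+z. pd z \<partial>lborel) < \<infinity>"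
  shows "\<exists>M. (\<forall>x y. x \<le> y \<longrightarrow> y < M \<longrightarrow> pd x \<le> pd y) \<and> (\<forall>x y. M < x \<longrightarrow> x \<le> y \<longrightarrow> pd y \<le> pd x)"
proof -
  have neg: "pd x \<le> pd y" if "x \<le> y" "y \<le> 0" for x y
  proof -
    have "f (x / m) = 0" "f (y / m) = 0" using that m by (auto intro!: f0(2) simp: divide_le_0_iff)
    moreover have "product_density f \<psi> x \<le> product_density f \<psi> y"
      unfolding product_density_def
    proof (intro nn_integral_mono ennreal_leI)
      fix w :: real
      show "f w * \<psi> (x / w) / w \<le> f w * \<psi> (y / w) / w"
      proof (cases "0 < w")
        case True
        have "y / w \<le> 0" using that True by (simp add: divide_le_0_iff)
        hence "\<psi> (x / w) \<le> \<psi> (y / w)" using that True m by (intro inc divide_right_mono) auto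
        thus ?thesis using True f0(1) by (intro divide_right_mono mult_left_mono) auto
      qed (use f0(2)[of w] in simp)
    qed
    ultimately show ?thesis unfolding pdens_def by simp
  qed
  have zero: "pd 0 \<le> pd z" if z: "0 < z" and mono: "\<And>x. 0 < x \<Longrightarrow> x \<le> z \<Longrightarrow> pd x \<le> pd z" for z
  proof -
    have "product_density f \<psi> 0 \<le> (\<integral>\<^sup>+x. liminf (\<lambda>n. ennreal (f x * \<psi> (z / real (Suc n) / x) / x)) \<partial>lborel)"
      unfolding product_density_def
    proof (intro nn_integral_mono)
      fix x :: real
      show "ennreal (f x * \<psi> (0 / x) / x) \<le> liminf (\<lambda>n. ennreal (f x * \<psi> (z / real (Suc n) / x) / x))"
      proof (cases "0 < x")
        case True
        have "(\<lambda>n. z / x * (1 / real (Suc n))) \<longlonglongrightarrow> z / x * 0"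
          by (intro tendsto_intros LIMSEQ_Suc[OF lim_1_over_n])
        hence "\<forall>\<^sub>F n in sequentially. z / x * (1 / real (Suc n)) < m" using m by (intro order_tendstoD) auto
        hence "\<forall>\<^sub>F n in sequentially. ennreal (f x * \<psi> (0 / x) / x) \<le> ennreal (f x * \<psi> (z / real (Suc n) / x) / x)"
        proof eventually_elim
          case (elim n)
          have "\<psi> 0 \<le> \<psi> (z / real (Suc n) / x)" using elim z True by (intro inc) (auto simp: mult_ac)
          thus ?case using True f0(1) by (intro ennreal_leI divide_right_mono mult_left_mono) auto
        qed
        thus ?thesis by (rule Liminf_bounded)
      next
        case False thus ?thesis using f0(2)[of x] by simp
      qed
    qed
    also have "\<dots> \<le> liminf (\<lambda>n. product_density f \<psi> (z / real (Suc n)))"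
      unfolding product_density_def by (intro nn_integral_liminf) measurable
    also have "\<dots> \<le> liminf (\<lambda>n::nat. pd z)"
    proof (intro Liminf_mono always_eventually allI)
      fix n
      have "z / real (Suc n) \<le> z / 1" using z by (intro divide_left_mono) auto
      hence "pd (z / real (Suc n)) \<le> pd z" using z by (intro mono) auto
      moreover have "product_density f \<psi> (z / real (Suc n)) \<le> pd (z / real (Suc n))"
        unfolding pdens_def by (simp add: add_increasing)
      ultimately show "product_density f \<psi> (z / real (Suc n)) \<le> pd z" by (rule order_trans[rotated])
    qed
    finally show ?thesis using f0(2)[of 0] by (simp add: pdens_def Liminf_const)
  qed
  define S where "S = {z2. \<exists>z1. 0 < z1 \<and> z1 < z2 \<and> pd z2 < pd z1}"
  have after: "pd b \<le> pd a" if "s \<in> S" "s \<le> a" "a \<le> b" for s a b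
    using that pdens_decreasing_after unfolding S_def by blast
  have below: "pd x \<le> pd y" if "x \<le> y" "\<And>s. s \<in> S \<Longrightarrow> y < s" for x y
  proof -
    have pos: "pd a \<le> pd b" if "0 < a" "a \<le> b" "b \<le> y" for a b
    proof (cases "a = b")
      case False
      have "b \<notin> S" using \<open>\<And>s. s \<in> S \<Longrightarrow> y < s\<close> that by fastforce
      hence "\<not> (0 < a \<and> a < b \<and> pd b < pd a)" unfolding S_def by blast
      thus ?thesis using that False by (auto simp: not_less)
    qed simp
    consider "y \<le> 0" | "0 < x" | "x \<le> 0" "0 < y" by linarith
    then show ?thesis
    proof cases
      case 3
      have "pd x \<le> pd 0" using 3 by (intro neg) auto
      also have "\<dots> \<le> pd y" using 3 pos by (intro zero) auto
      finally show ?thesis .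
    qed (use that neg pos in auto)
  qed
  show ?thesis
  proof (cases "S = {}")
    case True
    have "pd z = 0" for z
    proof (rule ccontr)
      assume nz: "pd z \<noteq> 0"
      have "(\<integral>\<^sup>+x. pd z * indicator {z..} x \<partial>lborel) \<le> (\<integral>\<^sup>+x. pd x \<partial>lborel)"
        using below[of z] True by (intro nn_integral_mono) (auto simp: indicator_def)
      moreover have "(\<integral>\<^sup>+x. pd z * indicator {z..} x \<partial>lborel) = \<infinity>"
      proof -
        have "emeasure lborel {z..} = \<infinity>"
        proof (rule ennreal_top_unique_ge)
          fix n :: nat
          show "of_nat n \<le> emeasure lborel {z..}"
            using emeasure_mono[of "{z..z + real n}" "{z..}" lborel] by (simp add: ennreal_of_nat_eq_real_of_nat)
        qed
        thus ?thesis using nz by (simp add: nn_integral_cmult_indicator ennreal_mult_eq_top_iff)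
      qed
      ultimately show False using fin by simp
    qed
    thus ?thesis by auto
  next
    case False
    have bdd: "bdd_below S" unfolding S_def by (intro bdd_belowI[of _ 0]) auto
    show ?thesis
    proof (intro exI[of _ "Inf S"] conjI allI impI)
      fix x y assume "x \<le> y" "y < Inf S"
      thus "pd x \<le> pd y" using cInf_lower[OF _ bdd] by (intro below) (auto intro: less_le_trans)
    next
      fix x y assume "Inf S < x" "x \<le> y"
      then obtain s where "s \<in> S" "s < x" using cInf_lessD[OF False] by blast
      thus "pd y \<le> pd x" using \<open>x \<le> y\<close> by (intro after[of s]) auto
    qed
  qed
qed

end

text \<open>A log-concave density may be positive and discontinuous at the ends of its support.
  Setting it to 0 there changes at most two positive points and makes it continuous wherever it is
  positive, as \<open>pdens_lsc\<close> requires.\<close>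

lemma MSU_star_regular_density:
  assumes "MSU_star \<mu>"
  obtains f where "f \<in> borel_measurable borel" "\<And>x. 0 \<le> f x" "\<And>x. x \<le> 0 \<Longrightarrow> f x = 0"
    "\<mu> = density lborel (\<lambda>x. ennreal (f x))"
    "\<And>a b r. 0 < a \<Longrightarrow> 1 \<le> r \<Longrightarrow> a * r \<le> b \<Longrightarrow> f a * f b \<le> f (a * r) * f (b / r)"
    "\<And>x. 0 < x \<Longrightarrow> 0 < f x \<Longrightarrow> isCont f x"
proof -
  obtain f0 where m[measurable]: "f0 \<in> borel_measurable borel" and nn: "\<And>x. 0 \<le> f0 x"
    and \<mu>: "\<mu> = density lborel (\<lambda>x. ennreal (f0 x))" and lc: "log_concave (\<lambda>t. f0 (exp t))"
    using assms unfolding MSU_star_def by blast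
  interpret positive_distribution \<mu> using assms unfolding MSU_star_def by blast
  define S where "S = {t. 0 < f0 (exp t)}"
  define U where "U = interior S"
  have conc: "concave_on S (\<lambda>t. ln (f0 (exp t)))" using lc unfolding log_concave_def S_def by simp
  hence "convex S" by (simp add: concave_on_def convex_on_def)
  hence U: "open U" "convex U" "U \<subseteq> S" unfolding U_def by (auto intro: convex_interior interior_subset[THEN subsetD])
  define f where "f x = (if 0 < x \<and> ln x \<in> U then f0 x else 0)" for x
  have fexp: "f (exp t) = (if t \<in> U then f0 (exp t) else 0)" for t unfolding f_def by simp
  have Ub[measurable]: "U \<in> sets borel" using U by simp
  have fm: "f \<in> borel_measurable borel" unfolding f_def by measurable
  have fn: "0 \<le> f x" for x unfolding f_def using nn by simp
  have fz: "f x = 0" if "x \<le> 0" for x using that unfolding f_def by simp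
  have concU: "concave_on U (\<lambda>t. ln (f0 (exp t)))"
    using conc U unfolding concave_on_def by (auto intro: convex_on_subset)
  have SU: "{t. 0 < f (exp t)} = U" unfolding fexp using U(3) by (auto simp: S_def)
  have lcf: "log_concave (\<lambda>t. f (exp t))"
    unfolding log_concave_def SU using fn nn by (auto intro: concave_on_eq[OF concU] simp: fexp)
  have tp: "f a * f b \<le> f (a * r) * f (b / r)" if "0 < a" "1 \<le> r" "a * r \<le> b" for a b r
  proof -
    have "0 < a * r" using that by simp
    hence b: "0 < b" using that by linarith
    have "ln (a * r) \<le> ln b" using that b \<open>0 < a * r\<close> by (simp only: ln_le_cancel_iff)
    hence "ln a + ln r \<le> ln b" using that by (simp add: ln_mult)
    hence "f (exp (ln a)) * f (exp (ln b)) \<le> f (exp (ln a + ln r)) * f (exp (ln b - ln r))"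
      using log_concave_tp2[OF lcf, unfolded tp2_def, rule_format, of "ln r" "ln a" "ln b"] that ln_ge_zero[of r] by blast
    thus ?thesis using that b by (simp add: exp_add exp_diff)
  qed
  have cont: "isCont f x" if "0 < x" "0 < f x" for x
  proof -
    have "ln x \<in> U" using that unfolding f_def by (auto split: if_splits)
    have "continuous_on U (\<lambda>t. - ln (f0 (exp t)))" using concU U(1) unfolding concave_on_def by (intro convex_on_continuous) auto
    from continuous_on_minus[OF this] have "continuous_on U (\<lambda>t. exp (ln (f0 (exp t))))" by (intro continuous_on_exp) simp
    hence c0: "continuous_on U (\<lambda>t. f0 (exp t))" by (rule continuous_on_eq) (use U(3) in \<open>auto simp: S_def\<close>)
    define V where "V = {0<..} \<inter> ln -` U"
    have V: "open V" unfolding V_def by (rule continuous_open_preimage) (use U in \<open>auto intro!: continuous_intros\<close>)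
    have "continuous_on V (\<lambda>y. f0 (exp (ln y)))"
      by (rule continuous_on_compose2[OF c0]) (auto simp: V_def intro!: continuous_intros)
    hence "continuous_on V f" by (rule continuous_on_eq) (auto simp: V_def f_def)
    thus ?thesis using V \<open>ln x \<in> U\<close> that by (auto simp: continuous_on_eq_continuous_at V_def)
  qed
  have fin: "finite (S - U)"
  proof -
    have one: "finite A" if "\<And>x y. x \<in> A \<Longrightarrow> y \<in> A \<Longrightarrow> x = y" for A :: "real set"
    proof (cases "A = {}")
      case False
      then obtain a where "a \<in> A" by blast
      hence "A = {a}" using that by blast
      thus ?thesis by simp
    qed simp
    have "S - U \<subseteq> {t \<in> S. \<forall>s\<in>S. t \<le> s} \<union> {t \<in> S. \<forall>s\<in>S. s \<le> t}"
    proof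
      fix t assume t: "t \<in> S - U"
      show "t \<in> {t \<in> S. \<forall>s\<in>S. t \<le> s} \<union> {t \<in> S. \<forall>s\<in>S. s \<le> t}"
      proof (rule ccontr)
        assume "t \<notin> {t \<in> S. \<forall>s\<in>S. t \<le> s} \<union> {t \<in> S. \<forall>s\<in>S. s \<le> t}"
        then obtain a b where ab: "a \<in> S" "b \<in> S" "a < t" "t < b" using t by (auto simp: not_le)
        have "{a..b} \<subseteq> S" 
        proof -
          have "closed_segment a b \<subseteq> S" using \<open>convex S\<close> ab unfolding convex_contains_segment by blast
          thus ?thesis using ab by (simp add: closed_segment_eq_real_ivl)
        qed
        hence "{a<..<b} \<subseteq> S" by (meson greaterThanLessThan_subseteq_atLeastAtMost_iff order_refl order_trans)
        hence "t \<in> U" unfolding U_def using ab by (intro interiorI[of "{a<..<b}"]) auto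
        thus False using t by simp
      qed
    qed
    moreover have "finite {t \<in> S. \<forall>s\<in>S. t \<le> s}" "finite {t \<in> S. \<forall>s\<in>S. s \<le> t}"
      by (rule one; force)+
    ultimately show ?thesis by (meson finite_Un finite_subset)
  qed
  have "\<mu> = density lborel (\<lambda>x. ennreal (f x))"
    unfolding \<mu>
  proof (rule density_cong)
    have "AE x in lborel. 0 < ennreal (f0 x) \<longrightarrow> 0 < x"
      using AE_pos unfolding \<mu> by (subst (asm) AE_density) auto
    moreover have "AE x in lborel. x \<notin> exp ` (S - U)"
      using fin by (intro AE_not_in finite_imp_null_set_lborel) auto
    ultimately show "AE x in lborel. ennreal (f0 x) = ennreal (f x)"
    proof eventually_elim
      case (elim x)
      show ?case
      proof (cases "0 < x")
        case True
        have "ln x \<notin> S - U" using elim(2) True by (metis exp_ln image_eqI)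
        thus ?thesis using True nn[of x] unfolding f_def S_def by (auto simp: less_le)
      next
        case False thus ?thesis using elim(1) nn[of x] by (auto simp: f_def less_le)
      qed
    qed
  qed (use fm in auto)
  thus thesis using that fm fn fz tp cont by blast
qed

lemma nn_integral_reflect: "f \<in> borel_measurable borel \<Longrightarrow> (\<integral>\<^sup>+x. f x \<partial>lborel) = (\<integral>\<^sup>+x. f (- x) \<partial>lborel)"
  for f :: "real \<Rightarrow> ennreal"
  using nn_integral_real_affine[of f "- 1" 0] by simp

text \<open>The multiplicative counterpart of one half of Ibragimov's theorem on strong unimodality.
  As X is positive, only the sign of the mode of Y has to be distinguished.\<close>

lemma MSU_star_imp_MSU:
  assumes "MSU_star \<mu>"
  shows "MSU \<mu>"
proof -
  obtain f where f[measurable]: "f \<in> borel_measurable borel" and fn: "\<And>x. 0 \<le> f x" and fz: "\<And>x. x \<le> 0 \<Longrightarrow> f x = 0"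
    and \<mu>: "\<mu> = density lborel (\<lambda>x. ennreal (f x))"
    and tp: "\<And>a b r. 0 < a \<Longrightarrow> 1 \<le> r \<Longrightarrow> a * r \<le> b \<Longrightarrow> f a * f b \<le> f (a * r) * f (b / r)"
    and cont: "\<And>x. 0 < x \<Longrightarrow> 0 < f x \<Longrightarrow> isCont f x"
    using MSU_star_regular_density[OF assms] by metis
  have pd: "positive_distribution \<mu>" using assms by (simp add: MSU_star_def)
  hence rd: "real_distribution \<mu>" by (simp add: positive_distribution_def)
  have "unimodal (distr (\<mu> \<Otimes>\<^sub>M \<nu>) borel (\<lambda>(x, y). x * y))" if \<nu>: "real_distribution \<nu>" "unimodal \<nu>" for \<nu>
  proof -
    define \<kappa> where "\<kappa> = distr (\<mu> \<Otimes>\<^sub>M \<nu>) borel (\<lambda>(x, y). x * y)"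
    have \<kappa>: "real_distribution \<kappa>" unfolding \<kappa>_def by (rule real_distribution_product[OF rd \<nu>(1)])
    interpret \<kappa>: real_distribution \<kappa> by fact
    obtain m p \<psi> where ud: "unimodal_density \<nu> m p \<psi>" using unimodal_imp_density[OF \<nu>] by blast
    hence p: "0 \<le> p" and \<psi>m[measurable]: "\<psi> \<in> borel_measurable borel" and \<psi>0: "\<And>x. 0 \<le> \<psi> x"
      and inc: "\<And>x y. x \<le> y \<Longrightarrow> y < m \<Longrightarrow> \<psi> x \<le> \<psi> y" and dec: "\<And>x y. m < x \<Longrightarrow> x \<le> y \<Longrightarrow> \<psi> y \<le> \<psi> x"
      unfolding unimodal_density_def by (auto simp: mono_on_def monotone_on_def)
    have em: "emeasure \<kappa> A = (\<integral>\<^sup>+x. ennreal (p * f x) * indicator A (x * m) \<partial>lborel) + (\<integral>\<^sup>+z. product_density f \<psi> z * indicator A z \<partial>lborel)"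
      if "A \<in> sets borel" for A
      unfolding \<kappa>_def by (rule emeasure_product[OF rd \<mu> f fn fz \<nu>(1) ud that])
    have atom: "(\<integral>\<^sup>+x. ennreal (p * f x) * indicator A (x * m) \<partial>lborel) = (\<integral>\<^sup>+z. ennreal (p * f (z / m) / \<bar>m\<bar>) * indicator A z \<partial>lborel)"
      if "m \<noteq> 0" and [measurable]: "A \<in> sets borel" for A
    proof -
      have "(\<integral>\<^sup>+x. ennreal (p * f x) * indicator A (x * m) \<partial>lborel)
        = ennreal \<bar>1 / m\<bar> * (\<integral>\<^sup>+z. ennreal (p * f (0 + 1 / m * z)) * indicator A ((0 + 1 / m * z) * m) \<partial>lborel)"
        using that by (intro nn_integral_real_affine) auto
      also have "\<dots> = (\<integral>\<^sup>+z. ennreal \<bar>1 / m\<bar> * (ennreal (p * f (0 + 1 / m * z)) * indicator A ((0 + 1 / m * z) * m)) \<partial>lborel)"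
        by (simp add: nn_integral_cmult)
      also have "\<dots> = (\<integral>\<^sup>+z. ennreal (p * f (z / m) / \<bar>m\<bar>) * indicator A z \<partial>lborel)"
        using that(1) p fn by (intro nn_integral_cong) (auto simp: indicator_def ennreal_mult'[symmetric] divide_simps)
      finally show ?thesis .
    qed
    have emz: "emeasure \<kappa> A = (\<integral>\<^sup>+z. (ennreal (p * f (z / m) / \<bar>m\<bar>) + product_density f \<psi> z) * indicator A z \<partial>lborel)"
      if "m \<noteq> 0" and [measurable]: "A \<in> sets borel" for A
      unfolding em[OF that(2)] atom[OF that] by (subst nn_integral_add[symmetric]) (auto simp: distrib_right)
    consider "m = 0" | "0 < m" | "m < 0" by linarith
    then have "unimodal \<kappa>"
    proof cases
      \<comment> \<open>A mixture of positive dilations of a law with mode 0 again has mode 0, and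
        its atom stays at 0, outside the intervals that are tested.\<close>
      case 1
      show ?thesis
      proof (rule unimodalI_density[OF \<kappa>, where g = "product_density f \<psi>" and m = 0])
        fix x y :: real assume xy: "x \<le> y" "y < 0"
        show "product_density f \<psi> x \<le> product_density f \<psi> y"
          unfolding product_density_def
        proof (intro nn_integral_mono ennreal_leI)
          fix w :: real
          show "f w * \<psi> (x / w) / w \<le> f w * \<psi> (y / w) / w"
          proof (cases "0 < w")
            case True
            hence "\<psi> (x / w) \<le> \<psi> (y / w)" using xy 1 by (intro inc divide_right_mono) (auto simp: divide_less_0_iff)
            thus ?thesis using True fn by (intro divide_right_mono mult_left_mono) auto
          qed (use fz[of w] in simp)
        qed
      next
        fix x y :: real assume xy: "0 < x" "x \<le> y"
        show "product_density f \<psi> y \<le> product_density f \<psi> x"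
          unfolding product_density_def
        proof (intro nn_integral_mono ennreal_leI)
          fix w :: real
          show "f w * \<psi> (y / w) / w \<le> f w * \<psi> (x / w) / w"
          proof (cases "0 < w")
            case True
            hence "\<psi> (y / w) \<le> \<psi> (x / w)" using xy 1 by (intro dec divide_right_mono) auto
            thus ?thesis using True fn by (intro divide_right_mono mult_left_mono) auto
          qed (use fz[of w] in simp)
        qed
      next
        fix a b :: real assume "a < b" "b < 0 \<or> 0 < a"
        thus "emeasure \<kappa> {a<..b} = (\<integral>\<^sup>+x\<in>{a<..b}. product_density f \<psi> x \<partial>lborel)"
          using 1 by (subst em) auto
      qed measurable
    next
      case 2
      define P where "P = pdens f \<psi> m p"
      have P: "emeasure \<kappa> A = (\<integral>\<^sup>+z. P z * indicator A z \<partial>lborel)" if "A \<in> sets borel" for A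
        using emz[OF _ that] 2 by (simp add: P_def pdens_def)
      have "(\<integral>\<^sup>+z. P z \<partial>lborel) < \<infinity>" using P[of UNIV] \<kappa>.emeasure_finite[of UNIV] by (simp add: less_top)
      then obtain M where M: "\<And>x y. x \<le> y \<Longrightarrow> y < M \<Longrightarrow> P x \<le> P y" "\<And>x y. M < x \<Longrightarrow> x \<le> y \<Longrightarrow> P y \<le> P x"
        using pdens_unimodal[OF f fn fz \<psi>m \<psi>0 inc dec 2 p tp cont] unfolding P_def by blast
      have [measurable]: "P \<in> borel_measurable borel"
        unfolding P_def pdens_def[abs_def] by measurable
      show ?thesis by (rule unimodalI_density[OF \<kappa>, where g = P and m = M]) (use M P in auto)
    next
      \<comment> \<open>Reflecting Y turns the negative mode m into the positive mode -m and
        reflects the product density.\<close>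
      case 3
      define \<psi>' where "\<psi>' x = \<psi> (- x)" for x
      have \<psi>'m[measurable]: "\<psi>' \<in> borel_measurable borel" unfolding \<psi>'_def[abs_def] by measurable
      have \<psi>'0: "0 \<le> \<psi>' x" for x unfolding \<psi>'_def using \<psi>0 by simp
      have inc': "\<psi>' x \<le> \<psi>' y" if "x \<le> y" "y < - m" for x y unfolding \<psi>'_def using that by (intro dec) auto
      have dec': "\<psi>' y \<le> \<psi>' x" if "- m < x" "x \<le> y" for x y unfolding \<psi>'_def using that by (intro inc) auto
      have m': "0 < - m" using 3 by simp
      note ctx = f fn fz \<psi>'m \<psi>'0 inc' dec' m' p tp cont
      define P where "P = pdens f \<psi>' (- m) p"
      have [measurable]: "P \<in> borel_measurable borel" unfolding P_def pdens_def[abs_def] by measurable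
      have P: "emeasure \<kappa> A = (\<integral>\<^sup>+z. P (- z) * indicator A z \<partial>lborel)" if "A \<in> sets borel" for A
        using emz[OF _ that] 3 by (simp add: P_def pdens_def product_density_def \<psi>'_def)
      have "(\<integral>\<^sup>+z. P z \<partial>lborel) < \<infinity>" using P[of UNIV] nn_integral_reflect[of P] \<kappa>.emeasure_finite[of UNIV] by (simp add: less_top)
      then obtain M where M: "\<And>x y. x \<le> y \<Longrightarrow> y < M \<Longrightarrow> P x \<le> P y" "\<And>x y. M < x \<Longrightarrow> x \<le> y \<Longrightarrow> P y \<le> P x"
        using pdens_unimodal[OF ctx] unfolding P_def by blast
      show ?thesis
      proof (rule unimodalI_density[OF \<kappa>, where g = "\<lambda>z. P (- z)" and m = "- M"])
        show "P (- x) \<le> P (- y)" if "x \<le> y" "y < - M" for x y using that by (intro M(2)) auto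
        show "P (- y) \<le> P (- x)" if "- M < x" "x \<le> y" for x y using that by (intro M(1)) auto
      qed (use P in auto)
    qed
    thus ?thesis unfolding \<kappa>_def .
  qed
  thus ?thesis unfolding MSU_def using pd by blast
qed

text \<open>A mode m > 0 would make the distribution function convex just above 0, against the
  descent there; a mode m \<le> 0 would make it concave on the positive half line, against the
  ascent. Each conflict appears when the masses of two adjacent intervals of equal length are
  compared.\<close>

lemma not_unimodal_valley:
  fixes g :: "real \<Rightarrow> ennreal"
  assumes "real_distribution \<kappa>" and [measurable]: "g \<in> borel_measurable borel"
    and em: "\<And>a b. 0 < a \<Longrightarrow> a < b \<Longrightarrow> emeasure \<kappa> {a<..b} = (\<integral>\<^sup>+x. g x * indicator {a<..b} x \<partial>lborel)"
    and dec: "0 < \<delta>" "\<And>x y. 0 < x \<Longrightarrow> x < y \<Longrightarrow> y < \<delta> \<Longrightarrow> g y < g x"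
    and inc: "0 < z1" "z1 < z2" "\<And>x y. z1 < x \<Longrightarrow> x < y \<Longrightarrow> y < z2 \<Longrightarrow> g x < g y"
  shows "\<not> unimodal \<kappa>"
proof
  interpret real_distribution \<kappa> by fact
  assume "unimodal \<kappa>"
  then obtain m where cvx: "convex_on {..<m} (cdf \<kappa>)" and ccv: "convex_on {m<..} (\<lambda>x. - cdf \<kappa> x)"
    unfolding unimodal_def concave_on_def by blast
  have em': "emeasure \<kappa> {a<..b} = ennreal (cdf \<kappa> b - cdf \<kappa> a)" if "a < b" for a b
    using cdf_diff_eq[of a b] that by (auto simp: emeasure_eq_measure)
  have shift: "emeasure \<kappa> {x + h<..x + 2 * h} = (\<integral>\<^sup>+u. g (h + u) * indicator {x<..x + h} u \<partial>lborel)" if "0 < x" "0 < h" for x h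
  proof -
    have "emeasure \<kappa> {x + h<..x + 2 * h} = (\<integral>\<^sup>+u. g u * indicator {x + h<..x + 2 * h} u \<partial>lborel)" using that by (intro em) auto
    also have "\<dots> = (\<integral>\<^sup>+u. g (h + u) * indicator {x + h<..x + 2 * h} (h + u) \<partial>lborel)"
      by (subst nn_integral_real_affine[where c = 1 and t = h]) auto
    also have "\<dots> = (\<integral>\<^sup>+u. g (h + u) * indicator {x<..x + h} u \<partial>lborel)"
      by (intro nn_integral_cong) (auto simp: indicator_def)
    finally show ?thesis .
  qed
  have strict: "(\<integral>\<^sup>+u. p u * indicator {x<..x + h} u \<partial>lborel) < (\<integral>\<^sup>+u. q u * indicator {x<..x + h} u \<partial>lborel)"
    if [measurable]: "p \<in> borel_measurable borel" "q \<in> borel_measurable borel" and h: "0 < h"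
      and fin: "(\<integral>\<^sup>+u. p u * indicator {x<..x + h} u \<partial>lborel) < \<infinity>"
      and less: "\<And>u. x < u \<Longrightarrow> u \<le> x + h \<Longrightarrow> p u < q u" for p q :: "real \<Rightarrow> ennreal" and x h :: real
  proof (rule nn_integral_less)
    show "AE u in lborel. p u * indicator {x<..x + h} u \<le> q u * indicator {x<..x + h} u"
      using less by (intro AE_I2) (auto simp: indicator_def less_imp_le)
    show "\<not> (AE u in lborel. q u * indicator {x<..x + h} u \<le> p u * indicator {x<..x + h} u)"
    proof
      assume "AE u in lborel. q u * indicator {x<..x + h} u \<le> p u * indicator {x<..x + h} u"
      hence "AE u in lborel. u \<notin> {x<..x + h}"
      proof eventually_elim
        case (elim u)
        show ?case
        proof
          assume u: "u \<in> {x<..x + h}"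
          hence "p u < q u" using less by simp
          thus False using elim u by simp
        qed
      qed
      hence "emeasure lborel {x<..x + h} = 0"
        by (subst (asm) AE_iff_measurable[of "{x<..x + h}"]) (auto simp del: greaterThanAtMost_iff)
      thus False using h by simp
    qed
  qed (use fin in auto)
  show False
  proof (cases "0 < m")
    case True
    define D where "D = min \<delta> m"
    define h where "h = D / 4"
    have D: "0 < D" "D \<le> \<delta>" "D \<le> m" using True dec unfolding D_def by auto
    have h: "0 < h" using D by (simp add: h_def)
    have e: "emeasure \<kappa> {h<..h + h} = (\<integral>\<^sup>+u. g u * indicator {h<..h + h} u \<partial>lborel)" using h by (intro em) auto
    have "emeasure \<kappa> {h + h<..h + 2 * h} < emeasure \<kappa> {h<..h + h}"
      unfolding shift[OF h h] e
    proof (rule strict)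
      show "(\<integral>\<^sup>+u. g (h + u) * indicator {h<..h + h} u \<partial>lborel) < \<infinity>"
        unfolding shift[OF h h, symmetric] using emeasure_finite unfolding less_top by simp
      show "g (h + u) < g u" if "h < u" "u \<le> h + h" for u
        using that h D by (intro dec) (auto simp: h_def)
    qed (use h in auto)
    hence "cdf \<kappa> (h + 2 * h) - cdf \<kappa> (h + h) < cdf \<kappa> (h + h) - cdf \<kappa> h"
      using h cdf_nondecreasing[of "h + h" "h + 2 * h"] by (simp add: em' ennreal_less_iff)
    moreover have "cdf \<kappa> ((1 - 1 / 2) *\<^sub>R h + (1 / 2) *\<^sub>R (h + 2 * h)) \<le> (1 - 1 / 2) * cdf \<kappa> h + 1 / 2 * cdf \<kappa> (h + 2 * h)"
      by (rule convex_onD[OF cvx]) (use h D in \<open>auto simp: h_def\<close>)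
    ultimately show False by (simp add: algebra_simps)
  next
    case False
    define h where "h = (z2 - z1) / 4"
    define x where "x = z1 + h"
    have h: "0 < h" using inc by (simp add: h_def)
    have x: "0 < x" using inc h by (simp add: x_def)
    have e: "emeasure \<kappa> {x<..x + h} = (\<integral>\<^sup>+u. g u * indicator {x<..x + h} u \<partial>lborel)" using h x by (intro em) auto
    have "emeasure \<kappa> {x<..x + h} < emeasure \<kappa> {x + h<..x + 2 * h}"
      unfolding shift[OF x h] e
    proof (rule strict)
      show "(\<integral>\<^sup>+u. g u * indicator {x<..x + h} u \<partial>lborel) < \<infinity>"
        unfolding e[symmetric] using emeasure_finite unfolding less_top by simp
      show "g u < g (h + u)" if "x < u" "u \<le> x + h" for u
      proof (rule inc)
        have "4 * h = z2 - z1" by (simp add: h_def)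
        thus "z1 < u" "u < h + u" "h + u < z2" using that h unfolding x_def by linarith+
      qed
    qed (use h in auto)
    hence "cdf \<kappa> (x + h) - cdf \<kappa> x < cdf \<kappa> (x + 2 * h) - cdf \<kappa> (x + h)"
      using h cdf_nondecreasing[of x "x + h"] by (simp add: em' ennreal_less_iff)
    moreover have "- cdf \<kappa> ((1 - 1 / 2) *\<^sub>R x + (1 / 2) *\<^sub>R (x + 2 * h)) \<le> (1 - 1 / 2) * - cdf \<kappa> x + 1 / 2 * - cdf \<kappa> (x + 2 * h)"
      by (rule convex_onD[OF ccv]) (use h x False in auto)
    moreover have "(1 - 1 / 2) *\<^sub>R x + (1 / 2) *\<^sub>R (x + 2 * h) = x + h" by (simp add: algebra_simps)
    ultimately show False by simp
  qed
qed

text \<open>The law of \<open>Y\<close> has a density with an upward jump \<open>c\<close> at \<open>1\<close> and a downward jump \<open>1\<close> at \<open>b\<close>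
  (up to a constant), so \<open>z\<close> times the derivative of the density of \<open>X * Y\<close> is proportional to
  \<open>c * f z - f (z / b)\<close>.\<close>

lemma not_MSU_criterion:
  fixes f :: "real \<Rightarrow> real"
  assumes \<mu>: "real_distribution \<mu>" "\<mu> = density lborel (\<lambda>x. ennreal (f x))"
    and f[measurable]: "f \<in> borel_measurable borel" and f0: "\<And>x. 0 \<le> f x" "\<And>x. x \<le> 0 \<Longrightarrow> f x = 0"
    and b: "1 < b" and c: "0 < c" "c < 1"
    and dec: "0 < \<delta>" "\<And>w. 0 < w \<Longrightarrow> w < \<delta> \<Longrightarrow> c * f w < f (w / b)"
    and inc: "0 < z1" "z1 < z2" "\<And>w. z1 < w \<Longrightarrow> w < z2 \<Longrightarrow> f (w / b) < c * f w"
  shows "\<not> MSU \<mu>"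
proof
  assume "MSU \<mu>"
  define C where "C = 1 / (b - c)"
  have C: "0 < C" unfolding C_def using b c by simp
  \<comment> \<open>The levels are C (1 - c) on [0, 1] and C on (1, b], so the mass is C (b - c) = 1
    and b is a mode.\<close>
  define \<psi> where "\<psi> x = C * (indicator {0..b} x - c * indicator {0..1} x)" for x
  have \<psi>m[measurable]: "\<psi> \<in> borel_measurable borel" unfolding \<psi>_def[abs_def] by measurable
  have \<psi>0: "0 \<le> \<psi> x" "\<psi> x \<le> C * indicator {0..b} x" for x
    unfolding \<psi>_def using C c b by (auto simp: indicator_def)
  define \<nu> where "\<nu> = density lborel (\<lambda>x. ennreal (\<psi> x))"
  have \<nu>em: "emeasure \<nu> A = (\<integral>\<^sup>+x. ennreal (indicator A x * \<psi> x) \<partial>lborel)" if "A \<in> sets borel" for A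
    unfolding \<nu>_def using that by (subst emeasure_density) (auto intro!: nn_integral_cong simp: indicator_def)
  have "(\<integral>\<^sup>+x. ennreal (\<psi> x) \<partial>lborel) = (\<integral>\<^sup>+x. ennreal (C * (1 - c)) * indicator {0..1} x + ennreal C * indicator {1<..b} x \<partial>lborel)"
    using b C c by (intro nn_integral_cong) (auto simp: \<psi>_def indicator_def)
  also have "\<dots> = ennreal (C * (1 - c)) + ennreal (C * (b - 1))"
    using b C c by (subst nn_integral_add) (auto simp: nn_integral_cmult_indicator ennreal_mult'[symmetric])
  also have "\<dots> = 1" using b C c unfolding C_def by (simp add: ennreal_plus[symmetric] add_divide_distrib[symmetric] del: ennreal_plus)
  finally have tot: "(\<integral>\<^sup>+x. ennreal (\<psi> x) \<partial>lborel) = 1" .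
  have "prob_space \<nu>" by (rule prob_spaceI) (simp add: \<nu>em tot \<nu>_def emeasure_density)
  hence \<nu>: "real_distribution \<nu>" unfolding real_distribution_def real_distribution_axioms_def by (simp add: \<nu>_def)
  have ud: "unimodal_density \<nu> b 0 \<psi>"
    unfolding unimodal_density_def using \<psi>0 C c b
    by (auto simp: \<nu>em mono_on_def monotone_on_def \<psi>_def indicator_def)
  have "unimodal \<nu>"
  proof (rule unimodalI_density[OF \<nu>, where g = "\<lambda>x. ennreal (\<psi> x)" and m = b])
    show "ennreal (\<psi> x) \<le> ennreal (\<psi> y)" if "x \<le> y" "y < b" for x y
      using ud that unfolding unimodal_density_def mono_on_def by (intro ennreal_leI) auto
    show "ennreal (\<psi> y) \<le> ennreal (\<psi> x)" if "b < x" "x \<le> y" for x y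
      using ud that unfolding unimodal_density_def monotone_on_def by (intro ennreal_leI) auto
    show "emeasure \<nu> {x<..y} = (\<integral>\<^sup>+z\<in>{x<..y}. ennreal (\<psi> z) \<partial>lborel)" for x y
      by (subst \<nu>em) (auto intro!: nn_integral_cong simp: indicator_def)
  qed measurable
  hence uni: "unimodal (distr (\<mu> \<Otimes>\<^sub>M \<nu>) borel (\<lambda>(x, y). x * y))"
    using \<open>MSU \<mu>\<close> \<nu> unfolding MSU_def by blast
  interpret real_distribution \<mu> by fact
  have f1: "(\<integral>\<^sup>+x. ennreal (f x) \<partial>lborel) = 1"
    using emeasure_space_1 unfolding \<mu>(2) by (simp add: emeasure_density)
  define g where "g = product_density f \<psi>"
  have [measurable]: "g \<in> borel_measurable borel" unfolding g_def by measurable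
  have gfin: "g z < \<infinity>" if z: "0 < z" for z
  proof -
    have "g z \<le> (\<integral>\<^sup>+x. ennreal (C * b / z) * ennreal (f x) \<partial>lborel)"
      unfolding g_def product_density_def
    proof (intro nn_integral_mono)
      fix x :: real
      have "f x * \<psi> (z / x) / x \<le> C * b / z * f x"
      proof (cases "0 < x \<and> z / x \<le> b")
        case True
        have 1: "1 / x \<le> b / z" using True z by (simp add: field_simps)
        have "C * indicator {0..b} (z / x) \<le> C * 1" using C by (intro mult_left_mono) (auto simp: indicator_def)
        hence 2: "\<psi> (z / x) \<le> C" using \<psi>0(2)[of "z / x"] by simp
        have "\<psi> (z / x) * (1 / x) \<le> C * (b / z)" using True C \<psi>0(1) by (intro mult_mono 1 2) auto
        from mult_left_mono[OF this f0(1)[of x]] show ?thesis by (simp add: mult_ac)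
      next
        case False
        have "f x * \<psi> (z / x) = 0"
        proof (cases "0 < x")
          case True
          hence "b < z / x" using False by simp
          hence "\<psi> (z / x) = 0" using b by (simp add: \<psi>_def)
          thus ?thesis by simp
        next
          case False
          thus ?thesis using f0(2)[of x] by simp
        qed
        hence "f x * \<psi> (z / x) / x = 0" by (simp only: div_0)
        moreover have "0 \<le> C * b / z * f x" using C b z f0(1)[of x] by simp
        ultimately show ?thesis by linarith
      qed
      thus "ennreal (f x * \<psi> (z / x) / x) \<le> ennreal (C * b / z) * ennreal (f x)"
        using C b z f0 by (subst ennreal_mult[symmetric]) (auto intro: ennreal_leI)
    qed
    also have "\<dots> = ennreal (C * b / z)" by (simp add: nn_integral_cmult f1)
    finally show ?thesis by (rule le_less_trans) simp
  qed
  \<comment> \<open>I and J integrate the two terms of the derivative formula over [x, y). The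
    identity \<open>IJ\<close> then states the increment of g as C (J - I), without differentiating
    g.\<close>
  define I J where "I x y = (\<integral>\<^sup>+w. ennreal (indicator {x..<y} w * (f (w / b) / w)) \<partial>lborel)"
    and "J x y = (\<integral>\<^sup>+w. ennreal (indicator {x..<y} w * (c * f w / w)) \<partial>lborel)" for x y
  have IJ: "g x + ennreal C * J x y = g y + ennreal C * I x y" if x: "0 < x" "x < y" for x y
  proof -
    have "I x y = ennreal b * (\<integral>\<^sup>+w. ennreal (indicator {x..<y} (b * w) * (f (b * w / b) / (b * w))) \<partial>lborel)"
      unfolding I_def using b by (intro nn_integral_dilate) auto
    also have "\<dots> = (\<integral>\<^sup>+w. ennreal b * ennreal (indicator {x..<y} (b * w) * (f (b * w / b) / (b * w))) \<partial>lborel)"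
      by (simp add: nn_integral_cmult)
    also have "\<dots> = (\<integral>\<^sup>+w. ennreal (indicator {x / b..<y / b} w * (f w / w)) \<partial>lborel)"
      using b by (intro nn_integral_cong) (auto simp: ennreal_mult'[symmetric] indicator_def field_simps)
    finally have I: "I x y = (\<integral>\<^sup>+w. ennreal (indicator {x / b..<y / b} w * (f w / w)) \<partial>lborel)" .
    have "g x + ennreal C * J x y = (\<integral>\<^sup>+w. ennreal (f w * \<psi> (x / w) / w) + ennreal C * ennreal (indicator {x..<y} w * (c * f w / w)) \<partial>lborel)"
      unfolding g_def product_density_def J_def by (simp add: nn_integral_add nn_integral_cmult)
    also have "\<dots> = (\<integral>\<^sup>+w. ennreal (f w * \<psi> (y / w) / w) + ennreal C * ennreal (indicator {x / b..<y / b} w * (f w / w)) \<partial>lborel)"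
    proof (intro nn_integral_cong)
      fix w :: real
      show "ennreal (f w * \<psi> (x / w) / w) + ennreal C * ennreal (indicator {x..<y} w * (c * f w / w))
        = ennreal (f w * \<psi> (y / w) / w) + ennreal C * ennreal (indicator {x / b..<y / b} w * (f w / w))"
      proof (cases "0 < w")
        case True
        have \<psi>w: "\<psi> (v / w) = C * (indicator {v / b..} w - c * indicator {v..} w)" if "0 < v" for v
          unfolding \<psi>_def using True that b by (auto simp: indicator_def field_simps)
        have xb: "x / b < y / b" using x b by (simp add: divide_strict_right_mono)
        have "\<psi> (x / w) + C * (indicator {x..<y} w * c) = \<psi> (y / w) + C * indicator {x / b..<y / b} w"
          using x xb by (subst (1 2) \<psi>w) (auto simp: indicator_def algebra_simps)
        from arg_cong[OF this, of "\<lambda>s. f w / w * s"]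
        have "f w * \<psi> (x / w) / w + C * (indicator {x..<y} w * (c * f w / w)) = f w * \<psi> (y / w) / w + C * (indicator {x / b..<y / b} w * (f w / w))"
          by (simp add: algebra_simps)
        thus ?thesis using True f0 \<psi>0 C c
          by (simp add: ennreal_mult'[symmetric] ennreal_plus[symmetric] del: ennreal_plus)
      next
        case False thus ?thesis using f0(2)[of w] by simp
      qed
    qed
    also have "\<dots> = g y + ennreal C * I x y"
      unfolding g_def product_density_def I by (simp add: nn_integral_add nn_integral_cmult)
    finally show ?thesis .
  qed
  have Jfin: "J x y < \<infinity>" if "0 < x" for x y
  proof -
    have "J x y \<le> (\<integral>\<^sup>+w. ennreal (1 / x) * ennreal (f w) \<partial>lborel)"
      unfolding J_def
    proof (intro nn_integral_mono)
      fix w :: real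
      have "indicator {x..<y} w * (c * f w / w) \<le> 1 / x * f w"
      proof (cases "w \<in> {x..<y}")
        case True
        have "c * f w / w \<le> 1 * f w / x" using True that c f0 by (intro frac_le mult_right_mono) auto
        thus ?thesis using True by simp
      qed (use that f0 in simp)
      thus "ennreal (indicator {x..<y} w * (c * f w / w)) \<le> ennreal (1 / x) * ennreal (f w)"
        using that f0 by (subst ennreal_mult[symmetric]) (auto intro: ennreal_leI)
    qed
    also have "\<dots> = ennreal (1 / x)" by (simp add: nn_integral_cmult f1)
    finally show ?thesis by (rule le_less_trans) simp
  qed
  have Ifin: "I x y < \<infinity>" if "0 < x" "x < y" for x y
  proof -
    have "ennreal C * I x y \<le> g x + ennreal C * J x y" unfolding IJ[OF that] by simp
    also have "\<dots> < \<infinity>" using gfin[OF that(1)] Jfin[OF that(1)] by (simp add: ennreal_mult_less_top)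
    finally show ?thesis using C by (auto simp: ennreal_mult_less_top)
  qed
  have strict: "(\<integral>\<^sup>+w. ennreal (indicator {x..<y} w * p w) \<partial>lborel) < (\<integral>\<^sup>+w. ennreal (indicator {x..<y} w * q w) \<partial>lborel)"
    if [measurable]: "p \<in> borel_measurable borel" "q \<in> borel_measurable borel" and "x < y"
      and fin: "(\<integral>\<^sup>+w. ennreal (indicator {x..<y} w * p w) \<partial>lborel) < \<infinity>"
      and less: "\<And>w. x < w \<Longrightarrow> w < y \<Longrightarrow> 0 \<le> p w \<and> p w < q w" for p q :: "real \<Rightarrow> real" and x y
  proof (rule nn_integral_less)
    show "AE w in lborel. ennreal (indicator {x..<y} w * p w) \<le> ennreal (indicator {x..<y} w * q w)"
      using AE_lborel_singleton[of x]
    proof eventually_elim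
      case (elim w)
      thus ?case using less[of w] by (auto simp: indicator_def intro!: ennreal_leI)
    qed
    show "\<not> (AE w in lborel. ennreal (indicator {x..<y} w * q w) \<le> ennreal (indicator {x..<y} w * p w))"
    proof
      assume "AE w in lborel. ennreal (indicator {x..<y} w * q w) \<le> ennreal (indicator {x..<y} w * p w)"
      hence "AE w in lborel. w \<notin> {x<..<y}"
      proof eventually_elim
        case (elim w)
        show ?case
        proof
          assume w: "w \<in> {x<..<y}"
          hence "0 \<le> p w" "p w < q w" using less by auto
          thus False using elim w by (simp add: ennreal_le_iff)
        qed
      qed
      hence "emeasure lborel {x<..<y} = 0"
        by (subst (asm) AE_iff_measurable[of "{x<..<y}"]) (auto simp del: greaterThanLessThan_iff)
      thus False using \<open>x < y\<close> by simp
    qed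
  qed (use fin in auto)
  have cmp: "p < q" if "p + ennreal C * i = q + ennreal C * j" "j < i" "i < \<infinity>" "q < \<infinity>" "p < \<infinity>" for p q i j :: ennreal
  proof -
    have "p < top" "q < top" "i < top" "j < top" using that less_trans[OF that(2,3)] by simp_all
    then obtain p' q' i' j' where r: "p = ennreal p'" "q = ennreal q'" "i = ennreal i'" "j = ennreal j'" "0 \<le> p'" "0 \<le> q'" "0 \<le> i'" "0 \<le> j'"
      unfolding less_top_ennreal by blast
    have "p' + C * i' = q' + C * j'" using that(1) C r by (simp add: ennreal_mult[symmetric] ennreal_plus[symmetric] del: ennreal_plus)
    moreover have "C * j' < C * i'" using that(2) C r by (simp add: ennreal_less_iff)
    ultimately show ?thesis using r by (simp add: ennreal_less_iff)
  qed
  have "\<not> unimodal (distr (\<mu> \<Otimes>\<^sub>M \<nu>) borel (\<lambda>(x, y). x * y))"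
  proof (rule not_unimodal_valley[where g = g, OF real_distribution_product[OF \<mu>(1) \<nu>] _ _ dec(1) _ inc(1,2)])
    show "emeasure (distr (\<mu> \<Otimes>\<^sub>M \<nu>) borel (\<lambda>(x, y). x * y)) {a<..e} = (\<integral>\<^sup>+x. g x * indicator {a<..e} x \<partial>lborel)" for a e
      unfolding g_def by (subst emeasure_product[OF \<mu> f f0 \<nu> ud]) auto
    show "g y < g x" if "0 < x" "x < y" "y < \<delta>" for x y
    proof (rule cmp)
      show "g y + ennreal C * I x y = g x + ennreal C * J x y" using IJ[OF that(1,2)] by simp
      show "J x y < I x y" unfolding I_def J_def
      proof (rule strict)
        show "0 \<le> c * f w / w \<and> c * f w / w < f (w / b) / w" if w: "x < w" "w < y" for w
        proof
          have "0 < w" "w < \<delta>" using w \<open>0 < x\<close> \<open>y < \<delta>\<close> by auto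
          thus "0 \<le> c * f w / w" "c * f w / w < f (w / b) / w" using dec(2)[of w] c f0 by (auto intro: divide_strict_right_mono)
        qed
      qed (use that Jfin[OF that(1), of y] in \<open>auto simp: J_def\<close>)
    qed (use that gfin Ifin in auto)
    show "g x < g y" if "z1 < x" "x < y" "y < z2" for x y
    proof (rule cmp)
      have x0: "0 < x" using that inc by simp
      show "g x + ennreal C * J x y = g y + ennreal C * I x y" using IJ[OF x0 that(2)] .
      show "I x y < J x y" unfolding I_def J_def
      proof (rule strict)
        show "0 \<le> f (w / b) / w \<and> f (w / b) / w < c * f w / w" if w: "x < w" "w < y" for w
        proof
          have "0 < w" "z1 < w" "w < z2" using w \<open>0 < x\<close> \<open>z1 < x\<close> \<open>y < z2\<close> by auto
          thus "0 \<le> f (w / b) / w" "f (w / b) / w < c * f w / w" using inc(3)[of w] c f0 by (auto intro: divide_strict_right_mono)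
        qed
      qed (use that x0 Ifin[OF x0 that(2)] in \<open>auto simp: I_def\<close>)
      show "J x y < \<infinity>" "g y < \<infinity>" "g x < \<infinity>" using Jfin x0 gfin that by auto
    qed
  qed measurable
  thus False using uni by simp
qed

text \<open>For large b the point w / b is so close to 0 that k (w / b) is nearly k0. With c
  slightly below 1, c k w is smaller than this near 0, where k w is close to k0 as well, and larger
  in the window, where k w \<ge> k0 + \<epsilon>.\<close>

lemma not_MSU_of_increasing_factor:
  fixes f k :: "real \<Rightarrow> real" and j :: nat
  assumes \<mu>: "real_distribution \<mu>" "\<mu> = density lborel (\<lambda>x. ennreal (f x))"
    and f: "f \<in> borel_measurable borel" and f0: "\<And>x. 0 \<le> f x" "\<And>x. x \<le> 0 \<Longrightarrow> f x = 0"
    and fk: "\<And>x. 0 < x \<Longrightarrow> x < x0 \<Longrightarrow> f x = x ^ j * k x" and x0: "0 < x0"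
    and lim: "(k \<longlongrightarrow> k0) (at_right 0)" "0 < k0"
    and z: "0 < z1" "z1 < z2" "z2 \<le> x0" "0 < \<epsilon>" "\<And>x. z1 < x \<Longrightarrow> x < z2 \<Longrightarrow> k0 + \<epsilon> \<le> k x"
  shows "\<not> MSU \<mu>"
proof -
  \<comment> \<open>Then c (k0 + \<epsilon>) = k0 + 3 \<epsilon> / 4, which beats the bound k0 +
    \<epsilon> / 2 on k (w / b), and still c < 1; \<eta> is the tolerance for both
    comparisons.\<close>
  define c where "c = (k0 + 3 * \<epsilon> / 4) / (k0 + \<epsilon>)"
  have c: "0 < c" "c < 1" "c * (k0 + \<epsilon>) = k0 + 3 * \<epsilon> / 4" unfolding c_def using lim(2) z(4) by (auto simp: divide_simps)
  define \<eta> where "\<eta> = min (\<epsilon> / 2) ((1 - c) * k0 / 4)"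
  have \<eta>: "0 < \<eta>" "\<eta> \<le> \<epsilon> / 2" "\<eta> \<le> (1 - c) * k0 / 4" unfolding \<eta>_def using c lim(2) z(4) by auto
  have "\<forall>\<^sub>F x in at_right 0. \<bar>k x - k0\<bar> < \<eta>" using tendstoD[OF lim(1) \<eta>(1)] by (simp add: dist_real_def)
  then obtain d where d: "0 < d" "\<And>x. 0 < x \<Longrightarrow> x < d \<Longrightarrow> \<bar>k x - k0\<bar> < \<eta>"
    unfolding eventually_at_right_field by auto
  define b where "b = z2 / d + 1"
  have b: "1 < b" unfolding b_def using z d by simp
  have bd: "w / b < d" "w / b < x0" if "0 < w" "w < z2" for w
  proof -
    have "d * b = z2 + d" unfolding b_def using d(1) by (simp add: distrib_left)
    hence "w < d * b" using that d(1) by simp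
    thus "w / b < d" using b by (simp add: field_simps)
    have "w / b \<le> w / 1" using that b by (intro divide_left_mono) auto
    thus "w / b < x0" using that z by simp
  qed
  have bj: "0 < b ^ j" using b by simp
  \<comment> \<open>Division by b^j compensates the factor x^j: l f w compares with f (w / b) as c k
    w does with k (w / b).\<close>
  define l where "l = c / b ^ j"
  have "1 \<le> b ^ j" using b by (simp add: one_le_power)
  hence lc: "l \<le> c" unfolding l_def using c by (simp add: divide_le_eq)
  have "0 < l" unfolding l_def using c bj by simp
  with lc c have l: "0 < l" "l < 1" by linarith+
  show ?thesis
  proof (rule not_MSU_criterion[OF \<mu> f f0 b l, of "min d x0" z1 z2])
    show "0 < min d x0" using d x0 by simp
    fix w assume w: "0 < w" "w < min d x0"
    have wb: "0 < w / b" using w b by simp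
    have "w / b \<le> w / 1" using w b by (intro divide_left_mono) auto
    hence wb': "w / b < d" "w / b < x0" using w by auto
    have 1: "c * k w < k (w / b)"
    proof -
      have "k w < k0 + \<eta>" "k0 - \<eta> < k (w / b)" using d(2)[of w] d(2)[of "w / b"] w wb wb' by auto
      moreover have "c * (k0 + \<eta>) \<le> k0 - \<eta>"
      proof -
        have "c * \<eta> \<le> 1 * \<eta>" using c \<eta> by (intro mult_right_mono) auto
        moreover have "4 * \<eta> \<le> (1 - c) * k0" using \<eta> by simp
        ultimately show ?thesis using \<eta>(1) unfolding distrib_left left_diff_distrib by linarith
      qed
      moreover have "c * k w < c * (k0 + \<eta>)" using \<open>k w < k0 + \<eta>\<close> c by simp
      ultimately show ?thesis by linarith
    qed
    have "l * f w = (w / b) ^ j * (c * k w)" using w fk[of w] unfolding l_def by (simp add: power_divide)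
    also have "\<dots> < (w / b) ^ j * k (w / b)" using 1 wb by simp
    also have "\<dots> = f (w / b)" using fk[of "w / b"] wb wb' by simp
    finally show "l * f w < f (w / b)" .
  next
    fix w assume w: "z1 < w" "w < z2"
    have w0: "0 < w" using w z by simp
    have wb: "0 < w / b" using w0 b by simp
    have 1: "k (w / b) < c * k w"
    proof -
      have "k (w / b) < k0 + \<epsilon> / 2" using d(2)[OF wb bd(1)[OF w0 w(2)]] \<eta> by linarith
      also have "\<dots> < c * (k0 + \<epsilon>)" unfolding c(3) using z by simp
      also have "\<dots> \<le> c * k w" using z(5)[OF w] c by (intro mult_left_mono) auto
      finally show ?thesis .
    qed
    have "f (w / b) = (w / b) ^ j * k (w / b)" using fk[OF wb bd(2)[OF w0 w(2)]] .
    also have "\<dots> < (w / b) ^ j * (c * k w)" using 1 wb by simp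
    also have "\<dots> = l * f w" using w0 w z fk[of w] unfolding l_def by (simp add: power_divide)
    finally show "f (w / b) < l * f w" .
  qed (use z in auto)
qed

section \<open>Laws determined by their moments\<close>

text \<open>The characteristic functions share their Taylor polynomials. On the nonnegative half
  line absolute moments are moments, so the growth condition makes the remainders tend to 0 along
  the even orders.\<close>

lemma real_distribution_eqI_moments:
  fixes m :: "nat \<Rightarrow> real"
  assumes M: "real_distribution M1" "real_distribution M2"
    and nn: "AE x in M1. 0 \<le> x" "AE x in M2. 0 \<le> x"
    and mom: "\<And>n. has_bochner_integral M1 (\<lambda>x. x ^ n) (m n)" "\<And>n. has_bochner_integral M2 (\<lambda>x. x ^ n) (m n)"
    and growth: "\<And>t. (\<lambda>k. t ^ (2 * k) * m (2 * k) / fact (2 * k)) \<longlonglongrightarrow> 0"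
  shows "M1 = M2"
proof (rule Levy_uniqueness[OF M])
  have approx: "cmod (char M t - (\<Sum>k\<le>n. ((\<i> * t) ^ k / fact k) * m k)) \<le> 2 * \<bar>t\<bar> ^ n / fact n * m n"
    if "real_distribution M" "AE x in M. 0 \<le> x" "\<And>n. has_bochner_integral M (\<lambda>x. x ^ n) (m n)" for M t n
  proof -
    interpret real_distribution M by fact
    have i: "integrable M (\<lambda>x. x ^ k)" "expectation (\<lambda>x. x ^ k) = m k" for k
      using that(3)[of k] by (auto simp: has_bochner_integral_iff)
    have "expectation (\<lambda>x. \<bar>x\<bar> ^ n) = expectation (\<lambda>x. x ^ n)"
      using that(2) by (intro integral_cong_AE) (auto elim!: eventually_mono)
    thus ?thesis using char_approx1[of n t] i by simp
  qed
  show "char M1 = char M2"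
  proof
    fix t
    have "cmod (char M1 t - char M2 t) \<le> 4 * (\<bar>t\<bar> ^ (2 * k) * m (2 * k) / fact (2 * k))" for k
    proof -
      define S where "S = (\<Sum>j\<le>2 * k. ((\<i> * t) ^ j / fact j) * m j)"
      have "cmod (char M1 t - char M2 t) = cmod ((char M1 t - S) - (char M2 t - S))" by simp
      also have "\<dots> \<le> cmod (char M1 t - S) + cmod (char M2 t - S)" by (rule norm_triangle_ineq4)
      also have "\<dots> \<le> 2 * \<bar>t\<bar> ^ (2 * k) / fact (2 * k) * m (2 * k) + 2 * \<bar>t\<bar> ^ (2 * k) / fact (2 * k) * m (2 * k)"
        unfolding S_def by (intro add_mono approx M nn mom)
      finally show ?thesis by (simp add: field_simps)
    qed
    moreover have "(\<lambda>k. 4 * (\<bar>t\<bar> ^ (2 * k) * m (2 * k) / fact (2 * k))) \<longlonglongrightarrow> 4 * 0"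
      by (intro tendsto_intros growth)
    ultimately have "cmod (char M1 t - char M2 t) \<le> 4 * 0"
      by (intro tendsto_lowerbound[of _ _ sequentially]) auto
    thus "char M1 t = char M2 t" by simp
  qed
qed

text \<open>For k only the moments from order N on are known, and its total mass need not be among
  them. Both measures are therefore reweighted by x^N / c, which gives probability measures with all
  moments known; the weight is positive on the half line and is divided out at the end.\<close>

lemma moments_determine_density:
  fixes m :: "nat \<Rightarrow> real" and k :: "real \<Rightarrow> real"
  assumes \<mu>: "positive_distribution \<mu>" and k[measurable]: "k \<in> borel_measurable borel"
    and k0: "\<And>x. 0 \<le> k x" "\<And>x. x \<le> 0 \<Longrightarrow> k x = 0"
    and mom: "\<And>n. N \<le> n \<Longrightarrow> has_bochner_integral \<mu> (\<lambda>x. x ^ n) (m n)"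
      "\<And>n. N \<le> n \<Longrightarrow> (\<integral>\<^sup>+x. ennreal (x ^ n * k x) \<partial>lborel) = ennreal (m n)"
    and growth: "\<And>t. (\<lambda>n. t ^ n * m n / fact n) \<longlonglongrightarrow> 0"
  shows "\<mu> = density lborel (\<lambda>x. ennreal (k x))"
proof -
  interpret positive_distribution \<mu> by fact
  define c where "c = m N"
  have nnmom: "(\<integral>\<^sup>+x. ennreal (x ^ n) \<partial>\<mu>) = ennreal (m n)" "0 \<le> m n" if "N \<le> n" for n
  proof -
    have i: "integrable \<mu> (\<lambda>x. x ^ n)" "expectation (\<lambda>x. x ^ n) = m n" using mom(1)[OF that] by (auto simp: has_bochner_integral_iff)
    have ae: "AE x in \<mu>. 0 \<le> x ^ n" using AE_pos by eventually_elim simp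
    show "(\<integral>\<^sup>+x. ennreal (x ^ n) \<partial>\<mu>) = ennreal (m n)" using nn_integral_eq_integral[OF i(1) ae] i by simp
    show "0 \<le> m n" unfolding i(2)[symmetric] by (rule integral_nonneg_AE[OF ae])
  qed
  have c: "0 < c"
  proof (rule ccontr)
    assume "\<not> 0 < c"
    hence "c = 0" using nnmom(2)[of N] unfolding c_def by simp
    hence "(\<integral>\<^sup>+x. ennreal (x ^ N) \<partial>\<mu>) = 0" using nnmom(1)[of N] unfolding c_def by simp
    hence "AE x in \<mu>. ennreal (x ^ N) = 0" by (subst (asm) nn_integral_0_iff_AE) auto
    hence "AE x in \<mu>. False" using AE_pos
    proof eventually_elim
      case (elim x)
      hence "0 < x ^ N" by simp
      thus ?case using elim(1) by (simp add: ennreal_eq_0_iff)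
    qed
    thus False using AE_False by simp
  qed
  define w where "w x = (if 0 < x then x ^ N / c else 0)" for x :: real
  have w[measurable]: "w \<in> borel_measurable borel" unfolding w_def[abs_def] by measurable
  have w0: "0 \<le> w x" for x unfolding w_def using c by simp
  define K where "K = density lborel (\<lambda>x. ennreal (k x))"
  define M1 M2 where "M1 = density \<mu> (\<lambda>x. ennreal (w x))" and "M2 = density K (\<lambda>x. ennreal (w x))"
  have sK[measurable_cong]: "sets K = sets borel" unfolding K_def by simp
  have mu1: "(\<integral>\<^sup>+x. ennreal (w x * x ^ n) \<partial>\<mu>) = ennreal (m (N + n) / c)" for n
  proof -
    have "(\<integral>\<^sup>+x. ennreal (w x * x ^ n) \<partial>\<mu>) = (\<integral>\<^sup>+x. ennreal (1 / c) * ennreal (x ^ (N + n)) \<partial>\<mu>)"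
      using AE_pos c by (intro nn_integral_cong_AE) (auto elim!: eventually_mono simp: w_def power_add ennreal_mult'[symmetric])
    also have "\<dots> = ennreal (m (N + n) / c)"
      using c nnmom[of "N + n"] by (subst nn_integral_cmult) (auto simp: ennreal_mult'[symmetric])
    finally show ?thesis .
  qed
  have mu2: "(\<integral>\<^sup>+x. ennreal (w x * x ^ n) \<partial>K) = ennreal (m (N + n) / c)" for n
  proof -
    have "(\<integral>\<^sup>+x. ennreal (w x * x ^ n) \<partial>K) = (\<integral>\<^sup>+x. ennreal (1 / c) * ennreal (x ^ (N + n) * k x) \<partial>lborel)"
      unfolding K_def
    proof (subst nn_integral_density, measurable, intro nn_integral_cong)
      fix x :: real
      show "ennreal (k x) * ennreal (w x * x ^ n) = ennreal (1 / c) * ennreal (x ^ (N + n) * k x)"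
        using k0[of x] c by (cases "0 < x") (auto simp: w_def power_add ennreal_mult'[symmetric] mult_ac)
    qed
    also have "\<dots> = ennreal (m (N + n) / c)"
      using c mom(2)[of "N + n"] by (subst nn_integral_cmult) (auto simp: ennreal_mult'[symmetric])
    finally show ?thesis .
  qed
  have both: "real_distribution (density L (\<lambda>x. ennreal (w x)))" "AE x in density L (\<lambda>x. ennreal (w x)). 0 \<le> x"
    "has_bochner_integral (density L (\<lambda>x. ennreal (w x))) (\<lambda>x. x ^ n) (m (N + n) / c)"
    if L[measurable_cong]: "sets L = sets borel" and mu: "\<And>n. (\<integral>\<^sup>+x. ennreal (w x * x ^ n) \<partial>L) = ennreal (m (N + n) / c)" for L n
  proof -
    have "emeasure (density L (\<lambda>x. ennreal (w x))) (space (density L (\<lambda>x. ennreal (w x)))) = (\<integral>\<^sup>+x. ennreal (w x) \<partial>L)"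
      by (subst emeasure_density) (auto intro!: nn_integral_cong simp: indicator_def)
    also have "\<dots> = 1" using mu[of 0] c by (simp add: c_def)
    finally have "prob_space (density L (\<lambda>x. ennreal (w x)))" by (rule prob_spaceI)
    moreover have "space L = UNIV" using sets_eq_imp_space_eq[OF L] by simp
    ultimately show "real_distribution (density L (\<lambda>x. ennreal (w x)))"
      unfolding real_distribution_def real_distribution_axioms_def by (simp add: L)
    show ae: "AE x in density L (\<lambda>x. ennreal (w x)). 0 \<le> x" by (subst AE_density) (auto simp: w_def)
    show "has_bochner_integral (density L (\<lambda>x. ennreal (w x))) (\<lambda>x. x ^ n) (m (N + n) / c)"
    proof (rule has_bochner_integral_nn_integral)
      show "AE x in density L (\<lambda>x. ennreal (w x)). 0 \<le> x ^ n" using ae by eventually_elim simp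
      show "0 \<le> m (N + n) / c" using nnmom(2)[of "N + n"] c by simp
      show "(\<integral>\<^sup>+x. ennreal (x ^ n) \<partial>density L (\<lambda>x. ennreal (w x))) = ennreal (m (N + n) / c)"
        unfolding mu[symmetric] using w0 by (subst nn_integral_density) (auto intro!: nn_integral_cong simp: ennreal_mult'[symmetric])
    qed measurable
  qed
  have "M1 = M2" unfolding M1_def M2_def
  proof (rule real_distribution_eqI_moments[where m = "\<lambda>n. m (N + n) / c"])
    show "(\<lambda>j. t ^ (2 * j) * (m (N + 2 * j) / c) / fact (2 * j)) \<longlonglongrightarrow> 0" for t
    proof (rule Lim_null_comparison)
      define s where "s = \<bar>t\<bar> + 1"
      define C where "C = fact N / c"
      \<comment> \<open>The shift by N costs (N + n)! \<le> N! n! 2^(N + n), so the growth condition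
        is applied at 2 s, where s = |t| + 1.\<close>
      have bound: "\<bar>t\<bar> ^ n * (m (N + n) / c) / fact n \<le> C * ((2 * s) ^ (N + n) * m (N + n) / fact (N + n))" for n
      proof -
        have "real (N + n choose N) \<le> 2 ^ (N + n)"
        proof -
          have "N + n choose N \<le> (\<Sum>i\<le>N + n. N + n choose i)" by (intro member_le_sum) auto
          hence "N + n choose N \<le> 2 ^ (N + n)" unfolding choose_row_sum .
          thus ?thesis by (metis of_nat_le_iff of_nat_numeral of_nat_power)
        qed
        hence "fact (N + n) \<le> fact N * fact n * (2::real) ^ (N + n)"
          using binomial_fact[of N "N + n", where 'a = real] by (simp add: field_simps)
        hence f: "1 / fact n \<le> fact N * 2 ^ (N + n) / (fact (N + n) :: real)" by (simp add: field_simps)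
        have "\<bar>t\<bar> ^ n \<le> s ^ n" unfolding s_def by (intro power_mono) auto
        also have "\<dots> \<le> s ^ (N + n)" unfolding s_def by (intro power_increasing) auto
        finally have "\<bar>t\<bar> ^ n * (m (N + n) / c) * (1 / fact n) \<le> s ^ (N + n) * (m (N + n) / c) * (fact N * 2 ^ (N + n) / fact (N + n))"
          using f nnmom(2)[of "N + n"] c by (intro mult_mono) (auto simp: s_def)
        thus ?thesis unfolding C_def by (simp add: power_mult_distrib mult_ac)
      qed
      show "\<forall>\<^sub>F j in sequentially. norm (t ^ (2 * j) * (m (N + 2 * j) / c) / fact (2 * j)) \<le> C * ((2 * s) ^ (N + 2 * j) * m (N + 2 * j) / fact (N + 2 * j))"
      proof (intro always_eventually allI)
        fix j
        have "norm (t ^ (2 * j) * (m (N + 2 * j) / c) / fact (2 * j)) = \<bar>t\<bar> ^ (2 * j) * (m (N + 2 * j) / c) / fact (2 * j)"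
          using nnmom(2)[of "N + 2 * j"] c by (simp add: abs_mult power_abs)
        thus "norm (t ^ (2 * j) * (m (N + 2 * j) / c) / fact (2 * j)) \<le> C * ((2 * s) ^ (N + 2 * j) * m (N + 2 * j) / fact (N + 2 * j))"
          using bound[of "2 * j"] by simp
      qed
      have "filterlim (\<lambda>j. N + 2 * j) sequentially sequentially"
        by (rule filterlim_subseq) (auto simp: strict_mono_def)
      from filterlim_compose[OF growth this]
      have "(\<lambda>j. C * ((2 * s) ^ (N + 2 * j) * m (N + 2 * j) / fact (N + 2 * j))) \<longlonglongrightarrow> C * 0"
        by (intro tendsto_intros)
      thus "(\<lambda>j. C * ((2 * s) ^ (N + 2 * j) * m (N + 2 * j) / fact (N + 2 * j))) \<longlonglongrightarrow> 0" by simp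
    qed
  qed (use both[OF _ mu1] both[OF sK mu2] in auto)
  hence eq: "density M1 (\<lambda>x. ennreal (1 / w x)) = density M2 (\<lambda>x. ennreal (1 / w x))" by simp
  have inv: "density (density L (\<lambda>x. ennreal (w x))) (\<lambda>x. ennreal (1 / w x)) = L"
    if L[measurable_cong]: "sets L = sets borel" and ae: "AE x in L. 0 < x" for L
  proof -
    have "density (density L (\<lambda>x. ennreal (w x))) (\<lambda>x. ennreal (1 / w x)) = density L (\<lambda>x. ennreal (w x) * ennreal (1 / w x))"
      by (rule density_density_eq) measurable
    also have "\<dots> = density L (\<lambda>_. 1)"
      using ae c by (intro density_cong) (auto elim!: eventually_mono simp: w_def ennreal_mult'[symmetric])
    finally show ?thesis by (simp add: density_1)
  qed
  have "AE x in K. 0 < x" unfolding K_def using k0 by (subst AE_density) (auto simp: not_le[symmetric])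
  from inv[OF sK this] inv[of \<mu>] AE_pos eq show ?thesis unfolding M1_def M2_def K_def by simp
qed

lemma Gamma_lower_bound:
  fixes z M :: real
  assumes "1 \<le> z" "0 < M"
  shows "M powr (z - 1) * exp (- (M + 1)) \<le> Gamma z"
proof -
  have "ennreal (M powr (z - 1) * exp (- (M + 1))) = (\<integral>\<^sup>+t. ennreal (M powr (z - 1) * exp (- (M + 1))) * indicator {M..M + 1} t \<partial>lborel)"
    by (simp add: nn_integral_cmult_indicator)
  also have "\<dots> \<le> (\<integral>\<^sup>+t. ennreal (indicator {0..} t * t powr (z - 1) / exp t) \<partial>lborel)"
  proof (intro nn_integral_mono)
    fix t :: real
    have "M powr (z - 1) * exp (- (M + 1)) \<le> t powr (z - 1) * exp (- t)" if "M \<le> t" "t \<le> M + 1"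
      using that assms by (intro mult_mono powr_mono2) auto
    thus "ennreal (M powr (z - 1) * exp (- (M + 1))) * indicator {M..M + 1} t \<le> ennreal (indicator {0..} t * t powr (z - 1) / exp t)"
      using assms by (auto simp: indicator_def exp_minus field_simps intro!: ennreal_leI)
  qed
  also have "\<dots> = ennreal (Gamma z)" using Gamma_conv_nn_integral_real[of z] assms by simp
  finally show ?thesis using assms Gamma_real_pos[of z] by (simp add: ennreal_le_iff)
qed

lemma rGamma_growth:
  fixes a \<alpha> t :: real
  assumes "0 < \<alpha>"
  shows "(\<lambda>n. t ^ n * rGamma (a + \<alpha> * real n)) \<longlonglongrightarrow> 0"
proof (rule Lim_null_comparison)
  \<comment> \<open>M^\<alpha> = s makes Gamma (a + \<alpha> n) at least s^n / C for large n, and s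
    > 2 |t| leaves a ratio of at most 1 / 2.\<close>
  define s M C where "s = 2 * \<bar>t\<bar> + 1" and "M = s powr (1 / \<alpha>)" and "C = M powr (1 - a) * exp (M + 1)"
  have s: "0 < s" unfolding s_def by simp
  have M: "0 < M" "M powr (\<alpha> * n) = s ^ n" for n :: nat
    unfolding M_def using s assms by (auto simp: powr_powr powr_realpow)
  obtain n0 :: nat where n0: "(1 - a) / \<alpha> < n0" using reals_Archimedean2 by blast
  show "\<forall>\<^sub>F n in sequentially. norm (t ^ n * rGamma (a + \<alpha> * real n)) \<le> C * (1 / 2) ^ n"
  proof (rule eventually_sequentiallyI[of n0])
    fix n assume n: "n0 \<le> n"
    have "(1 - a) / \<alpha> \<le> n" using n0 n by linarith
    hence z: "1 \<le> a + \<alpha> * n" using assms by (simp add: field_simps)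
    have "M powr (a + \<alpha> * n - 1) * exp (- (M + 1)) = s ^ n / C"
    proof -
      have "M powr (a + \<alpha> * n - 1) = M powr (\<alpha> * n) / M powr (1 - a)" unfolding powr_diff[symmetric] by (simp add: algebra_simps)
      thus ?thesis unfolding C_def M(2) by (simp only: exp_minus divide_inverse) (simp add: field_simps)
    qed
    hence G: "s ^ n / C \<le> Gamma (a + \<alpha> * n)" using Gamma_lower_bound[OF z M(1)] by simp
    have C: "0 < C" unfolding C_def using M by simp
    have "norm (t ^ n * rGamma (a + \<alpha> * n)) = \<bar>t\<bar> ^ n / Gamma (a + \<alpha> * n)"
      using Gamma_real_pos[of "a + \<alpha> * n"] z by (simp add: abs_mult power_abs rGamma_inverse_Gamma field_simps)
    also have "\<dots> \<le> \<bar>t\<bar> ^ n / (s ^ n / C)"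
    proof -
      have "0 < s ^ n / C" using s C by simp
      hence "0 < Gamma (a + \<alpha> * n) * (s ^ n / C)" using G by (intro mult_pos_pos) auto
      thus ?thesis using G by (intro divide_left_mono) auto
    qed
    also have "\<dots> = C * (\<bar>t\<bar> / s) ^ n" by (simp add: power_divide)
    also have "\<dots> \<le> C * (1 / 2) ^ n"
    proof -
      have "\<bar>t\<bar> / s \<le> 1 / 2" unfolding s_def by (simp add: field_simps)
      thus ?thesis using C s by (intro mult_left_mono power_mono) auto
    qed
    finally show "norm (t ^ n * rGamma (a + \<alpha> * n)) \<le> C * (1 / 2) ^ n" .
  qed
  show "(\<lambda>n. C * (1 / 2) ^ n) \<longlonglongrightarrow> 0" by (rule tendsto_mult_right_zero[OF LIMSEQ_realpow_zero]) auto
qed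

section \<open>The laws \<open>M\<^sub>\<alpha>\<^sub>,\<^sub>\<beta>\<close>\<close>

lemma M_distribution_powr:
  assumes "M_distribution \<alpha> \<beta> \<mu>" "-1 < s"
  shows "has_bochner_integral \<mu> (\<lambda>x. x powr s) (gen_pochhammer 1 s / gen_pochhammer (\<alpha> + \<beta>) (\<alpha> * s))"
  using assms unfolding M_distribution_def by blast

lemma M_distribution_moment:
  assumes M: "M_distribution \<alpha> \<beta> \<mu>" and "0 \<le> \<alpha>" "0 < \<alpha> + \<beta>"
  shows "has_bochner_integral \<mu> (\<lambda>x. x ^ n) (fact n * (Gamma (\<alpha> + \<beta>) * rGamma (\<alpha> + \<beta> + \<alpha> * real n)))"
proof -
  interpret positive_distribution \<mu> using M by (simp add: M_distribution_def)
  have G: "0 < Gamma (\<alpha> + \<beta>)" using assms by (intro Gamma_real_pos) simp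
  have n: "gen_pochhammer 1 (real n) = fact n"
    unfolding gen_pochhammer_def using Gamma_fact[of n, where 'a = real] by (simp add: add.commute)
  have d: "gen_pochhammer (\<alpha> + \<beta>) (\<alpha> * real n) = Gamma (\<alpha> + \<beta> + \<alpha> * real n) / Gamma (\<alpha> + \<beta>)"
    unfolding gen_pochhammer_def using G by auto
  have "has_bochner_integral \<mu> (\<lambda>x. x powr real n) (fact n * (Gamma (\<alpha> + \<beta>) * rGamma (\<alpha> + \<beta> + \<alpha> * real n)))"
    using M_distribution_powr[OF M, of "real n"] unfolding n d by (simp add: rGamma_inverse_Gamma divide_inverse mult_ac)
  moreover have "AE x in \<mu>. x powr real n = x ^ n"
    using AE_pos by eventually_elim (simp add: powr_realpow)
  ultimately show ?thesis by (subst has_bochner_integral_cong_AE[where g = "\<lambda>x. x powr real n"]) auto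
qed

text \<open>\<open>k\<close> is the density of \<open>M\<^sub>\<alpha>\<^sub>,\<^sub>\<beta>\<close> up to the factor \<open>\<Gamma>(\<alpha> + \<beta>)\<close>. Prescribing only the moments of large
  order allows for densities given by integrals whose low moments are hard to evaluate directly.\<close>

definition M_kernel :: "real \<Rightarrow> real \<Rightarrow> (real \<Rightarrow> real) \<Rightarrow> bool" where
  "M_kernel \<alpha> \<beta> k \<longleftrightarrow> k \<in> borel_measurable borel \<and> (\<forall>x. 0 \<le> k x) \<and> (\<forall>x\<le>0. k x = 0) \<and>
     (\<exists>N. \<forall>n\<ge>N. (\<integral>\<^sup>+x. ennreal (x ^ n * k x) \<partial>lborel) = ennreal (fact n * rGamma (\<alpha> + \<beta> + \<alpha> * real n)))"

lemma M_distribution_density: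
  assumes M: "M_distribution \<alpha> \<beta> \<mu>" and \<alpha>: "0 < \<alpha>" "0 < \<alpha> + \<beta>" and k: "M_kernel \<alpha> \<beta> k"
  shows "\<mu> = density lborel (\<lambda>x. ennreal (Gamma (\<alpha> + \<beta>) * k x))"
proof -
  have [measurable]: "k \<in> borel_measurable borel" and k0: "\<And>x. 0 \<le> k x" "\<And>x. x \<le> 0 \<Longrightarrow> k x = 0"
    using k by (auto simp: M_kernel_def)
  obtain N where N: "\<And>n. N \<le> n \<Longrightarrow> (\<integral>\<^sup>+x. ennreal (x ^ n * k x) \<partial>lborel) = ennreal (fact n * rGamma (\<alpha> + \<beta> + \<alpha> * real n))"
    using k by (auto simp: M_kernel_def)
  have G: "0 < Gamma (\<alpha> + \<beta>)" using \<alpha> by (intro Gamma_real_pos) simp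
  show ?thesis
  proof (rule moments_determine_density[where m = "\<lambda>n. fact n * (Gamma (\<alpha> + \<beta>) * rGamma (\<alpha> + \<beta> + \<alpha> * real n))" and N = N])
    show "positive_distribution \<mu>" using M by (simp add: M_distribution_def)
    show "has_bochner_integral \<mu> (\<lambda>x. x ^ n) (fact n * (Gamma (\<alpha> + \<beta>) * rGamma (\<alpha> + \<beta> + \<alpha> * real n)))" for n
      using M_distribution_moment[OF M] \<alpha> by simp
    show "(\<integral>\<^sup>+x. ennreal (x ^ n * (Gamma (\<alpha> + \<beta>) * k x)) \<partial>lborel) = ennreal (fact n * (Gamma (\<alpha> + \<beta>) * rGamma (\<alpha> + \<beta> + \<alpha> * real n)))"
      if "N \<le> n" for n
    proof -
      have "(\<integral>\<^sup>+x. ennreal (x ^ n * (Gamma (\<alpha> + \<beta>) * k x)) \<partial>lborel) = (\<integral>\<^sup>+x. ennreal (Gamma (\<alpha> + \<beta>)) * ennreal (x ^ n * k x) \<partial>lborel)"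
        using G by (intro nn_integral_cong) (simp add: ennreal_mult'[symmetric] mult_ac)
      also have "\<dots> = ennreal (Gamma (\<alpha> + \<beta>)) * ennreal (fact n * rGamma (\<alpha> + \<beta> + \<alpha> * real n))"
        by (subst nn_integral_cmult) (simp_all add: N[OF that])
      finally show ?thesis using G by (simp add: ennreal_mult'[symmetric] mult_ac)
    qed
    show "(\<lambda>n. t ^ n * (fact n * (Gamma (\<alpha> + \<beta>) * rGamma (\<alpha> + \<beta> + \<alpha> * real n))) / fact n) \<longlonglongrightarrow> 0" for t
      using tendsto_mult_right_zero[OF rGamma_growth[OF \<alpha>(1), of t "\<alpha> + \<beta>"], of "Gamma (\<alpha> + \<beta>)"] by (simp add: mult_ac)
  qed (use k0 G in auto)
qed

lemma log_concave_scale: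
  assumes "log_concave g" "0 < c"
  shows "log_concave (\<lambda>t. c * g t)"
proof -
  have g: "\<forall>t. 0 \<le> g t" and conc: "concave_on {t. 0 < g t} (\<lambda>t. ln (g t))" using assms by (auto simp: log_concave_def)
  have e: "{t. 0 < c * g t} = {t. 0 < g t}" using assms(2) by (simp add: zero_less_mult_iff)
  have "concave_on {t. 0 < g t} (\<lambda>t. ln c + ln (g t))"
    using conc by (intro concave_on_add) (auto simp: concave_on_const concave_on_def convex_on_def)
  hence "concave_on {t. 0 < g t} (\<lambda>t. ln (c * g t))"
    by (rule concave_on_eq) (use assms(2) in \<open>simp add: ln_mult\<close>)
  thus ?thesis unfolding log_concave_def e using g assms(2) by simp
qed

lemma M_distribution_MSU_star:
  assumes M: "M_distribution \<alpha> \<beta> \<mu>" and \<alpha>: "0 < \<alpha>" "0 < \<alpha> + \<beta>" and k: "M_kernel \<alpha> \<beta> k"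
    and lc: "log_concave (\<lambda>t. k (exp t))"
  shows "MSU_star \<mu>"
  unfolding MSU_star_def
proof (intro conjI exI[of _ "\<lambda>x. Gamma (\<alpha> + \<beta>) * k x"])
  have G: "0 < Gamma (\<alpha> + \<beta>)" using \<alpha> by (intro Gamma_real_pos) simp
  show "positive_distribution \<mu>" using M by (simp add: M_distribution_def)
  show "(\<lambda>x. Gamma (\<alpha> + \<beta>) * k x) \<in> borel_measurable borel" "\<forall>x. 0 \<le> Gamma (\<alpha> + \<beta>) * k x" using k G by (auto simp: M_kernel_def)
  show "\<mu> = density lborel (\<lambda>x. ennreal (Gamma (\<alpha> + \<beta>) * k x))" by (rule M_distribution_density[OF M \<alpha> k])
  show "log_concave (\<lambda>t. Gamma (\<alpha> + \<beta>) * k (exp t))" by (rule log_concave_scale[OF lc G])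
qed

lemma M_distribution_not_MSU:
  assumes M: "M_distribution \<alpha> \<beta> \<mu>" and \<alpha>: "0 < \<alpha>" "0 < \<alpha> + \<beta>" and k: "M_kernel \<alpha> \<beta> k"
    and fk: "\<And>x. 0 < x \<Longrightarrow> x < x0 \<Longrightarrow> k x = x ^ j * h x" and x0: "0 < x0"
    and lim: "(h \<longlongrightarrow> h0) (at_right 0)" "0 < h0"
    and z: "0 < z1" "z1 < z2" "z2 \<le> x0" "0 < \<epsilon>" "\<And>x. z1 < x \<Longrightarrow> x < z2 \<Longrightarrow> h0 + \<epsilon> \<le> h x"
  shows "\<not> MSU \<mu>"
proof (rule not_MSU_of_increasing_factor[OF _ M_distribution_density[OF M \<alpha> k], where k = "\<lambda>x. Gamma (\<alpha> + \<beta>) * h x" and j = j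
    and ?x0.0 = x0 and \<epsilon> = "Gamma (\<alpha> + \<beta>) * \<epsilon>" and ?k0.0 = "Gamma (\<alpha> + \<beta>) * h0" and ?z1.0 = z1 and ?z2.0 = z2])
  have G: "0 < Gamma (\<alpha> + \<beta>)" using \<alpha> by (intro Gamma_real_pos) simp
  show "real_distribution \<mu>" using M by (simp add: M_distribution_def positive_distribution_def)
  show "(\<lambda>x. Gamma (\<alpha> + \<beta>) * k x) \<in> borel_measurable borel" "0 \<le> Gamma (\<alpha> + \<beta>) * k x" for x using k G by (auto simp: M_kernel_def)
  show "Gamma (\<alpha> + \<beta>) * k x = 0" if "x \<le> 0" for x using k that by (auto simp: M_kernel_def)
  show "((\<lambda>x. Gamma (\<alpha> + \<beta>) * h x) \<longlongrightarrow> Gamma (\<alpha> + \<beta>) * h0) (at_right 0)" by (intro tendsto_intros lim)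
  show "0 < Gamma (\<alpha> + \<beta>) * h0" "0 < Gamma (\<alpha> + \<beta>) * \<epsilon>" using G lim z by auto
  show "Gamma (\<alpha> + \<beta>) * h0 + Gamma (\<alpha> + \<beta>) * \<epsilon> \<le> Gamma (\<alpha> + \<beta>) * h x" if "z1 < x" "x < z2" for x
    using z(5)[OF that] G by (simp only: distrib_left[symmetric] mult_le_cancel_left_pos)
qed (use fk x0 z in auto)

lemma M_kernel_wright_density:
  assumes \<alpha>: "0 < \<alpha>" "\<alpha> < 1" and \<beta>: "0 < \<beta>" "\<beta> < 2"
  shows "M_kernel \<alpha> \<beta> (wright_density \<alpha> (1 - \<beta>))"
proof -
  have g: "\<bar>1 - \<beta>\<bar> < 1" using \<beta> by auto
  obtain N where N: "\<And>n. N \<le> n \<Longrightarrow> 0 < (1 - \<alpha>) * (real n + 1) + (1 - \<beta>)" using exponent_pos[OF \<alpha> g] by blast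
  have "(\<integral>\<^sup>+x. ennreal (x ^ n * wright_density \<alpha> (1 - \<beta>) x) \<partial>lborel) = ennreal (fact n * rGamma (\<alpha> + \<beta> + \<alpha> * real n))" if "N \<le> n" for n
    using wright_density_moment[OF \<alpha> g N[OF that]] by (simp add: algebra_simps)
  thus ?thesis unfolding M_kernel_def using wright_density_nonneg[OF \<alpha> g] wright_density_0 by auto
qed

text \<open>Multiplication by x shifts the moments by one. With z = \<alpha> (n + 1) the extra
  factors \<alpha> and n + 1 combine to z, and z rGamma (z + 1) = rGamma z.\<close>

lemma M_kernel_0:
  assumes \<alpha>: "0 < \<alpha>" "\<alpha> < 1"
  shows "M_kernel \<alpha> 0 (\<lambda>x. \<alpha> * (x * wright_density \<alpha> \<alpha> x))"
proof -
  have g: "\<bar>\<alpha>\<bar> < 1" using \<alpha> by auto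
  have m: "(\<integral>\<^sup>+x. ennreal (x ^ n * (\<alpha> * (x * wright_density \<alpha> \<alpha> x))) \<partial>lborel) = ennreal (fact n * rGamma (\<alpha> + 0 + \<alpha> * real n))" for n
  proof -
    have q: "0 < (1 - \<alpha>) * (real (Suc n) + 1) + \<alpha>" using \<alpha> by (intro add_pos_pos) auto
    define z where "z = \<alpha> * (real n + 1)"
    have "(\<integral>\<^sup>+x. ennreal (x ^ n * (\<alpha> * (x * wright_density \<alpha> \<alpha> x))) \<partial>lborel) = (\<integral>\<^sup>+x. ennreal \<alpha> * ennreal (x ^ Suc n * wright_density \<alpha> \<alpha> x) \<partial>lborel)"
      using \<alpha> by (intro nn_integral_cong) (simp add: ennreal_mult'[symmetric] mult_ac)
    also have "\<dots> = ennreal \<alpha> * ennreal (fact (Suc n) * rGamma (1 - \<alpha> + \<alpha> * (real (Suc n) + 1)))"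
      by (subst nn_integral_cmult) (simp_all only: wright_density_moment[OF \<alpha> g q], measurable)
    also have "1 - \<alpha> + \<alpha> * (real (Suc n) + 1) = z + 1" unfolding z_def by (simp add: algebra_simps)
    also have "ennreal \<alpha> * ennreal (fact (Suc n) * rGamma (z + 1)) = ennreal (fact n * (z * rGamma (z + 1)))"
      using \<alpha> unfolding z_def by (simp add: ennreal_mult'[symmetric] algebra_simps)
    also have "z * rGamma (z + 1) = rGamma z" by (rule rGamma_plus1)
    finally show ?thesis unfolding z_def by (simp add: algebra_simps)
  qed
  have "0 \<le> \<alpha> * (x * wright_density \<alpha> \<alpha> x)" for x
    using wright_density_nonneg[OF \<alpha> g, of x] wright_density_0[of x \<alpha> \<alpha>] \<alpha> by (cases "x \<le> 0") auto
  thus ?thesis unfolding M_kernel_def using m wright_density_0 by auto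
qed

text \<open>By Tonelli's theorem the moment of order n of the tail integral is the one of order n +
  1 of k divided by n + 1, which raises \<beta> by \<alpha>. In logarithmic variables the tail is
  the convolution of k (exp a) exp a with the indicator of a half line, and both are
  \<open>tp2\<close>.\<close>

lemma M_kernel_tail:
  assumes \<alpha>: "0 < \<alpha>" and k: "M_kernel \<alpha> \<beta> k" and pos: "\<And>x. 0 < x \<Longrightarrow> 0 < k x" and lc: "log_concave (\<lambda>t. k (exp t))"
  shows "\<exists>K. M_kernel \<alpha> (\<beta> + \<alpha>) K \<and> (\<forall>x>0. 0 < K x) \<and> log_concave (\<lambda>t. K (exp t))"
proof -
  define K where "K x = (if 0 < x then enn2real (\<integral>\<^sup>+u. ennreal (indicator {x<..} u * k u) \<partial>lborel) else 0)" for x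
  have [measurable]: "k \<in> borel_measurable borel" and k0: "\<And>x. 0 \<le> k x" "\<And>x. x \<le> 0 \<Longrightarrow> k x = 0"
    using k by (auto simp: M_kernel_def)
  obtain N where N: "\<And>n. N \<le> n \<Longrightarrow> (\<integral>\<^sup>+x. ennreal (x ^ n * k x) \<partial>lborel) = ennreal (fact n * rGamma (\<alpha> + \<beta> + \<alpha> * real n))"
    using k by (auto simp: M_kernel_def)
  define T where "T x = (\<integral>\<^sup>+u. ennreal (indicator {x<..} u * k u) \<partial>lborel)" for x
  have T': "T x = (\<integral>\<^sup>+u. ennreal (if x < u then k u else 0) \<partial>lborel)" for x
    unfolding T_def by (intro nn_integral_cong) (simp add: indicator_def)
  have T_meas [measurable]: "T \<in> borel_measurable borel" unfolding T'[abs_def] by measurable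
  \<comment> \<open>For u > x the factor (u / x)^N is at least 1, so the moment of order N, known to
    be finite, bounds the tail.\<close>
  have Tfin: "T x < top" if "0 < x" for x
  proof -
    have "T x \<le> (\<integral>\<^sup>+u. ennreal (inverse x ^ N) * ennreal (u ^ N * k u) \<partial>lborel)"
      unfolding T_def
    proof (intro nn_integral_mono)
      fix u :: real
      show "ennreal (indicator {x<..} u * k u) \<le> ennreal (inverse x ^ N) * ennreal (u ^ N * k u)"
      proof (cases "x < u")
        case True
        have "1 \<le> (inverse x * u) ^ N" using True that by (intro one_le_power) (simp add: field_simps)
        hence "1 * k u \<le> (inverse x * u) ^ N * k u" using k0 by (intro mult_right_mono) auto
        hence "ennreal (k u) \<le> ennreal (inverse x ^ N * (u ^ N * k u))" by (intro ennreal_leI) (simp add: power_mult_distrib mult_ac)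
        thus ?thesis using True that by (simp add: ennreal_mult')
      qed simp
    qed
    also have "\<dots> = ennreal (inverse x ^ N) * ennreal (fact N * rGamma (\<alpha> + \<beta> + \<alpha> * real N))"
      by (subst nn_integral_cmult) (simp_all add: N)
    also have "\<dots> < top" by (simp add: ennreal_mult_less_top)
    finally show ?thesis .
  qed
  have KT: "ennreal (K x) = T x" if "0 < x" for x using Tfin[OF that] that by (simp add: K_def T_def)
  have Tpos: "0 < T x" if "0 < x" for x
  proof (rule ccontr)
    assume "\<not> 0 < T x"
    hence "T x = 0" by (simp add: zero_less_iff_neq_zero)
    hence "AE u in lborel. ennreal (indicator {x<..} u * k u) = 0"
      unfolding T_def by (subst (asm) nn_integral_0_iff_AE) auto
    hence "AE u in lborel. u \<notin> {x<..<x + 1}"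
    proof eventually_elim
      case (elim u)
      show ?case
      proof
        assume "u \<in> {x<..<x + 1}"
        hence "0 < k u" "x < u" using pos[of u] that by auto
        thus False using elim by simp
      qed
    qed
    hence "emeasure lborel {x<..<x + 1} = 0"
      by (subst (asm) AE_iff_measurable[of "{x<..<x + 1}"]) (auto simp del: greaterThanLessThan_iff)
    thus False by simp
  qed
  have Kpos: "0 < K x" if "0 < x" for x
    using Tpos[OF that] unfolding KT[OF that, symmetric] by simp
  have K0: "0 \<le> K x" for x unfolding K_def by simp
  have Kmeas [measurable]: "K \<in> borel_measurable borel" unfolding K_def[abs_def] T_def[symmetric] by measurable
  have Kker: "M_kernel \<alpha> (\<beta> + \<alpha>) K"
  proof -
    have "(\<integral>\<^sup>+x. ennreal (x ^ n * K x) \<partial>lborel) = ennreal (fact n * rGamma (\<alpha> + (\<beta> + \<alpha>) + \<alpha> * real n))" if n: "N \<le> n" for n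
    proof -
      have "(\<integral>\<^sup>+x. ennreal (x ^ n * K x) \<partial>lborel) = (\<integral>\<^sup>+x. \<integral>\<^sup>+u. ennreal (if 0 < x \<and> x < u then x ^ n * k u else 0) \<partial>lborel \<partial>lborel)"
      proof (intro nn_integral_cong)
        fix x :: real
        show "ennreal (x ^ n * K x) = (\<integral>\<^sup>+u. ennreal (if 0 < x \<and> x < u then x ^ n * k u else 0) \<partial>lborel)"
        proof (cases "0 < x")
          case True
          have "ennreal (x ^ n * K x) = ennreal (x ^ n) * T x" using True by (simp add: ennreal_mult' KT)
          also have "\<dots> = (\<integral>\<^sup>+u. ennreal (x ^ n) * ennreal (if x < u then k u else 0) \<partial>lborel)"
            unfolding T' by (rule nn_integral_cmult[symmetric]) measurable
          also have "\<dots> = (\<integral>\<^sup>+u. ennreal (if 0 < x \<and> x < u then x ^ n * k u else 0) \<partial>lborel)"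
            using True by (intro nn_integral_cong) (simp add: ennreal_mult')
          finally show ?thesis .
        qed (simp add: K_def)
      qed
      also have "\<dots> = (\<integral>\<^sup>+u. \<integral>\<^sup>+x. ennreal (if 0 < x \<and> x < u then x ^ n * k u else 0) \<partial>lborel \<partial>lborel)"
        by (rule lborel_pair.Fubini') measurable
      also have "\<dots> = (\<integral>\<^sup>+u. ennreal (1 / (real n + 1)) * ennreal (u ^ Suc n * k u) \<partial>lborel)"
      proof (intro nn_integral_cong)
        fix u :: real
        show "(\<integral>\<^sup>+x. ennreal (if 0 < x \<and> x < u then x ^ n * k u else 0) \<partial>lborel) = ennreal (1 / (real n + 1)) * ennreal (u ^ Suc n * k u)"
        proof (cases "0 < u")
          case True
          have "(\<integral>\<^sup>+x. ennreal (if 0 < x \<and> x < u then x ^ n * k u else 0) \<partial>lborel)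
            = (\<integral>\<^sup>+x. ennreal (k u) * (ennreal (x ^ n) * indicator {0..u} x) \<partial>lborel)"
            using AE_lborel_singleton[of "0::real"] AE_lborel_singleton[of u]
          proof (intro nn_integral_cong_AE, eventually_elim)
            case (elim x)
            show ?case
            proof (cases "0 < x \<and> x < u")
              case True
              thus ?thesis using k0(1)[of u] by (simp add: ennreal_mult'[symmetric] mult.commute)
            next
              case False
              hence "x \<notin> {0..u}" using elim by auto
              thus ?thesis using False by auto
            qed
          qed
          also have "\<dots> = ennreal (k u) * (\<integral>\<^sup>+x. ennreal (x ^ n) * indicator {0..u} x \<partial>lborel)"
            by (rule nn_integral_cmult) measurable
          also have "(\<integral>\<^sup>+x. ennreal (x ^ n) * indicator {0..u} x \<partial>lborel) = ennreal (u ^ Suc n / (real n + 1) - 0 ^ Suc n / (real n + 1))"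
          proof (rule nn_integral_FTC_Icc)
            show "((\<lambda>x. x ^ Suc n / (real n + 1)) has_real_derivative x ^ n) (at x)" for x
              using DERIV_cdivide[OF DERIV_pow[of "Suc n" x UNIV], of "real n + 1"] by (simp add: add.commute)
          qed (use True in auto)
          also have "ennreal (k u) * \<dots> = ennreal (1 / (real n + 1)) * ennreal (u ^ Suc n * k u)"
            using k0 by (simp add: ennreal_mult'[symmetric] mult_ac)
          finally show ?thesis .
        next
          case False
          hence "(if 0 < x \<and> x < u then x ^ n * k u else 0) = 0" for x by auto
          moreover have "k u = 0" using False k0 by simp
          ultimately show ?thesis by simp
        qed
      qed
      also have "\<dots> = ennreal (1 / (real n + 1)) * ennreal (fact (Suc n) * rGamma (\<alpha> + \<beta> + \<alpha> * real (Suc n)))"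
        using n by (subst nn_integral_cmult) (simp_all only: N le_SucI, measurable)
      also have "\<dots> = ennreal (1 / (real n + 1) * (fact (Suc n) * rGamma (\<alpha> + \<beta> + \<alpha> * real (Suc n))))"
        by (rule ennreal_mult'[symmetric]) simp
      also have "1 / (real n + 1) * (fact (Suc n) * rGamma (\<alpha> + \<beta> + \<alpha> * real (Suc n))) = fact n * rGamma (\<alpha> + (\<beta> + \<alpha>) + \<alpha> * real n)"
      proof -
        have "\<alpha> + \<beta> + \<alpha> * real (Suc n) = \<alpha> + (\<beta> + \<alpha>) + \<alpha> * real n" by (simp add: algebra_simps)
        moreover have "fact (Suc n) = (real n + 1) * fact n" by (simp add: add.commute)
        ultimately show ?thesis by (simp only: mult.assoc[symmetric]) simp
      qed
      finally show ?thesis .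
    qed
    thus ?thesis unfolding M_kernel_def using K0 by (auto simp: K_def[symmetric]) (auto simp: K_def)
  qed
  define l where "l a = k (exp a) * exp a" for a
  have [measurable]: "l \<in> borel_measurable borel" unfolding l_def by measurable
  have l0: "0 \<le> l a" for a using k0 by (simp add: l_def)
  have C: "ennreal (K (exp t)) = (\<integral>\<^sup>+a. ennreal (indicator {0<..} (- t + a) * l a) \<partial>lborel)" for t
  proof -
    have "(\<integral>\<^sup>+a. ennreal (indicator UNIV a * (exp a * (indicator {exp t<..} (exp a) * k (exp a)))) \<partial>lborel)
      = (\<integral>\<^sup>+u. ennreal (indicator (range exp) u * (indicator {exp t<..} u * k u)) \<partial>lborel)"
    proof (rule nn_integral_subst)
      have "range exp = {0::real<..}" using exp_ln by (auto simp: image_iff) (metis exp_ln)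
      thus "range exp \<in> sets (borel :: real measure)" by simp
    qed (use k0 in \<open>auto intro!: DERIV_exp inj_onI\<close>)
    also have "\<dots> = T (exp t)"
      unfolding T_def
    proof (intro nn_integral_cong)
      fix u :: real
      show "ennreal (indicator (range exp) u * (indicator {exp t<..} u * k u)) = ennreal (indicator {exp t<..} u * k u)"
      proof (cases "exp t < u")
        case True
        hence "0 < u" by (rule less_trans[rotated]) simp
        hence "u \<in> range exp" by (metis exp_ln rangeI)
        thus ?thesis by simp
      qed simp
    qed
    finally have "T (exp t) = (\<integral>\<^sup>+a. ennreal (exp a * (indicator {exp t<..} (exp a) * k (exp a))) \<partial>lborel)" by simp
    also have "\<dots> = (\<integral>\<^sup>+a. ennreal (indicator {0<..} (- t + a) * l a) \<partial>lborel)"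
      by (intro nn_integral_cong) (auto simp: l_def indicator_def mult_ac)
    finally show ?thesis by (simp add: KT)
  qed
  have tF: "tp2 (indicator {0<..})" unfolding tp2_def by (auto simp: indicator_def)
  have tl: "tp2 l"
  proof -
    have tk: "tp2 (\<lambda>t. k (exp t))" by (rule log_concave_tp2[OF lc])
    show ?thesis unfolding tp2_def
    proof (intro allI impI)
      fix x y h :: real assume h: "0 \<le> h" "x + h \<le> y"
      have "k (exp x) * k (exp y) \<le> k (exp (x + h)) * k (exp (y - h))"
        using tk h unfolding tp2_def by blast
      hence "k (exp x) * k (exp y) * exp (x + y) \<le> k (exp (x + h)) * k (exp (y - h)) * exp (x + y)"
        by (intro mult_right_mono) auto
      moreover have "exp (x + y) = exp x * exp y" "exp (x + y) = exp (x + h) * exp (y - h)" by (simp_all add: exp_add[symmetric])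
      ultimately show "l x * l y \<le> l (x + h) * l (y - h)" unfolding l_def by (metis mult.assoc mult.left_commute)
    qed
  qed
  have "concave_on UNIV (\<lambda>t. ln (K (exp t)))"
  proof (rule tp2_antimono_concave)
    show "0 < K (exp t)" for t by (rule Kpos) simp
    show "antimono (\<lambda>t. K (exp t))"
    proof (rule antimonoI)
      fix s t :: real assume "s \<le> t"
      have "ennreal (K (exp t)) \<le> ennreal (K (exp s))"
        unfolding C using \<open>s \<le> t\<close> k0 by (intro nn_integral_mono ennreal_leI) (auto simp: indicator_def l_def)
      thus "K (exp t) \<le> K (exp s)" using K0 by simp
    qed
    show "tp2 (\<lambda>t. K (exp t))"
      unfolding tp2_def
    proof (intro allI impI)
      fix x y h :: real assume h: "0 \<le> h" "x + h \<le> y"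
      \<comment> \<open>The tail is a convolution evaluated at -t, so x and y exchange their
        roles.\<close>
      have I: "(\<integral>\<^sup>+a. ennreal (indicator {0<..} (- y + a) * l a) \<partial>lborel) * (\<integral>\<^sup>+a. ennreal (indicator {0<..} (- x + a) * l a) \<partial>lborel)
        \<le> (\<integral>\<^sup>+a. ennreal (indicator {0<..} ((- y + h) + a) * l a) \<partial>lborel) * (\<integral>\<^sup>+a. ennreal (indicator {0<..} ((- x - h) + a) * l a) \<partial>lborel)"
      proof (rule tp2_convolution[OF _ _ _ l0 tF tl h(1)])
        show "- y + h \<le> - x" using h by simp
      qed auto
      have e: "- y + h = - (y - h)" "- x - h = - (x + h)" by auto
      have "ennreal (K (exp y)) * ennreal (K (exp x)) \<le> ennreal (K (exp (y - h))) * ennreal (K (exp (x + h)))"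
        using I unfolding e C[symmetric] .
      hence "ennreal (K (exp y) * K (exp x)) \<le> ennreal (K (exp (y - h)) * K (exp (x + h)))"
        unfolding ennreal_mult'[OF K0] .
      hence "K (exp y) * K (exp x) \<le> K (exp (y - h)) * K (exp (x + h))"
        by (rule ennreal_le_iff[THEN iffD1, rotated]) (intro mult_nonneg_nonneg K0)
      thus "K (exp x) * K (exp y) \<le> K (exp (x + h)) * K (exp (y - h))" by (simp only: mult.commute)
    qed
  qed
  hence "log_concave (\<lambda>t. K (exp t))" unfolding log_concave_def using Kpos K0 by simp
  with Kker Kpos show ?thesis by blast
qed

lemma M_kernel_log_concave:
  assumes \<alpha>: "0 < \<alpha>" "\<alpha> < 1" and "\<alpha> \<le> \<beta>"
  shows "\<exists>k. M_kernel \<alpha> \<beta> k \<and> (\<forall>x>0. 0 < k x) \<and> log_concave (\<lambda>t. k (exp t))"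
proof -
  have "\<exists>k. M_kernel \<alpha> \<beta> k \<and> (\<forall>x>0. 0 < k x) \<and> log_concave (\<lambda>t. k (exp t))"
    if "\<alpha> \<le> \<beta>" "\<beta> < \<alpha> * (real m + 2)" for m \<beta>
    using that
  proof (induction m arbitrary: \<beta>)
    case 0
    \<comment> \<open>For \<alpha> \<le> \<beta> < 2 \<alpha> the value \<gamma> = 1 - \<beta> lies
      in the range of \<open>wright_density_log_concave\<close>, because 2 \<alpha> < 1 + \<alpha>.
      Each later step adds \<alpha> to \<beta>.\<close>
    have \<beta>: "0 < \<beta>" "\<beta> < 2" and g: "\<bar>1 - \<beta>\<bar> < 1" "- \<alpha> \<le> 1 - \<beta>" "1 - \<beta> \<le> 1 - \<alpha>" using 0 \<alpha> by auto
    show ?case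
      using M_kernel_wright_density[OF \<alpha> \<beta>] wright_density_pos[OF \<alpha> g(1)] wright_density_log_concave[OF \<alpha> g] by blast
  next
    case (Suc m)
    show ?case
    proof (cases "\<beta> < \<alpha> * (real m + 2)")
      case True
      thus ?thesis using Suc by blast
    next
      case False
      have "\<alpha> * 2 \<le> \<alpha> * (real m + 2)" using \<alpha> by (intro mult_left_mono) auto
      hence "\<alpha> \<le> \<beta> - \<alpha>" using False by linarith
      moreover have "\<beta> - \<alpha> < \<alpha> * (real m + 2)" using Suc.prems by (simp add: algebra_simps)
      ultimately obtain k where k: "M_kernel \<alpha> (\<beta> - \<alpha>) k" "\<forall>x>0. 0 < k x" "log_concave (\<lambda>t. k (exp t))" using Suc.IH by blast
      show ?thesis using M_kernel_tail[OF \<alpha>(1) k(1) _ k(3)] k(2) by simp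
    qed
  qed
  moreover obtain m :: nat where "\<beta> / \<alpha> < m" using reals_Archimedean2 by blast
  hence "\<beta> < \<alpha> * (real m + 2)" using \<alpha> by (simp add: divide_less_eq distrib_left mult.commute)
  ultimately show ?thesis using assms(3) by blast
qed

section \<open>The boundary values \<alpha> = 1 and \<alpha> = 0\<close>

lemma M_kernel_Beta:
  assumes \<beta>: "0 < \<beta>"
  shows "M_kernel 1 \<beta> (\<lambda>x. if 0 < x \<and> x < 1 then (1 - x) powr (\<beta> - 1) / Gamma \<beta> else 0)"
proof -
  define k where "k x = (if 0 < x \<and> x < 1 then (1 - x) powr (\<beta> - 1) / Gamma \<beta> else 0)" for x
  have G: "0 < Gamma \<beta>" using \<beta> by (rule Gamma_real_pos)
  have "(\<integral>\<^sup>+x. ennreal (x ^ n * k x) \<partial>lborel) = ennreal (fact n * rGamma (1 + \<beta> + 1 * real n))" for n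
  proof -
    have "(\<integral>\<^sup>+x. ennreal (x ^ n * k x) \<partial>lborel)
      = (\<integral>\<^sup>+x. ennreal (1 / Gamma \<beta>) * ennreal (indicator {0..1} x * (x powr (real (Suc n) - 1) * (1 - x) powr (\<beta> - 1))) \<partial>lborel)"
      using AE_lborel_singleton[of "0::real"] AE_lborel_singleton[of "1::real"]
    proof (intro nn_integral_cong_AE, eventually_elim)
      case (elim x)
      thus ?case using G
        by (cases "0 < x \<and> x < 1") (auto simp: k_def indicator_def powr_realpow ennreal_mult'[symmetric] divide_inverse mult_ac)
    qed
    also have "\<dots> = ennreal (1 / Gamma \<beta>) * ennreal (Beta (real (Suc n)) \<beta>)"
      using nn_integral_has_integral_lebesgue[OF _ has_integral_Beta_real[of "real (Suc n)" \<beta>]] \<beta>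
      by (subst nn_integral_cmult) auto
    also have "\<dots> = ennreal (1 / Gamma \<beta> * Beta (real (Suc n)) \<beta>)" using G by (intro ennreal_mult'[symmetric]) simp
    also have "Beta (real (Suc n)) \<beta> = fact n * Gamma \<beta> * rGamma (real (Suc n) + \<beta>)"
      unfolding Beta_def using Gamma_fact[of n, where 'a = real] by (simp add: rGamma_inverse_Gamma divide_inverse add.commute)
    also have "1 / Gamma \<beta> * (fact n * Gamma \<beta> * rGamma (real (Suc n) + \<beta>)) = fact n * rGamma (1 + \<beta> + 1 * real n)"
      using G by (simp add: add_ac)
    finally show ?thesis .
  qed
  moreover have "0 \<le> k x" for x unfolding k_def using G by simp
  ultimately have "M_kernel 1 \<beta> k" unfolding M_kernel_def by (auto simp: k_def[abs_def])
  thus ?thesis unfolding k_def[abs_def] .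
qed

lemma log_concave_Beta:
  fixes \<beta> C :: real
  assumes "1 \<le> \<beta>" "0 < C"
  defines "k \<equiv> \<lambda>x. if 0 < x \<and> x < 1 then (1 - x) powr (\<beta> - 1) / C else (0 :: real)"
  shows "log_concave (\<lambda>t. k (exp t))"
proof -
  have "k (exp t) = (if t < 0 then (1 - exp t) powr (\<beta> - 1) / C else 0)" for t by (simp add: k_def)
  hence S: "{t. 0 < k (exp t)} = {..<0}" using assms(2) by auto
  have "concave_on {..<0} (\<lambda>t. ln (1 - exp t))"
  proof (rule f''_le0_imp_concave)
    fix t :: real assume "t \<in> {..<0}"
    hence t: "0 < 1 - exp t" by simp
    show "DERIV (\<lambda>t. ln (1 - exp t)) t :> - exp t / (1 - exp t)"
      using t by (auto intro!: derivative_eq_intros)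
    show "DERIV (\<lambda>t. - exp t / (1 - exp t)) t :> - exp t / (1 - exp t) ^ 2"
      using t by (auto intro!: derivative_eq_intros simp: field_simps power2_eq_square)
    show "- exp t / (1 - exp t) ^ 2 \<le> 0" using t by simp
  qed simp
  hence "concave_on {..<0} (\<lambda>t. (\<beta> - 1) * ln (1 - exp t) + - ln C)"
    using assms(1) by (intro concave_on_add concave_on_cmul) (auto simp: concave_on_const)
  hence "concave_on {..<0} (\<lambda>t. ln (k (exp t)))"
    by (rule concave_on_eq) (use assms(2) in \<open>simp add: k_def ln_div ln_powr\<close>)
  moreover have "0 \<le> k (exp t)" for t using assms(2) by (simp add: k_def)
  ultimately show ?thesis unfolding log_concave_def S by simp
qed

text \<open>The Mellin transform at s = n / 2, available because it is prescribed for all real s >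
  -1.\<close>

lemma M_distribution_0_sqrt_moment:
  assumes M: "M_distribution 0 \<beta> \<mu>"
  shows "has_bochner_integral (distr \<mu> borel sqrt) (\<lambda>x. x ^ n) (Gamma (1 + real n / 2))"
proof -
  interpret positive_distribution \<mu> using M by (simp add: M_distribution_def)
  have e: "gen_pochhammer 1 (real n / 2) / gen_pochhammer (0 + \<beta>) (0 * (real n / 2)) = Gamma (1 + real n / 2)"
    by (simp add: gen_pochhammer_def)
  have "has_bochner_integral \<mu> (\<lambda>x. x powr (real n / 2)) (Gamma (1 + real n / 2))"
    using M_distribution_powr[OF M, of "real n / 2"] unfolding e by simp
  moreover have "AE x in \<mu>. x powr (real n / 2) = sqrt x ^ n"
    using AE_pos by eventually_elim (simp add: powr_half_sqrt[symmetric] powr_powr powr_realpow[symmetric])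
  ultimately have "has_bochner_integral \<mu> (\<lambda>x. sqrt x ^ n) (Gamma (1 + real n / 2))"
    by (subst has_bochner_integral_cong_AE[where g = "\<lambda>x. x powr (real n / 2)"]) auto
  thus ?thesis by (intro has_bochner_integral_distr) auto
qed

text \<open>The moments of \<open>M\<^sub>0\<^sub>,\<^sub>\<beta>\<close> grow too fast for comparing the characteristic functions directly,
  but those of its square root do not.\<close>

lemma M_distribution_0_exponential:
  assumes M: "M_distribution 0 \<beta> \<mu>"
  shows "\<mu> = density lborel (exponential_density 1)"
proof -
  define \<nu> where "\<nu> = density lborel (exponential_density 1 :: real \<Rightarrow> real)"
  have N: "M_distribution 0 \<beta> \<nu>" unfolding \<nu>_def by (rule M_distribution_0)
  interpret \<mu>: positive_distribution \<mu> using M by (simp add: M_distribution_def)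
  interpret \<nu>: positive_distribution \<nu> using N by (simp add: M_distribution_def)
  have "distr \<mu> borel sqrt = distr \<nu> borel sqrt"
  proof (rule real_distribution_eqI_moments[where m = "\<lambda>n. Gamma (1 + real n / 2)"])
    show "real_distribution (distr \<mu> borel sqrt)" by (rule \<mu>.real_distribution_distr) simp
    show "real_distribution (distr \<nu> borel sqrt)" by (rule \<nu>.real_distribution_distr) simp
    show "AE x in distr \<mu> borel sqrt. 0 \<le> x" using \<mu>.AE_pos by (subst AE_distr_iff) (auto elim!: eventually_mono)
    show "AE x in distr \<nu> borel sqrt. 0 \<le> x" using \<nu>.AE_pos by (subst AE_distr_iff) (auto elim!: eventually_mono)
    show "has_bochner_integral (distr \<mu> borel sqrt) (\<lambda>x. x ^ n) (Gamma (1 + real n / 2))" for n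
      by (rule M_distribution_0_sqrt_moment[OF M])
    show "has_bochner_integral (distr \<nu> borel sqrt) (\<lambda>x. x ^ n) (Gamma (1 + real n / 2))" for n
      by (rule M_distribution_0_sqrt_moment[OF N])
    show "(\<lambda>k. t ^ (2 * k) * Gamma (1 + real (2 * k) / 2) / fact (2 * k)) \<longlonglongrightarrow> 0" for t :: real
    proof (rule Lim_null_comparison)
      show "(\<lambda>k. inverse (fact k) * (t\<^sup>2) ^ k) \<longlonglongrightarrow> 0" by (rule summable_LIMSEQ_zero[OF summable_exp])
      show "\<forall>\<^sub>F k in sequentially. norm (t ^ (2 * k) * Gamma (1 + real (2 * k) / 2) / fact (2 * k)) \<le> inverse (fact k) * (t\<^sup>2) ^ k"
      proof (intro always_eventually allI)
        fix k :: nat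
        \<comment> \<open>The moment of order 2 k is k!, and (k!)^2 \<le> (2 k)! leaves a term of
          the exponential series at t^2.\<close>
        have "fact k * fact k \<le> (fact (k + k) :: nat)" by (intro dvd_imp_le fact_fact_dvd_fact) simp
        hence "real (fact k * fact k) \<le> real (fact (k + k))" by (simp only: of_nat_le_iff)
        hence "fact k * fact k \<le> (fact (2 * k) :: real)" by (simp add: mult_2)
        hence "fact k / fact (2 * k) \<le> inverse (fact k :: real)" by (simp add: field_simps)
        hence "(t\<^sup>2) ^ k * (fact k / fact (2 * k)) \<le> (t\<^sup>2) ^ k * inverse (fact k)" by (intro mult_left_mono) auto
        moreover have "Gamma (1 + real (2 * k) / 2) = fact k" using Gamma_fact[of k, where 'a = real] by (simp add: add.commute)
        ultimately show "norm (t ^ (2 * k) * Gamma (1 + real (2 * k) / 2) / fact (2 * k)) \<le> inverse (fact k) * (t\<^sup>2) ^ k"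
          unfolding power_mult[of t 2 k] by (simp add: abs_mult mult.commute)
      qed
    qed
  qed
  hence eq: "distr (distr \<mu> borel sqrt) borel (\<lambda>x. x\<^sup>2) = distr (distr \<nu> borel sqrt) borel (\<lambda>x. x\<^sup>2)" by simp
  have sq: "distr (distr M borel sqrt) borel (\<lambda>x. x\<^sup>2) = M" if "positive_distribution M" for M
  proof -
    interpret positive_distribution M by fact
    have "distr (distr M borel sqrt) borel (\<lambda>x. x\<^sup>2) = distr M borel (\<lambda>x. (sqrt x)\<^sup>2)"
      by (simp add: distr_distr comp_def)
    also have "\<dots> = distr M borel (\<lambda>x. x)"
      using AE_pos by (intro distr_cong_AE) (auto elim!: eventually_mono)
    also have "\<dots> = M" by (intro distr_id2) simp
    finally show ?thesis .
  qed
  show ?thesis using eq sq[OF \<mu>.positive_distribution_axioms] sq[OF \<nu>.positive_distribution_axioms] unfolding \<nu>_def by simp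
qed

lemma MSU_star_0:
  assumes M: "M_distribution 0 \<beta> \<mu>"
  shows "MSU_star \<mu>"
  unfolding MSU_star_def
proof (intro conjI exI[of _ "exponential_density 1"])
  show "positive_distribution \<mu>" using M by (simp add: M_distribution_def)
  show "\<mu> = density lborel (\<lambda>x. ennreal (exponential_density 1 x))" by (rule M_distribution_0_exponential[OF M])
  have "concave_on UNIV (\<lambda>t::real. - exp t)" unfolding concave_on_def using exp_convex by simp
  thus "log_concave (\<lambda>t. exponential_density 1 (exp t))"
    unfolding log_concave_def exponential_density_def by simp
qed (auto simp: exponential_density_def)

text \<open>The first two moments equal 1, so the expectation of (x - 1)^2 is 0. The law is the
  point mass at 1, which has no density.\<close>

lemma not_MSU_star_1_0:
  assumes M: "M_distribution 1 0 \<mu>"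
  shows "\<not> MSU_star \<mu>"
proof
  assume "MSU_star \<mu>"
  then obtain f where [measurable]: "f \<in> borel_measurable borel" and \<mu>: "\<mu> = density lborel (\<lambda>x. ennreal (f x))"
    unfolding MSU_star_def by blast
  interpret positive_distribution \<mu> using M by (simp add: M_distribution_def)
  have m: "has_bochner_integral \<mu> (\<lambda>x. x ^ n) 1" for n
  proof -
    have "fact n * (Gamma (1 + 0) * rGamma (1 + 0 + 1 * real n)) = (1 :: real)"
      using Gamma_fact[of n, where 'a = real] by (simp add: rGamma_inverse_Gamma)
    thus ?thesis using M_distribution_moment[OF M, of n] by simp
  qed
  have "has_bochner_integral \<mu> (\<lambda>x. (x ^ 2 - 2 * x ^ 1) + x ^ 0) ((1 - 2 * 1) + 1)"
    by (intro has_bochner_integral_add has_bochner_integral_diff has_bochner_integral_mult_right m)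
  hence i: "integrable \<mu> (\<lambda>x. (x - 1)\<^sup>2)" "(\<integral>x. (x - 1)\<^sup>2 \<partial>\<mu>) = 0"
    by (simp_all add: has_bochner_integral_iff power2_eq_square algebra_simps)
  hence "AE x in \<mu>. (x - 1)\<^sup>2 = 0" by (subst (asm) integral_nonneg_eq_0_iff_AE) auto
  hence 1: "AE x in \<mu>. x = 1" by eventually_elim simp
  have "AE x in \<mu>. x \<noteq> 1" unfolding \<mu> using AE_lborel_singleton[of "1::real"] by (subst AE_density) (auto elim!: eventually_mono)
  with 1 have "AE x in \<mu>. False" by eventually_elim simp
  thus False by simp
qed

text \<open>At (1, 0) the law is the point mass at 1, which is MSU but has no density. The first
  equivalence therefore leaves this pair out; the second holds there with both sides false.\<close>

theorem proposition1:
  fixes \<alpha> \<beta> :: real and \<mu> :: "real measure"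
  assumes "0 \<le> \<alpha>" and "\<alpha> \<le> 1" and "0 \<le> \<beta>"
    and "M_distribution \<alpha> \<beta> \<mu>"
  shows "((\<alpha>, \<beta>) \<noteq> (1, 0) \<longrightarrow> (MSU \<mu> \<longleftrightarrow> MSU_star \<mu>)) \<and>
         (MSU_star \<mu> \<longleftrightarrow> \<beta> \<ge> \<alpha> \<or> (\<beta> = 0 \<and> \<alpha> \<le> 1 / 2))"
proof -
  note M = assms(4)
  \<comment> \<open>As MSU* implies MSU, every pair other than (1, 0) is settled by proving MSU*
    inside the stated range or refuting MSU outside of it.\<close>
  have yes: ?thesis if "MSU_star \<mu>" "\<beta> \<ge> \<alpha> \<or> (\<beta> = 0 \<and> \<alpha> \<le> 1 / 2)"
    using that MSU_star_imp_MSU by blast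
  have no: ?thesis if "\<not> MSU \<mu>" "\<not> (\<beta> \<ge> \<alpha> \<or> (\<beta> = 0 \<and> \<alpha> \<le> 1 / 2))"
    using that MSU_star_imp_MSU by blast
  consider "\<alpha> = 0" | "\<alpha> = 1" "\<beta> = 0" | "\<alpha> = 1" "0 < \<beta>" | "0 < \<alpha>" "\<alpha> < 1"
    using assms by linarith
  thus ?thesis
  proof cases
    case 1
    thus ?thesis using MSU_star_0 M assms by (intro yes) auto
  next
    case 2
    thus ?thesis using not_MSU_star_1_0 M by auto
  next
    case 3
    define k where "k x = (if 0 < x \<and> x < 1 then (1 - x) powr (\<beta> - 1) / Gamma \<beta> else 0)" for x :: real
    have G: "0 < Gamma \<beta>" using 3 by (intro Gamma_real_pos)
    have k: "M_kernel 1 \<beta> k" unfolding k_def[abs_def] by (rule M_kernel_Beta[OF 3(2)])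
    have M1: "M_distribution 1 \<beta> \<mu>" using M 3 by simp
    show ?thesis
    proof (cases "1 \<le> \<beta>")
      case True
      show ?thesis
      proof (rule yes)
        show "MSU_star \<mu>"
          by (rule M_distribution_MSU_star[OF M1 _ _ k]) (use 3 log_concave_Beta[OF True G] in \<open>auto simp: k_def\<close>)
      qed (use True 3 in simp)
    next
      case False
      define h where "h x = (1 - x) powr (\<beta> - 1) / Gamma \<beta>" for x
      \<comment> \<open>For \<beta> < 1 the function h increases. On (1/4, 1/2) one has 1 - x \<le>
        3/4, so there h exceeds its limit 1 / Gamma \<beta> at 0 by at least \<epsilon>.\<close>
      define \<epsilon> where "\<epsilon> = ((3 / 4) powr (\<beta> - 1) - 1) / Gamma \<beta>"
      have "1 powr (\<beta> - 1) < (3 / 4) powr (\<beta> - 1)" using False by (intro powr_less_mono2_neg) auto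
      hence \<epsilon>: "0 < \<epsilon>" unfolding \<epsilon>_def using G by simp
      have "(h \<longlongrightarrow> (1 - 0) powr (\<beta> - 1) / Gamma \<beta>) (at_right 0)"
        unfolding h_def using G by (intro tendsto_intros tendsto_ident_at) auto
      hence lim: "(h \<longlongrightarrow> 1 / Gamma \<beta>) (at_right 0)" by simp
      have inc: "1 / Gamma \<beta> + \<epsilon> \<le> h x" if "1 / 4 < x" "x < 1 / 2" for x
      proof -
        have "(3 / 4) powr (\<beta> - 1) \<le> (1 - x) powr (\<beta> - 1)" using that False by (intro powr_mono2') auto
        hence "(3 / 4) powr (\<beta> - 1) / Gamma \<beta> \<le> h x" unfolding h_def using G by (intro divide_right_mono) auto
        thus ?thesis unfolding \<epsilon>_def by (simp add: diff_divide_distrib)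
      qed
      have "\<not> MSU \<mu>"
        by (rule M_distribution_not_MSU[OF M1 _ _ k _ _ lim, where j = 0 and ?x0.0 = 1 and ?z1.0 = "1 / 4" and ?z2.0 = "1 / 2" and \<epsilon> = \<epsilon>])
          (use 3 G \<epsilon> inc in \<open>auto simp: k_def h_def\<close>)
      thus ?thesis by (rule no) (use False 3 in auto)
    qed
  next
    case 4
    note \<alpha> = 4
    consider "\<alpha> \<le> \<beta>" | "\<beta> = 0" "\<alpha> \<le> 1 / 2" | "\<beta> = 0" "1 / 2 < \<alpha>" | "0 < \<beta>" "\<beta> < \<alpha>" using assms by linarith
    thus ?thesis
    proof cases
      case 1
      obtain k where "M_kernel \<alpha> \<beta> k" "log_concave (\<lambda>t. k (exp t))" using M_kernel_log_concave[OF 4 1] by blast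
      hence "MSU_star \<mu>" using M_distribution_MSU_star[OF M 4(1)] 4 assms by simp
      thus ?thesis by (rule yes) (use 1 in simp)
    next
      case 2
      have g: "\<bar>\<alpha>\<bar> < 1" "- \<alpha> \<le> \<alpha>" "\<alpha> \<le> 1 - \<alpha>" using 2 4 by auto
      define w where "w = wright_density \<alpha> \<alpha>"
      have w: "0 < w (exp t)" for t unfolding w_def by (rule wright_density_pos[OF 4 g(1)]) simp
      have "log_concave (\<lambda>t. w (exp t))" unfolding w_def by (rule wright_density_log_concave[OF 4 g])
      hence "concave_on UNIV (\<lambda>t. ln (w (exp t)))" unfolding log_concave_def using w by simp
      moreover have "concave_on UNIV (\<lambda>t::real. t)" by (simp add: concave_on_iff)
      ultimately have "concave_on UNIV (\<lambda>t. t + ln (w (exp t)))" by (intro concave_on_add)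
      hence "concave_on UNIV (\<lambda>t. ln (exp t * w (exp t)))" by (rule concave_on_eq) (use w in \<open>simp add: ln_mult less_imp_neq[symmetric]\<close>)
      hence "log_concave (\<lambda>t. exp t * w (exp t))" unfolding log_concave_def using w by (simp add: less_imp_le)
      hence "log_concave (\<lambda>t. \<alpha> * (exp t * w (exp t)))" using 4 by (intro log_concave_scale)
      moreover have "M_kernel \<alpha> \<beta> (\<lambda>x. \<alpha> * (x * w x))" unfolding w_def using M_kernel_0[OF 4] 2 by simp
      ultimately have "MSU_star \<mu>" using M_distribution_MSU_star[OF M 4(1)] 4 assms by simp
      thus ?thesis by (rule yes) (use 2 in simp)
    next
      case 3
      have g: "1 - \<alpha> < \<alpha>" using 3 by simp
      obtain h0 \<epsilon> z where h: "0 < h0" "0 < \<epsilon>" "0 < z" "(wright_density \<alpha> \<alpha> \<longlongrightarrow> h0) (at_right 0)"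
        "\<And>x. z < x \<Longrightarrow> x < 2 * z \<Longrightarrow> h0 + \<epsilon> \<le> wright_density \<alpha> \<alpha> x"
        using wright_density_near_0[OF 4 g 4(2)] by blast
      \<comment> \<open>For \<beta> = 0 the density vanishes at 0 like x; taking j = 1 leaves the
        factor that has a positive limit.\<close>
      have k: "M_kernel \<alpha> \<beta> (\<lambda>x. \<alpha> * (x * wright_density \<alpha> \<alpha> x))" using M_kernel_0[OF 4] 3 by simp
      have lim: "((\<lambda>x. \<alpha> * wright_density \<alpha> \<alpha> x) \<longlongrightarrow> \<alpha> * h0) (at_right 0)" by (intro tendsto_intros h)
      have inc: "\<alpha> * h0 + \<alpha> * \<epsilon> \<le> \<alpha> * wright_density \<alpha> \<alpha> x" if "z < x" "x < 2 * z" for x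
        using h(5)[OF that] 4 by (simp only: distrib_left[symmetric] mult_le_cancel_left_pos)
      have "\<not> MSU \<mu>"
        by (rule M_distribution_not_MSU[OF M 4(1) _ k _ _ lim _ h(3) _ _ _ inc, where j = 1 and ?x0.0 = "2 * z"])
          (use 4 h 3 in auto)
      thus ?thesis by (rule no) (use 3 4 in auto)
    next
      case 4
      have g: "1 - \<alpha> < 1 - \<beta>" "1 - \<beta> < 1" using 4 by auto
      obtain h0 \<epsilon> z where h: "0 < h0" "0 < \<epsilon>" "0 < z" "(wright_density \<alpha> (1 - \<beta>) \<longlongrightarrow> h0) (at_right 0)"
        "\<And>x. z < x \<Longrightarrow> x < 2 * z \<Longrightarrow> h0 + \<epsilon> \<le> wright_density \<alpha> (1 - \<beta>) x"
        using wright_density_near_0[OF \<alpha> g] by blast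
      have k: "M_kernel \<alpha> \<beta> (wright_density \<alpha> (1 - \<beta>))" using M_kernel_wright_density[OF \<alpha> 4(1)] 4 \<alpha> by simp
      have "\<not> MSU \<mu>"
        by (rule M_distribution_not_MSU[OF M \<alpha>(1) _ k _ _ h(4) h(1) h(3) _ _ h(2) h(5), where j = 0 and ?x0.0 = "2 * z"])
          (use 4 \<alpha> h in auto)
      thus ?thesis by (rule no) (use 4 in auto)
    qed
  qed
qed

end
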